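(* Let $\varepsilon\in(0,1)$ be fixed and let $u^\varepsilon_{\mathrm{in}}\in H^2(\mathbb{R})$ with $\lim_{|x|\to\infty}u_{\mathrm{in}}^\varepsilon(x)=0$. Then there is a weak solution $u^\varepsilon:[0,\infty)\times\mathbb{R}\to\mathbb{R}$ of the viscoplastic Cauchy problem $$\partial_t u^\varepsilon + \partial_x\Big(\frac{(u^\varepsilon)^2}{2}\Big) - \partial_x \Big(\frac{\partial_x u^\varepsilon}{\sqrt{|\partial_x u^\varepsilon|^2 + \varepsilon^2}}\Big) - \varepsilon\, \partial_{xx} u^\varepsilon = 0\ \text{ in }(0,\infty)\times\mathbb{R},\quad \lim_{|x|\to\infty}u^\varepsilon(t,x)=0\ \ \forall t\ge 0,\quad u^\varepsilon(0,\cdot)=u^\varepsilon_{\mathrm{in}},$$ i.e., with $R^\varepsilon:=\frac{\partial_x u^\varepsilon}{\sqrt{|\partial_x u^\varepsilon|^2 + \varepsilon^2}}$, $$\int_0^\infty\int_{\mathbb{R}}\Big(u^\varepsilon\partial_t\phi+\Big(\frac{(u^\varepsilon)^2}{2}-\varepsilon\partial_xu^\varepsilon-R^\varepsilon\Big)\partial_x\phi\Big)\,\mathrm{d}x\,\mathrm{d}t+\int_{\mathbb{R}}u^\varepsilon_{\mathrm{in}}\,\phi(0,\cdot)\,\mathrm{d}x=0\qquad\forall\phi\in C^1_c([0,\infty)\times\mathbb{R}).$$ For every $T>0$ it has the regularity $$u^\varepsilon\in L^\infty(0,T;H^2(\mathbb{R})),\qquad \partial_tu^\varepsilon\in L^\infty(0,T;L^2(\mathbb{R}))\cap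 L^2(0,T;H^1(\mathbb{R})),$$ and for every $T\in(0,\infty)$ it satisfies, as $r\to\infty$, $$\int_0^T\tfrac13u^\varepsilon(t,\pm r)^3\,\mathrm{d}t\to0,\qquad \int_0^Tu^\varepsilon(t,\pm r)\,\varepsilon\,\partial_xu^\varepsilon(t,\pm r)\,\mathrm{d}t\to0,\qquad \int_0^Tu^\varepsilon(t,\pm r)\frac{\partial_xu^\varepsilon(t,\pm r)}{\sqrt{|\partial_xu^\varepsilon(t,\pm r)|^2+\varepsilon^2}}\,\mathrm{d}t\to0 .$$
   Context: All derivatives are weak derivatives. $C^1_c([0,\infty)\times\mathbb{R})$ denotes $C^1$ functions with compact support in $[0,\infty)\times\mathbb{R}$ (not necessarily vanishing at $t=0$). *)

theory Defs
  imports "HOL-Analysis.Analysis"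
begin

(* phi is a C^1 function on S with compact support in S, and D is its derivative. S is meant to be
   open or the closed half plane [0,oo) x R: there the derivative within S is unique (one-sided on
   the boundary), and phi need not vanish on the boundary of S. Values outside S are irrelevant. *)
definition C1_compact_support ::
    "'a::euclidean_space set \<Rightarrow> ('a \<Rightarrow> real) \<Rightarrow> ('a \<Rightarrow> 'a \<Rightarrow> real) \<Rightarrow> bool" where
  "C1_compact_support S \<phi> D \<longleftrightarrow>
     (\<forall>z\<in>S. (\<phi> has_derivative D z) (at z within S)) \<and>
     (\<forall>v. continuous_on S (\<lambda>z. D z v)) \<and>
     (\<exists>K. compact K \<and> K \<subseteq> S \<and> (\<forall>z\<in>S - K. \<phi> z = 0))"

definition locally_integrable :: "'a::euclidean_space set \<Rightarrow> ('a \<Rightarrow> real) \<Rightarrow> bool" where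
  "locally_integrable \<Omega> f \<longleftrightarrow> (\<forall>K. compact K \<and> K \<subseteq> \<Omega> \<longrightarrow> integrable (lebesgue_on K) f)"

(* g is the weak derivative of f in direction v on the open set Omega, tested with C^1_c functions
   as in Brezis and in Gilbarg-Trudinger. *)
definition weak_derivative ::
    "'a::euclidean_space set \<Rightarrow> 'a \<Rightarrow> ('a \<Rightarrow> real) \<Rightarrow> ('a \<Rightarrow> real) \<Rightarrow> bool" where
  "weak_derivative \<Omega> v f g \<longleftrightarrow>
     locally_integrable \<Omega> f \<and> locally_integrable \<Omega> g \<and>
     (\<forall>\<phi> D. C1_compact_support \<Omega> \<phi> D \<longrightarrow>
        (LINT z|lebesgue_on \<Omega>. f z * D z v) = - (LINT z|lebesgue_on \<Omega>. g z * \<phi> z))"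

definition square_integrable :: "(real \<Rightarrow> real) \<Rightarrow> bool" where
  "square_integrable f \<longleftrightarrow>
     f \<in> borel_measurable lebesgue \<and> integrable lebesgue (\<lambda>x. (f x)\<^sup>2)"

(* The space H^k(R); its elements are functions, not classes modulo equality almost everywhere. *)
primrec sobolev :: "nat \<Rightarrow> (real \<Rightarrow> real) set" where
  "sobolev 0 = {f. square_integrable f}"
| "sobolev (Suc k) = {f. square_integrable f \<and> (\<exists>g\<in>sobolev k. weak_derivative UNIV 1 f g)}"

(* The square of the H^k norm, the sum of |D^j f|^2 over j <= k in L^2. Weak derivatives are unique
   up to null sets, so it does not depend on the choice of the derivative. *)
primrec sobolev_norm_sq :: "nat \<Rightarrow> (real \<Rightarrow> real) \<Rightarrow> real" where
  "sobolev_norm_sq 0 f = (LINT x|lebesgue. (f x)\<^sup>2)"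
| "sobolev_norm_sq (Suc k) f =
     (LINT x|lebesgue. (f x)\<^sup>2) + sobolev_norm_sq k (SOME g. weak_derivative UNIV 1 f g)"

definition sobolev_norm :: "nat \<Rightarrow> (real \<Rightarrow> real) \<Rightarrow> real" where
  "sobolev_norm k f = sqrt (sobolev_norm_sq k f)"

(* Strong (Bochner) measurability of t |-> u(t) as a map from (0,T) to H^k(R). *)
definition bochner_measurable :: "real \<Rightarrow> nat \<Rightarrow> (real \<Rightarrow> real \<Rightarrow> real) \<Rightarrow> bool" where
  "bochner_measurable T k u \<longleftrightarrow>
     (\<exists>s :: nat \<Rightarrow> real \<Rightarrow> real \<Rightarrow> real.
        (\<forall>n. simple_function (lebesgue_on {0<..<T}) (s n) \<and> (\<forall>t\<in>{0<..<T}. s n t \<in> sobolev k)) \<and>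
        (AE t in lebesgue_on {0<..<T}.
           u t \<in> sobolev k \<and> (\<lambda>n. sobolev_norm k (\<lambda>x. s n t x - u t x)) \<longlonglongrightarrow> 0))"

definition Linf_sobolev :: "real \<Rightarrow> nat \<Rightarrow> (real \<Rightarrow> real \<Rightarrow> real) set" where
  "Linf_sobolev T k = {u. bochner_measurable T k u \<and>
     (\<exists>C. AE t in lebesgue_on {0<..<T}. sobolev_norm k (u t) \<le> C)}"

definition L2_sobolev :: "real \<Rightarrow> nat \<Rightarrow> (real \<Rightarrow> real \<Rightarrow> real) set" where
  "L2_sobolev T k = {u. bochner_measurable T k u \<and>
     integrable (lebesgue_on {0<..<T}) (\<lambda>t. (sobolev_norm k (u t))\<^sup>2)}"

abbreviation weak_dt :: "(real \<Rightarrow> real \<Rightarrow> real) \<Rightarrow> (real \<Rightarrow> real \<Rightarrow> real) \<Rightarrow> bool" where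
  "weak_dt u ut \<equiv> weak_derivative ({0<..} \<times> UNIV) (1, 0) (\<lambda>(t, x). u t x) (\<lambda>(t, x). ut t x)"

abbreviation weak_dx :: "(real \<Rightarrow> real \<Rightarrow> real) \<Rightarrow> (real \<Rightarrow> real \<Rightarrow> real) \<Rightarrow> bool" where
  "weak_dx u ux \<equiv> weak_derivative ({0<..} \<times> UNIV) (0, 1) (\<lambda>(t, x). u t x) (\<lambda>(t, x). ux t x)"

definition plastic_stress :: "real \<Rightarrow> real \<Rightarrow> real" where
  "plastic_stress \<epsilon> p = p / sqrt (\<bar>p\<bar>\<^sup>2 + \<epsilon>\<^sup>2)"

(* u is a weak solution of the Cauchy problem with initial datum uin, and ux is its weak
   x-derivative. As uin stands for an element of H^2(R), the initial condition is an equality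
   almost everywhere; it holds everywhere if u(0,.) and uin are continuous. *)
definition weak_solution ::
    "real \<Rightarrow> (real \<Rightarrow> real) \<Rightarrow> (real \<Rightarrow> real \<Rightarrow> real) \<Rightarrow> (real \<Rightarrow> real \<Rightarrow> real) \<Rightarrow> bool" where
  "weak_solution \<epsilon> uin u ux \<longleftrightarrow>
     weak_dx u ux \<and>
     (\<forall>\<phi> D. C1_compact_support ({0..} \<times> UNIV) \<phi> D \<longrightarrow>
        (LINT t|lebesgue_on {0..}. LINT x|lebesgue.
            u t x * D (t, x) (1, 0)
            + ((u t x)\<^sup>2 / 2 - \<epsilon> * ux t x - plastic_stress \<epsilon> (ux t x)) * D (t, x) (0, 1))
        + (LINT x|lebesgue. uin x * \<phi> (0, x)) = 0) \<and>
     (\<forall>t\<ge>0. (u t \<longlongrightarrow> 0) at_infinity) \<and>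
     (AE x in lebesgue. u 0 x = uin x)"

(* The integrals of F(t, r) and of F(t, -r) over 0 < t < T exist and tend to 0 as r tends to
   infinity. Integrability is stated because the integral of a non-integrable function is 0. *)
definition vanishing_flux :: "real \<Rightarrow> (real \<Rightarrow> real \<Rightarrow> real) \<Rightarrow> bool" where
  "vanishing_flux T F \<longleftrightarrow>
     (\<forall>x. integrable (lebesgue_on {0<..<T}) (\<lambda>t. F t x)) \<and>
     ((\<lambda>r. LINT t|lebesgue_on {0<..<T}. F t r) \<longlongrightarrow> 0) at_top \<and>
     ((\<lambda>r. LINT t|lebesgue_on {0<..<T}. F t (- r)) \<longlongrightarrow> 0) at_top"

end

theory Submission
  imports Defs "HOL-Complex_Analysis.Great_Picard"
begin

text \<open>The solution is a limit of the explicit finite difference scheme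
  \<open>u(t + \<tau>) = S (u t)\<close> with \<open>\<tau>\<close> proportional to \<open>h\<^sup>2\<close>. The scheme acts on functions on the
  whole line, not on grid functions, so that it commutes with translations and no interpolation is needed.
  It is monotone, which gives the maximum principle, and the map
  \<open>p \<mapsto> \<epsilon> p + p / sqrt (p\<^sup>2 + \<epsilon>\<^sup>2)\<close> has slope at least \<open>\<epsilon>\<close>. One energy estimate for the
  difference of two numerical solutions therefore bounds, when applied to zero, to a space translate and
  to the next time step, the solution itself, its space differences, and its time
  difference together with the time integral of the space differences of the latter. The equation then bounds
  the second space differences. By a uniform Hoelder estimate a subsequence converges pointwise. The limit
  inherits the bounds on second differences, so its space differences converge uniformly to a continuous
  derivative, and this allows the passage to the limit in the nonlinear flux.

  Weak compactness in \<open>L\<^sup>2\<close> is replaced by Mazur's lemma for midpoint combinations. Bochner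
  measurability follows from the separability of \<open>L\<^sup>2\<close> and from the fact that the norm of a weak
  derivative is the supremum of the norms of difference quotients.\<close>

section \<open>Square integrable functions\<close>

text \<open>The estimates of the scheme concern quotients with its own steps \<open>h\<close> and
  \<open>\<tau>\<close>, which change along the sequence, whereas the limit needs bounds for fixed
  steps. This is why the space steps are dyadic: the time steps, proportional to
  \<open>h\<^sup>2\<close>, then have ratios that are powers of 4, and a quotient with a fixed
  coarse step is an average of translates of quotients with the fine step, so that bounds pass from
  fine to coarse. Monotonicity fixes the sizes: centred convection is outweighed by the viscosity if
  \<open>h * M \<le> 2 * \<epsilon>\<close>, and explicit diffusion is stable if
  \<open>\<tau>\<close> is a small multiple of \<open>h\<^sup>2\<close>. The growth rate
  \<open>4 * M\<^sup>2 / \<epsilon>\<close> of the energy is independent of the mesh because the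
  maximum principle bounds the convective coefficient by \<open>M\<close>; and \<open>M\<close> is
  the sup bound that H^1 provides for the datum. A second obstacle is the target space: its elements
  are functions, and the norm is computed from an arbitrarily chosen weak derivative, so the
  argument works with Borel representatives and uniqueness up to null sets.\<close>

definition L2 :: "'a measure \<Rightarrow> ('a \<Rightarrow> real) \<Rightarrow> bool" where
  "L2 M f \<longleftrightarrow> f \<in> borel_measurable M \<and> integrable M (\<lambda>x. (f x)\<^sup>2)"

text \<open>The squared norm is used throughout: the energy estimates are linear in it, and the
  triangle inequality is replaced by a factor 2 (\<open>nsq_add_le\<close>).\<close>

definition nsq :: "'a measure \<Rightarrow> ('a \<Rightarrow> real) \<Rightarrow> real" where
  "nsq M f = (LINT x|M. (f x)\<^sup>2)"

lemma L2_measurable [measurable_dest]: "L2 M f \<Longrightarrow> f \<in> borel_measurable M"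
  by (simp add: L2_def)

lemma nsq_nonneg [simp]: "0 \<le> nsq M f"
  by (simp add: nsq_def)

text \<open>Comparison by squares. Two majorants are allowed because the convective flux is bounded
  by a function together with its translate.\<close>

lemma L2_le_sum:
  assumes "L2 M g" "L2 M k" "f \<in> borel_measurable M"
    and le: "AE x in M. (f x)\<^sup>2 \<le> a * (g x)\<^sup>2 + b * (k x)\<^sup>2"
  shows "L2 M f" and "nsq M f \<le> a * nsq M g + b * nsq M k"
proof -
  have int: "integrable M (\<lambda>x. a * (g x)\<^sup>2 + b * (k x)\<^sup>2)"
    using assms by (simp add: L2_def)
  have "integrable M (\<lambda>x. (f x)\<^sup>2)"
    by (rule Bochner_Integration.integrable_bound[OF int]) (use assms in auto)
  then show "L2 M f"
    using assms by (simp add: L2_def)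
  then have "nsq M f \<le> (LINT x|M. a * (g x)\<^sup>2 + b * (k x)\<^sup>2)"
    unfolding nsq_def by (intro integral_mono_AE int le) (simp_all add: L2_def)
  also have "\<dots> = a * nsq M g + b * nsq M k"
    using assms by (simp add: L2_def nsq_def)
  finally show "nsq M f \<le> a * nsq M g + b * nsq M k" .
qed

lemma L2_le:
  assumes "L2 M g" "f \<in> borel_measurable M" "AE x in M. (f x)\<^sup>2 \<le> a * (g x)\<^sup>2"
  shows "L2 M f" and "nsq M f \<le> a * nsq M g"
  using L2_le_sum[OF assms(1,1,2), of a 0] assms(3) by simp_all

lemma L2_cmult: "L2 M f \<Longrightarrow> L2 M (\<lambda>x. c * f x)"
  by (auto simp: L2_def power_mult_distrib)

lemma nsq_cmult: "nsq M (\<lambda>x. c * f x) = c\<^sup>2 * nsq M f"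
  by (simp add: nsq_def power_mult_distrib)

lemma power2_add_le: "((a::real) + b)\<^sup>2 \<le> 2 * a\<^sup>2 + 2 * b\<^sup>2"
  using zero_le_power2[of "a - b"] by (simp add: power2_eq_square algebra_simps)

lemma power2_diff_le: "((a::real) - b)\<^sup>2 \<le> 2 * a\<^sup>2 + 2 * b\<^sup>2"
  using zero_le_power2[of "a + b"] by (simp add: power2_eq_square algebra_simps)

lemma L2_add: "L2 M f \<Longrightarrow> L2 M g \<Longrightarrow> L2 M (\<lambda>x. f x + g x)"
  by (rule L2_le_sum(1)[of M f g _ 2 2]) (auto simp: L2_def intro: power2_add_le)

lemma nsq_add_le: "L2 M f \<Longrightarrow> L2 M g \<Longrightarrow> nsq M (\<lambda>x. f x + g x) \<le> 2 * nsq M f + 2 * nsq M g"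
  by (rule L2_le_sum(2)[of M f g _ 2 2]) (auto simp: L2_def intro: power2_add_le)

lemma L2_diff: "L2 M f \<Longrightarrow> L2 M g \<Longrightarrow> L2 M (\<lambda>x. f x - g x)"
  using L2_add[of M f "\<lambda>x. -1 * g x"] L2_cmult[of M g "-1"] by simp

lemma nsq_diff_le: "L2 M f \<Longrightarrow> L2 M g \<Longrightarrow> nsq M (\<lambda>x. f x - g x) \<le> 2 * nsq M f + 2 * nsq M g"
  by (rule L2_le_sum(2)[of M f g _ 2 2]) (auto simp: L2_def intro: power2_diff_le)

lemma nsq_minus_commute: "nsq M (\<lambda>x. f x - g x) = nsq M (\<lambda>x. g x - f x)"
  by (simp add: nsq_def power2_commute)

lemma L2_zero [simp]: "L2 M (\<lambda>x. 0)"
  by (simp add: L2_def)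

lemma nsq_zero [simp]: "nsq M (\<lambda>x. 0) = 0"
  by (simp add: nsq_def)

lemma L2_sum: "(\<And>i. i \<in> I \<Longrightarrow> L2 M (f i)) \<Longrightarrow> L2 M (\<lambda>x. \<Sum>i\<in>I. f i x)"
  by (induction I rule: infinite_finite_induct) (auto intro: L2_add)

lemma L2_mult_integrable:
  assumes "L2 M f" "L2 M g"
  shows "integrable M (\<lambda>x. f x * g x)"
proof (rule Bochner_Integration.integrable_bound)
  show "integrable M (\<lambda>x. (f x)\<^sup>2 + (g x)\<^sup>2)"
    using assms by (simp add: L2_def)
  have "\<bar>a * b\<bar> \<le> a\<^sup>2 + b\<^sup>2" for a b :: real
    using zero_le_power2[of "\<bar>a\<bar> - \<bar>b\<bar>"] zero_le_power2[of a] zero_le_power2[of b]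
    unfolding power2_diff power2_abs abs_mult
    using mult_nonneg_nonneg[OF abs_ge_zero[of a] abs_ge_zero[of b]] by linarith
  then show "AE x in M. norm (f x * g x) \<le> norm ((f x)\<^sup>2 + (g x)\<^sup>2)"
    by auto
qed (use assms in \<open>auto simp: L2_def\<close>)

text \<open>The parameter \<open>c\<close> stays free: as a polynomial in \<open>c\<close> the
  expansion gives Cauchy-Schwarz, for \<open>c = 1\<close> and \<open>c = -1\<close> the
  parallelogram law, and for \<open>c = \<tau>\<close> the energy balance of one explicit time
  step.\<close>

lemma nsq_add:
  assumes "L2 M f" "L2 M g"
  shows "nsq M (\<lambda>x. f x + c * g x) = nsq M f + 2 * c * (LINT x|M. f x * g x) + c\<^sup>2 * nsq M g"
proof -
  have "nsq M (\<lambda>x. f x + c * g x) = (LINT x|M. (f x)\<^sup>2 + (2 * c) * (f x * g x) + c\<^sup>2 * (g x)\<^sup>2)"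
    unfolding nsq_def by (intro Bochner_Integration.integral_cong) (auto simp: power2_eq_square algebra_simps)
  also have "\<dots> = nsq M f + 2 * c * (LINT x|M. f x * g x) + c\<^sup>2 * nsq M g"
    using assms L2_mult_integrable[OF assms] by (simp add: nsq_def L2_def)
  finally show ?thesis .
qed

lemma Young_ineq: "0 < (c::real) \<Longrightarrow> a * b \<le> (c * a\<^sup>2 + b\<^sup>2 / c) / 2"
  using zero_le_power2[of "c * a - b"]
  by (simp add: power2_eq_square divide_simps algebra_simps)

text \<open>Young's inequality with a weight; the choice \<open>c = 2 / \<epsilon>\<close> later
  lets the dissipation absorb the convective term.\<close>

lemma L2_mult_le:
  assumes "L2 M f" "L2 M g" "0 < c"
  shows "\<bar>LINT x|M. f x * g x\<bar> \<le> (c * nsq M f + nsq M g / c) / 2"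
proof -
  have "\<bar>LINT x|M. f x * g x\<bar> \<le> (LINT x|M. \<bar>f x * g x\<bar>)"
    using integral_norm_bound[of M "\<lambda>x. f x * g x"] by simp
  also have "\<dots> \<le> (LINT x|M. (c * (f x)\<^sup>2 + (g x)\<^sup>2 / c) / 2)"
  proof (rule integral_mono)
    show "\<bar>f x * g x\<bar> \<le> (c * (f x)\<^sup>2 + (g x)\<^sup>2 / c) / 2" for x
      using Young_ineq[OF assms(3), of "\<bar>f x\<bar>" "\<bar>g x\<bar>"] by (simp add: abs_mult)
  qed (use assms L2_mult_integrable[OF assms(1,2)] in \<open>auto simp: L2_def\<close>)
  also have "\<dots> = (c * nsq M f + nsq M g / c) / 2"
    using assms by (simp add: L2_def nsq_def)
  finally show ?thesis .
qed

lemma Cauchy_Schwarz_L2: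
  assumes "L2 M f" "L2 M g"
  shows "(LINT x|M. f x * g x)\<^sup>2 \<le> nsq M f * nsq M g"
proof -
  define a b c where "a = nsq M f" and "b = (LINT x|M. f x * g x)" and "c = nsq M g"
  have *: "0 \<le> a + 2 * t * b + t\<^sup>2 * c" for t
    using nsq_add[OF assms, of t] nsq_nonneg[of M "\<lambda>x. f x + t * g x"] by (simp add: a_def b_def c_def)
  have "0 \<le> a" "0 \<le> c" by (simp_all add: a_def c_def)
  have "b\<^sup>2 \<le> a * c"
  proof (cases "c = 0")
    case True
    have "b = 0"
    proof (rule ccontr)
      assume "b \<noteq> 0"
      \<comment> \<open>Without a quadratic term the polynomial is affine in \<open>t\<close>; at
        this \<open>t\<close> it would take the value -1.\<close>
      have "0 \<le> a + 2 * (- (a + 1) / (2 * b)) * b"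
        using *[of "- (a + 1) / (2 * b)"] True by simp
      also have "\<dots> = -1" using \<open>b \<noteq> 0\<close> by (simp add: field_simps)
      finally show False by simp
    qed
    then show ?thesis using True by simp
  next
    case False
    then have "c > 0" using \<open>0 \<le> c\<close> by simp
    have "0 \<le> (a + 2 * (-b/c) * b + (-b/c)\<^sup>2 * c) * c"
      using *[of "-b/c"] \<open>c > 0\<close> by simp
    also have "\<dots> = a * c - b\<^sup>2"
      using False by (simp add: power2_eq_square field_simps)
    finally show ?thesis by simp
  qed
  then show ?thesis by (simp add: a_def b_def c_def)
qed

section \<open>Fatou's lemma, completeness and weak compactness in L^2\<close>

text \<open>Membership and bound become one condition on a nonnegative integral, where Fatou and
  Tonelli apply without integrability. \<open>0 \<le> C\<close> is required on the right because
  \<open>ennreal\<close> maps negative numbers to 0.\<close>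

lemma L2_nn:
  "L2 M f \<and> nsq M f \<le> C \<longleftrightarrow>
     f \<in> borel_measurable M \<and> 0 \<le> C \<and> (\<integral>\<^sup>+x. ennreal ((f x)\<^sup>2) \<partial>M) \<le> ennreal C"
proof (intro iffI conjI; (elim conjE)?)
  assume *: "L2 M f" "nsq M f \<le> C"
  show "0 \<le> C" using nsq_nonneg[of M f] * by linarith
  have "(\<integral>\<^sup>+x. ennreal ((f x)\<^sup>2) \<partial>M) = ennreal (nsq M f)"
    unfolding nsq_def using * by (intro nn_integral_eq_integral) (auto simp: L2_def)
  then show "(\<integral>\<^sup>+x. ennreal ((f x)\<^sup>2) \<partial>M) \<le> ennreal C"
    using * by (simp add: ennreal_leI)
next
  assume *: "f \<in> borel_measurable M" "0 \<le> C" "(\<integral>\<^sup>+x. ennreal ((f x)\<^sup>2) \<partial>M) \<le> ennreal C"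
  have "integrable M (\<lambda>x. (f x)\<^sup>2)"
    using * by (intro integrableI_bounded) (auto simp: le_less_trans)
  then show "L2 M f" using * by (simp add: L2_def)
  then have "(\<integral>\<^sup>+x. ennreal ((f x)\<^sup>2) \<partial>M) = ennreal (nsq M f)"
    unfolding nsq_def by (intro nn_integral_eq_integral) (auto simp: L2_def)
  then show "nsq M f \<le> C" using * by (simp add: ennreal_le_iff)
qed (simp add: L2_def)

text \<open>Lower semicontinuity of the norm under pointwise convergence; the L^2 bounds on the
  limit solution come from the scheme in this way. The bounds may hold only eventually, because a
  given coarse step is a multiple of the fine step only from some index on.\<close>

lemma L2_Fatou:
  assumes f: "f \<in> borel_measurable M"
    and bd: "\<forall>\<^sub>F n in sequentially. L2 M (s n) \<and> nsq M (s n) \<le> C"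
    and lim: "AE x in M. (\<lambda>n. s n x) \<longlonglongrightarrow> f x"
  shows "L2 M f" and "nsq M f \<le> C"
proof -
  obtain n0 where n0: "\<And>n. n \<ge> n0 \<Longrightarrow> L2 M (s n) \<and> nsq M (s n) \<le> C"
    using bd by (auto simp: eventually_sequentially)
  define s' where "s' n = s (n + n0)" for n
  have s': "s' n \<in> borel_measurable M" "(\<integral>\<^sup>+x. ennreal ((s' n x)\<^sup>2) \<partial>M) \<le> ennreal C" for n
    using n0[of "n + n0"] L2_nn[of M "s' n" C] by (auto simp: s'_def)
  have "0 \<le> C" using n0[of n0] nsq_nonneg[of M "s n0"] by linarith
  have "(\<integral>\<^sup>+x. ennreal ((f x)\<^sup>2) \<partial>M) = (\<integral>\<^sup>+x. liminf (\<lambda>n. ennreal ((s' n x)\<^sup>2)) \<partial>M)"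
  proof (rule nn_integral_cong_AE)
    show "AE x in M. ennreal ((f x)\<^sup>2) = liminf (\<lambda>n. ennreal ((s' n x)\<^sup>2))"
      using lim
    proof eventually_elim
      case (elim x)
      then have "(\<lambda>n. s' n x) \<longlonglongrightarrow> f x" unfolding s'_def by (rule LIMSEQ_ignore_initial_segment)
      then have "(\<lambda>n. ennreal ((s' n x)\<^sup>2)) \<longlonglongrightarrow> ennreal ((f x)\<^sup>2)"
        by (intro tendsto_ennrealI tendsto_power)
      then show ?case using lim_imp_Liminf[OF trivial_limit_sequentially] by metis
    qed
  qed
  also have "\<dots> \<le> liminf (\<lambda>n. \<integral>\<^sup>+x. ennreal ((s' n x)\<^sup>2) \<partial>M)"
    using s' by (intro nn_integral_liminf) auto
  also have "\<dots> \<le> ennreal C"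
    using s'(2) by (intro Liminf_le) auto
  finally have "L2 M f \<and> nsq M f \<le> C"
    using f \<open>0 \<le> C\<close> by (simp add: L2_nn)
  then show "L2 M f" "nsq M f \<le> C" by auto
qed

text \<open>Riesz-Fischer: a rapidly converging subsequence converges almost everywhere, and Fatou
  along it turns the Cauchy condition into convergence of the whole sequence.\<close>

lemma L2_complete:
  fixes s :: "nat \<Rightarrow> 'a \<Rightarrow> real"
  assumes s: "\<And>n. L2 M (s n)"
    and Cauchy: "\<And>e. e > 0 \<Longrightarrow> \<exists>n0. \<forall>m\<ge>n0. \<forall>n\<ge>n0. nsq M (\<lambda>x. s m x - s n x) \<le> e"
  obtains r f where "strict_mono (r :: nat \<Rightarrow> nat)" "L2 M f" "AE x in M. (\<lambda>i. s (r i) x) \<longlonglongrightarrow> f x"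
    "(\<lambda>n. nsq M (\<lambda>x. s n x - f x)) \<longlonglongrightarrow> 0"
proof -
  have [measurable]: "s n \<in> borel_measurable M" for n using s by (simp add: L2_def)
  \<comment> \<open>The rate 1/8 leaves room for the weights \<open>2^i\<close> below: the weighted
    squares still sum to at most the series of \<open>(1/4)^i\<close>.\<close>
  have "\<exists>n0. \<forall>m\<ge>n0. \<forall>n\<ge>n0. nsq M (\<lambda>x. s m x - s n x) \<le> (1/8)^i" for i :: nat
    using Cauchy[of "(1/8)^i"] by simp
  then obtain n0 where n0: "\<And>i m n. m \<ge> n0 i \<Longrightarrow> n \<ge> n0 i \<Longrightarrow> nsq M (\<lambda>x. s m x - s n x) \<le> (1/8)^i"
    by metis
  define r where "r = rec_nat (n0 0) (\<lambda>i k. max (Suc k) (n0 (Suc i)))"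
  have r_Suc: "r (Suc i) = max (Suc (r i)) (n0 (Suc i))" for i by (simp add: r_def)
  have mono: "strict_mono r" by (rule strict_monoI_Suc) (simp add: r_Suc)
  have rn: "r i \<ge> n0 i" for i by (cases i) (simp_all add: r_def)
  have dr: "nsq M (\<lambda>x. s (r (Suc i)) x - s (r i) x) \<le> (1/8)^i" for i
    using n0[of i "r (Suc i)" "r i"] rn[of i] strict_mono_less[OF mono, of i "Suc i"] by simp
  have "(\<integral>\<^sup>+x. (\<Sum>i. ennreal (2^i * (s (r (Suc i)) x - s (r i) x)\<^sup>2)) \<partial>M)
      = (\<Sum>i. \<integral>\<^sup>+x. ennreal (2^i * (s (r (Suc i)) x - s (r i) x)\<^sup>2) \<partial>M)"
    by (intro nn_integral_suminf) simp
  also have "\<dots> \<le> (\<Sum>i. ennreal ((1/4)^i))"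
  proof (intro suminf_le)
    fix i
    have "(\<integral>\<^sup>+x. ennreal (2^i * (s (r (Suc i)) x - s (r i) x)\<^sup>2) \<partial>M)
        = ennreal (2^i) * (\<integral>\<^sup>+x. ennreal ((s (r (Suc i)) x - s (r i) x)\<^sup>2) \<partial>M)"
      by (subst nn_integral_cmult[symmetric]) (auto simp: ennreal_mult)
    also have "\<dots> \<le> ennreal (2^i) * ennreal ((1/8)^i)"
      using L2_nn[of M "\<lambda>x. s (r (Suc i)) x - s (r i) x" "(1/8)^i"] dr[of i] L2_diff[OF s s]
      by (intro mult_left_mono) auto
    also have "\<dots> = ennreal ((1/4)^i)"
      by (subst ennreal_mult[symmetric]) (auto simp: power_mult_distrib[symmetric])
    finally show "(\<integral>\<^sup>+x. ennreal (2^i * (s (r (Suc i)) x - s (r i) x)\<^sup>2) \<partial>M) \<le> ennreal ((1/4)^i)" .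
  qed auto
  also have "\<dots> = ennreal (\<Sum>i. (1/4)^i)"
    by (intro suminf_ennreal2) (auto intro: summable_geometric)
  also have "\<dots> < \<infinity>" by simp
  finally have "AE x in M. (\<Sum>i. ennreal (2^i * (s (r (Suc i)) x - s (r i) x)\<^sup>2)) \<noteq> \<infinity>"
    by (intro nn_integral_PInf_AE) auto
  then have conv: "AE x in M. convergent (\<lambda>i. s (r i) x)"
  proof eventually_elim
    case (elim x)
    have "summable (\<lambda>i. 2^i * (s (r (Suc i)) x - s (r i) x)\<^sup>2)"
      using elim by (intro summable_suminf_not_top) auto
    then have "(\<lambda>i. 2^i * (s (r (Suc i)) x - s (r i) x)\<^sup>2) \<longlonglongrightarrow> 0"
      by (rule summable_LIMSEQ_zero)
    then have "Bseq (\<lambda>i. 2^i * (s (r (Suc i)) x - s (r i) x)\<^sup>2)"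
      by (intro convergent_imp_Bseq convergentI)
    then obtain K where K: "K > 0" "\<And>i. \<bar>2^i * (s (r (Suc i)) x - s (r i) x)\<^sup>2\<bar> \<le> K"
      by (auto simp: Bseq_def)
    \<comment> \<open>Where the weighted series is finite its terms are bounded by some
      \<open>K\<close>, so the increments decay geometrically with ratio
      \<open>sqrt (1/2)\<close>.\<close>
    have le: "\<bar>s (r (Suc i)) x - s (r i) x\<bar> \<le> sqrt K * (sqrt (1/2))^i" for i
    proof -
      have "(s (r (Suc i)) x - s (r i) x)\<^sup>2 \<le> K * (1/2)^i"
        using K(2)[of i] by (simp add: field_simps)
      then have "sqrt ((s (r (Suc i)) x - s (r i) x)\<^sup>2) \<le> sqrt (K * (1/2)^i)"
        by (rule real_sqrt_le_mono)
      moreover have "sqrt (K * (1/2)^i) = sqrt K * (sqrt (1/2))^i"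
        by (simp only: real_sqrt_mult real_sqrt_power)
      ultimately show ?thesis by simp
    qed
    have "summable (\<lambda>i. sqrt K * (sqrt (1/2))^i)"
      by (intro summable_mult summable_geometric) simp
    then have "summable (\<lambda>i. s (r (Suc i)) x - s (r i) x)"
      by (rule summable_comparison_test'[where N=0]) (simp only: real_norm_def le)
    then have "convergent (\<lambda>n. \<Sum>i<n. s (r (Suc i)) x - s (r i) x)"
      by (simp only: summable_iff_convergent)
    then have "convergent (\<lambda>n. s (r n) x - s (r 0) x)"
      using sum_lessThan_telescope[of "\<lambda>i. s (r i) x"] by simp
    from convergent_add[OF this convergent_const[of "s (r 0) x"]] show ?case by simp
  qed
  define f where "f x = lim (\<lambda>i. s (r i) x)" for x
  have f_meas [measurable]: "f \<in> borel_measurable M"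
    unfolding f_def by measurable
  have lim: "AE x in M. (\<lambda>i. s (r i) x) \<longlonglongrightarrow> f x"
    using conv by eventually_elim (simp add: f_def convergent_LIMSEQ_iff)
  have key: "L2 M (\<lambda>x. s m x - f x) \<and> nsq M (\<lambda>x. s m x - f x) \<le> e"
    if e: "\<forall>m\<ge>n1. \<forall>n\<ge>n1. nsq M (\<lambda>x. s m x - s n x) \<le> e" and "m \<ge> n1" for e n1 m
  proof -
    have "\<forall>\<^sub>F i in sequentially. L2 M (\<lambda>x. s m x - s (r i) x) \<and> nsq M (\<lambda>x. s m x - s (r i) x) \<le> e"
    proof (rule eventually_sequentiallyI[of n1])
      fix i assume "n1 \<le> i"
      then have "n1 \<le> r i" using seq_suble[OF mono, of i] by linarith
      then show "L2 M (\<lambda>x. s m x - s (r i) x) \<and> nsq M (\<lambda>x. s m x - s (r i) x) \<le> e"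
        using e \<open>m \<ge> n1\<close> L2_diff[OF s s] by auto
    qed
    moreover have "AE x in M. (\<lambda>i. s m x - s (r i) x) \<longlonglongrightarrow> s m x - f x"
      using lim by eventually_elim (intro tendsto_intros)
    ultimately show ?thesis
      using L2_Fatou[of "\<lambda>x. s m x - f x" M "\<lambda>i x. s m x - s (r i) x" e] by simp
  qed
  obtain n1 where "\<forall>m\<ge>n1. \<forall>n\<ge>n1. nsq M (\<lambda>x. s m x - s n x) \<le> 1" using Cauchy[of 1] by auto
  then have "L2 M (\<lambda>x. s n1 x - f x)" using key by blast
  then have "L2 M f" using L2_diff[OF s[of n1], of "\<lambda>x. s n1 x - f x"] by simp
  moreover have "(\<lambda>n. nsq M (\<lambda>x. s n x - f x)) \<longlonglongrightarrow> 0"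
  proof (rule LIMSEQ_I)
    fix e :: real assume "e > 0"
    then obtain n1 where "\<forall>m\<ge>n1. \<forall>n\<ge>n1. nsq M (\<lambda>x. s m x - s n x) \<le> e/2" using Cauchy[of "e/2"] by auto
    then show "\<exists>n0. \<forall>n\<ge>n0. norm (nsq M (\<lambda>x. s n x - f x) - 0) < e"
      using key[of n1 "e/2"] \<open>e > 0\<close> by (intro exI[of _ n1]) force
  qed
  ultimately show ?thesis using that[OF mono _ lim] by blast
qed

text \<open>Closure under midpoints replaces convex hulls in Mazur's lemma.\<close>

inductive_set mid :: "('a \<Rightarrow> real) set \<Rightarrow> ('a \<Rightarrow> real) set" for G where
  base: "f \<in> G \<Longrightarrow> f \<in> mid G"
| step: "f \<in> mid G \<Longrightarrow> g \<in> mid G \<Longrightarrow> (\<lambda>x. (f x + g x) / 2) \<in> mid G"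

lemma mid_mono: "G \<subseteq> H \<Longrightarrow> mid G \<subseteq> mid H"
proof
  fix f assume "G \<subseteq> H" "f \<in> mid G"
  from this(2,1) show "f \<in> mid H"
    by (induction rule: mid.induct) (auto intro: mid.intros)
qed

lemma L2_midpoint:
  assumes "L2 M f" "L2 M g"
  shows "L2 M (\<lambda>x. (f x + g x) / 2)"
    and "4 * nsq M (\<lambda>x. (f x + g x) / 2) + nsq M (\<lambda>x. f x - g x) = 2 * nsq M f + 2 * nsq M g"
proof -
  show "L2 M (\<lambda>x. (f x + g x) / 2)"
    using L2_cmult[OF L2_add[OF assms], of "1/2"] by simp
  have "4 * nsq M (\<lambda>x. (f x + g x) / 2) = nsq M (\<lambda>x. f x + 1 * g x)"
    using nsq_cmult[of M "1/2" "\<lambda>x. f x + g x"] by (simp add: power2_eq_square)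
  then show "4 * nsq M (\<lambda>x. (f x + g x) / 2) + nsq M (\<lambda>x. f x - g x) = 2 * nsq M f + 2 * nsq M g"
    using nsq_add[OF assms, of 1] nsq_add[OF assms, of "-1"] by simp
qed

lemma mid_L2:
  assumes "f \<in> mid G" "\<And>g. g \<in> G \<Longrightarrow> L2 M g \<and> nsq M g \<le> C"
  shows "L2 M f \<and> nsq M f \<le> C"
  using assms(1)
proof (induction rule: mid.induct)
  case (step f g)
  then have "nsq M (\<lambda>x. (f x + g x) / 2) \<le> C"
    using L2_midpoint(2)[of M f g] nsq_nonneg[of M "\<lambda>x. f x - g x"] by linarith
  then show ?case
    using step L2_midpoint(1)[of M f g] by auto
qed (use assms in auto)

text \<open>The norm-minimising midpoint combinations of the tails form a Cauchy sequence, by the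
  parallelogram law; this gives weak compactness of bounded sequences without duality.\<close>

lemma Mazur:
  fixes g :: "nat \<Rightarrow> 'a \<Rightarrow> real"
  assumes g: "\<And>k. L2 M (g k)" "\<And>k. nsq M (g k) \<le> C"
  obtains s f where "\<And>n. s n \<in> mid (g ` {n..})" "L2 M f" "nsq M f \<le> C"
    "AE x in M. (\<lambda>n. s n x) \<longlonglongrightarrow> f x" "(\<lambda>n. nsq M (\<lambda>x. s n x - f x)) \<longlonglongrightarrow> 0"
proof -
  define K where "K n = mid (g ` {n..})" for n
  have K_anti: "K m \<subseteq> K n" if "n \<le> m" for m n
    unfolding K_def using that by (intro mid_mono) auto
  have K_L2: "L2 M f \<and> nsq M f \<le> C" if "f \<in> K n" for f n
    using mid_L2[of f "g ` {n..}" M C] that g by (auto simp: K_def)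
  have gK: "g n \<in> K n" for n unfolding K_def by (intro mid.base) auto
  define d where "d n = Inf (nsq M ` K n)" for n
  have bdd: "bdd_below (nsq M ` K n)" for n by (auto intro!: bdd_belowI[of _ 0])
  have d_le: "d n \<le> nsq M f" if "f \<in> K n" for f n
    unfolding d_def using that by (intro cInf_lower bdd) auto
  have "\<exists>f\<in>K n. nsq M f < d n + 1 / real (Suc n)" for n
  proof -
    have "Inf (nsq M ` K n) < d n + 1 / real (Suc n)" by (simp add: d_def)
    then show ?thesis using cInf_lessD[of "nsq M ` K n"] gK[of n] by auto
  qed
  then obtain f where f: "\<And>n. f n \<in> K n" "\<And>n. nsq M (f n) < d n + 1 / real (Suc n)" by metis
  \<comment> \<open>The sets \<open>K n\<close> shrink, so their infima increase; being at most
    \<open>C\<close>, these form a Cauchy sequence.\<close>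
  have d_mono: "d n \<le> d m" if "n \<le> m" for m n
    unfolding d_def using gK[of m] K_anti[OF that] by (intro cInf_superset_mono bdd) auto
  have "d n \<le> C" for n using d_le[OF gK] g(2) order_trans by blast
  then have "convergent d"
    using d_mono by (intro Bseq_mono_convergent BseqI'[of _ "\<bar>d 0\<bar> + \<bar>C\<bar>"])
      (smt (verit, best) le0 real_norm_def)+
  then have dC: "Cauchy d" by (simp add: Cauchy_convergent_iff)
  have diff: "nsq M (\<lambda>x. f m x - f n x) \<le> 2 * (d m - d n) + 4 / real (Suc n)" if "n \<le> m" for m n
  proof -
    have "(\<lambda>x. (f m x + f n x) / 2) \<in> K n"
      using f(1)[of n] f(1)[of m] K_anti[OF that] unfolding K_def by (intro mid.step) auto
    from d_le[OF this] have "d n \<le> nsq M (\<lambda>x. (f m x + f n x) / 2)" .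
    moreover have "1 / real (Suc m) \<le> 1 / real (Suc n)"
      using that by (intro divide_left_mono) auto
    ultimately have "nsq M (\<lambda>x. f m x - f n x) \<le> 2 * (d m - d n) + 4 * (1 / real (Suc n))"
      using L2_midpoint(2)[OF conjunct1[OF K_L2[OF f(1)[of m]]] conjunct1[OF K_L2[OF f(1)[of n]]]]
        less_imp_le[OF f(2)[of m]] less_imp_le[OF f(2)[of n]]
      by argo
    then show ?thesis by simp
  qed
  have "\<exists>n0. \<forall>m\<ge>n0. \<forall>n\<ge>n0. nsq M (\<lambda>x. f m x - f n x) \<le> e" if "e > 0" for e
  proof -
    obtain n1 where n1: "\<And>m n. m \<ge> n1 \<Longrightarrow> n \<ge> n1 \<Longrightarrow> \<bar>d m - d n\<bar> < e / 4"
      using dC \<open>e > 0\<close> unfolding Cauchy_def dist_real_def by (metis zero_less_divide_iff zero_less_numeral)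
    obtain n2 :: nat where n2: "real n2 > 8 / e" using reals_Archimedean2 by blast
    have "nsq M (\<lambda>x. f m x - f n x) \<le> e" if "n \<ge> max n1 n2" "m \<ge> n" for m n
    proof -
      have "real (Suc n) \<ge> 8 / e" using n2 that by linarith
      then have "4 / real (Suc n) \<le> e / 2" using \<open>e > 0\<close> by (simp add: field_simps)
      moreover have "\<bar>d m - d n\<bar> < e / 4" using n1[of m n] that by simp
      ultimately show ?thesis using diff[OF that(2)] unfolding abs_less_iff by argo
    qed
    note le = this
    have "nsq M (\<lambda>x. f m x - f n x) \<le> e" if "n \<ge> max n1 n2" "m \<ge> max n1 n2" for m n
    proof (cases "n \<le> m")
      case True
      show ?thesis by (rule le[OF that(1) True])
    next
      case False
      then show ?thesis
        using le[OF that(2), of n] by (subst nsq_minus_commute) simp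
    qed
    then show ?thesis by blast
  qed
  from L2_complete[of M f, OF conjunct1[OF K_L2[OF f(1)]] this]
  obtain r F where r: "strict_mono (r :: nat \<Rightarrow> nat)" "L2 M F" "AE x in M. (\<lambda>i. f (r i) x) \<longlonglongrightarrow> F x"
    "(\<lambda>n. nsq M (\<lambda>x. f n x - F x)) \<longlonglongrightarrow> 0"
    by blast
  have "nsq M F \<le> C"
    using L2_Fatou(2)[of F M "\<lambda>i. f (r i)" C] r K_L2[OF f(1)] by (auto simp: L2_def)
  moreover have "f (r n) \<in> mid (g ` {n..})" for n
    using f(1)[of "r n"] K_anti[OF seq_suble[OF r(1), of n]] by (auto simp: K_def)
  moreover have "(\<lambda>n. nsq M (\<lambda>x. f (r n) x - F x)) \<longlonglongrightarrow> 0"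
    using LIMSEQ_subseq_LIMSEQ[OF r(4,1)] by (simp add: o_def)
  ultimately show ?thesis using r that[of "\<lambda>n. f (r n)" F] by blast
qed

section \<open>Weak derivatives and difference quotients\<close>

lemma lborel_distr_translate: "distr lborel borel (\<lambda>z. z + c) = (lborel :: 'a::euclidean_space measure)"
proof -
  have "(\<lambda>z. z + c) = (+) c" by (auto simp: add.commute)
  then show ?thesis using lborel_distr_plus[of c] by simp
qed

lemma integral_translate:
  fixes f :: "'a::euclidean_space \<Rightarrow> real"
  assumes "f \<in> borel_measurable borel"
  shows "(LINT z|lborel. f (z + c)) = (LINT z|lborel. f z)"
proof -
  have "(LINT z|lborel. f z) = (LINT z|distr lborel borel (\<lambda>z. z + c). f z)"
    by (simp add: lborel_distr_translate)
  also have "\<dots> = (LINT z|lborel. f (z + c))"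
    using assms by (intro integral_distr) auto
  finally show ?thesis by simp
qed

lemma integrable_translate:
  fixes f :: "'a::euclidean_space \<Rightarrow> real"
  assumes "f \<in> borel_measurable borel"
  shows "integrable lborel (\<lambda>z. f (z + c)) \<longleftrightarrow> integrable lborel f"
proof -
  have "integrable lborel f \<longleftrightarrow> integrable (distr lborel borel (\<lambda>z. z + c)) f"
    by (simp add: lborel_distr_translate)
  also have "\<dots> \<longleftrightarrow> integrable lborel (\<lambda>z. f (z + c))"
    using assms by (intro integrable_distr_eq) auto
  finally show ?thesis by simp
qed

lemma AE_translate:
  fixes P :: "'a::euclidean_space \<Rightarrow> bool"
  assumes "Measurable.pred borel P" "AE z in lborel. P z"
  shows "AE z in lborel. P (z + c)"
proof -
  have "AE z in distr lborel borel (\<lambda>z. z + c). P z"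
    unfolding lborel_distr_translate by (rule assms(2))
  then show ?thesis
    using assms(1) by (subst (asm) AE_distr_iff) auto
qed

abbreviation L2R :: "('a::euclidean_space \<Rightarrow> real) \<Rightarrow> bool" where "L2R \<equiv> L2 lborel"
abbreviation nr :: "('a::euclidean_space \<Rightarrow> real) \<Rightarrow> real" where "nr \<equiv> nsq lborel"

lemma L2R_borel [measurable_dest]: "L2R f \<Longrightarrow> f \<in> borel_measurable borel"
  by (simp add: L2_def)

lemma L2R_translate:
  fixes f :: "'a::euclidean_space \<Rightarrow> real"
  assumes "L2R f"
  shows "L2R (\<lambda>z. f (z + c))" and "nr (\<lambda>z. f (z + c)) = nr f"
  using assms integrable_translate[of "\<lambda>z. (f z)\<^sup>2" c] integral_translate[of "\<lambda>z. (f z)\<^sup>2" c]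
  by (auto simp: L2_def nsq_def)

text \<open>The direction is a parameter, so that the same lemmas serve the line and both coordinate
  directions of the plane. For \<open>s = 0\<close> the value is 0 by the convention for
  division.\<close>

definition dqv :: "'a::euclidean_space \<Rightarrow> real \<Rightarrow> ('a \<Rightarrow> real) \<Rightarrow> 'a \<Rightarrow> real" where
  "dqv v s f z = (f (z + s *\<^sub>R v) - f z) / s"

lemma dqv_measurable [measurable]:
  assumes [measurable]: "f \<in> borel_measurable borel"
  shows "dqv v s f \<in> borel_measurable borel"
  unfolding dqv_def[abs_def] by measurable

lemma L2R_dqv: "L2R f \<Longrightarrow> L2R (dqv v s f)"
  unfolding dqv_def[abs_def] divide_inverse
  using L2_cmult[OF L2_diff[OF L2R_translate(1)], of f f "inverse s" "s *\<^sub>R v"] by (simp add: mult.commute)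

text \<open>Translation invariance moves the shift from \<open>f\<close> to \<open>g\<close>. The
  adjoint of a forward quotient is minus a backward one, which is why the scheme combines the
  two.\<close>

lemma dqv_by_parts:
  fixes f g :: "'a::euclidean_space \<Rightarrow> real"
  assumes [measurable]: "f \<in> borel_measurable borel" "g \<in> borel_measurable borel"
    and int: "integrable lborel (\<lambda>z. f z * g z)" "integrable lborel (\<lambda>z. f (z + s *\<^sub>R v) * g z)"
  shows "(LINT z|lborel. dqv v s f z * g z) = - (LINT z|lborel. f z * dqv v (- s) g z)"
proof -
  have int3: "integrable lborel (\<lambda>z. f z * g (z - s *\<^sub>R v))"
    using integrable_translate[of "\<lambda>z. f (z + s *\<^sub>R v) * g z" "- s *\<^sub>R v"] int(2) by simp
  have "(LINT z|lborel. dqv v s f z * g z) = (LINT z|lborel. (f (z + s *\<^sub>R v) * g z - f z * g z) / s)"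
    by (intro Bochner_Integration.integral_cong) (auto simp: dqv_def field_simps)
  also have "\<dots> = ((LINT z|lborel. f (z + s *\<^sub>R v) * g z) - (LINT z|lborel. f z * g z)) / s"
    using int by simp
  also have "(LINT z|lborel. f (z + s *\<^sub>R v) * g z) = (LINT z|lborel. f z * g (z - s *\<^sub>R v))"
    using integral_translate[of "\<lambda>z. f (z + s *\<^sub>R v) * g z" "- s *\<^sub>R v"] by simp
  also have "((LINT z|lborel. f z * g (z - s *\<^sub>R v)) - (LINT z|lborel. f z * g z)) / s
      = (LINT z|lborel. (f z * g (z - s *\<^sub>R v) - f z * g z) / s)"
    using int int3 by simp
  also have "\<dots> = (LINT z|lborel. - (f z * dqv v (- s) g z))"
    by (intro Bochner_Integration.integral_cong) (auto simp: dqv_def field_simps)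
  finally show ?thesis by simp
qed

lemma dqv_by_parts_L2:
  assumes "L2R f" "L2R g"
  shows "(LINT z|lborel. dqv v s f z * g z) = - (LINT z|lborel. f z * dqv v (- s) g z)"
  using assms by (intro dqv_by_parts L2_mult_integrable L2R_translate) auto

text \<open>A Borel version of \<open>locally_integrable\<close>. Borel measurability is what
  translations and Fubini for \<open>lborel\<close> require; balls suffice because every compact set
  lies in one.\<close>

definition loc_int :: "('a::euclidean_space \<Rightarrow> real) \<Rightarrow> bool" where
  "loc_int f \<longleftrightarrow> f \<in> borel_measurable borel \<and> (\<forall>R. integrable lborel (\<lambda>z. indicator (cball 0 R) z * f z))"

lemma cball_borel [measurable]: "cball (c::'a::euclidean_space) R \<in> sets borel"
  by (intro borel_closed closed_cball)

lemma loc_int_L2: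
  fixes f :: "'a::euclidean_space \<Rightarrow> real"
  assumes "L2R f" shows "loc_int f"
proof -
  have "L2R (indicator (cball (0::'a) R))" for R
    unfolding L2_def power2_eq_square indicator_inter_arith[symmetric] Int_absorb
    by (auto intro!: integrable_real_indicator emeasure_bounded_finite)
  then show ?thesis
    using assms L2_mult_integrable[of lborel "indicator (cball 0 _)" f] by (auto simp: loc_int_def)
qed

lemma loc_int_times_bounded:
  assumes f: "loc_int f" and g [measurable]: "g \<in> borel_measurable borel"
    and B: "\<And>z. \<bar>g z\<bar> \<le> B" and 0: "\<And>z. norm z > R \<Longrightarrow> g z = 0"
  shows "integrable lborel (\<lambda>z. f z * g z)"
proof (rule Bochner_Integration.integrable_bound)
  show "integrable lborel (\<lambda>z. B * (indicator (cball 0 R) z * f z))"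
    using f by (simp add: loc_int_def)
  have [measurable]: "f \<in> borel_measurable borel" using f by (simp add: loc_int_def)
  show "(\<lambda>z. f z * g z) \<in> borel_measurable lborel" by measurable
  have "0 \<le> B" using B[of 0] by linarith
  show "AE z in lborel. norm (f z * g z) \<le> norm (B * (indicator (cball 0 R) z * f z))"
  proof (rule AE_I2)
    fix z
    show "norm (f z * g z) \<le> norm (B * (indicator (cball 0 R) z * f z))"
      using B[of z] 0[of z] \<open>0 \<le> B\<close>
      by (cases "norm z > R") (auto simp: abs_mult indicator_def mult.commute[of B] intro: mult_left_mono)
  qed
qed

lemma loc_int_bounded:
  assumes f [measurable]: "f \<in> borel_measurable borel" and "\<And>R. \<exists>B. \<forall>z\<in>cball 0 R. \<bar>f z\<bar> \<le> B"
  shows "loc_int f"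
  unfolding loc_int_def
proof (intro conjI allI f)
  fix R
  obtain B where B: "\<And>z. z \<in> cball 0 R \<Longrightarrow> \<bar>f z\<bar> \<le> B" using assms(2)[of R] by blast
  show "integrable lborel (\<lambda>z. indicator (cball 0 R) z * f z)"
  proof (rule Bochner_Integration.integrable_bound)
    show "integrable lborel (\<lambda>z. indicator (cball 0 R) z * B :: real)"
      by (intro integrable_mult_left integrable_real_indicator emeasure_bounded_finite) auto
    show "AE z in lborel. norm (indicator (cball 0 R) z * f z) \<le> norm (indicator (cball 0 R) z * B)"
    proof (rule AE_I2)
      fix z
      show "norm (indicator (cball 0 R) z * f z) \<le> norm (indicator (cball 0 R) z * B)"
        using B[of z] by (cases "z \<in> cball 0 R") auto
    qed
  qed (use f in measurable)
qed

section \<open>Integrals over subsets and test functions\<close>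

text \<open>The theorem integrates over \<open>lebesgue_on\<close>, the proof over
  \<open>lborel\<close>. Only the values of \<open>k\<close> on \<open>S\<close> matter, so
  \<open>h\<close> may be a clamped or extended replacement outside \<open>S\<close>.\<close>

lemma integral_lebesgue_on_eq:
  fixes h k :: "'a::euclidean_space \<Rightarrow> real"
  assumes [measurable]: "h \<in> borel_measurable borel" "S \<in> sets borel"
    and eq: "\<And>z. z \<in> S \<Longrightarrow> k z = h z"
  shows "(LINT z|lebesgue_on S. k z) = (LINT z|lborel. indicator S z * h z)"
proof -
  have S: "S \<in> sets lebesgue" by simp
  have "(LINT z|lebesgue_on S. k z) = (LINT z|lebesgue_on S. h z)"
    using eq S by (intro Bochner_Integration.integral_cong) (auto simp: space_restrict_space)
  also have "\<dots> = (LINT z|lebesgue. indicator S z *\<^sub>R h z)"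
    using S by (intro integral_restrict_space) auto
  also have "\<dots> = (LINT z|lborel. indicator S z * h z)"
    by (subst integral_completion) auto
  finally show ?thesis .
qed

lemma integrable_lebesgue_on_eq:
  fixes h k :: "'a::euclidean_space \<Rightarrow> real"
  assumes [measurable]: "h \<in> borel_measurable borel" "S \<in> sets borel"
    and eq: "\<And>z. z \<in> S \<Longrightarrow> k z = h z"
  shows "integrable (lebesgue_on S) k \<longleftrightarrow> integrable lborel (\<lambda>z. indicator S z * h z)"
proof -
  have S: "S \<in> sets lebesgue" by simp
  have "integrable (lebesgue_on S) k \<longleftrightarrow> integrable (lebesgue_on S) h"
    using eq S by (intro Bochner_Integration.integrable_cong) (auto simp: space_restrict_space)
  also have "\<dots> \<longleftrightarrow> integrable lebesgue (\<lambda>z. indicator S z *\<^sub>R h z)"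
    using S by (intro integrable_restrict_space) auto
  also have "\<dots> \<longleftrightarrow> integrable lborel (\<lambda>z. indicator S z * h z)"
    by (subst integrable_completion) auto
  finally show ?thesis .
qed

lemma compact_subset_cball_0:
  fixes K :: "'a::euclidean_space set"
  assumes "compact K" shows "\<exists>R. K \<subseteq> cball 0 R"
  using compact_imp_bounded[OF assms] unfolding bounded_iff subset_eq by simp

lemma locally_integrable_loc_int:
  fixes f :: "'a::euclidean_space \<Rightarrow> real"
  assumes "loc_int f" shows "locally_integrable \<Omega> f"
  unfolding locally_integrable_def
proof safe
  fix K :: "'a set" assume K: "compact K"
  have [measurable]: "f \<in> borel_measurable borel" using assms by (simp add: loc_int_def)
  obtain R where R: "K \<subseteq> cball 0 R" using compact_subset_cball_0[OF K] by blast
  have [measurable]: "K \<in> sets borel" using K by (simp add: borel_compact)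
  have "integrable lborel (\<lambda>z. f z * indicator K z)"
    by (rule loc_int_times_bounded[OF assms, where B=1 and R=R]) (use R in \<open>auto simp: indicator_def\<close>)
  then show "integrable (lebesgue_on K) f"
    by (subst integrable_lebesgue_on_eq[where h=f]) (auto simp: mult.commute)
qed

lemma C1_compact_supportE:
  fixes \<phi> :: "'a::euclidean_space \<Rightarrow> real"
  assumes "C1_compact_support UNIV \<phi> D"
  obtains R where "\<And>z. (\<phi> has_derivative D z) (at z)" "continuous_on UNIV \<phi>"
    "\<And>v. continuous_on UNIV (\<lambda>z. D z v)" "\<And>z. norm z > R \<Longrightarrow> \<phi> z = 0" "\<And>z v. norm z > R \<Longrightarrow> D z v = 0"
proof -
  obtain K where K: "compact K" "\<And>z. z \<notin> K \<Longrightarrow> \<phi> z = 0"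
    and d: "\<And>z. (\<phi> has_derivative D z) (at z)" and c: "\<And>v. continuous_on UNIV (\<lambda>z. D z v)"
    using assms by (auto simp: C1_compact_support_def)
  obtain R where R: "K \<subseteq> cball 0 R" using compact_subset_cball_0[OF K(1)] by blast
  have D0: "D z v = 0" if "norm z > R" for z v
  proof -
    have "open (- cball (0::'a) R)" by (intro open_Compl closed_cball)
    then have "(\<phi> has_derivative (\<lambda>_. 0)) (at z)"
    proof (rule has_derivative_transform_within_open[OF has_derivative_const])
      show "0 = \<phi> x" if "x \<in> - cball 0 R" for x
      proof -
        have "x \<notin> K" using R that by auto
        then show ?thesis using K(2) by simp
      qed
    qed (use that in auto)
    then have "D z = (\<lambda>_. 0)" using d[of z] has_derivative_unique by blast
    then show ?thesis by simp
  qed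
  have "continuous_on UNIV \<phi>"
    using d by (intro has_derivative_continuous_on) auto
  moreover have "\<phi> z = 0" if "norm z > R" for z
  proof (rule K(2))
    show "z \<notin> K" using R that by auto
  qed
  ultimately show ?thesis using that[OF d _ c, of R] D0 by blast
qed

text \<open>\<open>\<Omega>\<close> and the complement of \<open>K\<close> are open and cover the
  space. On their overlap the extension is locally zero, so by uniqueness \<open>D\<close> vanishes
  there and the two local descriptions of the derivative agree.\<close>

lemma C1_compact_support_extend:
  assumes \<Omega>: "open \<Omega>" and \<phi>: "C1_compact_support \<Omega> \<phi> D"
  shows "C1_compact_support UNIV (\<lambda>z. if z \<in> \<Omega> then \<phi> z else 0) (\<lambda>z v. if z \<in> \<Omega> then D z v else 0)"
    and "\<exists>K. compact K \<and> K \<subseteq> \<Omega> \<and> (\<forall>z\<in>\<Omega> - K. \<phi> z = 0 \<and> (\<forall>v. D z v = 0))"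
proof -
  obtain K where K: "compact K" "K \<subseteq> \<Omega>" "\<And>z. z \<in> \<Omega> \<Longrightarrow> z \<notin> K \<Longrightarrow> \<phi> z = 0"
    and d: "\<And>z. z \<in> \<Omega> \<Longrightarrow> (\<phi> has_derivative D z) (at z)"
    and c: "\<And>v. continuous_on \<Omega> (\<lambda>z. D z v)"
    using \<phi> at_within_open[OF _ \<Omega>] by (force simp: C1_compact_support_def)
  define \<phi>' where "\<phi>' = (\<lambda>z. if z \<in> \<Omega> then \<phi> z else 0)"
  define D' where "D' = (\<lambda>z v. if z \<in> \<Omega> then D z v else 0)"
  have oK: "open (- K)" using K(1) by (simp add: compact_imp_closed open_Compl)
  have d1: "(\<phi>' has_derivative D z) (at z)" if "z \<in> \<Omega>" for z
    by (rule has_derivative_transform_within_open[OF d[OF that] \<Omega> that]) (simp add: \<phi>'_def)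
  have d0: "(\<phi>' has_derivative (\<lambda>_. 0)) (at z)" if "z \<notin> K" for z
    by (rule has_derivative_transform_within_open[OF has_derivative_const oK])
      (use that K in \<open>auto simp: \<phi>'_def\<close>)
  have D0: "D z = (\<lambda>_. 0)" if "z \<in> \<Omega>" "z \<notin> K" for z
    using has_derivative_unique[OF d1[OF that(1)] d0[OF that(2)]] .
  show "\<exists>K. compact K \<and> K \<subseteq> \<Omega> \<and> (\<forall>z\<in>\<Omega> - K. \<phi> z = 0 \<and> (\<forall>v. D z v = 0))"
    using K D0 by (intro exI[of _ K]) auto
  have "(\<phi>' has_derivative D' z) (at z)" for z
    using d1[of z] d0[of z] K(2) by (cases "z \<in> \<Omega>") (auto simp: D'_def)
  moreover have "continuous_on UNIV (\<lambda>z. D' z v)" for v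
  proof -
    have "continuous_on \<Omega> (\<lambda>z. D' z v)"
      using c[of v] by (rule continuous_on_eq) (simp add: D'_def)
    moreover have "continuous_on (- K) (\<lambda>z. D' z v)"
      by (rule continuous_on_eq[OF continuous_on_const[of _ 0]]) (use D0 in \<open>auto simp: D'_def\<close>)
    ultimately have "continuous_on (\<Omega> \<union> - K) (\<lambda>z. D' z v)"
      using \<Omega> oK by (intro continuous_on_open_Un)
    moreover have "\<Omega> \<union> - K = UNIV" using K(2) by auto
    ultimately show ?thesis by simp
  qed
  moreover have "\<forall>z. z \<notin> K \<longrightarrow> \<phi>' z = 0" using K by (auto simp: \<phi>'_def)
  ultimately have "C1_compact_support UNIV \<phi>' D'"
    using K(1) by (auto simp: C1_compact_support_def)
  then show "C1_compact_support UNIV (\<lambda>z. if z \<in> \<Omega> then \<phi> z else 0) (\<lambda>z v. if z \<in> \<Omega> then D z v else 0)"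
    unfolding \<phi>'_def D'_def .
qed

text \<open>Restriction to lines in direction \<open>v\<close> reduces both claims to one variable;
  the bound is the mean value inequality. For steps of size at most 1 the supports stay in one ball,
  which provides the majorant for dominated convergence.\<close>

lemma C1_compact_support_dqv:
  assumes "C1_compact_support UNIV \<phi> D"
  shows "(\<And>n. s n \<noteq> 0) \<Longrightarrow> s \<longlonglongrightarrow> 0 \<Longrightarrow> (\<lambda>n. dqv v (s n) \<phi> z) \<longlonglongrightarrow> D z v"
    and "\<exists>B R. \<forall>s z. s \<noteq> 0 \<and> \<bar>s\<bar> \<le> 1 \<longrightarrow> \<bar>dqv v s \<phi> z\<bar> \<le> B \<and> (norm z > R \<longrightarrow> dqv v s \<phi> z = 0)"
proof -
  obtain R where d: "\<And>z. (\<phi> has_derivative D z) (at z)"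
    and c: "continuous_on UNIV (\<lambda>z. D z v)" and R: "\<And>z. norm z > R \<Longrightarrow> \<phi> z = 0" "\<And>z v. norm z > R \<Longrightarrow> D z v = 0"
    using C1_compact_supportE[OF assms] by metis
  have line: "((\<lambda>r. \<phi> (z + r *\<^sub>R v)) has_field_derivative D (z + r *\<^sub>R v) v) (at r)" for z r
  proof -
    have lin: "linear (D (z + r *\<^sub>R v))" using d[of "z + r *\<^sub>R v"] by (rule has_derivative_linear)
    have "((\<lambda>r. \<phi> (z + r *\<^sub>R v)) has_derivative (\<lambda>h. D (z + r *\<^sub>R v) (h *\<^sub>R v))) (at r)"
      by (rule has_derivative_compose[OF _ d]) (auto intro!: derivative_eq_intros)
    then show ?thesis
      by (simp add: has_field_derivative_def linear_cmul[OF lin] mult_commute_abs)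
  qed
  show "(\<lambda>n. dqv v (s n) \<phi> z) \<longlonglongrightarrow> D z v" if s: "\<And>n. s n \<noteq> 0" "s \<longlonglongrightarrow> 0"
  proof -
    have "((\<lambda>h. (\<phi> (z + (0 + h) *\<^sub>R v) - \<phi> (z + 0 *\<^sub>R v)) / h) \<longlongrightarrow> D (z + 0 *\<^sub>R v) v) (at 0)"
      using line[of z 0] by (simp add: DERIV_def)
    then have "((\<lambda>h. dqv v h \<phi> z) \<longlongrightarrow> D z v) (at 0)"
      by (simp add: dqv_def)
    moreover have "filterlim s (at 0) sequentially"
      using s by (auto simp: filterlim_at)
    ultimately show ?thesis by (rule filterlim_compose)
  qed
  have "compact ((\<lambda>z. D z v) ` cball 0 R)"
    using c by (intro compact_continuous_image continuous_on_subset[OF c]) auto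
  then obtain B where B: "B > 0" "\<And>z. z \<in> cball 0 R \<Longrightarrow> \<bar>D z v\<bar> \<le> B"
    using compact_imp_bounded[of "(\<lambda>z. D z v) ` cball 0 R"] by (auto simp: bounded_pos)
  have B': "\<bar>D z v\<bar> \<le> B" for z
    using B R(2)[of z v] by (cases "norm z \<le> R") auto
  have "\<bar>dqv v s \<phi> z\<bar> \<le> B" if "s \<noteq> 0" for s z
  proof -
    have "norm (\<phi> (z + s *\<^sub>R v) - \<phi> (z + 0 *\<^sub>R v)) \<le> B * norm (s - 0)"
      by (rule field_differentiable_bound[where S=UNIV]) (use line B' in auto)
    then show ?thesis using that by (simp add: dqv_def field_simps)
  qed
  moreover have "dqv v s \<phi> z = 0" if "\<bar>s\<bar> \<le> 1" "norm z > \<bar>R\<bar> + norm v" for s z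
  proof -
    have "norm (s *\<^sub>R v) \<le> norm v" using that by (simp add: mult_left_le_one_le)
    then have "norm (z + s *\<^sub>R v) > R" using that norm_triangle_ineq4[of "z + s *\<^sub>R v" "s *\<^sub>R v"]
      unfolding add_diff_cancel_right' by linarith
    moreover have "norm z > R" using that norm_ge_zero[of v] by linarith
    ultimately show ?thesis using R(1) by (simp add: dqv_def)
  qed
  ultimately show "\<exists>B R. \<forall>s z. s \<noteq> 0 \<and> \<bar>s\<bar> \<le> 1 \<longrightarrow> \<bar>dqv v s \<phi> z\<bar> \<le> B \<and> (norm z > R \<longrightarrow> dqv v s \<phi> z = 0)"
    by blast
qed

lemma C1_compact_support_borel:
  assumes "C1_compact_support UNIV \<phi> D"
  shows "\<phi> \<in> borel_measurable borel" "(\<lambda>z. D z v) \<in> borel_measurable borel"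
  using C1_compact_supportE[OF assms] borel_measurable_continuous_onI by metis+

lemma C1_compact_support_bounded:
  assumes "C1_compact_support UNIV \<phi> D"
  obtains B R where "\<And>z. \<bar>\<phi> z\<bar> \<le> B" "\<And>z. \<bar>D z v\<bar> \<le> B" "\<And>z. norm z > R \<Longrightarrow> \<phi> z = 0"
     "\<And>z. norm z > R \<Longrightarrow> D z v = 0"
proof -
  obtain R where c: "continuous_on UNIV (\<lambda>z. D z v)" "continuous_on UNIV \<phi>"
    and R: "\<And>z. norm z > R \<Longrightarrow> \<phi> z = 0" "\<And>z v. norm z > R \<Longrightarrow> D z v = 0"
    using C1_compact_supportE[OF assms] by metis
  have "compact ((\<lambda>z. D z v) ` cball 0 R \<union> \<phi> ` cball 0 R)"
    using c by (intro compact_Un compact_continuous_image) (auto intro: continuous_on_subset)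
  then obtain B where B: "B > 0" "\<And>z. z \<in> cball 0 R \<Longrightarrow> \<bar>D z v\<bar> \<le> B \<and> \<bar>\<phi> z\<bar> \<le> B"
    using compact_imp_bounded[of "(\<lambda>z. D z v) ` cball 0 R \<union> \<phi> ` cball 0 R"] unfolding bounded_pos
    by auto
  have "\<bar>D z v\<bar> \<le> B \<and> \<bar>\<phi> z\<bar> \<le> B" for z
    using B R[of z] by (cases "norm z \<le> R") auto
  then show ?thesis using that R by blast
qed

lemma L2R_C1_compact_support:
  assumes "C1_compact_support UNIV \<phi> D" shows "L2R \<phi>" "L2R (\<lambda>z. D z v)"
proof -
  obtain B R where *: "\<And>z. \<bar>\<phi> z\<bar> \<le> B" "\<And>z. \<bar>D z v\<bar> \<le> B" "\<And>z. norm z > R \<Longrightarrow> \<phi> z = 0"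
     "\<And>z. norm z > R \<Longrightarrow> D z v = 0" using C1_compact_support_bounded[OF assms] by metis
  note [measurable] = C1_compact_support_borel[OF assms]
  have l: "loc_int \<phi>" "loc_int (\<lambda>z. D z v)"
    using * by (auto intro!: loc_int_bounded)
  show "L2R \<phi>" "L2R (\<lambda>z. D z v)"
    using loc_int_times_bounded[OF l(1), of \<phi> B R] loc_int_times_bounded[OF l(2), of "\<lambda>z. D z v" B R] *
    by (auto simp: L2_def power2_eq_square)
qed

text \<open>The quotient is moved to the test function, where it converges boundedly; so the limit
  exists for every locally integrable \<open>f\<close>.\<close>

lemma dqv_pairing_tendsto:
  fixes \<phi> :: "'a::euclidean_space \<Rightarrow> real"
  assumes \<phi>: "C1_compact_support UNIV \<phi> D" and f: "loc_int f"
    and s: "\<And>n. s n \<noteq> 0" "s \<longlonglongrightarrow> 0"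
  shows "(\<lambda>n. LINT z|lborel. dqv v (s n) f z * \<phi> z) \<longlonglongrightarrow> - (LINT z|lborel. f z * D z v)"
proof -
  have [measurable]: "f \<in> borel_measurable borel" "\<phi> \<in> borel_measurable borel" "(\<lambda>z. D z v) \<in> borel_measurable borel"
    using f C1_compact_support_borel[OF \<phi>] by (auto simp: loc_int_def)
  obtain B R where BR: "\<And>s z. s \<noteq> 0 \<Longrightarrow> \<bar>s\<bar> \<le> 1 \<Longrightarrow> \<bar>dqv v s \<phi> z\<bar> \<le> B"
     "\<And>s z. s \<noteq> 0 \<Longrightarrow> \<bar>s\<bar> \<le> 1 \<Longrightarrow> norm z > R \<Longrightarrow> dqv v s \<phi> z = 0"
    using C1_compact_support_dqv(2)[OF \<phi>, of v] by metis
  obtain B' R' where B': "\<And>z. \<bar>\<phi> z\<bar> \<le> B'" "\<And>z. norm z > R' \<Longrightarrow> \<phi> z = 0"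
    using C1_compact_support_bounded[OF \<phi>] by metis
  have int1: "integrable lborel (\<lambda>z. f z * \<phi> z)"
    by (rule loc_int_times_bounded[OF f, where B=B' and R=R']) (use B' in auto)
  have int2: "integrable lborel (\<lambda>z. f (z + s *\<^sub>R v) * \<phi> z)" for s
  proof -
    have "integrable lborel (\<lambda>z. f z * \<phi> (z - s *\<^sub>R v))"
    proof (rule loc_int_times_bounded[OF f _ , where B=B' and R="R' + norm (s *\<^sub>R v)"])
      fix z :: 'a assume "norm z > R' + norm (s *\<^sub>R v)"
      then show "\<phi> (z - s *\<^sub>R v) = 0"
        using B'(2)[of "z - s *\<^sub>R v"] norm_triangle_ineq2[of z "s *\<^sub>R v"] by linarith
    qed (use B' in auto)
    then show ?thesis
      using integrable_translate[of "\<lambda>z. f z * \<phi> (z - s *\<^sub>R v)" "s *\<^sub>R v"] by simp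
  qed
  have "eventually (\<lambda>n. \<bar>s n\<bar> \<le> 1) sequentially"
    using order_tendstoD(2)[OF tendsto_rabs_zero[OF s(2)], of 1] by (auto elim: eventually_mono)
  then obtain n0 where n0: "\<And>n. n \<ge> n0 \<Longrightarrow> \<bar>s n\<bar> \<le> 1" by (auto simp: eventually_sequentially)
  have "(\<lambda>n. LINT z|lborel. f z * dqv v (- s (n + n0)) \<phi> z) \<longlonglongrightarrow> (LINT z|lborel. f z * D z v)"
  proof (rule integral_dominated_convergence[where w="\<lambda>z. B * \<bar>indicator (cball 0 R) z * f z\<bar>"])
    show "integrable lborel (\<lambda>z. B * \<bar>indicator (cball 0 R) z * f z\<bar>)"
      using f by (intro integrable_mult_right integrable_abs) (simp add: loc_int_def)
    have s': "(\<lambda>n. - s (n + n0)) \<longlonglongrightarrow> 0" "\<And>n. - s (n + n0) \<noteq> 0"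
      using LIMSEQ_ignore_initial_segment[OF s(2), of n0] tendsto_minus[of "\<lambda>n. s (n + n0)" 0] s(1) by auto
    show "AE z in lborel. (\<lambda>n. f z * dqv v (- s (n + n0)) \<phi> z) \<longlonglongrightarrow> f z * D z v"
      by (intro AE_I2 tendsto_mult_left C1_compact_support_dqv(1)[OF \<phi> s'(2,1)])
    have "0 \<le> B" using BR(1)[of 1 0] abs_ge_zero[of "dqv v 1 \<phi> 0"] by linarith
    show "AE z in lborel. norm (f z * dqv v (- s (n + n0)) \<phi> z) \<le> B * \<bar>indicator (cball 0 R) z * f z\<bar>" for n
    proof (rule AE_I2)
      fix z
      show "norm (f z * dqv v (- s (n + n0)) \<phi> z) \<le> B * \<bar>indicator (cball 0 R) z * f z\<bar>"
        using BR[of "- s (n + n0)" z] n0[of "n + n0"] s(1)[of "n + n0"] \<open>0 \<le> B\<close>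
        by (cases "norm z > R") (auto simp: abs_mult indicator_def mult.commute[of B] intro: mult_left_mono)
    qed
  qed auto
  then have "(\<lambda>n. LINT z|lborel. f z * dqv v (- s n) \<phi> z) \<longlonglongrightarrow> (LINT z|lborel. f z * D z v)"
    by (rule LIMSEQ_offset)
  from tendsto_minus[OF this] show ?thesis
    using dqv_by_parts[OF _ _ int1 int2] by simp
qed

text \<open>By \<open>dqv_pairing_tendsto\<close> the pairings of quotients converge to minus the
  pairing of \<open>f\<close> with the derivative of the test function; so it is enough to identify
  their limit along one null sequence. The weak derivatives of the limit solution are all obtained
  through this rule.\<close>

lemma weak_derivativeI:
  assumes \<Omega>: "open \<Omega>" and f: "loc_int f" and g: "loc_int g"
    and s: "\<And>n. s n \<noteq> 0" "s \<longlonglongrightarrow> 0"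
    and lim: "\<And>\<phi> D K. C1_compact_support UNIV \<phi> D \<Longrightarrow> compact K \<Longrightarrow> K \<subseteq> \<Omega> \<Longrightarrow> (\<And>z. z \<notin> K \<Longrightarrow> \<phi> z = 0) \<Longrightarrow>
       (\<lambda>n. LINT z|lborel. dqv v (s n) f z * \<phi> z) \<longlonglongrightarrow> (LINT z|lborel. g z * \<phi> z)"
  shows "weak_derivative \<Omega> v f g"
  unfolding weak_derivative_def
proof (intro conjI allI impI locally_integrable_loc_int f g)
  fix \<phi> D assume \<phi>: "C1_compact_support \<Omega> \<phi> D"
  define \<phi>' where "\<phi>' = (\<lambda>z. if z \<in> \<Omega> then \<phi> z else 0)"
  define D' where "D' = (\<lambda>z v. if z \<in> \<Omega> then D z v else 0)"
  have C1: "C1_compact_support UNIV \<phi>' D'"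
    using C1_compact_support_extend(1)[OF \<Omega> \<phi>] by (simp add: \<phi>'_def D'_def)
  obtain K where K: "compact K" "K \<subseteq> \<Omega>" "\<And>z. z \<in> \<Omega> - K \<Longrightarrow> \<phi> z = 0"
    using C1_compact_support_extend(2)[OF \<Omega> \<phi>] by metis
  note [measurable] = C1_compact_support_borel[OF C1]
  have [measurable]: "f \<in> borel_measurable borel" "g \<in> borel_measurable borel" "\<Omega> \<in> sets borel"
    using f g \<Omega> by (auto simp: loc_int_def)
  have "(LINT z|lborel. g z * \<phi>' z) = - (LINT z|lborel. f z * D' z v)"
    by (rule LIMSEQ_unique[OF lim[OF C1 K(1,2)] dqv_pairing_tendsto[OF C1 f s]])
      (use K in \<open>auto simp: \<phi>'_def\<close>)
  moreover have "(\<lambda>z. f z * D' z v) \<in> borel_measurable borel" "(\<lambda>z. g z * \<phi>' z) \<in> borel_measurable borel"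
    by measurable
  then have "(LINT z|lebesgue_on \<Omega>. f z * D z v) = (LINT z|lborel. indicator \<Omega> z * (f z * D' z v))"
    "(LINT z|lebesgue_on \<Omega>. g z * \<phi> z) = (LINT z|lborel. indicator \<Omega> z * (g z * \<phi>' z))"
    using \<Omega> by (intro integral_lebesgue_on_eq; simp add: D'_def \<phi>'_def)+
  moreover have "(\<lambda>z. indicator \<Omega> z * (f z * D' z v)) = (\<lambda>z. f z * D' z v)"
    "(\<lambda>z. indicator \<Omega> z * (g z * \<phi>' z)) = (\<lambda>z. g z * \<phi>' z)"
    by (auto simp: D'_def \<phi>'_def indicator_def)
  ultimately show "(LINT z|lebesgue_on \<Omega>. f z * D z v) = - (LINT z|lebesgue_on \<Omega>. g z * \<phi> z)"
    by simp
qed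

section \<open>The fundamental lemma and uniqueness of weak derivatives\<close>

text \<open>On a bounded window \<open>g\<close> is integrable, and the Borel sets over which its
  integral vanishes form a Dynkin system containing the intersection-stable family of open
  intervals. The windows exhaust the line.\<close>

lemma AE_zero_of_interval_integrals:
  fixes g :: "real \<Rightarrow> real"
  assumes g: "loc_int g" and 0: "\<And>a b. a < b \<Longrightarrow> (LINT x|lborel. indicator {a<..<b} x * g x) = 0"
  shows "AE x in lborel. g x = 0"
proof -
  have [measurable]: "g \<in> borel_measurable borel" using g by (simp add: loc_int_def)
  have "AE x in lborel. indicator {- real n<..<real n} x * g x = 0" for n :: nat
  proof -
    define I where "I = {- real n<..<real n}"
    define gI where "gI = (\<lambda>x. indicator I x * g x)"
    have "integrable lborel (\<lambda>x. g x * indicator I x)"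
      by (rule loc_int_times_bounded[OF g, where B=1 and R="real n"]) (auto simp: I_def indicator_def)
    then have int: "integrable lborel gI" by (simp add: gI_def mult.commute)
    have intA: "integrable lborel (\<lambda>x. indicator A x * gI x)" if "A \<in> sets borel" for A
      using that integrable_mult_indicator[of A lborel gI] int by simp
    have base: "(LINT x|lborel. indicator {a<..<b} x * gI x) = 0" for a b
    proof -
      have "(\<lambda>x. indicator {a<..<b} x * gI x) = (\<lambda>x. indicator {max a (- real n)<..<min b (real n)} x * g x)"
        by (auto simp: gI_def I_def indicator_def)
      then show ?thesis
        using 0[of "max a (- real n)" "min b (real n)"]
        by (cases "max a (- real n) < min b (real n)") (auto simp: indicator_def)
    qed
    have tot: "(LINT x|lborel. gI x) = 0"
    proof -
      have "gI = (\<lambda>x. indicator {- real n<..<real n} x * gI x)" by (auto simp: gI_def I_def indicator_def)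
      then show ?thesis using base[of "- real n" "real n"] by simp
    qed
    have all: "(LINT x|lborel. indicator A x * gI x) = 0" if "A \<in> sets borel" for A
    proof -
      let ?E = "range (\<lambda>(a, b). box a b :: real set)"
      have "Int_stable ?E" by (auto simp: Int_stable_def box_Int_box)
      moreover have "?E \<subseteq> Pow UNIV" by simp
      moreover have "A \<in> sigma_sets UNIV ?E" using that by (simp add: borel_eq_box)
      ultimately show ?thesis
      proof (induction rule: sigma_sets_induct_disjoint)
        case (basic A)
        then show ?case using base by (auto simp: box_real)
      next
        case (compl A)
        then have A: "A \<in> sets borel" by (simp add: borel_eq_box)
        have "(LINT x|lborel. indicator (UNIV - A) x * gI x) = (LINT x|lborel. gI x - indicator A x * gI x)"
          by (intro Bochner_Integration.integral_cong) (auto simp: indicator_def)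
        also have "\<dots> = 0" using compl tot int intA[OF A] by simp
        finally show ?case .
      next
        case (union A)
        then have A: "A i \<in> sets borel" for i by (auto simp: borel_eq_box)
        have "set_integrable lborel (\<Union>i. A i) gI"
          using intA[of "\<Union>i. A i"] A by (auto simp: set_integrable_def)
        then have "(LINT x:(\<Union>i. A i)|lborel. gI x) = (\<Sum>i. LINT x:A i|lborel. gI x)"
          using A union(1) by (intro lebesgue_integral_countable_add) (auto simp: disjoint_family_on_def)
        then show ?case using union by (simp add: set_lebesgue_integral_def)
      qed simp
    qed
    have "AE x in lborel. gI x = 0"
      by (rule density_unique_real[OF int]) (use all in \<open>auto simp: set_lebesgue_integral_def\<close>)
    then show ?thesis by (simp add: gI_def I_def)
  qed
  then have "AE x in lborel. \<forall>n. indicator {- real n<..<real n} x * g x = 0"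
    unfolding AE_all_countable by blast
  then show ?thesis
  proof eventually_elim
    case (elim x)
    obtain n :: nat where "\<bar>x\<bar> < real n" using reals_Archimedean2 by blast
    then have "indicator {- real n<..<real n} x = (1::real)" by (auto simp: abs_less_iff)
    then show ?case using elim[rule_format, of n] by simp
  qed
qed

lemma C1_compact_supportI_real:
  fixes \<phi> :: "real \<Rightarrow> real"
  assumes "\<And>z. (\<phi> has_real_derivative \<phi>' z) (at z)" "continuous_on UNIV \<phi>'" "\<And>z. z \<notin> {a..b} \<Longrightarrow> \<phi> z = 0"
  shows "C1_compact_support UNIV \<phi> (\<lambda>z v. \<phi>' z * v)"
  unfolding C1_compact_support_def
  using assms by (auto simp: has_field_derivative_def intro!: continuous_intros exI[of _ "{a..b}"])

text \<open>The square makes the positive part C^1, which is all the smoothness that test functions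
  need.\<close>

lemma DERIV_pos_part_sq: "((\<lambda>x. (max 0 x)\<^sup>2) has_real_derivative 2 * max 0 x) (at (x::real))"
proof -
  consider "x > 0" | "x < 0" | "x = 0" by linarith
  then show ?thesis
  proof cases
    case 1
    have "((\<lambda>x. x\<^sup>2) has_real_derivative 2 * max 0 x) (at x)"
      using 1 by (auto intro!: derivative_eq_intros)
    then show ?thesis
      by (rule has_field_derivative_transform_within_open[of _ _ _ "{0<..}"]) (use 1 in auto)
  next
    case 2
    have "((\<lambda>x. 0) has_real_derivative 2 * max 0 x) (at x)"
      using 2 by (auto intro!: derivative_eq_intros)
    then show ?thesis
      by (rule has_field_derivative_transform_within_open[of _ _ _ "{..<0}"]) (use 2 in auto)
  next
    case 3
    have "((\<lambda>h. max 0 h) \<longlongrightarrow> max 0 0) (at (0::real))"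
      by (intro tendsto_intros)
    moreover have "(max 0 (0 + h))\<^sup>2 / h = max 0 h" for h :: real
      by (cases "h > 0") (auto simp: power2_eq_square max_def)
    ultimately show ?thesis using 3 by (simp add: DERIV_def)
  qed
qed

text \<open>\<open>\<beta>\<close> is positive exactly on the open interval from \<open>a\<close> to
  \<open>b\<close>; hence \<open>\<beta> / (\<beta> + e)\<close> has values between 0 and 1,
  vanishes off the interval and tends to its indicator as \<open>e\<close> tends to 0.\<close>

lemma bump_function:
  fixes a b e :: real
  assumes "e > 0"
  defines "\<beta> \<equiv> \<lambda>x. (max 0 (x - a))\<^sup>2 * (max 0 (b - x))\<^sup>2"
  shows "\<exists>D. C1_compact_support UNIV (\<lambda>x. \<beta> x / (\<beta> x + e)) D"
proof -
  define \<beta>' where "\<beta>' = (\<lambda>x. (2 * max 0 (x - a)) * (max 0 (b - x))\<^sup>2 - (2 * max 0 (b - x)) * (max 0 (x - a))\<^sup>2)"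
  have d: "(\<beta> has_real_derivative \<beta>' x) (at x)" for x
  proof -
    have "((\<lambda>x. (max 0 (x - a))\<^sup>2) has_real_derivative (2 * max 0 (x - a)) * 1) (at x)"
      by (rule DERIV_chain2[OF DERIV_pos_part_sq]) (auto intro!: derivative_eq_intros)
    moreover have "((\<lambda>x. (max 0 (b - x))\<^sup>2) has_real_derivative (2 * max 0 (b - x)) * (-1)) (at x)"
      by (rule DERIV_chain2[OF DERIV_pos_part_sq]) (auto intro!: derivative_eq_intros)
    ultimately show ?thesis
      unfolding \<beta>_def \<beta>'_def by (rule DERIV_cong[OF DERIV_mult]) (simp add: algebra_simps)
  qed
  have nn: "\<beta> x + e \<noteq> 0" for x
  proof -
    have "\<beta> x \<ge> 0" by (simp add: \<beta>_def)
    then show ?thesis using assms(1) by linarith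
  qed
  have "C1_compact_support UNIV (\<lambda>x. \<beta> x / (\<beta> x + e)) (\<lambda>x v. (e * \<beta>' x / (\<beta> x + e)\<^sup>2) * v)"
  proof (rule C1_compact_supportI_real[where a=a and b=b])
    show "((\<lambda>x. \<beta> x / (\<beta> x + e)) has_real_derivative e * \<beta>' z / (\<beta> z + e)\<^sup>2) (at z)" for z
      by (rule derivative_eq_intros d refl nn)+ (use nn in \<open>simp add: power2_eq_square field_simps\<close>)
    show "continuous_on UNIV (\<lambda>x. e * \<beta>' x / (\<beta> x + e)\<^sup>2)"
      using nn unfolding \<beta>_def \<beta>'_def by (intro continuous_intros) auto
  qed (auto simp: \<beta>_def max_def)
  then show ?thesis by blast
qed

text \<open>The bump functions converge boundedly to the indicator of an interval, so the integral
  of \<open>g\<close> over every interval vanishes.\<close>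

lemma fundamental_lemma:
  fixes g :: "real \<Rightarrow> real"
  assumes g: "loc_int g" and 0: "\<And>\<phi> D. C1_compact_support UNIV \<phi> D \<Longrightarrow> (LINT x|lborel. g x * \<phi> x) = 0"
  shows "AE x in lborel. g x = 0"
proof (rule AE_zero_of_interval_integrals[OF g])
  fix a b :: real assume "a < b"
  define \<beta> where "\<beta> = (\<lambda>x. (max 0 (x - a))\<^sup>2 * (max 0 (b - x))\<^sup>2)"
  have [measurable]: "g \<in> borel_measurable borel" using g by (simp add: loc_int_def)
  have [measurable]: "\<beta> \<in> borel_measurable borel" unfolding \<beta>_def by measurable
  have \<beta>: "\<beta> x \<ge> 0" "x \<notin> {a<..<b} \<Longrightarrow> \<beta> x = 0" "x \<in> {a<..<b} \<Longrightarrow> \<beta> x > 0" for x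
    by (auto simp: \<beta>_def max_def)
  define R where "R = max \<bar>a\<bar> \<bar>b\<bar>"
  have "(\<lambda>n. LINT x|lborel. g x * (\<beta> x / (\<beta> x + 1 / real (Suc n)))) \<longlonglongrightarrow> (LINT x|lborel. g x * indicator {a<..<b} x)"
  proof (rule integral_dominated_convergence[where w="\<lambda>x. \<bar>indicator (cball 0 R) x * g x\<bar>"])
    show "AE x in lborel. (\<lambda>n. g x * (\<beta> x / (\<beta> x + 1 / real (Suc n)))) \<longlonglongrightarrow> g x * indicator {a<..<b} x"
    proof (intro AE_I2 tendsto_mult_left)
      fix x
      show "(\<lambda>n. \<beta> x / (\<beta> x + 1 / real (Suc n))) \<longlonglongrightarrow> indicator {a<..<b} x"
      proof (cases "x \<in> {a<..<b}")
        case True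
        have "(\<lambda>n. \<beta> x / (\<beta> x + 1 / real (Suc n))) \<longlonglongrightarrow> \<beta> x / (\<beta> x + 0)"
          using \<beta>(3)[OF True] by (intro tendsto_intros LIMSEQ_Suc[OF lim_1_over_n]) auto
        then show ?thesis using True \<beta>(3)[OF True] by simp
      qed (simp add: \<beta>(2))
    qed
    show "AE x in lborel. norm (g x * (\<beta> x / (\<beta> x + 1 / real (Suc n)))) \<le> \<bar>indicator (cball 0 R) x * g x\<bar>" for n
    proof (rule AE_I2)
      fix x
      show "norm (g x * (\<beta> x / (\<beta> x + 1 / real (Suc n)))) \<le> \<bar>indicator (cball 0 R) x * g x\<bar>"
      proof (cases "x \<in> {a<..<b}")
        case True
        then have "x \<in> cball 0 R" by (auto simp: R_def)
        moreover have "0 \<le> \<beta> x / (\<beta> x + 1 / real (Suc n))" "\<beta> x / (\<beta> x + 1 / real (Suc n)) \<le> 1"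
          using \<beta>(1)[of x] by (auto simp: divide_le_eq_1 add_nonneg_pos intro!: divide_nonneg_nonneg)
        ultimately have "\<bar>\<beta> x / (\<beta> x + 1 / real (Suc n))\<bar> \<le> 1" by linarith
        then have "\<bar>g x\<bar> * \<bar>\<beta> x / (\<beta> x + 1 / real (Suc n))\<bar> \<le> \<bar>g x\<bar> * 1"
          by (rule mult_left_mono) simp
        moreover have "indicator (cball 0 R) x = (1::real)" using \<open>x \<in> cball 0 R\<close> by simp
        ultimately show ?thesis by (simp only: real_norm_def abs_mult mult_1 mult_1_right)
      qed (simp add: \<beta>(2))
    qed
  qed (use g in \<open>auto simp: loc_int_def\<close>)
  moreover have "(LINT x|lborel. g x * (\<beta> x / (\<beta> x + 1 / real (Suc n)))) = 0" for n
    using bump_function[of "1 / real (Suc n)" a b] 0 unfolding \<beta>_def by fastforce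
  ultimately show "(LINT x|lborel. indicator {a<..<b} x * g x) = 0"
    by (simp add: LIMSEQ_const_iff mult.commute)
qed

lemma locally_integrable_UNIV_measurable:
  fixes f :: "'a::euclidean_space \<Rightarrow> real"
  assumes "locally_integrable UNIV f"
  shows "f \<in> borel_measurable lebesgue"
proof (rule borel_measurable_LIMSEQ_real)
  show "(\<lambda>x. indicator (cball 0 (real n)) x *\<^sub>R f x) \<in> borel_measurable lebesgue" for n
  proof -
    have "integrable (lebesgue_on (cball 0 (real n))) f"
      using assms by (auto simp: locally_integrable_def)
    then have "integrable lebesgue (\<lambda>x. indicator (cball 0 (real n)) x *\<^sub>R f x)"
      by (subst (asm) integrable_restrict_space) auto
    then show ?thesis by simp
  qed
  fix x :: 'a
  obtain N :: nat where "norm x < real N" using reals_Archimedean2 by blast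
  then have "\<forall>n\<ge>N. indicator (cball 0 (real n)) x *\<^sub>R f x = f x"
    by (auto simp: indicator_def)
  then show "(\<lambda>n. indicator (cball 0 (real n)) x *\<^sub>R f x) \<longlonglongrightarrow> f x"
    by (intro tendsto_eventually) (auto simp: eventually_sequentially)
qed

text \<open>\<open>weak_derivative\<close> speaks of Lebesgue measurable functions; changing them on
  a null set to Borel ones gives access to translations and Fubini.\<close>

lemma locally_integrable_Borel_version:
  fixes f :: "'a::euclidean_space \<Rightarrow> real"
  assumes "locally_integrable UNIV f"
  obtains f' where "loc_int f'" "AE x in lebesgue. f x = f' x"
proof -
  obtain f' where f' [measurable]: "f' \<in> borel_measurable lborel" and eq: "AE x in lborel. f x = f' x"
    using completion_ex_borel_measurable_real[OF locally_integrable_UNIV_measurable[OF assms]] by blast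
  have eq': "AE x in lebesgue. f x = f' x" using eq by (rule AE_completion)
  have "integrable lborel (\<lambda>z. indicator (cball 0 R) z * f' z)" for R
  proof -
    have "integrable (lebesgue_on (cball 0 R)) f"
      using assms by (auto simp: locally_integrable_def)
    then have "integrable lebesgue (\<lambda>x. indicator (cball 0 R) x *\<^sub>R f x)"
      by (subst (asm) integrable_restrict_space) auto
    then have "integrable lebesgue (\<lambda>x. indicator (cball 0 R) x *\<^sub>R f' x)"
      by (rule integrable_cong_AE_imp) (use eq' f' in \<open>auto intro!: measurable_completion\<close>)
    then show ?thesis by (subst (asm) integrable_completion) auto
  qed
  then have "loc_int f'" using f' by (simp add: loc_int_def)
  then show ?thesis using that eq' by blast
qed

lemma weak_derivative_AE_cong:
  fixes f :: "'a::euclidean_space \<Rightarrow> real"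
  assumes wd: "weak_derivative UNIV v f g" and f': "AE x in lebesgue. f x = f' x" "locally_integrable UNIV f'"
    and g': "AE x in lebesgue. g x = g' x" "locally_integrable UNIV g'"
  shows "weak_derivative UNIV v f' g'"
  unfolding weak_derivative_def
proof (intro conjI allI impI f' g')
  fix \<phi> :: "'a \<Rightarrow> real" and D assume \<phi>: "C1_compact_support UNIV \<phi> D"
  have li: "locally_integrable UNIV f" "locally_integrable UNIV g"
    using wd by (auto simp: weak_derivative_def)
  note [measurable] = li[THEN locally_integrable_UNIV_measurable] f'(2)[THEN locally_integrable_UNIV_measurable]
    g'(2)[THEN locally_integrable_UNIV_measurable]
  have [measurable]: "\<phi> \<in> borel_measurable lebesgue" "(\<lambda>z. D z v) \<in> borel_measurable lebesgue"
    using C1_compact_support_borel[OF \<phi>] by (auto intro: measurable_completion)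
  have "(LINT z|lebesgue. f z * D z v) = (LINT z|lebesgue. f' z * D z v)"
    by (intro integral_cong_AE) (use f' in auto)
  moreover have "(LINT z|lebesgue. g z * \<phi> z) = (LINT z|lebesgue. g' z * \<phi> z)"
    by (intro integral_cong_AE) (use g' in auto)
  moreover have "(LINT z|lebesgue_on UNIV. h z) = (LINT z|lebesgue. h z)" for h :: "'a \<Rightarrow> real"
    by (simp add: lebesgue_on_UNIV_eq)
  ultimately show "(LINT z|lebesgue_on UNIV. f' z * D z v) = - (LINT z|lebesgue_on UNIV. g' z * \<phi> z)"
    using wd \<phi> by (auto simp: weak_derivative_def)
qed

lemma weak_derivativeD_lborel:
  fixes f :: "'a::euclidean_space \<Rightarrow> real"
  assumes wd: "weak_derivative UNIV v f g" and [measurable]: "f \<in> borel_measurable borel" "g \<in> borel_measurable borel"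
    and \<phi>: "C1_compact_support UNIV \<phi> D"
  shows "(LINT z|lborel. f z * D z v) = - (LINT z|lborel. g z * \<phi> z)"
proof -
  note [measurable] = C1_compact_support_borel[OF \<phi>]
  have "(LINT z|lebesgue_on UNIV. f z * D z v) = - (LINT z|lebesgue_on UNIV. g z * \<phi> z)"
    using wd \<phi> by (auto simp: weak_derivative_def)
  then show ?thesis
    using integral_lebesgue_on_eq[of "\<lambda>z. f z * D z v" UNIV "\<lambda>z. f z * D z v"]
      integral_lebesgue_on_eq[of "\<lambda>z. g z * \<phi> z" UNIV "\<lambda>z. g z * \<phi> z"] by simp
qed

text \<open>\<open>sobolev_norm_sq\<close> is computed from a derivative chosen by
  \<open>SOME\<close>; uniqueness makes its value independent of the choice.\<close>

lemma weak_derivative_unique_AE: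
  fixes f :: "real \<Rightarrow> real"
  assumes "weak_derivative UNIV 1 f g" "weak_derivative UNIV 1 f h"
  shows "AE x in lebesgue. g x = h x"
proof -
  have li: "locally_integrable UNIV f" "locally_integrable UNIV g" "locally_integrable UNIV h"
    using assms by (auto simp: weak_derivative_def)
  obtain f' where f': "loc_int f'" "AE x in lebesgue. f x = f' x"
    using locally_integrable_Borel_version[OF li(1)] .
  obtain g' where g': "loc_int g'" "AE x in lebesgue. g x = g' x"
    using locally_integrable_Borel_version[OF li(2)] .
  obtain h' where h': "loc_int h'" "AE x in lebesgue. h x = h' x"
    using locally_integrable_Borel_version[OF li(3)] .
  have [measurable]: "f' \<in> borel_measurable borel" "g' \<in> borel_measurable borel" "h' \<in> borel_measurable borel"
    using f' g' h' by (auto simp: loc_int_def)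
  have wg: "weak_derivative UNIV 1 f' g'"
    by (rule weak_derivative_AE_cong[OF assms(1)]) (use f' g' in \<open>auto intro: locally_integrable_loc_int\<close>)
  have wh: "weak_derivative UNIV 1 f' h'"
    by (rule weak_derivative_AE_cong[OF assms(2)]) (use f' h' in \<open>auto intro: locally_integrable_loc_int\<close>)
  have "AE x in lborel. g' x - h' x = 0"
  proof (rule fundamental_lemma)
    show "loc_int (\<lambda>x. g' x - h' x)"
      using g'(1) h'(1) by (auto simp: loc_int_def right_diff_distrib)
    fix \<phi> D assume \<phi>: "C1_compact_support (UNIV::real set) \<phi> D"
    obtain B R where *: "\<And>z. \<bar>\<phi> z\<bar> \<le> B" "\<And>z. norm z > R \<Longrightarrow> \<phi> z = 0"
      using C1_compact_support_bounded[OF \<phi>] by metis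
    have "integrable lborel (\<lambda>x. g' x * \<phi> x)" "integrable lborel (\<lambda>x. h' x * \<phi> x)"
      using C1_compact_support_borel[OF \<phi>] *
      by (auto intro!: loc_int_times_bounded[OF g'(1), where B=B and R=R] loc_int_times_bounded[OF h'(1), where B=B and R=R])
    then show "(LINT x|lborel. (g' x - h' x) * \<phi> x) = 0"
      using weak_derivativeD_lborel[OF wg _ _ \<phi>] weak_derivativeD_lborel[OF wh _ _ \<phi>]
      by (simp add: left_diff_distrib)
  qed
  then have "AE x in lebesgue. g' x - h' x = 0" by (rule AE_completion)
  then show ?thesis using g'(2) h'(2) by eventually_elim simp
qed

section \<open>Weak limits of difference quotients\<close>

text \<open>The condition on the pairing is convex, so midpoints preserve it.\<close>

lemma mid_pairing:
  assumes "f \<in> mid G" "\<And>g. g \<in> G \<Longrightarrow> L2 M g \<and> \<bar>(LINT x|M. g x * \<phi> x) - l\<bar> \<le> e" "L2 M \<phi>"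
  shows "L2 M f \<and> \<bar>(LINT x|M. f x * \<phi> x) - l\<bar> \<le> e"
  using assms(1)
proof (induction rule: mid.induct)
  case (step f g)
  have "(LINT x|M. (f x + g x) / 2 * \<phi> x) = (LINT x|M. (f x * \<phi> x + g x * \<phi> x) / 2)"
    by (intro Bochner_Integration.integral_cong) (auto simp: field_simps)
  also have "\<dots> = ((LINT x|M. f x * \<phi> x) + (LINT x|M. g x * \<phi> x)) / 2"
    using step L2_mult_integrable[OF _ assms(3)] by simp
  finally have *: "(LINT x|M. (f x + g x) / 2 * \<phi> x) = ((LINT x|M. f x * \<phi> x) + (LINT x|M. g x * \<phi> x)) / 2" .
  have "\<bar>(a + b) / 2 - l\<bar> \<le> e" if "\<bar>a - l\<bar> \<le> e" "\<bar>b - l\<bar> \<le> e" for a b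
    using that by (simp add: abs_le_iff field_simps)
  then show ?case using step L2_midpoint(1)[of M f g] unfolding * by blast
qed (use assms in auto)

lemma L2_pairing_tendsto:
  assumes s: "\<And>n. L2 M (s n)" "L2 M f" "(\<lambda>n. nsq M (\<lambda>x. s n x - f x)) \<longlonglongrightarrow> 0" and \<phi>: "L2 M \<phi>"
  shows "(\<lambda>n. LINT x|M. s n x * \<phi> x) \<longlonglongrightarrow> (LINT x|M. f x * \<phi> x)"
proof -
  have "(\<lambda>n. sqrt (nsq M (\<lambda>x. s n x - f x) * nsq M \<phi>)) \<longlonglongrightarrow> sqrt (0 * nsq M \<phi>)"
    by (intro tendsto_intros s)
  then have lim: "(\<lambda>n. sqrt (nsq M (\<lambda>x. s n x - f x) * nsq M \<phi>)) \<longlonglongrightarrow> 0" by simp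
  have "norm ((LINT x|M. s n x * \<phi> x) - (LINT x|M. f x * \<phi> x)) \<le> sqrt (nsq M (\<lambda>x. s n x - f x) * nsq M \<phi>)" for n
  proof -
    have "(LINT x|M. s n x * \<phi> x) - (LINT x|M. f x * \<phi> x) = (LINT x|M. (s n x - f x) * \<phi> x)"
      using L2_mult_integrable[OF s(1) \<phi>] L2_mult_integrable[OF s(2) \<phi>] by (simp add: left_diff_distrib)
    then show ?thesis
      using Cauchy_Schwarz_L2[OF L2_diff[OF s(1)[of n] s(2)] \<phi>] by (simp add: real_le_rsqrt)
  qed
  then have "(\<lambda>n. (LINT x|M. s n x * \<phi> x) - (LINT x|M. f x * \<phi> x)) \<longlonglongrightarrow> 0"
    by (intro Lim_null_comparison[OF always_eventually lim]) simp
  then show ?thesis by (simp add: LIM_zero_iff)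
qed

text \<open>The combination \<open>s n\<close> uses only members from index \<open>n\<close> on, so
  the pairings of \<open>s\<close> have the same limit as those of \<open>g\<close>; strong
  convergence of \<open>s\<close> transfers it to \<open>f\<close>.\<close>

lemma weak_limit_pairing:
  assumes g: "\<And>k. L2 M (g k)" and s: "\<And>n. s n \<in> mid (g ` {n..})" and f: "L2 M f"
    and lim: "(\<lambda>n. nsq M (\<lambda>x. s n x - f x)) \<longlonglongrightarrow> 0"
    and \<phi>: "L2 M \<phi>" "(\<lambda>k. LINT x|M. g k x * \<phi> x) \<longlonglongrightarrow> l"
  shows "(LINT x|M. f x * \<phi> x) = l"
proof -
  have key: "\<exists>n0. \<forall>n\<ge>n0. L2 M (s n) \<and> \<bar>(LINT x|M. s n x * \<phi> x) - l\<bar> \<le> e" if "e > 0" for e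
  proof -
    obtain n0 where n0: "\<And>k. k \<ge> n0 \<Longrightarrow> \<bar>(LINT x|M. g k x * \<phi> x) - l\<bar> < e"
      using LIMSEQ_D[OF \<phi>(2) \<open>e > 0\<close>] by auto
    have "L2 M (s n) \<and> \<bar>(LINT x|M. s n x * \<phi> x) - l\<bar> \<le> e" if "n \<ge> n0" for n
      by (rule mid_pairing[OF s _ \<phi>(1)]) (use that g n0 in \<open>force intro: less_imp_le\<close>)
    then show ?thesis by blast
  qed
  have sL2: "L2 M (s n)" for n
  proof -
    have "L2 M h" if "h \<in> mid G" "\<And>g. g \<in> G \<Longrightarrow> L2 M g" for h and G :: "('a \<Rightarrow> real) set"
      using that by (induction rule: mid.induct) (auto intro: L2_midpoint)
    from this[OF s] show ?thesis using g by auto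
  qed
  have "(\<lambda>n. LINT x|M. s n x * \<phi> x) \<longlonglongrightarrow> l"
  proof (rule LIMSEQ_I)
    fix e :: real assume "e > 0"
    then obtain n0 where "\<forall>n\<ge>n0. \<bar>(LINT x|M. s n x * \<phi> x) - l\<bar> \<le> e / 2" using key[of "e/2"] by auto
    then show "\<exists>n0. \<forall>n\<ge>n0. norm ((LINT x|M. s n x * \<phi> x) - l) < e"
      using \<open>e > 0\<close> by (intro exI[of _ n0]) force
  qed
  then show ?thesis
    using L2_pairing_tendsto[OF sL2 f lim \<phi>(1)] LIMSEQ_unique by blast
qed

text \<open>The Mazur limit of the quotients is the derivative: their pairings converge by
  \<open>dqv_pairing_tendsto\<close>, and by \<open>weak_limit_pairing\<close> the limit function
  represents the same functional. The norm bound comes with \<open>Mazur\<close>.\<close>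

lemma weak_derivative_of_bounded_dqv:
  fixes f :: "'a::euclidean_space \<Rightarrow> real"
  assumes f: "L2R f" and y: "\<And>k. y k \<noteq> 0" "y \<longlonglongrightarrow> 0" and bd: "\<And>k. nr (dqv v (y k) f) \<le> C"
  obtains g where "L2R g" "nr g \<le> C" "weak_derivative UNIV v f g"
proof -
  from Mazur[of lborel "\<lambda>k. dqv v (y k) f" C, OF L2R_dqv[OF f] bd]
  obtain s g where s: "\<And>n. s n \<in> mid ((\<lambda>k. dqv v (y k) f) ` {n..})" and g: "L2R g" "nr g \<le> C"
    and lim: "(\<lambda>n. nr (\<lambda>x. s n x - g x)) \<longlonglongrightarrow> 0"
    by blast
  have "weak_derivative UNIV v f g"
  proof (rule weak_derivativeI[OF open_UNIV loc_int_L2[OF f] loc_int_L2[OF g(1)] y])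
    fix \<phi> :: "'a \<Rightarrow> real" and D assume \<phi>: "C1_compact_support UNIV \<phi> D"
    have conv: "(\<lambda>k. LINT z|lborel. dqv v (y k) f z * \<phi> z) \<longlonglongrightarrow> - (LINT z|lborel. f z * D z v)"
      by (rule dqv_pairing_tendsto[OF \<phi> loc_int_L2[OF f] y])
    have "(LINT z|lborel. g z * \<phi> z) = - (LINT z|lborel. f z * D z v)"
      by (rule weak_limit_pairing[OF L2R_dqv[OF f] s g(1) lim L2R_C1_compact_support(1)[OF \<phi>] conv])
    then show "(\<lambda>k. LINT z|lborel. dqv v (y k) f z * \<phi> z) \<longlonglongrightarrow> (LINT z|lborel. g z * \<phi> z)"
      using conv by simp
  qed
  then show ?thesis using that g by blast
qed

section \<open>Difference quotients on the line\<close>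

abbreviation dq :: "real \<Rightarrow> (real \<Rightarrow> real) \<Rightarrow> real \<Rightarrow> real" where "dq \<equiv> dqv 1"

lemma dq_eq: "dq y f x = (f (x + y) - f x) / y"
  by (simp add: dqv_def)

lemma dq_minus: "dq (- y) f x = dq y f (x - y)"
  by (cases "y = 0") (simp_all add: dq_eq field_simps)

lemma nr_dq_minus: "L2R f \<Longrightarrow> nr (dq (- y) f) = nr (dq y f)"
  using L2R_translate(2)[OF L2R_dqv[of f 1 y], of "- y"] by (simp add: dq_minus[abs_def])

lemma dq_commute: "dq y (dq z f) x = dq z (dq y f) x"
  by (cases "y = 0"; cases "z = 0") (simp_all add: dq_eq field_simps)

lemma dq_translate: "dq y (\<lambda>x. f (x + c)) x = dq y f (x + c)"
  by (simp add: dq_eq algebra_simps)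

lemma dq_diff: "dq y (\<lambda>x. f x - g x) x = dq y f x - dq y g x"
  by (simp add: dq_eq diff_divide_distrib)

lemma dq_cmult: "dq y (\<lambda>x. c * f x) x = c * dq y f x"
  by (simp add: dq_eq diff_divide_distrib algebra_simps)

lemma sq_sum_le:
  fixes a :: "nat \<Rightarrow> real" shows "(\<Sum>i<n. a i)\<^sup>2 \<le> real n * (\<Sum>i<n. (a i)\<^sup>2)"
proof -
  have "(\<Sum>i<n. 1 * a i)\<^sup>2 \<le> (\<Sum>i<n. 1\<^sup>2) * (\<Sum>i<n. (a i)\<^sup>2)" by (rule Cauchy_Schwarz_ineq_sum)
  then show ?thesis by simp
qed

lemma nsq_sum_le:
  fixes f :: "nat \<Rightarrow> 'a \<Rightarrow> real"
  assumes "\<And>i. i < n \<Longrightarrow> L2 M (f i)" "\<And>i. i < n \<Longrightarrow> nsq M (f i) \<le> C"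
  shows "nsq M (\<lambda>x. \<Sum>i<n. f i x) \<le> (real n)\<^sup>2 * C"
proof -
  have "nsq M (\<lambda>x. \<Sum>i<n. f i x) \<le> (LINT x|M. real n * (\<Sum>i<n. (f i x)\<^sup>2))"
    unfolding nsq_def using assms L2_sum[of "{..<n}" M f]
    by (intro integral_mono sq_sum_le integrable_mult_right Bochner_Integration.integrable_sum) (auto simp: L2_def)
  also have "\<dots> = real n * (\<Sum>i<n. nsq M (f i))"
    using assms by (simp add: Bochner_Integration.integral_sum L2_def nsq_def)
  also have "\<dots> \<le> real n * (real n * C)"
    using assms(2) sum_bounded_above[of "{..<n}" "\<lambda>i. nsq M (f i)" C] by (intro mult_left_mono) auto
  finally show ?thesis by (simp add: power2_eq_square)
qed

text \<open>Telescoping. With the translation invariance of the norm this is the mechanism by which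
  bounds pass from fine to coarse steps.\<close>

lemma dq_multiple:
  assumes "n > 0" "h \<noteq> 0"
  shows "dq (real n * h) f x = (1 / real n) * (\<Sum>i<n. dq h f (x + real i * h))"
proof -
  have "(\<Sum>i<n. dq h f (x + real i * h)) = (\<Sum>i<n. f (x + real (Suc i) * h) - f (x + real i * h)) / h"
    by (simp add: dq_eq sum_divide_distrib algebra_simps)
  also have "\<dots> = (f (x + real n * h) - f x) / h"
    using sum_lessThan_telescope[of "\<lambda>i. f (x + real i * h)" n] by simp
  finally show ?thesis using assms by (simp add: dq_eq)
qed

lemma nr_dq_multiple_le:
  assumes f: "L2R f" and "n > 0" "h \<noteq> 0"
  shows "nr (dq (real n * h) f) \<le> nr (dq h f)"
proof -
  have "nr (dq (real n * h) f) = (1 / real n)\<^sup>2 * nr (\<lambda>x. \<Sum>i<n. dq h f (x + real i * h))"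
    unfolding dq_multiple[OF assms(2,3), abs_def] nsq_cmult ..
  also have "\<dots> \<le> (1 / real n)\<^sup>2 * ((real n)\<^sup>2 * nr (dq h f))"
    using L2R_translate[OF L2R_dqv[OF f]] by (intro mult_left_mono nsq_sum_le) auto
  also have "\<dots> = nr (dq h f)" using \<open>n > 0\<close> by (simp add: power_divide)
  finally show ?thesis .
qed

text \<open>Each translate in the mean of \<open>dq_multiple\<close> differs from the untranslated
  quotient by less than \<open>n * h\<close> times a second quotient. So a fine quotient is close to
  a coarse one, uniformly in the fine step once second quotients are bounded.\<close>

lemma nr_dq_minus_dq_multiple:
  assumes f: "L2R f" and "n > 0" "h > 0"
  shows "nr (\<lambda>x. dq h f x - dq (real n * h) f x) \<le> (real n * h)\<^sup>2 * nr (dq h (dq h f))"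
proof -
  have tr: "nr (\<lambda>x. dq h f (x + real i * h) - dq h f x) \<le> (real n * h)\<^sup>2 * nr (dq h (dq h f))" if "i < n" for i
  proof (cases "i = 0")
    case True
    then show ?thesis by simp
  next
    case False
    have "(\<lambda>x. dq h f (x + real i * h) - dq h f x) = (\<lambda>x. (real i * h) * dq (real i * h) (dq h f) x)"
      using False assms by (auto simp: dq_eq)
    then have "nr (\<lambda>x. dq h f (x + real i * h) - dq h f x) = (real i * h)\<^sup>2 * nr (dq (real i * h) (dq h f))"
      by (simp only: nsq_cmult)
    also have "\<dots> \<le> (real n * h)\<^sup>2 * nr (dq h (dq h f))"
      using False assms that nr_dq_multiple_le[OF L2R_dqv[OF f, of 1 h], of i h]
      by (intro mult_mono power_mono mult_right_mono) auto
    finally show ?thesis .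
  qed
  have "dq h f x - dq (real n * h) f x = (1 / real n) * (\<Sum>i<n. - 1 * (dq h f (x + real i * h) - dq h f x))" for x
    using assms unfolding dq_multiple[OF assms(2) less_imp_neq[OF assms(3), symmetric]]
    by (simp add: sum_subtractf sum_negf field_simps)
  then have "nr (\<lambda>x. dq h f x - dq (real n * h) f x)
      = (1 / real n)\<^sup>2 * nr (\<lambda>x. \<Sum>i<n. - 1 * (dq h f (x + real i * h) - dq h f x))"
    by (simp only: nsq_cmult)
  also have "\<dots> \<le> (1 / real n)\<^sup>2 * ((real n)\<^sup>2 * ((real n * h)\<^sup>2 * nr (dq h (dq h f))))"
    using tr L2_diff[OF L2R_translate(1)[OF L2R_dqv[OF f]] L2R_dqv[OF f]]
    by (intro mult_left_mono nsq_sum_le L2_cmult) (auto simp only: nsq_cmult power2_minus one_power2 mult_1 zero_le_power2)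
  also have "\<dots> = (real n * h)\<^sup>2 * nr (dq h (dq h f))" using \<open>n > 0\<close> by (simp add: power_divide)
  finally show ?thesis .
qed

section \<open>Averages, primitives and Hoelder continuous representatives\<close>

text \<open>The mean of \<open>g\<close> over the interval between \<open>x\<close> and
  \<open>x + y\<close>, written over \<open>{0..1}\<close> so that \<open>y\<close> may be negative
  and translations act only on the argument.\<close>

definition av :: "real \<Rightarrow> (real \<Rightarrow> real) \<Rightarrow> real \<Rightarrow> real" where
  "av y g x = (LINT r|lborel. indicator {0..1} r * g (x + y * r))"

lemma integrable_indicator_Icc: "integrable lborel (indicator {a..b::real} :: real \<Rightarrow> real)"
  by (auto intro!: integrable_real_indicator simp: emeasure_lborel_Icc_eq)

lemma L2R_indicator_Icc: "L2R (indicator {a..b::real})" "a \<le> b \<Longrightarrow> nr (indicator {a..b::real}) = b - a"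
  unfolding L2_def nsq_def power2_eq_square indicator_inter_arith[symmetric] Int_absorb
  by (auto intro!: integrable_real_indicator simp: emeasure_lborel_Icc_eq)

lemma av_measurable [measurable]:
  assumes [measurable]: "g \<in> borel_measurable borel"
  shows "av y g \<in> borel_measurable borel"
proof -
  have "(\<lambda>x. LINT r|lborel. indicator {0..1} r * g (x + y * r)) \<in> borel_measurable borel"
    by (rule lborel.borel_measurable_lebesgue_integral) measurable
  then show ?thesis by (simp add: av_def[abs_def])
qed

lemma L2R_affine:
  assumes "L2R g" "(y::real) \<noteq> 0"
  shows "L2R (\<lambda>r. g (x + y * r))"
  using assms lborel_integrable_real_affine[of "\<lambda>r. (g r)\<^sup>2" y x] by (auto simp: L2_def)

text \<open>Cauchy-Schwarz against the indicator of the unit interval. In \<open>ennreal\<close> the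
  case of an infinite right-hand side is trivial, so no integrability along the interval is
  assumed.\<close>

lemma av_sq_le:
  assumes [measurable]: "g \<in> borel_measurable borel"
  shows "ennreal ((av y g x)\<^sup>2) \<le> (\<integral>\<^sup>+r. indicator {0..1} r * ennreal ((g (x + y * r))\<^sup>2) \<partial>lborel)"
proof (cases "(\<integral>\<^sup>+r. indicator {0..1} r * ennreal ((g (x + y * r))\<^sup>2) \<partial>lborel) = \<infinity>")
  case False
  define k where "k r = indicator {0..1} r * g (x + y * r)" for r
  have eq: "indicator {0..1} r * ennreal ((g (x + y * r))\<^sup>2) = ennreal ((k r)\<^sup>2)" for r
    by (auto simp: k_def indicator_def)
  have [measurable]: "k \<in> borel_measurable borel" unfolding k_def[abs_def] by measurable
  obtain C where C: "(\<integral>\<^sup>+r. ennreal ((k r)\<^sup>2) \<partial>lborel) = ennreal C" "C \<ge> 0"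
    using False unfolding eq by (cases "\<integral>\<^sup>+r. ennreal ((k r)\<^sup>2) \<partial>lborel") auto
  have k: "L2R k" "nr k \<le> C" using L2_nn[of lborel k C] C by auto
  have "(av y g x)\<^sup>2 = (LINT r|lborel. indicator {0..1} r * k r)\<^sup>2"
    unfolding av_def k_def by (intro arg_cong[where f="\<lambda>x. x\<^sup>2"] Bochner_Integration.integral_cong) (auto simp: indicator_def)
  also have "\<dots> \<le> nr (indicator {0..1::real}) * nr k"
    by (rule Cauchy_Schwarz_L2[OF L2R_indicator_Icc(1) k(1)])
  also have "\<dots> \<le> C" using k(2) L2R_indicator_Icc(2)[of 0 1] by simp
  finally show ?thesis unfolding eq C by (simp add: ennreal_leI)
qed simp

text \<open>Tonelli and translation invariance: each translate of \<open>g\<close> has the norm of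
  \<open>g\<close>, and averaging does not increase it.\<close>

lemma L2R_av:
  assumes g: "L2R g" shows "L2R (av y g) \<and> nr (av y g) \<le> nr g"
proof -
  have [measurable]: "g \<in> borel_measurable borel" using g by simp
  have gn: "(\<integral>\<^sup>+x. ennreal ((g x)\<^sup>2) \<partial>lborel) \<le> ennreal (nr g)"
    using L2_nn[of lborel g "nr g"] g by auto
  have "(\<integral>\<^sup>+x. ennreal ((av y g x)\<^sup>2) \<partial>lborel)
      \<le> (\<integral>\<^sup>+x. \<integral>\<^sup>+r. indicator {0..1} r * ennreal ((g (x + y * r))\<^sup>2) \<partial>lborel \<partial>lborel)"
    by (intro nn_integral_mono av_sq_le) measurable
  also have "\<dots> = (\<integral>\<^sup>+r. \<integral>\<^sup>+x. indicator {0..1} r * ennreal ((g (x + y * r))\<^sup>2) \<partial>lborel \<partial>lborel)"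
    by (rule lborel_pair.Fubini'[symmetric]) measurable
  also have "\<dots> = (\<integral>\<^sup>+r. indicator {0..1} r * (\<integral>\<^sup>+x. ennreal ((g x)\<^sup>2) \<partial>lborel) \<partial>(lborel :: real measure))"
  proof (intro nn_integral_cong)
    fix r :: real
    have "(\<integral>\<^sup>+x. ennreal ((g (x + y * r))\<^sup>2) \<partial>lborel) = (\<integral>\<^sup>+x. ennreal ((g x)\<^sup>2) \<partial>lborel)"
      using nn_integral_real_affine[of "\<lambda>x. ennreal ((g x)\<^sup>2)" 1 "y * r"] by (simp add: add.commute)
    then show "(\<integral>\<^sup>+x. indicator {0..1} r * ennreal ((g (x + y * r))\<^sup>2) \<partial>lborel) = indicator {0..1} r * (\<integral>\<^sup>+x. ennreal ((g x)\<^sup>2) \<partial>lborel)"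
      by (simp add: nn_integral_cmult)
  qed
  also have "\<dots> \<le> (\<integral>\<^sup>+r. indicator {0..1} r * ennreal (nr g) \<partial>(lborel :: real measure))"
    by (intro nn_integral_mono mult_left_mono gn) auto
  also have "\<dots> = ennreal (nr g)" by (simp add: nn_integral_multc)
  finally show ?thesis
    using L2_nn[of lborel "av y g" "nr g"] by auto
qed

text \<open>Fubini; the majorant \<open>nr g + nr \<psi>\<close> of the inner integrals comes from
  Young's inequality and is uniform in \<open>r\<close>.\<close>

lemma av_pairing:
  assumes g: "L2R g" and \<psi>: "L2R \<psi>"
  shows "(LINT x|lborel. av y g x * \<psi> x) = (LINT r|lborel. indicator {0..1} r * (LINT x|lborel. g (x + y * r) * \<psi> x))"
proof -
  have [measurable]: "g \<in> borel_measurable borel" "\<psi> \<in> borel_measurable borel" using g \<psi> by auto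
  have abs_L2: "L2R (\<lambda>x. \<bar>g (x + c)\<bar>)" "nr (\<lambda>x. \<bar>g (x + c)\<bar>) = nr g" "L2R (\<lambda>x. \<bar>\<psi> x\<bar>)" "nr (\<lambda>x. \<bar>\<psi> x\<bar>) = nr \<psi>" for c
    using L2R_translate[OF g, of c] \<psi> by (auto simp: L2_def nsq_def)
  have "integrable (lborel \<Otimes>\<^sub>M lborel) (\<lambda>(r, x). indicator {0..1} r * (g (x + y * r) * \<psi> x))"
  proof (rule lborel_pair.Fubini_integrable)
    show "AE r in lborel. integrable lborel (\<lambda>x. case (r, x) of (r, x) \<Rightarrow> indicator {0..1} r * (g (x + y * r) * \<psi> x))"
      using L2_mult_integrable[OF L2R_translate(1)[OF g] \<psi>] by auto
    have meas: "(\<lambda>r. LINT x|lborel. norm (case (r, x) of (r, x) \<Rightarrow> indicator {0..1} r * (g (x + y * r) * \<psi> x))) \<in> borel_measurable lborel"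
      by measurable
    show "integrable lborel (\<lambda>r. LINT x|lborel. norm (case (r, x) of (r, x) \<Rightarrow> indicator {0..1} r * (g (x + y * r) * \<psi> x)))"
    proof (rule Bochner_Integration.integrable_bound[OF _ meas])
      show "integrable lborel (\<lambda>r. indicator {0..1::real} r * (nr g + nr \<psi>))"
        by (intro integrable_mult_left integrable_real_indicator) auto
      show "AE r in lborel. norm (LINT x|lborel. norm (case (r, x) of (r, x) \<Rightarrow> indicator {0..1} r * (g (x + y * r) * \<psi> x)))
          \<le> norm (indicator {0..1::real} r * (nr g + nr \<psi>))"
      proof (rule AE_I2)
        fix r :: real
        have "(LINT x|lborel. norm (indicator {0..1} r * (g (x + y * r) * \<psi> x)))
            = indicator {0..1} r * (LINT x|lborel. \<bar>g (x + y * r)\<bar> * \<bar>\<psi> x\<bar>)"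
          by (simp add: abs_mult)
        moreover have "(LINT x|lborel. \<bar>g (x + y * r)\<bar> * \<bar>\<psi> x\<bar>) \<le> nr g + nr \<psi>"
          using L2_mult_le[OF abs_L2(1)[of "y * r"] abs_L2(3), of 1, unfolded abs_L2(2) abs_L2(4)]
            nsq_nonneg[of lborel g] nsq_nonneg[of lborel \<psi>] unfolding abs_le_iff by argo
        moreover have "0 \<le> (LINT x|lborel. \<bar>g (x + y * r)\<bar> * \<bar>\<psi> x\<bar>)" by simp
        ultimately show "norm (LINT x|lborel. norm (case (r, x) of (r, x) \<Rightarrow> indicator {0..1} r * (g (x + y * r) * \<psi> x)))
            \<le> norm (indicator {0..1::real} r * (nr g + nr \<psi>))"
          by (simp add: indicator_def)
      qed
    qed
  qed measurable
  then have "(LINT x|lborel. LINT r|lborel. indicator {0..1} r * (g (x + y * r) * \<psi> x))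
      = (LINT r|lborel. LINT x|lborel. indicator {0..1} r * (g (x + y * r) * \<psi> x))"
    by (rule lborel_pair.Fubini_integral)
  moreover have "av y g x * \<psi> x = (LINT r|lborel. indicator {0..1} r * (g (x + y * r) * \<psi> x))" for x
    unfolding av_def by (subst integral_mult_left_zero[symmetric]) (simp add: mult.assoc)
  ultimately show ?thesis by simp
qed

lemma dq_av:
  assumes g: "L2R g" and "z \<noteq> 0"
  shows "dq y (av z g) x = av z (dq y g) x"
proof -
  have int: "integrable lborel (\<lambda>r. indicator {0..1} r * g (x' + z * r))" for x'
    by (rule L2_mult_integrable[OF L2R_indicator_Icc(1) L2R_affine[OF assms]])
  have "dq y (av z g) x = (LINT r|lborel. (indicator {0..1} r * g (x + y + z * r) - indicator {0..1} r * g (x + z * r)) / y)"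
    using int by (simp add: dq_eq av_def)
  also have "\<dots> = av z (dq y g) x"
    unfolding av_def by (intro Bochner_Integration.integral_cong) (auto simp: dq_eq field_simps add_ac)
  finally show ?thesis .
qed

text \<open>Prescribing increments leaves the additive constant free and avoids pointwise
  derivatives, which an L^2 function \<open>g\<close> need not provide everywhere.\<close>

definition prim :: "(real \<Rightarrow> real) \<Rightarrow> (real \<Rightarrow> real) \<Rightarrow> bool" where
  "prim F g \<longleftrightarrow> (\<forall>a b. a < b \<longrightarrow> F b - F a = (LINT s|lborel. indicator {a..b} s * g s))"

text \<open>Cauchy-Schwarz against the indicator of the interval: primitives of L^2 functions are
  Hoelder continuous with exponent 1/2.\<close>

lemma prim_diff_sq:
  assumes F: "prim F g" and g: "L2R g"
  shows "(F b - F a)\<^sup>2 \<le> \<bar>b - a\<bar> * nr g"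
proof -
  have *: "(F b - F a)\<^sup>2 \<le> \<bar>b - a\<bar> * nr g" if "a < b" for a b
    using Cauchy_Schwarz_L2[OF L2R_indicator_Icc(1)[of a b] g] F that L2R_indicator_Icc(2)[of a b]
    by (simp add: prim_def)
  show ?thesis
    using *[of a b] *[of b a] by (cases a b rule: linorder_cases) (auto simp: power2_commute abs_minus_commute)
qed

lemma Holder_half_continuous:
  fixes F :: "real \<Rightarrow> real"
  assumes "\<And>a b. (F b - F a)\<^sup>2 \<le> C * \<bar>b - a\<bar>"
  shows "continuous_on UNIV F"
proof (rule continuous_at_imp_continuous_on, rule ballI)
  fix a :: real
  have "((\<lambda>x. sqrt (C * \<bar>x - a\<bar>)) \<longlongrightarrow> sqrt (C * \<bar>a - a\<bar>)) (at a)"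
    by (intro tendsto_intros)
  then have lim: "((\<lambda>x. sqrt (C * \<bar>x - a\<bar>)) \<longlongrightarrow> 0) (at a)" by simp
  have "((\<lambda>x. F x - F a) \<longlongrightarrow> 0) (at a)"
    by (rule Lim_null_comparison[OF always_eventually lim])
      (use assms in \<open>auto intro: real_le_rsqrt\<close>)
  then show "isCont F a" by (simp add: isCont_def LIM_zero_iff)
qed

lemma prim_exists:
  assumes g: "L2R g" obtains F where "prim F g"
proof -
  \<comment> \<open>The oriented integral from 0 to \<open>z\<close>: one of the two intervals is
    empty unless \<open>z = 0\<close>, where they cancel.\<close>
  define F where "F z = (LINT s|lborel. (indicator {0..z} s - indicator {z..0} s) * g s)" for z
  have int: "integrable lborel (\<lambda>s. indicator {a..b::real} s * g s)" for a b
    by (rule L2_mult_integrable[OF L2R_indicator_Icc(1) g])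
  have [measurable]: "g \<in> borel_measurable borel" using g by simp
  have "F b - F a = (LINT s|lborel. indicator {a..b} s * g s)" if "a < b" for a b
  proof -
    have "F b - F a = (LINT s|lborel. (indicator {0..b} s - indicator {b..0} s) * g s - (indicator {0..a} s - indicator {a..0} s) * g s)"
      unfolding F_def using int by (intro Bochner_Integration.integral_diff[symmetric]) (auto simp: left_diff_distrib)
    also have "\<dots> = (LINT s|lborel. indicator {a..b} s * g s)"
    proof (rule integral_cong_AE)
      have "AE s in lborel. s \<noteq> 0 \<and> s \<noteq> a \<and> s \<noteq> b"
        by (intro AE_conjI AE_lborel_singleton)
      then show "AE s in lborel. (indicator {0..b} s - indicator {b..0} s) * g s - (indicator {0..a} s - indicator {a..0} s) * g s
          = indicator {a..b} s * g s"
        by eventually_elim (use that in \<open>auto simp: indicator_def\<close>)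
    qed measurable
    finally show ?thesis .
  qed
  then show ?thesis using that by (auto simp: prim_def)
qed

lemma prim_dq:
  assumes F: "prim F g" and g: "L2R g" and "y > 0"
  shows "dq y F x = av y g x"
proof -
  have "F (x + y) - F x = (LINT s|lborel. indicator {x..x + y} s * g s)"
    using F \<open>y > 0\<close> by (simp add: prim_def)
  also have "\<dots> = \<bar>y\<bar> *\<^sub>R (LINT r|lborel. indicator {x..x + y} (x + y * r) * g (x + y * r))"
    using \<open>y > 0\<close> by (intro lborel_integral_real_affine) auto
  also have "(LINT r|lborel. indicator {x..x + y} (x + y * r) * g (x + y * r)) = av y g x"
    unfolding av_def using \<open>y > 0\<close>
    by (intro Bochner_Integration.integral_cong) (auto simp: indicator_def zero_le_mult_iff)
  finally show ?thesis using \<open>y > 0\<close> by (simp add: dq_eq)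
qed

lemma nr_dq_prim_le:
  assumes F: "prim F g" and g: "L2R g" and "F \<in> borel_measurable borel" "y > 0"
  shows "L2R (dq y F) \<and> nr (dq y F) \<le> nr g"
  using L2R_av[OF g, of y] prim_dq[OF F g \<open>y > 0\<close>] by (simp add: ext[of "dq y F" "av y g"])

text \<open>A primitive \<open>\<Psi>\<close> of \<open>\<psi>\<close> need not have compact
  support, but its increment \<open>\<Psi> x - \<Psi> (x - y)\<close> does, being \<open>y\<close>
  times an average of \<open>\<psi>\<close>. Testing the weak derivative with this increment gives
  the identity.\<close>

lemma translate_test_function:
  assumes wd: "weak_derivative UNIV 1 f g" and f: "L2R f" and g: "L2R g" and "y > 0"
    and \<psi>: "C1_compact_support UNIV \<psi> D"
  shows "(LINT x|lborel. (f (x + y) - f x) * \<psi> x) = (LINT x|lborel. y * av y g x * \<psi> x)"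
proof -
  obtain B R where BR: "\<And>z. \<bar>\<psi> z\<bar> \<le> B" "\<And>z. norm z > R \<Longrightarrow> \<psi> z = 0"
    using C1_compact_support_bounded[OF \<psi>] by metis
  obtain c\<psi>: "continuous_on UNIV \<psi>" using C1_compact_supportE[OF \<psi>] by metis
  have L\<psi>: "L2R \<psi>" by (rule L2R_C1_compact_support(1)[OF \<psi>])
  have [measurable]: "f \<in> borel_measurable borel" "g \<in> borel_measurable borel" "\<psi> \<in> borel_measurable borel"
    using f g L\<psi> by auto
  obtain \<Psi> where \<Psi>: "prim \<Psi> \<psi>" using prim_exists[OF L\<psi>] .
  have d\<Psi>: "(\<Psi> has_real_derivative \<psi> x) (at x)" for x
  proof -
    define a where "a = x - 1"
    have eq: "\<Psi> t = \<Psi> a + integral {a..t} \<psi>" if "a < t" for t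
    proof -
      have "continuous_on {a..t} \<psi>" using c\<psi> continuous_on_subset by blast
      then have "set_integrable lborel {a..t} \<psi>" by (rule borel_integrable_atLeastAtMost')
      then have "(LINT s:{a..t}|lborel. \<psi> s) = integral {a..t} \<psi>" by (rule set_borel_integral_eq_integral(2))
      moreover have "\<Psi> t - \<Psi> a = (LINT s:{a..t}|lborel. \<psi> s)"
        using \<Psi> that by (simp add: prim_def set_lebesgue_integral_def)
      ultimately show ?thesis by linarith
    qed
    have "((\<lambda>t. integral {a..t} \<psi>) has_real_derivative \<psi> x) (at x within {a..x+1})"
      by (rule integral_has_real_derivative) (use c\<psi> continuous_on_subset in \<open>auto simp: a_def\<close>)
    then have "((\<lambda>t. integral {a..t} \<psi>) has_real_derivative \<psi> x) (at x)"
      by (subst (asm) at_within_interior) (auto simp: a_def)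
    then have "((\<lambda>t. \<Psi> a + integral {a..t} \<psi>) has_real_derivative \<psi> x) (at x)"
      by (auto intro!: derivative_eq_intros)
    then show ?thesis
      by (rule has_field_derivative_transform_within_open[of _ _ _ "{a<..}"]) (use eq in \<open>auto simp: a_def\<close>)
  qed
  define \<phi> where "\<phi> x = \<Psi> x - \<Psi> (x - y)" for x
  have \<phi>_av: "\<phi> x = y * av (- y) \<psi> x" for x
  proof -
    have "av y \<psi> (x - y) = (LINT r|lborel. indicator {0..1} r * \<psi> (x - y + y * r))" by (simp add: av_def)
    \<comment> \<open>Reflecting \<open>r\<close> to \<open>1 - r\<close> turns the average from
      \<open>x - y\<close> forwards into the average from \<open>x\<close> backwards.\<close>
    also have "\<dots> = (LINT r|lborel. indicator {0..1} (1 + (-1) * r) * \<psi> (x - y + y * (1 + (-1) * r)))"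
      using lborel_integral_real_affine[of "-1" "\<lambda>r. indicator {0..1} r * \<psi> (x - y + y * r)" 1] by simp
    also have "\<dots> = av (- y) \<psi> x"
      unfolding av_def by (intro Bochner_Integration.integral_cong) (auto simp: indicator_def algebra_simps)
    finally show ?thesis using prim_dq[OF \<Psi> L\<psi> \<open>y > 0\<close>, of "x - y"] \<open>y > 0\<close>
      by (simp add: \<phi>_def dq_eq field_simps)
  qed
  have C1: "C1_compact_support UNIV \<phi> (\<lambda>z v. (\<psi> z - \<psi> (z - y)) * v)"
  proof (rule C1_compact_supportI_real[where a="- (\<bar>R\<bar> + y)" and b="\<bar>R\<bar> + y"])
    show "(\<phi> has_real_derivative \<psi> z - \<psi> (z - y)) (at z)" for z
      unfolding \<phi>_def using d\<Psi>[of z] DERIV_shift[of \<Psi> "\<psi> (z - y)" z "- y"] d\<Psi>[of "z - y"]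
      by (intro DERIV_diff) auto
    show "continuous_on UNIV (\<lambda>z. \<psi> z - \<psi> (z - y))"
      using c\<psi> by (intro continuous_intros) (auto intro!: continuous_on_compose2[OF c\<psi>] continuous_intros)
    show "\<phi> z = 0" if z: "z \<notin> {- (\<bar>R\<bar> + y)..\<bar>R\<bar> + y}" for z
    proof -
      have "\<psi> (z + (- y) * r) = 0" if "r \<in> {0..1}" for r
      proof (rule BR(2))
        have "y * r \<le> y" "0 \<le> y * r" using that \<open>y > 0\<close> by (auto simp: mult_left_le)
        moreover have "\<bar>z\<bar> > \<bar>R\<bar> + y" using z by auto
        ultimately show "norm (z + (- y) * r) > R" unfolding real_norm_def mult_minus_left by linarith
      qed
      then have "indicator {0..1} r * \<psi> (z + (- y) * r) = 0" for r
        by (cases "r \<in> {0..1}") auto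
      then have "(\<lambda>r. indicator {0..1} r * \<psi> (z + (- y) * r)) = (\<lambda>r. 0)" by blast
      then have "av (- y) \<psi> z = 0" unfolding av_def by simp
      then show ?thesis by (simp add: \<phi>_av)
    qed
  qed
  have Lf\<psi>: "integrable lborel (\<lambda>x. f x * \<psi> x)" "integrable lborel (\<lambda>x. f x * \<psi> (x - y))" "integrable lborel (\<lambda>x. f (x + y) * \<psi> x)"
    using L2_mult_integrable[OF f L\<psi>] L2_mult_integrable[OF f L2R_translate(1)[OF L\<psi>, of "- y"]]
      L2_mult_integrable[OF L2R_translate(1)[OF f, of y] L\<psi>] by auto
  have "(LINT x|lborel. f (x + y) * \<psi> x) = (LINT x|lborel. f x * \<psi> (x - y))"
    using integral_translate[of "\<lambda>x. f x * \<psi> (x - y)" y] by simp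
  then have "(LINT x|lborel. (f (x + y) - f x) * \<psi> x) = (LINT x|lborel. f x * \<psi> (x - y)) - (LINT x|lborel. f x * \<psi> x)"
    using Lf\<psi> by (simp add: left_diff_distrib)
  also have "\<dots> = - (LINT x|lborel. f x * ((\<psi> x - \<psi> (x - y)) * 1))"
    using Lf\<psi> by (simp add: right_diff_distrib)
  also have "\<dots> = (LINT x|lborel. g x * \<phi> x)"
    using weak_derivativeD_lborel[OF wd _ _ C1] by simp
  also have "\<dots> = y * (LINT x|lborel. av (- y) \<psi> x * g x)"
    by (subst integral_mult_right_zero[symmetric], intro Bochner_Integration.integral_cong) (auto simp: \<phi>_av)
  also have "\<dots> = y * (LINT x|lborel. av y g x * \<psi> x)"
  proof -
    have "(LINT x|lborel. \<psi> (x + (- y) * r) * g x) = (LINT x|lborel. g (x + y * r) * \<psi> x)" for r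
      using integral_translate[of "\<lambda>x. \<psi> (x + (- y) * r) * g x" "y * r"] by (simp add: mult.commute)
    then show ?thesis unfolding av_pairing[OF g L\<psi>] av_pairing[OF L\<psi> g] by simp
  qed
  also have "\<dots> = (LINT x|lborel. y * av y g x * \<psi> x)"
    by (subst integral_mult_right_zero[symmetric]) (simp add: mult.assoc)
  finally show ?thesis .
qed

text \<open>Fubini exchanges the quantifiers: for almost every \<open>x\<close> the equality
  \<open>z (x + y) = z x\<close> holds for almost every \<open>y\<close>. One such point already
  makes \<open>z\<close> constant almost everywhere.\<close>

lemma Borel_pred_translate_AE:
  fixes z :: "real \<Rightarrow> real"
  assumes [measurable]: "z \<in> borel_measurable borel" and 0: "\<And>y. y > 0 \<Longrightarrow> AE x in lborel. z (x + y) = z x"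
  obtains c where "AE x in lborel. z x = c"
proof -
  have all: "AE x in lborel. z (x + y) = z x" for y
  proof (cases y "0::real" rule: linorder_cases)
    case less
    have "AE x in lborel. z (x + y + (- y)) = z (x + y)"
      by (rule AE_translate[of "\<lambda>x. z (x + (- y)) = z x" y]) (use 0[of "- y"] less in auto)
    then show ?thesis by eventually_elim simp
  qed (use 0 in auto)
  have "AE y in lborel. AE x in lborel. z (x + y) = z x" using all by simp
  moreover have "(AE y in lborel. AE x in lborel. z (x + y) = z x) \<longleftrightarrow> (AE x in lborel. AE y in lborel. z (x + y) = z x)"
    by (rule lborel_pair.AE_commute) measurable
  ultimately have "AE x in lborel. AE y in lborel. z (x + y) = z x" by simp
  then have "\<exists>x0. AE y in lborel. z (x0 + y) = z x0"
    using eventually_happens[of _ "ae_filter (lborel :: real measure)"] by (simp add: ae_filter_eq_bot_iff)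
  then obtain x0 where x0: "AE y in lborel. z (x0 + y) = z x0" ..
  have "AE y in lborel. z (x0 + (y + (- x0))) = z x0"
    by (rule AE_translate[of "\<lambda>y. z (x0 + y) = z x0" "- x0"]) (use x0 in auto)
  then have "AE y in lborel. z y = z x0" by simp
  then show ?thesis using that by blast
qed

text \<open>The difference of \<open>f\<close> and any primitive of \<open>g\<close> is invariant
  under translations up to null sets, hence almost everywhere a constant, which is added to the
  primitive. The result is the Hoelder continuous representative of \<open>f\<close>.\<close>

lemma weak_derivative_primitive:
  assumes wd: "weak_derivative UNIV 1 f g" and f: "L2R f" and g: "L2R g"
  obtains F where "prim F g" "AE x in lborel. f x = F x"
proof -
  obtain F where F: "prim F g" using prim_exists[OF g] .
  have Fc: "continuous_on UNIV F"
    by (rule Holder_half_continuous[of _ "nr g"]) (use prim_diff_sq[OF F g] in \<open>simp add: mult.commute\<close>)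
  have [measurable]: "f \<in> borel_measurable borel" "g \<in> borel_measurable borel" "F \<in> borel_measurable borel"
    using f g borel_measurable_continuous_onI[OF Fc] by auto
  have "AE x in lborel. f (x + y) - F (x + y) = f x - F x" if "y > 0" for y
  proof -
    have "AE x in lborel. f (x + y) - f x - y * av y g x = 0"
    proof (rule fundamental_lemma)
      have L: "L2R (\<lambda>x. f (x + y) - f x)" "L2R (\<lambda>x. y * av y g x)"
        by (intro L2_diff L2R_translate(1) f L2_cmult conjunct1[OF L2R_av] g)+
      show "loc_int (\<lambda>x. f (x + y) - f x - y * av y g x)" by (rule loc_int_L2[OF L2_diff[OF L]])
      fix \<phi> D assume \<phi>: "C1_compact_support (UNIV::real set) \<phi> D"
      show "(LINT x|lborel. (f (x + y) - f x - y * av y g x) * \<phi> x) = 0"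
        using translate_test_function[OF wd f g that \<phi>] L2_mult_integrable[OF L(1) L2R_C1_compact_support(1)[OF \<phi>]]
          L2_mult_integrable[OF L(2) L2R_C1_compact_support(1)[OF \<phi>]]
        by (subst left_diff_distrib) simp
    qed
    then show ?thesis
    proof eventually_elim
      case (elim x)
      have "y * av y g x = F (x + y) - F x"
        using prim_dq[OF F g that, of x] that by (simp add: dq_eq field_simps)
      then show ?case using elim by linarith
    qed
  qed
  then obtain c where c: "AE x in lborel. f x - F x = c"
    using Borel_pred_translate_AE[of "\<lambda>x. f x - F x"] by auto
  have "prim (\<lambda>x. F x + c) g" using F by (simp add: prim_def)
  moreover have "AE x in lborel. f x = F x + c" using c by eventually_elim linarith
  ultimately show ?thesis using that by blast
qed

section \<open>Hoelder continuity, sup bounds and decay from bounds on quotients\<close>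

lemma av_tendsto:
  assumes F: "continuous_on UNIV F" and y: "y \<longlonglongrightarrow> 0"
  shows "(\<lambda>k. av (y k) F x) \<longlonglongrightarrow> F x"
proof -
  have [measurable]: "F \<in> borel_measurable borel" by (rule borel_measurable_continuous_onI[OF F])
  have cont: "isCont F z" for z using F by (simp add: continuous_on_eq_continuous_at)
  obtain Y where Y: "\<And>k. \<bar>y k\<bar> \<le> Y"
    using convergent_imp_Bseq[OF convergentI[OF y]] by (auto simp: Bseq_def)
  have "compact (F ` cball x Y)"
    by (intro compact_continuous_image continuous_on_subset[OF F]) auto
  then have "\<exists>B. \<forall>w\<in>F ` cball x Y. norm w \<le> B"
    using compact_imp_bounded[of "F ` cball x Y"] unfolding bounded_iff by simp
  then obtain B where B: "\<And>z. z \<in> cball x Y \<Longrightarrow> \<bar>F z\<bar> \<le> B" by fastforce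
  have "(\<lambda>k. LINT r|lborel. indicator {0..1} r * F (x + y k * r)) \<longlonglongrightarrow> (LINT r|lborel. indicator {0..1::real} r * F x)"
  proof (rule integral_dominated_convergence[where w="\<lambda>r. indicator {0..1::real} r * B"])
    show "integrable lborel (\<lambda>r. indicator {0..1::real} r * B)"
      by (intro integrable_mult_left integrable_real_indicator) auto
    have "(\<lambda>k. F (x + y k * r)) \<longlonglongrightarrow> F x" for r
    proof -
      have "(\<lambda>k. x + y k * r) \<longlonglongrightarrow> x + 0 * r" by (intro tendsto_intros y)
      then show ?thesis using isCont_tendsto_compose[OF cont] by simp
    qed
    then show "AE r in lborel. (\<lambda>k. indicator {0..1} r * F (x + y k * r)) \<longlonglongrightarrow> indicator {0..1} r * F x"
      by (intro AE_I2 tendsto_mult_left)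
    show "AE r in lborel. norm (indicator {0..1} r * F (x + y k * r)) \<le> indicator {0..1::real} r * B" for k
    proof (rule AE_I2)
      fix r :: real
      show "norm (indicator {0..1} r * F (x + y k * r)) \<le> indicator {0..1::real} r * B"
      proof (cases "r \<in> {0..1}")
        case True
        then have "\<bar>y k * r\<bar> \<le> Y" using Y[of k] mult_mono[of "\<bar>y k\<bar>" Y "\<bar>r\<bar>" 1] by (auto simp: abs_mult)
        then show ?thesis using True B[of "x + y k * r"] by (simp add: dist_real_def)
      qed auto
    qed
  qed measurable
  then show ?thesis by (simp add: av_def L2R_indicator_Icc)
qed

text \<open>Averages of \<open>F\<close> over intervals of length \<open>y k\<close> inherit the bound on the difference quotients.\<close>

lemma Holder_of_dq_bound:
  assumes F: "L2R F" "continuous_on UNIV F" and y: "\<And>k. y k > 0" "y \<longlonglongrightarrow> 0"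
    and bd: "\<And>k. nr (dq (y k) F) \<le> C"
  shows "(F b - F a)\<^sup>2 \<le> C * \<bar>b - a\<bar>"
proof -
  obtain \<Phi> where \<Phi>: "prim \<Phi> F" using prim_exists[OF F(1)] .
  have [measurable]: "F \<in> borel_measurable borel" using F by auto
  have *: "(F b - F a)\<^sup>2 \<le> C * \<bar>b - a\<bar>" if "a < b" for a b
  proof -
    have "(av (y k) F b - av (y k) F a)\<^sup>2 \<le> C * (b - a)" for k
    proof -
      define h where "h = y k"
      have "h > 0" using y(1)[of k] by (simp add: h_def)
      have i: "integrable lborel (\<lambda>s. indicator {a..b} s * F (s + c))" for c
        by (rule L2_mult_integrable[OF L2R_indicator_Icc(1) L2R_translate(1)[OF F(1)]])
      have tr: "(LINT s|lborel. indicator {a..b} s * F (s + h)) = \<Phi> (b + h) - \<Phi> (a + h)"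
      proof -
        have "(LINT s|lborel. indicator {a..b} s * F (s + h)) = (LINT s|lborel. indicator {a + h..b + h} s * F s)"
          using integral_translate[of "\<lambda>s. indicator {a + h..b + h} s * F s" h] by (simp add: indicator_def)
        then show ?thesis using \<Phi> that by (simp add: prim_def)
      qed
      \<comment> \<open>A discrete fundamental theorem of calculus: the integral of the quotient of
        \<open>F\<close> over \<open>{a..b}\<close> is the difference of the averages of
        \<open>F\<close> at the two end points.\<close>
      have "(LINT s|lborel. indicator {a..b} s * dq h F s)
          = (LINT s|lborel. (indicator {a..b} s * F (s + h) - indicator {a..b} s * F s) / h)"
        by (intro Bochner_Integration.integral_cong) (auto simp: dq_eq diff_divide_distrib right_diff_distrib)
      also have "\<dots> = ((\<Phi> (b + h) - \<Phi> (a + h)) - (\<Phi> b - \<Phi> a)) / h"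
        using i[of h] i[of 0] tr \<Phi> that by (simp add: prim_def)
      also have "\<dots> = dq h \<Phi> b - dq h \<Phi> a" by (simp add: dq_eq diff_divide_distrib)
      finally have "av h F b - av h F a = (LINT s|lborel. indicator {a..b} s * dq h F s)"
        using prim_dq[OF \<Phi> F(1) \<open>h > 0\<close>] by simp
      then have "(av h F b - av h F a)\<^sup>2 \<le> nr (indicator {a..b}) * nr (dq h F)"
        using Cauchy_Schwarz_L2[OF L2R_indicator_Icc(1) L2R_dqv[OF F(1)]] by simp
      also have "\<dots> \<le> (b - a) * C"
        using bd[of k] that by (simp add: L2R_indicator_Icc h_def mult_left_mono)
      finally show ?thesis by (simp add: h_def mult.commute)
    qed
    moreover have "(\<lambda>k. (av (y k) F b - av (y k) F a)\<^sup>2) \<longlonglongrightarrow> (F b - F a)\<^sup>2"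
      by (intro tendsto_intros av_tendsto F y)
    ultimately show ?thesis using that by (intro LIMSEQ_le_const2) auto
  qed
  show ?thesis
    using *[of a b] *[of b a] by (cases a b rule: linorder_cases) (auto simp: power2_commute abs_minus_commute)
qed

text \<open>Integrate \<open>(F x)\<^sup>2 \<le> 2 * (F s)\<^sup>2 + 2 * (F x - F s)\<^sup>2\<close>
  over \<open>s\<close> in \<open>{x..x + y}\<close>. The length \<open>y\<close> stays free: 1
  gives sup bounds, and the length of a time increment gives Hoelder continuity in time.\<close>

lemma sup_bound_of_L2_Holder:
  assumes F: "L2R F" and H: "\<And>a b. (F b - F a)\<^sup>2 \<le> C * \<bar>b - a\<bar>" and "y > 0"
  shows "(F x)\<^sup>2 \<le> 2 * nr F / y + 2 * C * y"
proof -
  have C: "0 \<le> C" using order_trans[OF zero_le_power2 H[of 1 0]] by simp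
  have i: "integrable lborel (indicator {x..x + y} :: real \<Rightarrow> real)" by (rule integrable_indicator_Icc)
  have "(LINT s|lborel. indicator {x..x + y} s * (F x)\<^sup>2) \<le> (LINT s|lborel. 2 * (F s)\<^sup>2 + indicator {x..x + y} s * (2 * C * y))"
  proof (rule integral_mono)
    show "indicator {x..x + y} s * (F x)\<^sup>2 \<le> 2 * (F s)\<^sup>2 + indicator {x..x + y} s * (2 * C * y)" for s
    proof (cases "s \<in> {x..x + y}")
      case True
      have "(F x)\<^sup>2 \<le> 2 * (F s)\<^sup>2 + 2 * (F x - F s)\<^sup>2" using power2_add_le[of "F s" "F x - F s"] by simp
      also have "(F x - F s)\<^sup>2 \<le> C * y"
        using H[of x s] True C by (intro order_trans[OF H] mult_left_mono) auto
      finally show ?thesis using True by simp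
    qed auto
  qed (use F i in \<open>auto simp: L2_def\<close>)
  also have "\<dots> = 2 * nr F + y * (2 * C * y)"
    using F i \<open>y > 0\<close> by (simp add: L2_def nsq_def)
  finally show ?thesis using \<open>y > 0\<close> by (simp add: field_simps power2_eq_square)
qed

text \<open>The argument of \<open>sup_bound_of_L2_Holder\<close>, with the integral of the square
  replaced by its tail.\<close>

lemma L2_Holder_tendsto_0:
  assumes F: "L2R F" and H: "\<And>a b. (F b - F a)\<^sup>2 \<le> C * \<bar>b - a\<bar>"
  shows "(F \<longlongrightarrow> 0) at_infinity"
proof (rule tendstoI)
  fix e :: real assume "e > 0"
  have C: "0 \<le> C" using order_trans[OF zero_le_power2 H[of 1 0]] by simp
  \<comment> \<open>Small enough for the Hoelder term to contribute at most
    \<open>e\<^sup>2 / 2\<close>, and at most 1 so that \<open>{x..x + y}\<close> avoids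
    \<open>{- real n..real n}\<close> when \<open>\<bar>x\<bar> > real n + 1\<close>.\<close>
  define y where "y = min 1 (e\<^sup>2 / (4 * (C + 1)))"
  have y: "y > 0" using \<open>e > 0\<close> C by (auto simp: y_def)
  have Cy: "2 * C * y \<le> e\<^sup>2 / 2"
  proof -
    have "2 * C * y \<le> 2 * C * (e\<^sup>2 / (4 * (C + 1)))" using C by (intro mult_left_mono) (auto simp: y_def)
    also have "\<dots> \<le> e\<^sup>2 / 2" using C by (simp add: field_simps)
    finally show ?thesis .
  qed
  have [measurable]: "F \<in> borel_measurable borel" using F by auto
  have "(\<lambda>n. LINT s|lborel. indicator (- {- real n..real n}) s * (F s)\<^sup>2) \<longlonglongrightarrow> (LINT s|(lborel::real measure). 0)"
  proof (rule integral_dominated_convergence[where w="\<lambda>s. (F s)\<^sup>2"])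
    show "AE s in lborel. (\<lambda>n. indicator (- {- real n..real n}) s * (F s)\<^sup>2) \<longlonglongrightarrow> 0"
    proof (rule AE_I2)
      fix s :: real
      obtain n0 :: nat where "\<bar>s\<bar> < real n0" using reals_Archimedean2 by blast
      then have "\<forall>n\<ge>n0. indicator (- {- real n..real n}) s * (F s)\<^sup>2 = 0" by (auto simp: indicator_def)
      then show "(\<lambda>n. indicator (- {- real n..real n}) s * (F s)\<^sup>2) \<longlonglongrightarrow> 0"
        by (intro tendsto_eventually) (auto simp: eventually_sequentially)
    qed
  qed (use F in \<open>auto simp: L2_def indicator_def\<close>)
  then have "\<forall>\<^sub>F n in sequentially. (LINT s|lborel. indicator (- {- real n..real n}) s * (F s)\<^sup>2) < e\<^sup>2 * y / 4"
    using \<open>e > 0\<close> y by (intro order_tendstoD(2)) auto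
  then obtain n :: nat where n: "(LINT s|lborel. indicator (- {- real n..real n}) s * (F s)\<^sup>2) < e\<^sup>2 * y / 4"
    by (auto simp: eventually_sequentially)
  have "\<bar>F x\<bar> < e" if "\<bar>x\<bar> > real n + 1" for x
  proof -
    have i: "integrable lborel (\<lambda>s. indicator (- {- real n..real n}) s * (F s)\<^sup>2)"
      using integrable_mult_indicator[of "- {- real n..real n}" lborel "\<lambda>s. (F s)\<^sup>2"] F by (simp add: L2_def)
    have i1: "integrable lborel (indicator {x..x + y} :: real \<Rightarrow> real)" by (rule integrable_indicator_Icc)
    have "(LINT s|lborel. indicator {x..x + y} s * (F x)\<^sup>2)
        \<le> (LINT s|lborel. 2 * (indicator (- {- real n..real n}) s * (F s)\<^sup>2) + indicator {x..x + y} s * (2 * C * y))"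
    proof (rule integral_mono)
      show "indicator {x..x + y} s * (F x)\<^sup>2 \<le> 2 * (indicator (- {- real n..real n}) s * (F s)\<^sup>2) + indicator {x..x + y} s * (2 * C * y)" for s
      proof (cases "s \<in> {x..x + y}")
        case True
        have "y \<le> 1" by (simp add: y_def)
        then have "s \<notin> {- real n..real n}" using True that by auto
        moreover have "(F x)\<^sup>2 \<le> 2 * (F s)\<^sup>2 + 2 * (F x - F s)\<^sup>2" using power2_add_le[of "F s" "F x - F s"] by simp
        moreover have "(F x - F s)\<^sup>2 \<le> C * y"
          using True C by (intro order_trans[OF H] mult_left_mono) auto
        ultimately show ?thesis using True by simp
      qed (auto simp: indicator_def)
    qed (use i i1 in auto)
    also have "\<dots> = 2 * (LINT s|lborel. indicator (- {- real n..real n}) s * (F s)\<^sup>2) + y * (2 * C * y)"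
      using i i1 y by simp
    finally have "y * (F x)\<^sup>2 \<le> 2 * (LINT s|lborel. indicator (- {- real n..real n}) s * (F s)\<^sup>2) + y * (2 * C * y)"
      using y by simp
    also have "\<dots> < 2 * (e\<^sup>2 * y / 4) + y * (e\<^sup>2 / 2)"
    proof (rule add_less_le_mono)
      show "y * (2 * C * y) \<le> y * (e\<^sup>2 / 2)" using Cy y by (intro mult_left_mono) auto
    qed (use n in linarith)
    also have "\<dots> = y * e\<^sup>2" by simp
    finally have "\<bar>F x\<bar>\<^sup>2 < e\<^sup>2" using y by simp
    then show ?thesis using \<open>e > 0\<close> by (intro power2_less_imp_less[of "\<bar>F x\<bar>" e]) auto
  qed
  then show "\<forall>\<^sub>F x in at_infinity. dist (F x) 0 < e"
    unfolding eventually_at_infinity by (intro exI[of _ "real n + 2"]) auto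
qed

lemma av_approx:
  assumes F: "L2R F" and H: "\<And>a b. (F b - F a)\<^sup>2 \<le> C * \<bar>b - a\<bar>" and "y > 0"
  shows "\<bar>av y F x - F x\<bar> \<le> sqrt (C * y)"
proof -
  have C: "0 \<le> C" using order_trans[OF zero_le_power2 H[of 1 0]] by simp
  have i: "integrable lborel (indicator {0..1} :: real \<Rightarrow> real)" by (rule integrable_indicator_Icc)
  have i2: "integrable lborel (\<lambda>r. indicator {0..1} r * F (x + y * r))"
    using \<open>y > 0\<close> by (intro L2_mult_integrable[OF L2R_indicator_Icc(1) L2R_affine[OF F]]) auto
  have "av y F x - F x = (LINT r|lborel. indicator {0..1} r * F (x + y * r) - indicator {0..1} r * F x)"
    using i i2 by (simp add: av_def L2R_indicator_Icc)
  also have "\<bar>\<dots>\<bar> \<le> (LINT r|lborel. indicator {0..1::real} r * sqrt (C * y))"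
  proof (rule integral_abs_bound_integral)
    show "\<bar>indicator {0..1} r * F (x + y * r) - indicator {0..1} r * F x\<bar> \<le> indicator {0..1::real} r * sqrt (C * y)" for r
    proof (cases "r \<in> {0..1}")
      case True
      then have "C * \<bar>y * r\<bar> \<le> C * y"
        using C \<open>y > 0\<close> by (intro mult_left_mono) (auto simp: abs_mult mult_left_le)
      then have "(F (x + y * r) - F x)\<^sup>2 \<le> C * y"
        using order_trans[OF H[of "x + y * r" x]] by simp
      then have "\<bar>F (x + y * r) - F x\<bar> \<le> sqrt (C * y)" by (intro real_le_rsqrt) simp
      then show ?thesis using True by simp
    qed auto
  qed (use i i2 in auto)
  also have "\<dots> = sqrt (C * y)" using i by (simp add: L2R_indicator_Icc)
  finally show ?thesis .
qed

text \<open>The bound on second quotients makes the first quotients \<open>D k\<close> equi-Hoelder,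
  but convergence requires comparing different steps. Averaging \<open>D k\<close> over length
  \<open>y j\<close> equals averaging \<open>D j\<close> over length \<open>y k\<close>, since both
  are mixed second quotients of a primitive of \<open>u\<close>; and each average is close to the
  function averaged. So \<open>D\<close> is uniformly Cauchy with an explicit rate.\<close>

lemma C1_of_second_differences:
  fixes u :: "real \<Rightarrow> real"
  assumes u: "L2R u" "continuous_on UNIV u" and y: "\<And>k. y k > 0" "y \<longlonglongrightarrow> 0"
    and bd1: "\<And>k. nr (dq (y k) u) \<le> C1" and bd2: "\<And>j k. nr (dq (y j) (dq (y k) u)) \<le> C2"
  obtains v where "L2R v" "nr v \<le> C1" "continuous_on UNIV v" "\<And>k. nr (dq (y k) v) \<le> C2"
    "\<And>k x. \<bar>dq (y k) u x - v x\<bar> \<le> sqrt (C2 * y k)" "\<And>a b. (v b - v a)\<^sup>2 \<le> C2 * \<bar>b - a\<bar>"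
proof -
  define D where "D k = dq (y k) u" for k
  have D: "L2R (D k)" for k unfolding D_def by (rule L2R_dqv[OF u(1)])
  have Dc: "continuous_on UNIV (D k)" for k
    unfolding D_def dq_eq[abs_def] using u(2) y(1)[of k]
    by (intro continuous_intros continuous_on_compose2[OF u(2)]) auto
  have DH: "(D k b - D k a)\<^sup>2 \<le> C2 * \<bar>b - a\<bar>" for k a b
    by (rule Holder_of_dq_bound[OF D Dc y]) (simp add: D_def bd2)
  obtain \<Phi> where \<Phi>: "prim \<Phi> u" using prim_exists[OF u(1)] .
  have avu: "av (y k) u = dq (y k) \<Phi>" for k using prim_dq[OF \<Phi> u(1) y(1)] by auto
  have comm: "av (y j) (D k) x = av (y k) (D j) x" for j k x
  proof -
    have "av (y j) (D k) x = dq (y k) (av (y j) u) x"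
      unfolding D_def using y(1)[of j] by (intro dq_av[symmetric] u) auto
    also have "\<dots> = dq (y j) (av (y k) u) x" unfolding avu by (rule dq_commute)
    also have "\<dots> = av (y k) (D j) x"
      unfolding D_def using y(1)[of k] by (intro dq_av u) auto
    finally show ?thesis .
  qed
  have close: "\<bar>D k x - D j x\<bar> \<le> sqrt (C2 * y j) + sqrt (C2 * y k)" for j k x
    using av_approx[OF D[of k] DH y(1)[of j], of x] av_approx[OF D[of j] DH y(1)[of k], of x] comm[of j k x]
    by linarith
  have sq0: "(\<lambda>k. sqrt (C2 * y k)) \<longlonglongrightarrow> 0"
  proof -
    have "(\<lambda>k. sqrt (C2 * y k)) \<longlonglongrightarrow> sqrt (C2 * 0)" by (intro tendsto_intros y)
    then show ?thesis by simp
  qed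
  have "Cauchy (\<lambda>k. D k x)" for x
  proof (rule metric_CauchyI)
    fix e :: real assume "e > 0"
    then obtain N where N: "\<And>k. k \<ge> N \<Longrightarrow> sqrt (C2 * y k) < e / 2"
      using order_tendstoD(2)[OF sq0, of "e/2"] by (auto simp: eventually_sequentially)
    have "dist (D m x) (D n x) < e" if "m \<ge> N" "n \<ge> N" for m n
      using N[OF that(1)] N[OF that(2)] close[of m x n] by (simp add: dist_real_def)
    then show "\<exists>M. \<forall>m\<ge>M. \<forall>n\<ge>M. dist (D m x) (D n x) < e" by blast
  qed
  then obtain v where v: "\<And>x. (\<lambda>k. D k x) \<longlonglongrightarrow> v x"
    unfolding Cauchy_convergent_iff convergent_def by metis
  have vc: "\<bar>D k x - v x\<bar> \<le> sqrt (C2 * y k)" for k x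
  proof -
    have "(\<lambda>j. \<bar>D k x - D j x\<bar>) \<longlonglongrightarrow> \<bar>D k x - v x\<bar>" by (intro tendsto_intros v)
    moreover have "(\<lambda>j. sqrt (C2 * y j) + sqrt (C2 * y k)) \<longlonglongrightarrow> 0 + sqrt (C2 * y k)"
      by (intro tendsto_intros sq0)
    ultimately show ?thesis using close by (intro LIMSEQ_le[of _ _ "\<lambda>j. sqrt (C2 * y j) + sqrt (C2 * y k)"]) auto
  qed
  have vH: "(v b - v a)\<^sup>2 \<le> C2 * \<bar>b - a\<bar>" for a b
  proof -
    have "(\<lambda>k. (D k b - D k a)\<^sup>2) \<longlonglongrightarrow> (v b - v a)\<^sup>2" by (intro tendsto_intros v)
    then show ?thesis using DH by (intro LIMSEQ_le_const2) auto
  qed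
  have vcont: "continuous_on UNIV v" by (rule Holder_half_continuous[OF vH])
  have [measurable]: "v \<in> borel_measurable borel" by (rule borel_measurable_continuous_onI[OF vcont])
  have v1: "L2R v" "nr v \<le> C1"
    using L2_Fatou[of v lborel D C1] v D bd1 by (auto simp: D_def)
  have v2: "nr (dq (y k) v) \<le> C2" for k
  proof (rule L2_Fatou(2)[where s="\<lambda>j. dq (y k) (D j)"])
    show "\<forall>\<^sub>F j in sequentially. L2R (dq (y k) (D j)) \<and> nr (dq (y k) (D j)) \<le> C2"
      using bd2 L2R_dqv[OF D] by (simp add: D_def)
    show "AE x in lborel. (\<lambda>j. dq (y k) (D j) x) \<longlonglongrightarrow> dq (y k) v x"
      using y(1)[of k] unfolding dq_eq[of "y k"] by (intro AE_I2 tendsto_intros v) auto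
  qed measurable
  show ?thesis using that[of v] v1 v2 vc vH vcont by (simp add: D_def)
qed

section \<open>Continuous representatives of data in H^2\<close>

lemma square_integrable_Borel_version:
  assumes f: "square_integrable f"
  obtains f' where "L2R f'" "AE x in lebesgue. f x = f' x"
proof -
  obtain f' where f' [measurable]: "f' \<in> borel_measurable lborel" and eq: "AE x in lborel. f x = f' x"
    using completion_ex_borel_measurable_real[of f lborel] f by (auto simp: square_integrable_def)
  have eq': "AE x in lebesgue. f x = f' x" using eq by (rule AE_completion)
  have "integrable lebesgue (\<lambda>x. (f' x)\<^sup>2)"
    by (rule integrable_cong_AE_imp[of _ "\<lambda>x. (f x)\<^sup>2"])
      (use f eq' measurable_completion[OF f'] in \<open>auto simp: square_integrable_def\<close>)
  then have "L2R f'" using f' by (auto simp: L2_def integrable_completion)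
  then show ?thesis using that eq' by blast
qed

lemma AE_lborel_of_lebesgue:
  fixes f g :: "real \<Rightarrow> real"
  assumes "AE x in lebesgue. f x = g x" and [measurable]: "f \<in> borel_measurable borel" "g \<in> borel_measurable borel"
  shows "AE x in lborel. f x = g x"
  using assms(1) by (subst (asm) AE_completion_iff) auto

text \<open>First quotients of the representative are averages of the first derivative, second
  quotients are averages of quotients of that derivative; so both are bounded for every step, not
  only along a sequence.\<close>

lemma sobolev_2_representative:
  assumes "uin \<in> sobolev 2"
  obtains u0 A where "L2R u0" "continuous_on UNIV u0" "AE x in lebesgue. uin x = u0 x"
    "\<And>y. y > 0 \<Longrightarrow> nr (dq y u0) \<le> A" "\<And>y. y > 0 \<Longrightarrow> nr (dq y (dq y u0)) \<le> A"
proof -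
  obtain g h where f: "square_integrable uin" and g: "square_integrable g" and h: "square_integrable h"
    and wg: "weak_derivative UNIV 1 uin g" and wh: "weak_derivative UNIV 1 g h"
    using assms by (auto simp: numeral_2_eq_2)
  obtain f' where f': "L2R f'" "AE x in lebesgue. uin x = f' x" using square_integrable_Borel_version[OF f] .
  obtain g' where g': "L2R g'" "AE x in lebesgue. g x = g' x" using square_integrable_Borel_version[OF g] .
  obtain h' where h': "L2R h'" "AE x in lebesgue. h x = h' x" using square_integrable_Borel_version[OF h] .
  note li = locally_integrable_loc_int[OF loc_int_L2]
  have w1: "weak_derivative UNIV 1 f' g'"
    by (rule weak_derivative_AE_cong[OF wg f'(2) li[OF f'(1)] g'(2) li[OF g'(1)]])
  have w2: "weak_derivative UNIV 1 g' h'"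
    by (rule weak_derivative_AE_cong[OF wh g'(2) li[OF g'(1)] h'(2) li[OF h'(1)]])
  obtain u0 where u0: "prim u0 g'" "AE x in lborel. f' x = u0 x"
    using weak_derivative_primitive[OF w1 f'(1) g'(1)] .
  obtain G where G: "prim G h'" "AE x in lborel. g' x = G x"
    using weak_derivative_primitive[OF w2 g'(1) h'(1)] .
  have c: "continuous_on UNIV u0" "continuous_on UNIV G"
    using Holder_half_continuous[of u0 "nr g'"] Holder_half_continuous[of G "nr h'"]
      prim_diff_sq[OF u0(1) g'(1)] prim_diff_sq[OF G(1) h'(1)] by (simp_all add: mult.commute)
  note [measurable] = c[THEN borel_measurable_continuous_onI] f'(1)[THEN L2R_borel] g'(1)[THEN L2R_borel]
  have "L2R u0"
    by (rule L2_le(1)[OF f'(1), of _ 1]) (use u0(2) in auto)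
  moreover have "AE x in lebesgue. uin x = u0 x"
    using f'(2) AE_completion[OF u0(2)] by eventually_elim simp
  moreover have dq1: "dq y u0 = av y g'" if "y > 0" for y
    using prim_dq[OF u0(1) g'(1) that] by auto
  moreover have "nr (dq y u0) \<le> nr g' + nr h'" if "y > 0" for y
    using L2R_av[OF g'(1), of y] nsq_nonneg[of lborel h'] unfolding dq1[OF that] by linarith
  moreover have "nr (dq y (dq y u0)) \<le> nr g' + nr h'" if "y > 0" for y
  proof -
    have "dq y (dq y u0) = av y (dq y g')"
      unfolding dq1[OF that] using dq_av[OF g'(1), of y y] that by auto
    then have "nr (dq y (dq y u0)) \<le> nr (dq y g')" using L2R_av[OF L2R_dqv[OF g'(1)]] by simp
    \<comment> \<open>\<open>g'\<close> agrees with a primitive of \<open>h'\<close> only almost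
      everywhere, so the exceptional set has to be translated along with the quotient.\<close>
    also have "nr (dq y g') \<le> 1 * nr (dq y G)"
    proof (rule L2_le(2))
      show "L2R (dq y G)" using nr_dq_prim_le[OF G(1) h'(1) _ that] by simp
      have "AE x in lborel. g' (x + y) = G (x + y)"
        by (rule AE_translate[of "\<lambda>x. g' x = G x"]) (use G(2) in auto)
      then show "AE x in lborel. (dq y g' x)\<^sup>2 \<le> 1 * (dq y G x)\<^sup>2"
        using G(2) by eventually_elim (simp add: dq_eq)
    qed measurable
    also have "\<dots> \<le> nr h'" using nr_dq_prim_le[OF G(1) h'(1) _ that] by simp
    finally show ?thesis using nsq_nonneg[of lborel g'] by linarith
  qed
  ultimately show ?thesis using that[of u0 "nr g' + nr h'"] c by blast
qed

section \<open>The difference scheme\<close>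

text \<open>The derivative \<open>\<epsilon>\<^sup>2 / sqrt (p\<^sup>2 + \<epsilon>\<^sup>2) ^
  3\<close> lies between 0 and \<open>1 / \<epsilon>\<close>. Secant slopes are recorded instead of
  derivatives, because differences of fluxes will be written as a coefficient times a
  difference.\<close>

lemma plastic_stress_mean_value:
  assumes "0 < \<epsilon>"
  obtains a where "0 \<le> a" "a \<le> 1 / \<epsilon>" "plastic_stress \<epsilon> p - plastic_stress \<epsilon> q = a * (p - q)"
proof -
  define f where "f p = plastic_stress \<epsilon> p" for p
  have pos: "0 < p\<^sup>2 + \<epsilon>\<^sup>2" for p using zero_le_power2[of p] zero_less_power[OF assms, of 2] by linarith
  have d: "(f has_real_derivative \<epsilon>\<^sup>2 / (sqrt (p\<^sup>2 + \<epsilon>\<^sup>2)) ^ 3) (at p)" for p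
  proof -
    have s: "sqrt (p\<^sup>2 + \<epsilon>\<^sup>2) > 0" using pos by simp
    have s2: "sqrt (p\<^sup>2 + \<epsilon>\<^sup>2) * sqrt (p\<^sup>2 + \<epsilon>\<^sup>2) = p\<^sup>2 + \<epsilon>\<^sup>2" using pos[of p] by simp
    have "((\<lambda>p. p / sqrt (p\<^sup>2 + \<epsilon>\<^sup>2)) has_real_derivative
        (1 * sqrt (p\<^sup>2 + \<epsilon>\<^sup>2) - p * (2 * p * (inverse (sqrt (p\<^sup>2 + \<epsilon>\<^sup>2)) / 2))) / (sqrt (p\<^sup>2 + \<epsilon>\<^sup>2) * sqrt (p\<^sup>2 + \<epsilon>\<^sup>2))) (at p)"
      using pos[of p] by (auto intro!: derivative_eq_intros simp: less_imp_neq[symmetric])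
    also have "(1 * sqrt (p\<^sup>2 + \<epsilon>\<^sup>2) - p * (2 * p * (inverse (sqrt (p\<^sup>2 + \<epsilon>\<^sup>2)) / 2))) / (sqrt (p\<^sup>2 + \<epsilon>\<^sup>2) * sqrt (p\<^sup>2 + \<epsilon>\<^sup>2))
        = \<epsilon>\<^sup>2 / (sqrt (p\<^sup>2 + \<epsilon>\<^sup>2)) ^ 3"
    proof -
      define r where "r = sqrt (p\<^sup>2 + \<epsilon>\<^sup>2)"
      have "r > 0" "r * r = p\<^sup>2 + \<epsilon>\<^sup>2" using s s2 by (auto simp: r_def)
      then have "(1 * r - p * (2 * p * (inverse r / 2))) / (r * r) = (r * r - p\<^sup>2) / r ^ 3"
        by (simp add: field_simps power2_eq_square power3_eq_cube)
      then show ?thesis using \<open>r * r = p\<^sup>2 + \<epsilon>\<^sup>2\<close> by (simp add: r_def)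
    qed
    finally show ?thesis by (simp add: f_def[abs_def] plastic_stress_def[abs_def])
  qed
  have b: "0 \<le> \<epsilon>\<^sup>2 / (sqrt (p\<^sup>2 + \<epsilon>\<^sup>2)) ^ 3" "\<epsilon>\<^sup>2 / (sqrt (p\<^sup>2 + \<epsilon>\<^sup>2)) ^ 3 \<le> 1 / \<epsilon>" for p
  proof -
    have "\<epsilon> \<le> sqrt (p\<^sup>2 + \<epsilon>\<^sup>2)" using assms by (intro real_le_rsqrt) simp
    then have "\<epsilon> ^ 3 \<le> (sqrt (p\<^sup>2 + \<epsilon>\<^sup>2)) ^ 3" using assms by (intro power_mono) auto
    moreover have "0 < \<epsilon> ^ 3" using assms by simp
    ultimately have "\<epsilon>\<^sup>2 / (sqrt (p\<^sup>2 + \<epsilon>\<^sup>2)) ^ 3 \<le> \<epsilon>\<^sup>2 / \<epsilon> ^ 3"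
      using pos[of p] by (intro divide_left_mono mult_pos_pos zero_less_power) auto
    also have "\<dots> = 1 / \<epsilon>" using assms by (simp add: power2_eq_square power3_eq_cube)
    finally show "\<epsilon>\<^sup>2 / (sqrt (p\<^sup>2 + \<epsilon>\<^sup>2)) ^ 3 \<le> 1 / \<epsilon>" .
  qed (use pos in auto)
  have *: "\<exists>a. 0 \<le> a \<and> a \<le> 1 / \<epsilon> \<and> f p - f q = a * (p - q)" if qp: "q < p" for p q
  proof -
    obtain z where "f p - f q = (p - q) * (\<epsilon>\<^sup>2 / (sqrt (z\<^sup>2 + \<epsilon>\<^sup>2)) ^ 3)"
      using MVT2[OF qp, of f "\<lambda>z. \<epsilon>\<^sup>2 / (sqrt (z\<^sup>2 + \<epsilon>\<^sup>2)) ^ 3"] d by blast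
    then show ?thesis using b[of z] by (intro exI[of _ "\<epsilon>\<^sup>2 / (sqrt (z\<^sup>2 + \<epsilon>\<^sup>2)) ^ 3"]) (simp add: mult.commute)
  qed
  have "\<exists>a. 0 \<le> a \<and> a \<le> 1 / \<epsilon> \<and> f p - f q = a * (p - q)"
  proof (cases p q rule: linorder_cases)
    case less
    then obtain a where "0 \<le> a" "a \<le> 1 / \<epsilon>" "f q - f p = a * (q - p)" using *[of p q] by auto
    then show ?thesis by (intro exI[of _ a]) (auto simp: algebra_simps)
  next
    case equal
    then show ?thesis using assms by (intro exI[of _ 0]) auto
  qed (use * in auto)
  then show ?thesis using that by (auto simp: f_def)
qed

lemma plastic_stress_0 [simp]: "plastic_stress \<epsilon> 0 = 0"
  by (simp add: plastic_stress_def)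

lemma continuous_plastic_stress:
  assumes "0 < \<epsilon>" shows "continuous_on UNIV (plastic_stress \<epsilon>)"
proof -
  have "sqrt (\<bar>p\<bar>\<^sup>2 + \<epsilon>\<^sup>2) \<noteq> 0" for p using assms by (simp add: add_nonneg_eq_0_iff)
  then show ?thesis unfolding plastic_stress_def[abs_def] by (intro continuous_intros) auto
qed

lemma abs_plastic_stress_le: "\<bar>plastic_stress \<epsilon> p\<bar> \<le> 1"
proof -
  define s where "s = sqrt (\<bar>p\<bar>\<^sup>2 + \<epsilon>\<^sup>2)"
  have "\<bar>p\<bar> \<le> s" unfolding s_def by (intro real_le_rsqrt) simp
  then have "\<bar>p / s\<bar> \<le> 1" by (cases "s = 0") (simp_all add: abs_divide)
  then show ?thesis by (simp add: plastic_stress_def s_def)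
qed

text \<open>The mesh condition \<open>h * M \<le> 2 * \<epsilon>\<close> says that over one cell the
  viscosity dominates centred convection with speeds up to \<open>M\<close>; it makes the weights in
  the maximum principle nonnegative.\<close>

locale scheme =
  fixes \<epsilon> h M :: real
  assumes eps: "0 < \<epsilon>" and h: "0 < h" and M: "0 \<le> M" and hM: "h * M \<le> 2 * \<epsilon>"
begin

text \<open>\<open>\<Lambda>\<close> is the Lipschitz constant of \<open>\<sigma>\<close>, and the choice of \<open>\<tau>\<close> is the CFL condition.\<close>

definition "\<Lambda> = \<epsilon> + 1 / \<epsilon>"
definition "\<tau> = h\<^sup>2 / (16 * \<Lambda>)"
definition \<sigma> :: "real \<Rightarrow> real" where "\<sigma> p = \<epsilon> * p + plastic_stress \<epsilon> p"
text \<open>The numerical flux between \<open>x\<close> and \<open>x + h\<close>, with the sign that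
  makes \<open>F\<close> the right-hand side of the equation; convection enters by the mean of half
  the square at both end points. \<open>F\<close> takes the backward quotient, so that discrete
  integration by parts returns to the forward quotient inside \<open>\<sigma>\<close>.\<close>

definition Q :: "(real \<Rightarrow> real) \<Rightarrow> real \<Rightarrow> real" where
  "Q u x = \<sigma> (dq h u x) - ((u x)\<^sup>2 + (u (x + h))\<^sup>2) / 4"
definition F :: "(real \<Rightarrow> real) \<Rightarrow> real \<Rightarrow> real" where "F u = dq (- h) (Q u)"
definition S :: "(real \<Rightarrow> real) \<Rightarrow> real \<Rightarrow> real" where "S u x = u x + \<tau> * F u x"

lemma \<Lambda>_pos: "\<Lambda> > 0" using eps by (simp add: \<Lambda>_def add_pos_pos)
lemma \<tau>_pos: "\<tau> > 0" using h \<Lambda>_pos by (simp add: \<tau>_def)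
lemma eps_\<Lambda>: "\<epsilon> \<le> \<Lambda>" using eps by (simp add: \<Lambda>_def)

lemma \<sigma>_mean_value:
  obtains a where "\<epsilon> \<le> a" "a \<le> \<Lambda>" "\<sigma> p - \<sigma> q = a * (p - q)"
proof -
  obtain a where "0 \<le> a" "a \<le> 1 / \<epsilon>" "plastic_stress \<epsilon> p - plastic_stress \<epsilon> q = a * (p - q)"
    using plastic_stress_mean_value[OF eps] .
  then show ?thesis using that[of "\<epsilon> + a"] by (simp add: \<sigma>_def \<Lambda>_def algebra_simps)
qed

lemma \<sigma>_0 [simp]: "\<sigma> 0 = 0" by (simp add: \<sigma>_def)

lemma continuous_\<sigma>: "continuous_on UNIV \<sigma>"
  unfolding \<sigma>_def[abs_def] by (intro continuous_intros continuous_plastic_stress eps)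

lemma continuous_Q: assumes "continuous_on UNIV u" shows "continuous_on UNIV (Q u)"
proof -
  have c: "continuous_on UNIV (\<lambda>x. u (x + h))"
    by (intro continuous_on_compose2[OF assms] continuous_intros) auto
  have "continuous_on UNIV (dq h u)"
    unfolding dq_eq[abs_def] using h by (intro continuous_intros c assms) auto
  then have "continuous_on UNIV (\<lambda>x. \<sigma> (dq h u x))"
    by (intro continuous_on_compose2[OF continuous_\<sigma>]) auto
  then show ?thesis unfolding Q_def[abs_def] by (intro continuous_intros c assms) auto
qed

lemma continuous_F: assumes "continuous_on UNIV u" shows "continuous_on UNIV (F u)"
  unfolding F_def dq_eq[abs_def] using h
  by (intro continuous_intros continuous_on_compose2[OF continuous_Q[OF assms]] continuous_Q[OF assms]) auto

lemma continuous_S: assumes "continuous_on UNIV u" shows "continuous_on UNIV (S u)"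
  unfolding S_def[abs_def] by (intro continuous_intros continuous_F assms)

lemma Q_translate: "Q (\<lambda>x. u (x + c)) x = Q u (x + c)"
  by (simp add: Q_def dq_translate add_ac)

lemma S_translate: "S (\<lambda>x. u (x + c)) x = S u (x + c)"
proof -
  have "Q (\<lambda>x. u (x + c)) = (\<lambda>x. Q u (x + c))" by (rule ext) (rule Q_translate)
  then show ?thesis by (simp add: S_def F_def dq_translate)
qed

lemma F_eq: "F u x = (\<sigma> (dq h u x) - \<sigma> (dq h u (x - h))) / h - ((u (x + h))\<^sup>2 - (u (x - h))\<^sup>2) / (4 * h)"
  using h by (simp add: F_def dq_minus) (simp add: dq_eq Q_def field_simps)

text \<open>Under the two conditions on the step sizes, \<open>S u x\<close> is a convex combination of
  \<open>u (x - h)\<close>, \<open>u x\<close> and \<open>u (x + h)\<close>.\<close>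

lemma maximum_principle:
  assumes u: "\<And>x. \<bar>u x\<bar> \<le> M" shows "\<bar>S u x\<bar> \<le> M"
proof -
  obtain a where a: "\<epsilon> \<le> a" "a \<le> \<Lambda>" "\<sigma> (dq h u x) - \<sigma> 0 = a * (dq h u x - 0)" using \<sigma>_mean_value .
  obtain b where b: "\<epsilon> \<le> b" "b \<le> \<Lambda>" "\<sigma> (dq h u (x - h)) - \<sigma> 0 = b * (dq h u (x - h) - 0)" using \<sigma>_mean_value .
  define l m r where "l = u (x - h)" and "m = u x" and "r = u (x + h)"
  define k where "k = \<tau> / h\<^sup>2"
  have k: "k > 0" "k * \<Lambda> = 1 / 16" using \<tau>_pos h \<Lambda>_pos by (auto simp: k_def \<tau>_def)
  \<comment> \<open>\<open>A\<close> and \<open>B\<close> are the coefficients of \<open>r\<close>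
    and \<open>l\<close> in \<open>S u x\<close>; the terms with \<open>r + l\<close> come from
    \<open>r\<^sup>2 - l\<^sup>2 = (r - l) * (r + l)\<close>.\<close>
  define A where "A = k * (a - h * (r + l) / 4)"
  define B where "B = k * (b + h * (r + l) / 4)"
  have "\<bar>l\<bar> \<le> M" "\<bar>m\<bar> \<le> M" "\<bar>r\<bar> \<le> M" using u by (auto simp: l_def m_def r_def)
  then have rl: "\<bar>r + l\<bar> \<le> 2 * M" by linarith
  have "\<bar>h * (r + l) / 4\<bar> \<le> h * (2 * M) / 4" using h rl by (simp add: abs_mult)
  also have "\<dots> \<le> \<epsilon>" using hM by (simp add: mult.commute)
  finally have "\<bar>h * (r + l) / 4\<bar> \<le> \<epsilon>" .
  then have AB: "A \<ge> 0" "B \<ge> 0" using k a(1) b(1) by (auto simp: A_def B_def abs_le_iff intro!: mult_nonneg_nonneg)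
  have "A + B = k * (a + b)" by (simp add: A_def B_def algebra_simps)
  also have "\<dots> \<le> k * (2 * \<Lambda>)" using k a(2) b(2) by (intro mult_left_mono) auto
  also have "\<dots> \<le> 1" using k by simp
  finally have AB1: "A + B \<le> 1" .
  have "S u x = m + \<tau> * ((a * ((r - m) / h) - b * ((m - l) / h)) / h - (r\<^sup>2 - l\<^sup>2) / (4 * h))"
    using a(3) b(3) unfolding S_def F_eq by (simp add: dq_eq l_def m_def r_def)
  also have "\<dots> = m + k * ((a * (r - m) - b * (m - l)) - h * (r\<^sup>2 - l\<^sup>2) / 4)"
    using h by (simp add: k_def field_simps power2_eq_square)
  also have "\<dots> = A * r + B * l + (1 - (A + B)) * m"
    by (simp add: A_def B_def field_simps power2_eq_square)
  finally have "\<bar>S u x\<bar> \<le> \<bar>A * r\<bar> + \<bar>B * l\<bar> + \<bar>(1 - (A + B)) * m\<bar>" by linarith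
  also have "\<dots> \<le> A * M + B * M + (1 - (A + B)) * M"
    using AB AB1 \<open>\<bar>l\<bar> \<le> M\<close> \<open>\<bar>m\<bar> \<le> M\<close> \<open>\<bar>r\<bar> \<le> M\<close> by (auto simp: abs_mult intro!: add_mono mult_left_mono)
  finally show ?thesis by (simp add: algebra_simps)
qed

lemma L2R_Q: "L2R u \<Longrightarrow> (\<And>x. \<bar>u x\<bar> \<le> M) \<Longrightarrow> L2R (Q u)"
proof -
  assume u: "L2R u" "\<And>x. \<bar>u x\<bar> \<le> M"
  have [measurable]: "u \<in> borel_measurable borel" "\<sigma> \<in> borel_measurable borel"
    using u borel_measurable_continuous_onI[OF continuous_\<sigma>] by auto
  have s: "L2R (\<lambda>x. \<sigma> (dq h u x))"
  proof (rule L2_le(1)[OF L2R_dqv[OF u(1), of 1 h], of _ "\<Lambda>\<^sup>2"])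
    have "(\<sigma> p)\<^sup>2 \<le> \<Lambda>\<^sup>2 * p\<^sup>2" for p
    proof -
      obtain a where a: "\<epsilon> \<le> a" "a \<le> \<Lambda>" "\<sigma> p - \<sigma> 0 = a * (p - 0)" using \<sigma>_mean_value .
      then show ?thesis using eps by (simp add: power_mult_distrib power_mono mult_right_mono)
    qed
    then show "AE x in lborel. (\<sigma> (dq h u x))\<^sup>2 \<le> \<Lambda>\<^sup>2 * (dq h u x)\<^sup>2" by auto
  qed measurable
  have q: "L2R (\<lambda>x. (u x)\<^sup>2)"
  proof (rule L2_le(1)[OF u(1), of _ "M\<^sup>2"])
    have "((u x)\<^sup>2)\<^sup>2 \<le> M\<^sup>2 * (u x)\<^sup>2" for x
    proof -
      have "(u x)\<^sup>2 \<le> M\<^sup>2" using u(2)[of x] M by (simp add: abs_le_square_iff[symmetric])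
      then have "(u x)\<^sup>2 * (u x)\<^sup>2 \<le> M\<^sup>2 * (u x)\<^sup>2" by (intro mult_right_mono) auto
      then show ?thesis by (simp add: power2_eq_square)
    qed
    then show "AE x in lborel. ((u x)\<^sup>2)\<^sup>2 \<le> M\<^sup>2 * (u x)\<^sup>2" by auto
  qed measurable
  show "L2R (Q u)"
    unfolding Q_def[abs_def]
    using L2_diff[OF s L2_cmult[OF L2_add[OF q L2R_translate(1)[OF q, of h]], of "1/4"]] by simp
qed

lemma L2R_F: "L2R u \<Longrightarrow> (\<And>x. \<bar>u x\<bar> \<le> M) \<Longrightarrow> L2R (F u)"
  unfolding F_def by (intro L2R_dqv L2R_Q)

lemma L2R_S: "L2R u \<Longrightarrow> (\<And>x. \<bar>u x\<bar> \<le> M) \<Longrightarrow> L2R (S u)"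
  unfolding S_def[abs_def] by (intro L2_add L2_cmult L2R_F)

text \<open>The energy estimate produces the rate \<open>3 * M\<^sup>2 / \<epsilon>\<close>, of
  which 2 stem from absorbing the convective flux and 1 from the quadratic term of the time step; it
  is rounded up.\<close>

definition "K = 4 * M\<^sup>2 / \<epsilon>"

lemma K_nonneg: "K \<ge> 0" using eps by (simp add: K_def)

text \<open>The inverse inequality on the mesh; its factor of order \<open>1 / h\<^sup>2\<close> is
  compensated by \<open>\<tau>\<close>.\<close>

lemma nr_dq_minus_le: "L2R f \<Longrightarrow> nr (dq (- h) f) \<le> 4 / h\<^sup>2 * nr f"
proof -
  assume f: "L2R f"
  have "nr (dq (- h) f) = nr (\<lambda>x. (1 / h) * (f x - f (x + (- h))))"
    by (simp add: nsq_def dq_eq power2_commute power_divide)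
  also have "\<dots> \<le> (1 / h)\<^sup>2 * (2 * nr f + 2 * nr f)"
    unfolding nsq_cmult using nsq_diff_le[OF f L2R_translate(1)[OF f, of "- h"]] L2R_translate(2)[OF f, of "- h"]
    by (intro mult_left_mono) auto
  finally show ?thesis by (simp add: power_divide)
qed

text \<open>The difference of the fluxes of \<open>u\<close> and \<open>v\<close> is \<open>a q - g\<close> with \<open>q = dq h (u - v)\<close>, a
  coefficient \<open>a\<close> between \<open>\<epsilon>\<close> and \<open>\<Lambda>\<close>, and a convective part \<open>g\<close> of order zero.\<close>

lemma flux_difference:
  assumes u: "L2R u" "\<And>x. \<bar>u x\<bar> \<le> M" and v: "L2R v" "\<And>x. \<bar>v x\<bar> \<le> M"
  defines "\<delta> \<equiv> \<lambda>x. u x - v x" and "J \<equiv> \<lambda>x. Q u x - Q v x"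
  obtains P where "\<epsilon> * nr (dq h \<delta>) \<le> P" "(LINT x|lborel. J x * dq h \<delta> x) \<ge> P - \<epsilon> / 4 * nr (dq h \<delta>) - M\<^sup>2 / \<epsilon> * nr \<delta>"
    "nr J \<le> 2 * \<Lambda> * P + 2 * M\<^sup>2 * nr \<delta>"
proof -
  define q where "q = dq h \<delta>"
  define g where "g = (\<lambda>x. ((u x)\<^sup>2 + (u (x + h))\<^sup>2) / 4 - ((v x)\<^sup>2 + (v (x + h))\<^sup>2) / 4)"
  define A where "A = (\<lambda>x. \<sigma> (dq h u x) - \<sigma> (dq h v x))"
  have [measurable]: "u \<in> borel_measurable borel" "v \<in> borel_measurable borel" "\<sigma> \<in> borel_measurable borel"
    using u v borel_measurable_continuous_onI[OF continuous_\<sigma>] by auto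
  have \<delta>: "L2R \<delta>" unfolding \<delta>_def by (intro L2_diff u v)
  have q: "L2R q" unfolding q_def by (rule L2R_dqv[OF \<delta>])
  have J: "L2R J" unfolding J_def by (intro L2_diff L2R_Q u v)
  have Jeq: "J x = A x - g x" for x by (simp add: J_def A_def g_def Q_def)
  have Abd: "\<epsilon> * (q x)\<^sup>2 \<le> A x * q x" "(A x)\<^sup>2 \<le> \<Lambda> * (A x * q x)" for x
  proof -
    obtain a where a: "\<epsilon> \<le> a" "a \<le> \<Lambda>" "\<sigma> (dq h u x) - \<sigma> (dq h v x) = a * (dq h u x - dq h v x)" using \<sigma>_mean_value .
    have Ax: "A x = a * q x" using a(3) by (simp add: A_def q_def \<delta>_def dq_diff)
    have a0: "0 \<le> a" using a(1) eps by simp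
    show "\<epsilon> * (q x)\<^sup>2 \<le> A x * q x" using mult_right_mono[OF a(1) zero_le_power2[of "q x"]] by (simp add: Ax power2_eq_square mult.assoc)
    have "a * (a * (q x)\<^sup>2) \<le> \<Lambda> * (a * (q x)\<^sup>2)" using a(2) a0 by (intro mult_right_mono) auto
    then show "(A x)\<^sup>2 \<le> \<Lambda> * (A x * q x)" by (simp add: Ax power2_eq_square mult_ac)
  qed
  have AL: "L2R A"
  proof (rule L2_le(1)[OF q, of _ "\<Lambda>\<^sup>2"])
    have "(A x)\<^sup>2 \<le> \<Lambda>\<^sup>2 * (q x)\<^sup>2" for x
    proof -
      obtain a where a: "\<epsilon> \<le> a" "a \<le> \<Lambda>" "\<sigma> (dq h u x) - \<sigma> (dq h v x) = a * (dq h u x - dq h v x)" using \<sigma>_mean_value .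
      have Ax: "A x = a * q x" using a(3) by (simp add: A_def q_def \<delta>_def dq_diff)
      show ?thesis using a eps by (simp add: Ax power_mult_distrib power_mono mult_right_mono)
    qed
    then show "AE x in lborel. (A x)\<^sup>2 \<le> \<Lambda>\<^sup>2 * (q x)\<^sup>2" by auto
  qed (simp add: A_def)
  have gbd: "(g x)\<^sup>2 \<le> M\<^sup>2 / 2 * (\<delta> x)\<^sup>2 + M\<^sup>2 / 2 * (\<delta> (x + h))\<^sup>2" for x
  proof -
    define c d where "c = (u x + v x) / 4" and "d = (u (x + h) + v (x + h)) / 4"
    have "\<bar>c\<bar> \<le> M / 2" "\<bar>d\<bar> \<le> M / 2"
      using u(2)[of x] v(2)[of x] u(2)[of "x + h"] v(2)[of "x + h"] by (auto simp: c_def d_def abs_le_iff)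
    then have cd: "c\<^sup>2 \<le> (M / 2)\<^sup>2" "d\<^sup>2 \<le> (M / 2)\<^sup>2" using M by (auto simp: abs_le_square_iff[symmetric])
    have "g x = c * \<delta> x + d * \<delta> (x + h)"
      by (simp add: g_def c_def d_def \<delta>_def power2_eq_square field_simps)
    then have "(g x)\<^sup>2 \<le> 2 * (c * \<delta> x)\<^sup>2 + 2 * (d * \<delta> (x + h))\<^sup>2" using power2_add_le by simp
    also have "\<dots> \<le> 2 * ((M / 2)\<^sup>2 * (\<delta> x)\<^sup>2) + 2 * ((M / 2)\<^sup>2 * (\<delta> (x + h))\<^sup>2)"
      unfolding power_mult_distrib using cd by (intro add_mono mult_left_mono mult_right_mono) auto
    finally show ?thesis by (simp add: power2_eq_square)
  qed
  have gL: "L2R g" "nr g \<le> M\<^sup>2 * nr \<delta>"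
  proof -
    have *: "AE x in lborel. (g x)\<^sup>2 \<le> M\<^sup>2 / 2 * (\<delta> x)\<^sup>2 + M\<^sup>2 / 2 * (\<delta> (x + h))\<^sup>2" using gbd by auto
    have m: "g \<in> borel_measurable lborel" by (simp add: g_def)
    show "L2R g" by (rule L2_le_sum(1)[OF \<delta> L2R_translate(1)[OF \<delta>] m *])
    show "nr g \<le> M\<^sup>2 * nr \<delta>"
      using L2_le_sum(2)[OF \<delta> L2R_translate(1)[OF \<delta>, of h] m *] L2R_translate(2)[OF \<delta>, of h] by (simp add: mult.commute)
  qed
  \<comment> \<open>\<open>P\<close> keeps the coercive term exact. It dominates
    \<open>\<epsilon> * nr q\<close> and, by
    \<open>(A x)\<^sup>2 \<le> \<Lambda> * (A x * q x)\<close>, also controls the norm of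
    \<open>A\<close>; so the quadratic term of a time step can be absorbed by the same
    quantity.\<close>
  define P where "P = (LINT x|lborel. A x * q x)"
  have iAq: "integrable lborel (\<lambda>x. A x * q x)" by (rule L2_mult_integrable[OF AL q])
  have "\<epsilon> * nr q \<le> P"
    unfolding P_def nsq_def using q iAq Abd(1)
    by (subst integral_mult_right_zero[symmetric], intro integral_mono) (auto simp: L2_def)
  moreover have "(LINT x|lborel. J x * q x) \<ge> P - \<epsilon> / 4 * nr q - M\<^sup>2 / \<epsilon> * nr \<delta>"
  proof -
    have "(LINT x|lborel. J x * q x) = P - (LINT x|lborel. g x * q x)"
      using iAq L2_mult_integrable[OF gL(1) q] by (simp add: Jeq left_diff_distrib P_def)
    \<comment> \<open>The weight \<open>2 / \<epsilon>\<close> splits the pairing into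
      \<open>nr g / \<epsilon>\<close> and a quarter of the dissipation
      \<open>\<epsilon> * nr q\<close>.\<close>
    moreover have "\<bar>LINT x|lborel. g x * q x\<bar> \<le> (2 / \<epsilon> * nr g + nr q / (2 / \<epsilon>)) / 2"
      by (rule L2_mult_le[OF gL(1) q]) (use eps in auto)
    moreover have "2 / \<epsilon> * nr g \<le> 2 / \<epsilon> * (M\<^sup>2 * nr \<delta>)" using gL(2) eps by (intro mult_left_mono) auto
    moreover have "nr q / (2 / \<epsilon>) = \<epsilon> / 2 * nr q" by simp
    moreover have "2 / \<epsilon> * (M\<^sup>2 * nr \<delta>) = 2 * (M\<^sup>2 / \<epsilon> * nr \<delta>)" by simp
    ultimately show ?thesis unfolding abs_le_iff by argo
  qed
  moreover have "nr J \<le> 2 * \<Lambda> * P + 2 * M\<^sup>2 * nr \<delta>"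
  proof -
    have "nr A \<le> \<Lambda> * P"
      unfolding P_def nsq_def using AL iAq Abd(2)
      by (subst integral_mult_right_zero[symmetric], intro integral_mono) (auto simp: L2_def)
    then show ?thesis using nsq_diff_le[OF AL gL(1)] gL(2) by (simp add: Jeq[abs_def])
  qed
  ultimately show ?thesis using that unfolding q_def by blast
qed

text \<open>Expand the square of \<open>\<delta> + \<tau> * dq (- h) J\<close>. The cross term is,
  by parts, the dissipation; the quadratic term is of order
  \<open>\<tau>\<^sup>2 / h\<^sup>2\<close>, which the CFL condition turns into a fraction of the
  dissipation.\<close>

lemma S_difference_energy:
  assumes u: "L2R u" "\<And>x. \<bar>u x\<bar> \<le> M" and v: "L2R v" "\<And>x. \<bar>v x\<bar> \<le> M"
  shows "nr (\<lambda>x. S u x - S v x) + \<epsilon> * \<tau> / 2 * nr (dq h (\<lambda>x. u x - v x)) \<le> (1 + K * \<tau>) * nr (\<lambda>x. u x - v x)"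
proof -
  define \<delta> where "\<delta> = (\<lambda>x. u x - v x)"
  define J where "J = (\<lambda>x. Q u x - Q v x)"
  have \<delta>: "L2R \<delta>" unfolding \<delta>_def by (intro L2_diff u v)
  have J: "L2R J" unfolding J_def by (intro L2_diff L2R_Q u v)
  obtain P where P: "\<epsilon> * nr (dq h \<delta>) \<le> P" "(LINT x|lborel. J x * dq h \<delta> x) \<ge> P - \<epsilon> / 4 * nr (dq h \<delta>) - M\<^sup>2 / \<epsilon> * nr \<delta>"
    "nr J \<le> 2 * \<Lambda> * P + 2 * M\<^sup>2 * nr \<delta>"
    using flux_difference[OF u v] unfolding \<delta>_def J_def by blast
  have "nr (\<lambda>x. S u x - S v x) = nr (\<lambda>x. \<delta> x + \<tau> * dq (- h) J x)"
    by (intro arg_cong[where f=nr]) (auto simp: S_def F_def \<delta>_def J_def dq_diff algebra_simps)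
  also have "\<dots> = nr \<delta> + 2 * \<tau> * (LINT x|lborel. \<delta> x * dq (- h) J x) + \<tau>\<^sup>2 * nr (dq (- h) J)"
    by (rule nsq_add[OF \<delta> L2R_dqv[OF J]])
  also have "(LINT x|lborel. \<delta> x * dq (- h) J x) = - (LINT x|lborel. J x * dq h \<delta> x)"
    using dqv_by_parts_L2[OF J \<delta>, of 1 "- h"] by (simp add: mult.commute)
  also have "\<tau>\<^sup>2 * nr (dq (- h) J) \<le> \<tau>\<^sup>2 * (4 / h\<^sup>2 * (2 * \<Lambda> * P + 2 * M\<^sup>2 * nr \<delta>))"
    using nr_dq_minus_le[OF J] P(3) h by (intro mult_left_mono order_trans[OF nr_dq_minus_le[OF J]]) auto
  \<comment> \<open>For \<open>\<tau> = h\<^sup>2 / (16 * \<Lambda>)\<close> the factor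
    \<open>8 * \<Lambda> * \<tau> / h\<^sup>2\<close> is 1/2, so the explicit error consumes only a
    quarter of the gain \<open>2 * P\<close>.\<close>
  also have "\<tau>\<^sup>2 * (4 / h\<^sup>2 * (2 * \<Lambda> * P + 2 * M\<^sup>2 * nr \<delta>)) = \<tau> * (P / 2 + M\<^sup>2 / (2 * \<Lambda>) * nr \<delta>)"
    using h \<Lambda>_pos by (simp add: \<tau>_def power2_eq_square field_simps)
  finally have "nr (\<lambda>x. S u x - S v x) \<le> nr \<delta> - 2 * \<tau> * (LINT x|lborel. J x * dq h \<delta> x) + \<tau> * (P / 2 + M\<^sup>2 / (2 * \<Lambda>) * nr \<delta>)"
    by simp
  also have "\<dots> \<le> nr \<delta> - 2 * \<tau> * (P - \<epsilon> / 4 * nr (dq h \<delta>) - M\<^sup>2 / \<epsilon> * nr \<delta>) + \<tau> * (P / 2 + M\<^sup>2 / \<epsilon> * nr \<delta>)"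
  proof -
    have "M\<^sup>2 / (2 * \<Lambda>) * nr \<delta> \<le> M\<^sup>2 / \<epsilon> * nr \<delta>"
      using eps eps_\<Lambda> \<Lambda>_pos by (intro mult_right_mono divide_left_mono) auto
    then have "\<tau> * (P / 2 + M\<^sup>2 / (2 * \<Lambda>) * nr \<delta>) \<le> \<tau> * (P / 2 + M\<^sup>2 / \<epsilon> * nr \<delta>)"
      using \<tau>_pos by (intro mult_left_mono) auto
    moreover have "2 * \<tau> * (P - \<epsilon> / 4 * nr (dq h \<delta>) - M\<^sup>2 / \<epsilon> * nr \<delta>) \<le> 2 * \<tau> * (LINT x|lborel. J x * dq h \<delta> x)"
      using \<tau>_pos P(2) by (intro mult_left_mono) auto
    ultimately show ?thesis
      using add_mono[OF diff_left_mono] by blast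
  qed
  also have "\<dots> = nr \<delta> - \<tau> * (3 / 2 * P) + \<epsilon> * \<tau> / 2 * nr (dq h \<delta>) + 3 * M\<^sup>2 / \<epsilon> * \<tau> * nr \<delta>"
    by (simp add: algebra_simps)
  also have "\<dots> \<le> nr \<delta> - \<tau> * (3 / 2 * (\<epsilon> * nr (dq h \<delta>))) + \<epsilon> * \<tau> / 2 * nr (dq h \<delta>) + 3 * M\<^sup>2 / \<epsilon> * \<tau> * nr \<delta>"
  proof -
    have "\<tau> * (3 / 2 * (\<epsilon> * nr (dq h \<delta>))) \<le> \<tau> * (3 / 2 * P)"
      using P(1) \<tau>_pos by (intro mult_left_mono) auto
    then show ?thesis by linarith
  qed
  \<comment> \<open>Of the dissipation
    \<open>3 / 2 * \<epsilon> - \<epsilon> / 2 = \<epsilon>\<close> is left, half of which is kept;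
    the rate 3 is rounded up to the 4 of \<open>K\<close>.\<close>
  also have "\<dots> \<le> nr \<delta> - \<epsilon> * \<tau> / 2 * nr (dq h \<delta>) + 4 * M\<^sup>2 / \<epsilon> * \<tau> * nr \<delta>"
  proof -
    have "0 \<le> \<epsilon> * \<tau> * nr (dq h \<delta>)" using eps \<tau>_pos by simp
    moreover have "0 \<le> M\<^sup>2 / \<epsilon> * \<tau> * nr \<delta>" using eps \<tau>_pos by simp
    moreover have "3 * M\<^sup>2 / \<epsilon> * \<tau> * nr \<delta> = 3 * (M\<^sup>2 / \<epsilon> * \<tau> * nr \<delta>)"
      "4 * M\<^sup>2 / \<epsilon> * \<tau> * nr \<delta> = 4 * (M\<^sup>2 / \<epsilon> * \<tau> * nr \<delta>)"
      "\<tau> * (3 / 2 * (\<epsilon> * nr (dq h \<delta>))) = 3 / 2 * (\<epsilon> * \<tau> * nr (dq h \<delta>))"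
      "\<epsilon> * \<tau> / 2 * nr (dq h \<delta>) = 1 / 2 * (\<epsilon> * \<tau> * nr (dq h \<delta>))" by simp_all
    ultimately show ?thesis by argo
  qed
  finally show ?thesis unfolding \<delta>_def[symmetric] by (simp add: K_def algebra_simps)
qed

lemma zero_solution: "F (\<lambda>x. 0) = (\<lambda>x. 0)" "S (\<lambda>x. 0) = (\<lambda>x. 0)" "Q (\<lambda>x. 0) = (\<lambda>x. 0)"
proof -
  show 1: "Q (\<lambda>x. 0) = (\<lambda>x. 0)" by (auto simp: Q_def dq_eq)
  then show 2: "F (\<lambda>x. 0) = (\<lambda>x. 0)" by (auto simp: F_def dq_eq)
  then show "S (\<lambda>x. 0) = (\<lambda>x. 0)" by (auto simp: S_def)
qed

text \<open>Squares factor as \<open>(a + b) * (a - b)\<close>, so the convective term is of first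
  order with coefficients at most \<open>M / 2\<close>.\<close>

lemma dq_minus_dq_bound:
  assumes u: "\<And>x. \<bar>u x\<bar> \<le> M"
  shows "\<bar>dq (- h) (\<lambda>x. ((u x)\<^sup>2 + (u (x + h))\<^sup>2) / 4) x\<bar> \<le> M / 2 * \<bar>dq h u x\<bar> + M / 2 * \<bar>dq h u (x - h)\<bar>"
proof -
  have "dq (- h) (\<lambda>x. ((u x)\<^sup>2 + (u (x + h))\<^sup>2) / 4) x
      = (u (x + h) + u x) / 4 * dq h u x + (u x + u (x - h)) / 4 * dq h u (x - h)"
    using h by (simp add: dq_minus) (simp add: dq_eq field_simps power2_eq_square)
  moreover have "\<bar>(u (x + h) + u x) / 4\<bar> \<le> M / 2" "\<bar>(u x + u (x - h)) / 4\<bar> \<le> M / 2"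
    using u[of x] u[of "x + h"] u[of "x - h"] by (auto simp: abs_le_iff)
  moreover have "\<bar>a * p + b * q\<bar> \<le> c * \<bar>p\<bar> + c * \<bar>q\<bar>" if "\<bar>a\<bar> \<le> c" "\<bar>b\<bar> \<le> c" for a b c p q :: real
    using abs_triangle_ineq[of "a * p" "b * q"] mult_right_mono[OF that(1) abs_ge_zero[of p]]
      mult_right_mono[OF that(2) abs_ge_zero[of q]] by (simp add: abs_mult)
  ultimately show ?thesis by presburger
qed

text \<open>Up to first-order convection, \<open>F u\<close> is a second quotient times a slope
  between \<open>\<epsilon>\<close> and \<open>\<Lambda>\<close>. Read one way, second quotients are
  bounded by the discrete time derivative; read the other way, the discrete time derivative of the
  datum is bounded by its second quotients.\<close>

lemma elliptic_second_order:
  assumes u: "L2R u" "\<And>x. \<bar>u x\<bar> \<le> M"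
  shows "\<epsilon>\<^sup>2 * nr (dq h (dq h u)) \<le> 2 * nr (F u) + 2 * M\<^sup>2 * nr (dq h u)"
    and "nr (F u) \<le> 2 * \<Lambda>\<^sup>2 * nr (dq h (dq h u)) + 2 * M\<^sup>2 * nr (dq h u)"
proof -
  have [measurable]: "u \<in> borel_measurable borel" "\<sigma> \<in> borel_measurable borel"
    using u borel_measurable_continuous_onI[OF continuous_\<sigma>] by auto
  define G where "G = dq (- h) (\<lambda>x. ((u x)\<^sup>2 + (u (x + h))\<^sup>2) / 4)"
  define D where "D = dq (- h) (dq h u)"
  define Z where "Z = dq (- h) (\<lambda>x. \<sigma> (dq h u x))"
  have D: "L2R D" unfolding D_def by (intro L2R_dqv u)
  have FZ: "F u x = Z x - G x" for x
    by (simp add: F_def Q_def[abs_def] dq_diff Z_def G_def)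
  have ZD: "\<epsilon>\<^sup>2 * (D x)\<^sup>2 \<le> (Z x)\<^sup>2" "(Z x)\<^sup>2 \<le> \<Lambda>\<^sup>2 * (D x)\<^sup>2" for x
  proof -
    obtain a where a: "\<epsilon> \<le> a" "a \<le> \<Lambda>" "\<sigma> (dq h u (x - h)) - \<sigma> (dq h u x) = a * (dq h u (x - h) - dq h u x)" using \<sigma>_mean_value .
    have "Z x = a * D x" using a(3) unfolding Z_def D_def by (simp add: dq_eq[of "- h"] del: divide_minus_right)
    then show "\<epsilon>\<^sup>2 * (D x)\<^sup>2 \<le> (Z x)\<^sup>2" "(Z x)\<^sup>2 \<le> \<Lambda>\<^sup>2 * (D x)\<^sup>2"
      using a eps by (auto simp: power_mult_distrib power_mono mult_right_mono)
  qed
  have G2: "(G x)\<^sup>2 \<le> M\<^sup>2 / 2 * (dq h u x)\<^sup>2 + M\<^sup>2 / 2 * (dq h u (x + (- h)))\<^sup>2" for x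
  proof -
    have "(G x)\<^sup>2 \<le> (M / 2 * \<bar>dq h u x\<bar> + M / 2 * \<bar>dq h u (x - h)\<bar>)\<^sup>2"
      using dq_minus_dq_bound[of u x, OF u(2)] M by (subst abs_le_square_iff[symmetric]) (auto simp: G_def)
    also have "\<dots> \<le> 2 * (M / 2 * \<bar>dq h u x\<bar>)\<^sup>2 + 2 * (M / 2 * \<bar>dq h u (x - h)\<bar>)\<^sup>2" by (rule power2_add_le)
    finally show ?thesis by (simp add: power_mult_distrib power_divide)
  qed
  have dqL: "L2R (dq h u)" "L2R (\<lambda>x. dq h u (x + (- h)))" "nr (\<lambda>x. dq h u (x + (- h))) = nr (dq h u)"
    using L2R_translate[OF L2R_dqv[OF u(1), of 1 h], of "- h"] L2R_dqv[OF u(1), of 1 h] by auto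
  have [measurable]: "G \<in> borel_measurable borel" "Z \<in> borel_measurable borel" unfolding G_def Z_def by measurable
  have GL: "L2R G" "nr G \<le> M\<^sup>2 * nr (dq h u)"
    using L2_le_sum[OF dqL(1,2), of G "M\<^sup>2 / 2" "M\<^sup>2 / 2"] G2 dqL(3) by auto
  have ZL: "L2R Z" using L2_le(1)[OF D, of Z "\<Lambda>\<^sup>2"] ZD by auto
  have Zu: "nr Z \<le> \<Lambda>\<^sup>2 * nr D" using L2_le(2)[OF D, of Z "\<Lambda>\<^sup>2"] ZD by auto
  have Zl: "\<epsilon>\<^sup>2 * nr D \<le> nr Z"
    unfolding nsq_def using D ZL ZD(1)
    by (subst integral_mult_right_zero[symmetric], intro integral_mono) (auto simp: L2_def)
  have ND: "nr D = nr (dq h (dq h u))"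
    unfolding D_def by (rule nr_dq_minus[OF dqL(1)])
  have FL: "L2R (F u)" by (rule L2R_F[OF u])
  have "nr Z \<le> 2 * nr (F u) + 2 * nr G" using nsq_add_le[OF FL GL(1)] by (simp add: FZ)
  then show "\<epsilon>\<^sup>2 * nr (dq h (dq h u)) \<le> 2 * nr (F u) + 2 * M\<^sup>2 * nr (dq h u)"
    using Zl GL(2) ND by simp
  have "nr (F u) \<le> 2 * nr Z + 2 * nr G" using nsq_diff_le[OF ZL GL(1)] by (simp add: FZ[abs_def])
  then show "nr (F u) \<le> 2 * \<Lambda>\<^sup>2 * nr (dq h (dq h u)) + 2 * M\<^sup>2 * nr (dq h u)"
    using Zu GL(2) ND by simp
qed

end

section \<open>Energy estimates for the iterates\<close>

lemma nsq_sum_le_sum: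
  fixes f :: "nat \<Rightarrow> 'a \<Rightarrow> real"
  assumes "\<And>i. i < n \<Longrightarrow> L2 M (f i)"
  shows "nsq M (\<lambda>x. \<Sum>i<n. f i x) \<le> real n * (\<Sum>i<n. nsq M (f i))"
proof -
  have "nsq M (\<lambda>x. \<Sum>i<n. f i x) \<le> (LINT x|M. real n * (\<Sum>i<n. (f i x)\<^sup>2))"
    unfolding nsq_def using assms L2_sum[of "{..<n}" M f]
    by (intro integral_mono sq_sum_le integrable_mult_right Bochner_Integration.integrable_sum) (auto simp: L2_def)
  also have "\<dots> = real n * (\<Sum>i<n. nsq M (f i))"
    using assms by (simp add: Bochner_Integration.integral_sum L2_def nsq_def)
  finally show ?thesis .
qed

lemma nn_integral_square_eq: "L2 M f \<Longrightarrow> (\<integral>\<^sup>+x. ennreal ((f x)\<^sup>2) \<partial>M) = ennreal (nsq M f)"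
  unfolding nsq_def by (intro nn_integral_eq_integral) (auto simp: L2_def)

context scheme
begin

lemma iterates:
  assumes u: "L2R u" "continuous_on UNIV u" "\<And>x. \<bar>u x\<bar> \<le> M"
  shows "L2R ((S ^^ n) u)" and "continuous_on UNIV ((S ^^ n) u)" and "\<bar>(S ^^ n) u x\<bar> \<le> M"
proof -
  have "L2R ((S ^^ n) u) \<and> continuous_on UNIV ((S ^^ n) u) \<and> (\<forall>x. \<bar>(S ^^ n) u x\<bar> \<le> M)"
    by (induction n) (use u in \<open>auto intro!: L2R_S continuous_S maximum_principle\<close>)
  then show "L2R ((S ^^ n) u)" "continuous_on UNIV ((S ^^ n) u)" "\<bar>(S ^^ n) u x\<bar> \<le> M" by auto
qed

lemma exp_Suc_step: "exp (K * (real (Suc n) * \<tau>)) = exp (K * \<tau>) * exp (K * (real n * \<tau>))"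
proof -
  have "K * (real (Suc n) * \<tau>) = K * \<tau> + K * (real n * \<tau>)" by (simp add: algebra_simps)
  then show ?thesis by (simp only: exp_add)
qed

text \<open>Discrete Gronwall, by \<open>1 + K * \<tau> \<le> exp (K * \<tau>)\<close>; the
  dissipation is dropped here.\<close>

lemma iterates_stability:
  assumes u: "L2R u" "continuous_on UNIV u" "\<And>x. \<bar>u x\<bar> \<le> M" and v: "L2R v" "continuous_on UNIV v" "\<And>x. \<bar>v x\<bar> \<le> M"
  shows "nr (\<lambda>x. (S ^^ n) u x - (S ^^ n) v x) \<le> exp (K * (real n * \<tau>)) * nr (\<lambda>x. u x - v x)"
proof (induction n)
  case (Suc n)
  have "0 \<le> \<epsilon> * \<tau> / 2 * nr (dq h (\<lambda>x. (S ^^ n) u x - (S ^^ n) v x))" using eps \<tau>_pos by simp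
  then have "nr (\<lambda>x. (S ^^ Suc n) u x - (S ^^ Suc n) v x) \<le> (1 + K * \<tau>) * nr (\<lambda>x. (S ^^ n) u x - (S ^^ n) v x)"
    using S_difference_energy[OF iterates(1,3)[OF u] iterates(1,3)[OF v], of n n] by simp
  also have "\<dots> \<le> exp (K * \<tau>) * (exp (K * (real n * \<tau>)) * nr (\<lambda>x. u x - v x))"
    using Suc K_nonneg \<tau>_pos exp_ge_add_one_self[of "K * \<tau>"] by (intro mult_mono) auto
  also have "\<dots> = exp (K * (real (Suc n) * \<tau>)) * nr (\<lambda>x. u x - v x)"
    by (simp only: exp_Suc_step mult.assoc)
  finally show ?case .
qed simp

text \<open>The difference of \<open>S v\<close> and \<open>v\<close> is
  \<open>\<tau> * F v\<close>; so \<open>S_difference_energy\<close> for two consecutive iterates,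
  divided by \<open>\<tau>\<^sup>2\<close>, is an estimate for the discrete time derivative. The
  dissipation is kept, because it will yield the time derivative in L^2 in time with values in
  H^1.\<close>

lemma iterates_energy:
  assumes u: "L2R u" "continuous_on UNIV u" "\<And>x. \<bar>u x\<bar> \<le> M"
  shows "nr (F ((S ^^ n) u)) + \<epsilon> * \<tau> / 2 * (\<Sum>k<n. nr (dq h (F ((S ^^ k) u)))) \<le> exp (K * (real n * \<tau>)) * nr (F u)"
proof (induction n)
  case (Suc n)
  define v w where "v = (S ^^ n) u" and "w = (S ^^ Suc n) u"
  note v = iterates[OF u, of n, folded v_def] and w = iterates[OF u, of "Suc n", folded w_def]
  have wv: "w = S v" by (simp add: v_def w_def)
  have d: "(\<lambda>x. w x - v x) = (\<lambda>x. \<tau> * F v x)" "(\<lambda>x. S w x - S v x) = (\<lambda>x. \<tau> * F w x)"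
    by (auto simp: wv S_def)
  have "dq h (\<lambda>x. \<tau> * F v x) = (\<lambda>x. \<tau> * dq h (F v) x)" by (auto simp: dq_cmult)
  then have "\<tau>\<^sup>2 * (nr (F w) + \<epsilon> * \<tau> / 2 * nr (dq h (F v))) \<le> \<tau>\<^sup>2 * ((1 + K * \<tau>) * nr (F v))"
    using S_difference_energy[OF w(1,3) v(1,3)] unfolding d by (simp add: nsq_cmult algebra_simps)
  then have "nr (F w) + \<epsilon> * \<tau> / 2 * nr (dq h (F v)) \<le> (1 + K * \<tau>) * nr (F v)" using \<tau>_pos by simp
  also have "\<dots> \<le> exp (K * \<tau>) * nr (F v)"
    using exp_ge_add_one_self[of "K * \<tau>"] by (intro mult_right_mono) auto
  finally have 1: "nr (F w) + \<epsilon> * \<tau> / 2 * nr (dq h (F v)) \<le> exp (K * \<tau>) * nr (F v)" .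
  define Z where "Z = \<epsilon> * \<tau> / 2 * (\<Sum>k<n. nr (dq h (F ((S ^^ k) u))))"
  have Z: "Z \<ge> 0" unfolding Z_def using eps \<tau>_pos by (intro mult_nonneg_nonneg sum_nonneg) auto
  have "nr (F w) + \<epsilon> * \<tau> / 2 * (\<Sum>k<Suc n. nr (dq h (F ((S ^^ k) u)))) = nr (F w) + \<epsilon> * \<tau> / 2 * nr (dq h (F v)) + Z"
    by (simp add: Z_def v_def algebra_simps)
  \<comment> \<open>The dissipation accumulated so far may be multiplied by the growth factor too,
    since this factor is at least 1.\<close>
  also have "\<dots> \<le> exp (K * \<tau>) * nr (F v) + exp (K * \<tau>) * Z"
    using 1 Z K_nonneg \<tau>_pos mult_right_mono[of 1 "exp (K * \<tau>)" Z] by simp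
  also have "\<dots> = exp (K * \<tau>) * (nr (F v) + Z)" by (simp add: algebra_simps)
  also have "\<dots> \<le> exp (K * \<tau>) * (exp (K * (real n * \<tau>)) * nr (F u))"
    using Suc by (intro mult_left_mono) (auto simp: v_def Z_def)
  also have "\<dots> = exp (K * (real (Suc n) * \<tau>)) * nr (F u)"
    by (simp only: exp_Suc_step mult.assoc)
  finally show ?case by (simp add: w_def)
qed simp

section \<open>The numerical solution in continuous time\<close>

text \<open>Solutions are extended in time as step functions. For negative \<open>t\<close> the
  conversion by \<open>nat\<close> gives step 0, so the solution equals its datum at all times
  before 0.\<close>

definition step :: "real \<Rightarrow> nat" where "step t = nat \<lfloor>t / \<tau>\<rfloor>"
definition U :: "(real \<Rightarrow> real) \<Rightarrow> real \<Rightarrow> real \<Rightarrow> real" where "U u0 t = (S ^^ step t) u0"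

lemma step_measurable [measurable]: "step \<in> measurable borel (count_space UNIV)"
  unfolding step_def[abs_def] by measurable

lemma step_le: "t \<le> T \<Longrightarrow> 0 \<le> T \<Longrightarrow> real (step t) * \<tau> \<le> T"
proof -
  assume t: "t \<le> T" "0 \<le> T"
  have "real (step t) \<le> T / \<tau>"
  proof (cases "t < 0")
    case True
    then have "t / \<tau> < 0" using \<tau>_pos by (simp add: divide_neg_pos)
    then have "step t = 0" by (simp add: step_def)
    then show ?thesis using t \<tau>_pos by simp
  next
    case False
    then have "real (step t) = of_int \<lfloor>t / \<tau>\<rfloor>" using \<tau>_pos by (simp add: step_def)
    also have "\<dots> \<le> t / \<tau>" by simp
    also have "\<dots> \<le> T / \<tau>" using t \<tau>_pos by (intro divide_right_mono) auto
    finally show ?thesis .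
  qed
  then show ?thesis using \<tau>_pos by (simp add: field_simps)
qed

lemma step_add: "0 \<le> t \<Longrightarrow> step (t + real n * \<tau>) = step t + n"
proof -
  assume t: "0 \<le> t"
  have "(t + real n * \<tau>) / \<tau> = t / \<tau> + of_int (int n)" using \<tau>_pos by (simp add: field_simps)
  then have "\<lfloor>(t + real n * \<tau>) / \<tau>\<rfloor> = \<lfloor>t / \<tau>\<rfloor> + int n" by (metis floor_add_int)
  moreover have "0 \<le> \<lfloor>t / \<tau>\<rfloor>" using t \<tau>_pos by simp
  ultimately show ?thesis by (simp add: step_def nat_add_distrib)
qed

text \<open>Rounding may add one step; this is the extra \<open>\<tau>\<close> in the time
  differences of the scheme, which disappears only in the limit.\<close>

lemma step_diff: "s \<le> t \<Longrightarrow> step s \<le> step t" "s \<le> t \<Longrightarrow> real (step t - step s) * \<tau> \<le> t - s + \<tau>"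
proof -
  assume st: "s \<le> t"
  have fl: "\<lfloor>s / \<tau>\<rfloor> \<le> \<lfloor>t / \<tau>\<rfloor>" using st \<tau>_pos by (intro floor_mono divide_right_mono) auto
  then show le: "step s \<le> step t" unfolding step_def by (rule nat_mono)
  have "real (step t - step s) \<le> real_of_int (\<lfloor>t / \<tau>\<rfloor> - \<lfloor>s / \<tau>\<rfloor>)"
    using fl by (simp add: step_def)
  also have "\<dots> \<le> t / \<tau> - s / \<tau> + 1" by linarith
  finally show "real (step t - step s) * \<tau> \<le> t - s + \<tau>" using \<tau>_pos by (simp add: field_simps)
qed

context
  fixes u0 :: "real \<Rightarrow> real"
  assumes u0: "L2R u0" "continuous_on UNIV u0" "\<And>x. \<bar>u0 x\<bar> \<le> M"
begin

lemma U_props: "L2R (U u0 t)" "continuous_on UNIV (U u0 t)" "\<bar>U u0 t x\<bar> \<le> M"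
  unfolding U_def by (rule iterates[OF u0])+

lemma U_nonpos: "t \<le> 0 \<Longrightarrow> U u0 t = u0"
proof -
  assume "t \<le> 0"
  then have "t / \<tau> \<le> 0" using \<tau>_pos by (simp add: divide_nonpos_pos)
  then have "\<lfloor>t / \<tau>\<rfloor> \<le> 0" by linarith
  then show "U u0 t = u0" by (simp add: U_def step_def)
qed

lemma U_step: "0 \<le> t \<Longrightarrow> U u0 (t + \<tau>) x = U u0 t x + \<tau> * F (U u0 t) x"
  using step_add[of t 1] by (simp add: U_def S_def)

lemma exp_step_le: "t \<le> T \<Longrightarrow> 0 \<le> T \<Longrightarrow> exp (K * (real (step t) * \<tau>)) \<le> exp (K * T)"
  using step_le[of t T] K_nonneg by (simp add: mult_left_mono)

lemma nr_U_le: "t \<le> T \<Longrightarrow> 0 \<le> T \<Longrightarrow> nr (U u0 t) \<le> exp (K * T) * nr u0"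
proof -
  assume t: "t \<le> T" "0 \<le> T"
  have S0: "(S ^^ n) (\<lambda>x. 0) = (\<lambda>x. 0)" for n by (induction n) (simp_all add: zero_solution)
  have "nr (U u0 t) \<le> exp (K * (real (step t) * \<tau>)) * nr u0"
    using iterates_stability[OF u0, of "\<lambda>x. 0" "step t"] M by (simp add: S0 U_def)
  also have "\<dots> \<le> exp (K * T) * nr u0" using exp_step_le[OF t] by (intro mult_right_mono) auto
  finally show ?thesis .
qed

text \<open>The translate of \<open>u0\<close> is an admissible datum for every shift, so
  \<open>y\<close> need not be a multiple of \<open>h\<close>.\<close>

lemma nr_dq_U_le: "t \<le> T \<Longrightarrow> 0 \<le> T \<Longrightarrow> y \<noteq> 0 \<Longrightarrow> nr (dq y (U u0 t)) \<le> exp (K * T) * nr (dq y u0)"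
proof -
  assume t: "t \<le> T" "0 \<le> T" and y: "y \<noteq> 0"
  have Str: "(S ^^ n) (\<lambda>x. u0 (x + y)) = (\<lambda>x. (S ^^ n) u0 (x + y))" for n
  proof (induction n)
    case (Suc n)
    then show ?case using S_translate[of "(S ^^ n) u0" y] by auto
  qed simp
  have v: "L2R (\<lambda>x. u0 (x + y))" "continuous_on UNIV (\<lambda>x. u0 (x + y))" "\<And>x. \<bar>u0 (x + y)\<bar> \<le> M"
    using u0 L2R_translate by (auto intro!: continuous_on_compose2[OF u0(2)] continuous_intros)
  have dqd: "nr (dq y f) = (1 / y)\<^sup>2 * nr (\<lambda>x. f (x + y) - f x)" for f :: "real \<Rightarrow> real"
    unfolding nsq_cmult[symmetric] by (simp add: dq_eq[abs_def])
  have "nr (\<lambda>x. U u0 t (x + y) - U u0 t x) \<le> exp (K * (real (step t) * \<tau>)) * nr (\<lambda>x. u0 (x + y) - u0 x)"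
    using iterates_stability[OF v u0, of "step t"] by (simp add: Str U_def)
  also have "\<dots> \<le> exp (K * T) * nr (\<lambda>x. u0 (x + y) - u0 x)" using exp_step_le[OF t] by (intro mult_right_mono) auto
  finally have "nr (\<lambda>x. U u0 t (x + y) - U u0 t x) \<le> exp (K * T) * nr (\<lambda>x. u0 (x + y) - u0 x)" .
  from mult_left_mono[OF this, of "(1 / y)\<^sup>2"] show ?thesis unfolding dqd by (simp add: mult.left_commute)
qed

lemma nr_F_U_le: "t \<le> T \<Longrightarrow> 0 \<le> T \<Longrightarrow> nr (F (U u0 t)) \<le> exp (K * T) * nr (F u0)"
proof -
  assume t: "t \<le> T" "0 \<le> T"
  have "0 \<le> \<epsilon> * \<tau> / 2 * (\<Sum>k<step t. nr (dq h (F ((S ^^ k) u0))))"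
    using eps \<tau>_pos by (intro mult_nonneg_nonneg sum_nonneg) auto
  then have "nr (F (U u0 t)) \<le> exp (K * (real (step t) * \<tau>)) * nr (F u0)"
    using iterates_energy[OF u0, of "step t"] by (simp add: U_def)
  also have "\<dots> \<le> exp (K * T) * nr (F u0)" using exp_step_le[OF t] by (intro mult_right_mono) auto
  finally show ?thesis .
qed

lemma U_telescope: "0 \<le> t \<Longrightarrow> U u0 (t + real n * \<tau>) x - U u0 t x = (\<Sum>i<n. \<tau> * F (U u0 (t + real i * \<tau>)) x)"
proof (induction n)
  case (Suc n)
  have "U u0 (t + real (Suc n) * \<tau>) x = U u0 (t + real n * \<tau>) x + \<tau> * F (U u0 (t + real n * \<tau>)) x"
    using U_step[of "t + real n * \<tau>" x] Suc.prems \<tau>_pos by (simp add: algebra_simps)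
  then show ?case using Suc by simp
qed simp

text \<open>The difference is a sum of at most \<open>(t - s) / \<tau> + 1\<close> increments
  \<open>\<tau> * F\<close>, each bounded by \<open>iterates_energy\<close>.\<close>

lemma nr_U_diff_le:
  assumes "s \<le> t" "t \<le> T" "0 \<le> T"
  shows "nr (\<lambda>x. U u0 t x - U u0 s x) \<le> (t - s + \<tau>)\<^sup>2 * (exp (K * T) * nr (F u0))"
proof -
  define n where "n = step t - step s"
  have *: "(S ^^ (step s + n)) u0 x - (S ^^ step s) u0 x = (\<Sum>i<n. \<tau> * F ((S ^^ (step s + i)) u0) x)" for x and n
    by (induction n) (simp_all add: S_def)
  have "step t = step s + n" using step_diff(1)[OF assms(1)] by (simp add: n_def)
  then have eq: "(\<lambda>x. U u0 t x - U u0 s x) = (\<lambda>x. \<Sum>i<n. \<tau> * F ((S ^^ (step s + i)) u0) x)"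
    using * by (simp add: U_def)
  have "nr (\<lambda>x. U u0 t x - U u0 s x) \<le> (real n)\<^sup>2 * (\<tau>\<^sup>2 * (exp (K * T) * nr (F u0)))"
    unfolding eq
  proof (rule nsq_sum_le)
    fix i assume "i < n"
    note it = iterates[OF u0, of "step s + i"]
    show "L2R (\<lambda>x. \<tau> * F ((S ^^ (step s + i)) u0) x)" using it by (intro L2_cmult L2R_F) auto
    have "real (step s + i) * \<tau> \<le> real (step t) * \<tau>"
      using \<open>i < n\<close> \<open>step t = step s + n\<close> \<tau>_pos by (intro mult_right_mono) auto
    also have "\<dots> \<le> T" by (rule step_le) (use assms in auto)
    finally have "K * (real (step s + i) * \<tau>) \<le> K * T" using K_nonneg by (rule mult_left_mono)
    then have e: "exp (K * (real (step s + i) * \<tau>)) \<le> exp (K * T)" by simp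
    have "0 \<le> \<epsilon> * \<tau> / 2 * (\<Sum>k<step s + i. nr (dq h (F ((S ^^ k) u0))))"
      using eps \<tau>_pos by (intro mult_nonneg_nonneg sum_nonneg) auto
    then have "nr (F ((S ^^ (step s + i)) u0)) \<le> exp (K * (real (step s + i) * \<tau>)) * nr (F u0)"
      using iterates_energy[OF u0, of "step s + i"] by linarith
    also have "\<dots> \<le> exp (K * T) * nr (F u0)" using e by (intro mult_right_mono) auto
    finally show "nr (\<lambda>x. \<tau> * F ((S ^^ (step s + i)) u0) x) \<le> \<tau>\<^sup>2 * (exp (K * T) * nr (F u0))"
      unfolding nsq_cmult by (intro mult_left_mono) auto
  qed
  also have "\<dots> = (real n * \<tau>)\<^sup>2 * (exp (K * T) * nr (F u0))" by (simp add: power_mult_distrib)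
  also have "\<dots> \<le> (t - s + \<tau>)\<^sup>2 * (exp (K * T) * nr (F u0))"
    using step_diff(2)[OF assms(1)] \<tau>_pos by (intro mult_right_mono power_mono) (auto simp: n_def)
  finally show ?thesis .
qed

lemma dissipation_time_integral:
  assumes "0 \<le> T"
  shows "(\<integral>\<^sup>+t. indicator {0..<T} t * ennreal (nr (dq h (F (U u0 t)))) \<partial>lborel) \<le> ennreal (2 / \<epsilon> * (exp (K * (T + \<tau>)) * nr (F u0)))"
proof -
  define c where "c n = nr (dq h (F ((S ^^ n) u0)))" for n
  \<comment> \<open>Rounded up so that the steps cover \<open>{0..<T}\<close>; the overshoot of at
    most one step is the \<open>T + \<tau>\<close> in the bound.\<close>
  define N where "N = nat \<lceil>T / \<tau>\<rceil>"
  have c0: "c n \<ge> 0" for n by (simp add: c_def)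
  have NT: "T \<le> real N * \<tau>" "real N * \<tau> \<le> T + \<tau>"
  proof -
    have "real N = of_int \<lceil>T / \<tau>\<rceil>" using assms \<tau>_pos by (simp add: N_def)
    then have "T / \<tau> \<le> real N" "real N \<le> T / \<tau> + 1" by linarith+
    then show "T \<le> real N * \<tau>" "real N * \<tau> \<le> T + \<tau>" using \<tau>_pos by (auto simp: field_simps)
  qed
  have "(\<integral>\<^sup>+t. indicator {0..<T} t * ennreal (nr (dq h (F (U u0 t)))) \<partial>lborel)
      \<le> (\<integral>\<^sup>+t. (\<Sum>n<N. ennreal (c n) * indicator {real n * \<tau>..real (Suc n) * \<tau>} t) \<partial>lborel)"
  proof (rule nn_integral_mono)
    fix t :: real
    show "indicator {0..<T} t * ennreal (nr (dq h (F (U u0 t)))) \<le> (\<Sum>n<N. ennreal (c n) * indicator {real n * \<tau>..real (Suc n) * \<tau>} t)"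
    proof (cases "t \<in> {0..<T}")
      case True
      define n where "n = step t"
      have rn: "real n = of_int \<lfloor>t / \<tau>\<rfloor>" using True \<tau>_pos by (simp add: n_def step_def)
      then have "real n \<le> t / \<tau>" "t / \<tau> \<le> real (Suc n)" by linarith+
      then have t1: "real n * \<tau> \<le> t" "t \<le> real (Suc n) * \<tau>" using \<tau>_pos by (auto simp: field_simps)
      have "real n * \<tau> < real N * \<tau>" using t1 True NT by simp
      then have "n < N" using \<tau>_pos by simp
      then have "ennreal (c n) * indicator {real n * \<tau>..real (Suc n) * \<tau>} t \<le> (\<Sum>n<N. ennreal (c n) * indicator {real n * \<tau>..real (Suc n) * \<tau>} t)"
        by (intro member_le_sum) auto
      then show ?thesis using True t1 by (simp add: c_def n_def U_def)
    qed auto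
  qed
  also have "\<dots> = (\<Sum>n<N. ennreal (c n) * ennreal \<tau>)"
    using \<tau>_pos by (subst nn_integral_sum) (auto simp: nn_integral_cmult_indicator algebra_simps)
  also have "\<dots> = ennreal (\<tau> * (\<Sum>n<N. c n))"
    using c0 \<tau>_pos by (simp add: ennreal_mult[symmetric] sum_ennreal sum_distrib_left mult.commute)
  also have "\<dots> \<le> ennreal (2 / \<epsilon> * (exp (K * (T + \<tau>)) * nr (F u0)))"
  proof (rule ennreal_leI)
    have "\<epsilon> * \<tau> / 2 * (\<Sum>n<N. c n) \<le> exp (K * (real N * \<tau>)) * nr (F u0)"
      using iterates_energy[OF u0, of N] nsq_nonneg[of lborel "F ((S ^^ N) u0)"] unfolding c_def by linarith
    also have "\<dots> \<le> exp (K * (T + \<tau>)) * nr (F u0)"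
      using NT K_nonneg by (intro mult_right_mono) (auto intro: mult_left_mono)
    finally show "\<tau> * (\<Sum>n<N. c n) \<le> 2 / \<epsilon> * (exp (K * (T + \<tau>)) * nr (F u0))"
      using eps by (simp add: field_simps)
  qed
  finally show ?thesis .
qed

text \<open>The quotient over \<open>n\<close> time steps is the mean of \<open>F\<close> at
  \<open>n\<close> successive steps, and the space quotient with step \<open>j * h\<close> is a mean
  of those with step \<open>h\<close>. Convexity bounds both means, at the price of a time window
  longer by \<open>n * \<tau>\<close>. So the dissipation controls mixed quotients at a fixed scale
  while \<open>h\<close> and \<open>\<tau>\<close> tend to 0.\<close>

lemma time_quotient_dissipation:
  assumes "0 \<le> T" "0 < n" "0 < j"
  shows "(\<integral>\<^sup>+t. indicator {0..<T} t * ennreal (nr (dq (real j * h) (\<lambda>x. (U u0 (t + real n * \<tau>) x - U u0 t x) / (real n * \<tau>)))) \<partial>lborel)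
     \<le> ennreal (2 / \<epsilon> * (exp (K * (T + real n * \<tau> + \<tau>)) * nr (F u0)))"
proof -
  define c where "c t = nr (dq h (F (U u0 t)))" for t
  define I where "I = ennreal (2 / \<epsilon> * (exp (K * (T + real n * \<tau> + \<tau>)) * nr (F u0)))"
  have [measurable]: "c \<in> borel_measurable borel"
    unfolding c_def[abs_def] U_def by (rule measurable_compose[OF step_measurable]) simp
  have LF: "L2R (F (U u0 t))" for t by (rule L2R_F[OF U_props(1,3)])
  have bd: "nr (dq (real j * h) (\<lambda>x. (U u0 (t + real n * \<tau>) x - U u0 t x) / (real n * \<tau>))) \<le> (1 / real n) * (\<Sum>i<n. c (t + real i * \<tau>))"
    if "t \<ge> 0" for t
  proof -
    have "dq (real j * h) (\<lambda>x. (U u0 (t + real n * \<tau>) x - U u0 t x) / (real n * \<tau>)) x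
        = (1 / real n) * (\<Sum>i<n. dq (real j * h) (F (U u0 (t + real i * \<tau>))) x)" for x
      using \<tau>_pos unfolding U_telescope[OF that] dq_eq
      by (simp add: sum_distrib_left[symmetric] sum_subtractf[symmetric] sum_divide_distrib[symmetric] diff_divide_distrib[symmetric])
    then have "nr (dq (real j * h) (\<lambda>x. (U u0 (t + real n * \<tau>) x - U u0 t x) / (real n * \<tau>)))
        = (1 / real n)\<^sup>2 * nr (\<lambda>x. \<Sum>i<n. dq (real j * h) (F (U u0 (t + real i * \<tau>))) x)"
      unfolding nsq_cmult[symmetric] by presburger
    also have "\<dots> \<le> (1 / real n)\<^sup>2 * (real n * (\<Sum>i<n. nr (dq (real j * h) (F (U u0 (t + real i * \<tau>))))))"
      using L2R_dqv[OF LF] by (intro mult_left_mono nsq_sum_le_sum) auto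
    also have "\<dots> = (1 / real n) * (\<Sum>i<n. nr (dq (real j * h) (F (U u0 (t + real i * \<tau>)))))"
      using \<open>0 < n\<close> by (simp add: power2_eq_square)
    also have "\<dots> \<le> (1 / real n) * (\<Sum>i<n. c (t + real i * \<tau>))"
      unfolding c_def using h \<open>0 < j\<close> by (intro mult_left_mono sum_mono nr_dq_multiple_le LF) auto
    finally show ?thesis .
  qed
  have "(\<integral>\<^sup>+t. indicator {0..<T} t * ennreal (nr (dq (real j * h) (\<lambda>x. (U u0 (t + real n * \<tau>) x - U u0 t x) / (real n * \<tau>)))) \<partial>lborel)
     \<le> (\<integral>\<^sup>+t. (\<Sum>i<n. ennreal (1 / real n) * (indicator {0..<T} t * ennreal (c (t + real i * \<tau>)))) \<partial>lborel)"
  proof (rule nn_integral_mono)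
    fix t :: real
    show "indicator {0..<T} t * ennreal (nr (dq (real j * h) (\<lambda>x. (U u0 (t + real n * \<tau>) x - U u0 t x) / (real n * \<tau>))))
      \<le> (\<Sum>i<n. ennreal (1 / real n) * (indicator {0..<T} t * ennreal (c (t + real i * \<tau>))))"
    proof (cases "t \<in> {0..<T}")
      case True
      have "ennreal (nr (dq (real j * h) (\<lambda>x. (U u0 (t + real n * \<tau>) x - U u0 t x) / (real n * \<tau>))))
         \<le> ennreal (\<Sum>i<n. (1 / real n) * c (t + real i * \<tau>))"
        using bd[of t] True by (intro ennreal_leI) (simp add: sum_distrib_left)
      also have "\<dots> = (\<Sum>i<n. ennreal (1 / real n) * ennreal (c (t + real i * \<tau>)))"
        by (subst sum_ennreal[symmetric]) (auto simp: c_def ennreal_mult[symmetric])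
      finally show ?thesis using True by simp
    qed auto
  qed
  also have "\<dots> = (\<Sum>i<n. ennreal (1 / real n) * (\<integral>\<^sup>+t. indicator {0..<T} t * ennreal (c (t + real i * \<tau>)) \<partial>lborel))"
    by (subst nn_integral_sum) (auto simp: nn_integral_cmult)
  also have "\<dots> \<le> (\<Sum>i<n. ennreal (1 / real n) * I)"
  proof (intro sum_mono mult_left_mono)
    fix i assume "i \<in> {..<n}"
    have "(\<integral>\<^sup>+t. indicator {0..<T} t * ennreal (c (t + real i * \<tau>)) \<partial>lborel)
        = (\<integral>\<^sup>+t. indicator {0..<T} (t - real i * \<tau>) * ennreal (c t) \<partial>lborel)"
      using nn_integral_real_affine[of "\<lambda>t. indicator {0..<T} (t - real i * \<tau>) * ennreal (c t)" 1 "real i * \<tau>"]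
      by (simp add: add.commute)
    also have "\<dots> \<le> (\<integral>\<^sup>+t. indicator {0..<T + real n * \<tau>} t * ennreal (nr (dq h (F (U u0 t)))) \<partial>lborel)"
    proof (intro nn_integral_mono)
      fix t :: real
      have "0 \<le> real i * \<tau>" "real i * \<tau> \<le> real n * \<tau>" using \<tau>_pos \<open>i \<in> {..<n}\<close> by (auto intro: mult_right_mono)
      then show "indicator {0..<T} (t - real i * \<tau>) * ennreal (c t) \<le> indicator {0..<T + real n * \<tau>} t * ennreal (nr (dq h (F (U u0 t))))"
        by (auto simp: indicator_def c_def)
    qed
    also have "\<dots> \<le> I"
      unfolding I_def using dissipation_time_integral[of "T + real n * \<tau>"] assms(1) \<tau>_pos by simp
    finally show "(\<integral>\<^sup>+t. indicator {0..<T} t * ennreal (c (t + real i * \<tau>)) \<partial>lborel) \<le> I" .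
  qed auto
  also have "\<dots> = I"
    using \<open>0 < n\<close> by (simp add: I_def ennreal_of_nat_eq_real_of_nat ennreal_mult[symmetric] mult.assoc[symmetric])
  finally show ?thesis by (simp add: I_def)
qed

end

end

section \<open>The limit of the scheme\<close>

text \<open>Arzela-Ascoli for functions that may jump: the numerical solutions are step functions in
  time, so they are equicontinuous only up to an error that becomes small for large
  \<open>m\<close>. Diagonal selection on a countable dense set gives a subsequence whose Cauchy
  property spreads to every point.\<close>

lemma pointwise_compactness:
  fixes f :: "nat \<Rightarrow> 'a::euclidean_space \<Rightarrow> real"
  assumes bd: "\<And>m z. \<bar>f m z\<bar> \<le> M"
    and eq: "\<And>z e. e > 0 \<Longrightarrow> \<exists>d>0. \<exists>m0. \<forall>m\<ge>m0. \<forall>z'. dist z z' < d \<longrightarrow> \<bar>f m z - f m z'\<bar> < e"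
  obtains r u where "strict_mono (r :: nat \<Rightarrow> nat)" "\<And>z. (\<lambda>i. f (r i) z) \<longlonglongrightarrow> u z" "continuous_on UNIV u"
proof -
  obtain D :: "'a set" where D: "countable D" "\<And>X. open X \<Longrightarrow> X \<noteq> {} \<Longrightarrow> \<exists>d\<in>D. d \<in> X"
    using countable_dense_setE by blast
  have nb: "norm (f m z) \<le> M" for m z using bd by simp
  obtain r where r: "strict_mono (r :: nat \<Rightarrow> nat)" and lim: "\<And>z. z \<in> D \<Longrightarrow> \<exists>l. (\<lambda>n. f (r n) z) \<longlonglongrightarrow> l"
    using function_convergent_subsequence[of D f M, OF D(1) nb] by blast
  have "Cauchy (\<lambda>i. f (r i) z)" for z
  proof (rule metric_CauchyI)
    fix e :: real assume "e > 0"
    obtain d m0 where d: "d > 0" "\<And>m z'. m \<ge> m0 \<Longrightarrow> dist z z' < d \<Longrightarrow> \<bar>f m z - f m z'\<bar> < e / 3"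
      using eq[of "e / 3" z] \<open>e > 0\<close> by auto
    obtain z' where z': "z' \<in> D" "dist z z' < d" using D(2)[of "ball z d"] d(1) by auto
    have "Cauchy (\<lambda>i. f (r i) z')" using lim[OF z'(1)] convergent_Cauchy convergentI by blast
    then obtain i0 where i0: "\<And>i j. i \<ge> i0 \<Longrightarrow> j \<ge> i0 \<Longrightarrow> dist (f (r i) z') (f (r j) z') < e / 3"
      using metric_CauchyD[of "\<lambda>i. f (r i) z'" "e / 3"] \<open>e > 0\<close> by auto
    have "dist (f (r i) z) (f (r j) z) < e" if "i \<ge> max i0 m0" "j \<ge> max i0 m0" for i j
    proof -
      have "r i \<ge> m0" "r j \<ge> m0" using that seq_suble[OF r, of i] seq_suble[OF r, of j] by auto
      then have "\<bar>f (r i) z - f (r i) z'\<bar> < e / 3" "\<bar>f (r j) z - f (r j) z'\<bar> < e / 3" using d(2) z'(2) by auto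
      moreover have "\<bar>f (r i) z' - f (r j) z'\<bar> < e / 3" using i0[of i j] that by (simp add: dist_real_def)
      ultimately show ?thesis unfolding dist_real_def by linarith
    qed
    then show "\<exists>k. \<forall>i\<ge>k. \<forall>j\<ge>k. dist (f (r i) z) (f (r j) z) < e" by blast
  qed
  then obtain u where u: "\<And>z. (\<lambda>i. f (r i) z) \<longlonglongrightarrow> u z"
    unfolding Cauchy_convergent_iff convergent_def by metis
  have "continuous_on UNIV u"
  proof (rule continuous_at_imp_continuous_on, rule ballI)
    fix z
    show "isCont u z"
      unfolding continuous_at_eps_delta
    proof (intro allI impI)
      fix e :: real assume "e > 0"
      obtain d m0 where d: "d > 0" "\<And>m z'. m \<ge> m0 \<Longrightarrow> dist z z' < d \<Longrightarrow> \<bar>f m z - f m z'\<bar> < e / 2"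
        using eq[of "e / 2" z] \<open>e > 0\<close> by auto
      have "dist (u z') (u z) < e" if "dist z' z < d" for z'
      proof -
        have "(\<lambda>i. \<bar>f (r i) z - f (r i) z'\<bar>) \<longlonglongrightarrow> \<bar>u z - u z'\<bar>" by (intro tendsto_intros u)
        moreover have "\<forall>i\<ge>m0. \<bar>f (r i) z - f (r i) z'\<bar> \<le> e / 2"
          using d(2)[of "r i" z' for i] that seq_suble[OF r] by (auto simp: dist_commute intro!: less_imp_le dest: le_trans)
        ultimately have "\<bar>u z - u z'\<bar> \<le> e / 2" by (intro LIMSEQ_le_const2) auto
        then show ?thesis using \<open>e > 0\<close> by (simp add: dist_real_def abs_minus_commute)
      qed
      then show "\<exists>d>0. \<forall>z'. dist z' z < d \<longrightarrow> dist (u z') (u z) < e" using d(1) by blast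
    qed
  qed
  then show ?thesis using that r u by blast
qed

lemma fst_snd_borel [measurable]:
  "(fst :: real \<times> real \<Rightarrow> real) \<in> borel_measurable borel" "(snd :: real \<times> real \<Rightarrow> real) \<in> borel_measurable borel"
  by (intro borel_measurable_continuous_onI continuous_intros)+

section \<open>Step sizes and uniform bounds\<close>

locale viscoplastic =
  fixes \<epsilon> M A :: real and u0 :: "real \<Rightarrow> real"
  assumes eps: "0 < \<epsilon>" "\<epsilon> < 1" and M: "0 \<le> M" and A: "0 \<le> A"
    and u0: "L2R u0" "continuous_on UNIV u0" "\<And>x. \<bar>u0 x\<bar> \<le> M"
    and dq_u0: "\<And>y. 0 < y \<Longrightarrow> nr (dq y u0) \<le> A" "\<And>y. 0 < y \<Longrightarrow> nr (dq y (dq y u0)) \<le> A"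
begin

text \<open>The factor \<open>\<epsilon> / (M + 1)\<close> enforces the mesh condition and
  \<open>hs m \<le> 1\<close>; the powers of 2 make each step an integer multiple of all later
  ones.\<close>

definition hs :: "nat \<Rightarrow> real" where "hs m = \<epsilon> / (M + 1) / 2 ^ m"

lemma hs_pos: "hs m > 0"
  using eps M by (simp add: hs_def)

lemma hs_le: "hs m \<le> \<epsilon> / (M + 1)" "hs m \<le> 1"
proof -
  have "(1::real) \<le> 2 ^ m" by simp
  then have "\<epsilon> / (M + 1) / 2 ^ m \<le> \<epsilon> / (M + 1) / 1" using eps M by (intro divide_left_mono) auto
  then show "hs m \<le> \<epsilon> / (M + 1)" by (simp add: hs_def)
  also have "\<dots> \<le> 1" using eps M by (simp add: divide_le_eq_1)
  finally show "hs m \<le> 1" .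
qed

lemma hs_tendsto: "hs \<longlonglongrightarrow> 0"
proof -
  have "(\<lambda>m. \<epsilon> / (M + 1) * (1 / 2) ^ m) \<longlonglongrightarrow> \<epsilon> / (M + 1) * 0"
    by (intro tendsto_intros LIMSEQ_realpow_zero) auto
  then show ?thesis by (simp add: hs_def[abs_def] power_divide)
qed

lemma hs_multiple: "k \<le> m \<Longrightarrow> hs k = real (2 ^ (m - k)) * hs m"
  by (auto simp: hs_def power_add dest: le_Suc_ex)

sublocale sc: scheme \<epsilon> "hs m" M for m
proof
  have "hs m * M \<le> \<epsilon> / (M + 1) * M" using hs_le(1) M by (rule mult_right_mono)
  also have "\<dots> \<le> 2 * \<epsilon>" using eps M by (simp add: field_simps)
  finally show "hs m * M \<le> 2 * \<epsilon>" .
qed (use eps M hs_pos in auto)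

abbreviation "\<Lambda> \<equiv> \<epsilon> + 1 / \<epsilon>"
definition "\<kappa> = 4 * M\<^sup>2 / \<epsilon>"
definition \<tau>s :: "nat \<Rightarrow> real" where "\<tau>s m = (hs m)\<^sup>2 / (16 * \<Lambda>)"
definition "V m = sc.U m u0"
definition "W0 = 2 * \<Lambda>\<^sup>2 * A + 2 * M\<^sup>2 * A"
text \<open>One summand for each estimate: the solution, its first quotients, the discrete time
  derivative (bounded for the datum by \<open>W0\<close>), the second quotients and the dissipation.
  A single \<open>B T\<close> then serves all of them.\<close>

definition "B0 = nr u0 + A + W0 + (2 * W0 + 2 * M\<^sup>2 * A) / \<epsilon>\<^sup>2 + 2 / \<epsilon> * W0"
text \<open>The 2 in the exponent leaves room for two time increments of size at most 1: the step of
  a time quotient, and the rounding of the scheme.\<close>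

definition "B T = exp (\<kappa> * (T + 2)) * B0"

lemma \<kappa>_nonneg: "\<kappa> \<ge> 0" using eps by (simp add: \<kappa>_def)

lemma sc_consts: "sc.K = \<kappa>" "sc.\<Lambda> = \<Lambda>" "sc.\<tau> m = \<tau>s m"
  unfolding sc.K_def \<kappa>_def sc.\<Lambda>_def sc.\<tau>_def \<tau>s_def by simp_all

lemma \<tau>s_pos: "\<tau>s m > 0" using sc.\<tau>_pos[of m] by (simp add: sc_consts)

lemma \<tau>s_le_1: "\<tau>s m \<le> 1"
proof -
  have "(hs m)\<^sup>2 \<le> 1" using hs_le(2)[of m] hs_pos[of m] by (simp add: power_le_one)
  moreover have "1 \<le> 16 * \<Lambda>"
  proof -
    have "1 \<le> 1 / \<epsilon>" using eps by simp
    then show ?thesis using eps by argo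
  qed
  ultimately show ?thesis unfolding \<tau>s_def by (simp add: divide_le_eq_1)
qed

lemma \<tau>s_tendsto: "\<tau>s \<longlonglongrightarrow> 0"
proof -
  have "(\<lambda>m. (hs m)\<^sup>2 / (16 * \<Lambda>)) \<longlonglongrightarrow> 0\<^sup>2 / (16 * \<Lambda>)"
    using eps sc.\<Lambda>_pos by (intro tendsto_intros hs_tendsto) (auto simp: sc_consts)
  then show ?thesis by (simp add: \<tau>s_def[abs_def])
qed

lemma \<tau>s_multiple: "k \<le> m \<Longrightarrow> \<tau>s k = real (4 ^ (m - k)) * \<tau>s m"
  using hs_multiple[of k m] by (simp add: \<tau>s_def power_mult_distrib power_mult[symmetric] power2_eq_square mult.assoc)
    (simp add: power_mult_distrib[symmetric] mult.assoc[symmetric])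

lemma W0_nonneg: "0 \<le> W0" using A eps by (simp add: W0_def)

lemma nr_F_u0: "nr (sc.F m u0) \<le> W0"
proof -
  have "nr (sc.F m u0) \<le> 2 * \<Lambda>\<^sup>2 * nr (dq (hs m) (dq (hs m) u0)) + 2 * M\<^sup>2 * nr (dq (hs m) u0)"
    using sc.elliptic_second_order(2)[OF u0(1,3)] by (simp add: sc_consts)
  also have "\<dots> \<le> W0"
    unfolding W0_def using dq_u0[OF hs_pos[of m]] by (intro add_mono mult_left_mono) auto
  finally show ?thesis .
qed

lemma B_ge:
  assumes "S \<le> T + 2" "c \<le> B0" "0 \<le> c" shows "exp (\<kappa> * S) * c \<le> B T"
  unfolding B_def using assms \<kappa>_nonneg by (intro mult_mono) (auto intro: mult_left_mono)

lemma B0_ge: "nr u0 \<le> B0" "A \<le> B0" "W0 \<le> B0" "(2 * W0 + 2 * M\<^sup>2 * A) / \<epsilon>\<^sup>2 \<le> B0" "2 / \<epsilon> * W0 \<le> B0" "0 \<le> B0"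
proof -
  have "0 \<le> 2 / \<epsilon> * W0" "0 \<le> (2 * W0 + 2 * M\<^sup>2 * A) / \<epsilon>\<^sup>2"
    using W0_nonneg A eps by auto
  then show "nr u0 \<le> B0" "A \<le> B0" "W0 \<le> B0" "(2 * W0 + 2 * M\<^sup>2 * A) / \<epsilon>\<^sup>2 \<le> B0" "2 / \<epsilon> * W0 \<le> B0" "0 \<le> B0"
    unfolding B0_def using W0_nonneg A nsq_nonneg[of lborel u0] by linarith+
qed

lemma B_nonneg: "0 \<le> B T" using B0_ge(6) by (simp add: B_def)

lemma V_props: "L2R (V m t)" "continuous_on UNIV (V m t)" "\<bar>V m t x\<bar> \<le> M"
  unfolding V_def by (rule sc.U_props[OF u0])+

lemma V_nonpos: "t \<le> 0 \<Longrightarrow> V m t = u0"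
  unfolding V_def by (rule sc.U_nonpos[OF u0])

lemma V_initial: "t < \<tau>s m \<Longrightarrow> V m t = u0"
proof -
  assume "t < \<tau>s m"
  then have "t / sc.\<tau> m < 1" using \<tau>s_pos[of m] by (simp add: sc_consts)
  then have "\<lfloor>t / sc.\<tau> m\<rfloor> \<le> 0" by linarith
  then show "V m t = u0" by (simp add: V_def sc.U_def sc.step_def)
qed

lemma V_bounds:
  assumes t: "t \<le> T" "0 \<le> T"
  shows "nr (V m t) \<le> B T" and "0 < y \<Longrightarrow> nr (dq y (V m t)) \<le> B T"
    and "nr (dq (hs m) (dq (hs m) (V m t))) \<le> B T"
proof -
  have "nr (V m t) \<le> exp (\<kappa> * T) * nr u0"
    unfolding V_def sc_consts(1)[symmetric] by (rule sc.nr_U_le[OF u0 t])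
  also have "\<dots> \<le> B T" by (rule B_ge) (use B0_ge in auto)
  finally show "nr (V m t) \<le> B T" .
  have dq: "nr (dq y (V m t)) \<le> exp (\<kappa> * T) * A" if "0 < y" for y
  proof -
    have "nr (dq y (V m t)) \<le> exp (\<kappa> * T) * nr (dq y u0)"
      unfolding V_def sc_consts(1)[symmetric] by (rule sc.nr_dq_U_le[OF u0 t]) (use that in auto)
    also have "\<dots> \<le> exp (\<kappa> * T) * A" using dq_u0(1)[OF that] by (intro mult_left_mono) auto
    finally show ?thesis .
  qed
  show "nr (dq y (V m t)) \<le> B T" if "0 < y"
    using dq[OF that] B_ge[of T T A] B0_ge A by linarith
  have "nr (sc.F m (V m t)) \<le> exp (\<kappa> * T) * nr (sc.F m u0)"
    unfolding V_def sc_consts(1)[symmetric] by (rule sc.nr_F_U_le[OF u0 t])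
  also have "\<dots> \<le> exp (\<kappa> * T) * W0" using nr_F_u0 by (intro mult_left_mono) auto
  finally have F: "nr (sc.F m (V m t)) \<le> exp (\<kappa> * T) * W0" .
  have "\<epsilon>\<^sup>2 * nr (dq (hs m) (dq (hs m) (V m t))) \<le> 2 * nr (sc.F m (V m t)) + 2 * M\<^sup>2 * nr (dq (hs m) (V m t))"
    by (rule sc.elliptic_second_order(1)[OF V_props(1,3)])
  also have "\<dots> \<le> 2 * (exp (\<kappa> * T) * W0) + 2 * M\<^sup>2 * (exp (\<kappa> * T) * A)"
    using F dq[OF hs_pos[of m]] by (intro add_mono mult_left_mono) auto
  finally have "nr (dq (hs m) (dq (hs m) (V m t))) \<le> exp (\<kappa> * T) * ((2 * W0 + 2 * M\<^sup>2 * A) / \<epsilon>\<^sup>2)"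
    using eps by (simp add: field_simps)
  also have "\<dots> \<le> B T" by (rule B_ge) (use B0_ge W0_nonneg A in auto)
  finally show "nr (dq (hs m) (dq (hs m) (V m t))) \<le> B T" .
qed

lemma V_time_diff:
  assumes "s \<le> t" "t \<le> T" "0 \<le> T"
  shows "nr (\<lambda>x. V m t x - V m s x) \<le> (t - s + \<tau>s m)\<^sup>2 * B T"
proof -
  have "nr (\<lambda>x. V m t x - V m s x) \<le> (t - s + \<tau>s m)\<^sup>2 * (exp (\<kappa> * T) * nr (sc.F m u0))"
    unfolding V_def sc_consts[symmetric] by (rule sc.nr_U_diff_le[OF u0 assms])
  also have "\<dots> \<le> (t - s + \<tau>s m)\<^sup>2 * B T"
    by (intro mult_left_mono B_ge) (use nr_F_u0[of m] B0_ge(3) in auto)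
  finally show ?thesis .
qed

lemma V_Holder_space:
  assumes "t \<le> T" "0 \<le> T" shows "(V m t b - V m t a)\<^sup>2 \<le> B T * \<bar>b - a\<bar>"
  by (rule Holder_of_dq_bound[OF V_props(1,2) hs_pos hs_tendsto]) (rule V_bounds(2)[OF assms hs_pos])

text \<open>Interpolation between the Lipschitz bound in time with values in L^2 and the Hoelder
  bound in space.\<close>

lemma V_Holder_time:
  assumes "s \<le> t" "t \<le> T" "0 \<le> T" shows "(V m t x - V m s x)\<^sup>2 \<le> 10 * B T * (t - s + \<tau>s m)"
proof -
  \<comment> \<open>This averaging length balances the two terms of
    \<open>sup_bound_of_L2_Holder\<close>, which become \<open>2 * B T * y\<close> and
    \<open>8 * B T * y\<close>.\<close>
  define y where "y = t - s + \<tau>s m"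
  have y: "y > 0" using assms(1) \<tau>s_pos[of m] by (simp add: y_def)
  have st: "s \<le> T" using assms by simp
  have "((V m t b - V m s b) - (V m t a - V m s a))\<^sup>2 \<le> (4 * B T) * \<bar>b - a\<bar>" for a b
  proof -
    have "((V m t b - V m s b) - (V m t a - V m s a))\<^sup>2 = ((V m t b - V m t a) - (V m s b - V m s a))\<^sup>2"
      by (simp add: algebra_simps)
    also have "\<dots> \<le> 2 * (V m t b - V m t a)\<^sup>2 + 2 * (V m s b - V m s a)\<^sup>2" by (rule power2_diff_le)
    also have "\<dots> \<le> 2 * (B T * \<bar>b - a\<bar>) + 2 * (B T * \<bar>b - a\<bar>)"
      using V_Holder_space[OF assms(2,3), of m b a] V_Holder_space[OF st assms(3), of m b a] by linarith
    finally show ?thesis by (simp add: mult_ac)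
  qed
  from sup_bound_of_L2_Holder[OF L2_diff[OF V_props(1) V_props(1)] this y, of x]
  have "(V m t x - V m s x)\<^sup>2 \<le> 2 * nr (\<lambda>x. V m t x - V m s x) / y + 2 * (4 * B T) * y" .
  also have "\<dots> \<le> 2 * (y\<^sup>2 * B T) / y + 2 * (4 * B T) * y"
    using V_time_diff[OF assms, of m] y by (intro add_right_mono divide_right_mono) (auto simp: y_def)
  also have "\<dots> = 10 * B T * y" using y by (simp add: power2_eq_square)
  finally show ?thesis by (simp add: y_def)
qed

lemma V_equicontinuous:
  assumes "t \<le> T" "s \<le> T" "0 \<le> T"
  shows "(V m t x - V m s x')\<^sup>2 \<le> 20 * B T * (\<bar>t - s\<bar> + \<tau>s m + \<bar>x - x'\<bar>)"
proof -
  have "(V m t x - V m s x)\<^sup>2 \<le> 10 * B T * (\<bar>t - s\<bar> + \<tau>s m)"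
    using V_Holder_time[of s t T m x] V_Holder_time[of t s T m x] assms
    by (cases "s \<le> t") (auto simp: power2_commute)
  moreover have "(V m s x - V m s x')\<^sup>2 \<le> B T * \<bar>x - x'\<bar>" by (rule V_Holder_space[OF assms(2,3)])
  moreover have "(V m t x - V m s x')\<^sup>2 \<le> 2 * (V m t x - V m s x)\<^sup>2 + 2 * (V m s x - V m s x')\<^sup>2"
    using power2_add_le[of "V m t x - V m s x" "V m s x - V m s x'"] by simp
  moreover have "0 \<le> B T * \<bar>x - x'\<bar>" using B_nonneg by simp
  ultimately show ?thesis by (simp add: algebra_simps)
qed

text \<open>Time enters only through the countably many values of the step counter, and each iterate
  is continuous in space.\<close>

lemma V_measurable [measurable]: "(\<lambda>z. V m (fst z) (snd z)) \<in> borel_measurable borel"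
proof -
  have [measurable]: "(sc.S m ^^ n) u0 \<in> borel_measurable borel" for n
    by (rule borel_measurable_continuous_onI[OF sc.iterates(2)[OF u0]])
  have "(\<lambda>z. (sc.S m ^^ sc.step m (fst z)) u0 (snd z)) \<in> borel_measurable (borel :: (real \<times> real) measure)"
    by (rule measurable_compose_countable[where f="\<lambda>n z. (sc.S m ^^ n) u0 (snd z)" and g="\<lambda>z. sc.step m (fst z)"])
      (auto intro!: measurable_compose[OF _ sc.step_measurable] measurable_compose[of snd borel borel])
  then show ?thesis by (simp add: V_def sc.U_def)
qed

lemma limit_exists:
  obtains r u where "strict_mono (r :: nat \<Rightarrow> nat)" "\<And>t x. (\<lambda>i. V (r i) t x) \<longlonglongrightarrow> u t x"
    "continuous_on UNIV (\<lambda>(t, x). u t x)"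
proof -
  have eq: "\<exists>d>0. \<exists>m0. \<forall>m\<ge>m0. \<forall>z'. dist z z' < d \<longrightarrow> \<bar>(case z of (t, x) \<Rightarrow> V m t x) - (case z' of (t, x) \<Rightarrow> V m t x)\<bar> < e"
    if "e > 0" for z e
  proof -
    obtain t x where z: "z = (t, x)" by (cases z)
    define T where "T = \<bar>t\<bar> + 1"
    define C where "C = 20 * B T + 1"
    have C: "C > 0" using B_nonneg[of T] by (simp add: C_def)
    \<comment> \<open>Time, space and the step size contribute less than \<open>d\<close> each,
      whence the 3; \<open>d \<le> 1\<close> keeps the second time below \<open>T\<close>.\<close>
    define d where "d = min 1 (e\<^sup>2 / (3 * C))"
    have d: "d > 0" "d \<le> 1" "d \<le> e\<^sup>2 / (3 * C)" using \<open>e > 0\<close> C by (auto simp: d_def)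
    obtain m0 where m0: "\<And>m. m \<ge> m0 \<Longrightarrow> \<tau>s m < d"
      using order_tendstoD(2)[OF \<tau>s_tendsto d(1)] by (auto simp: eventually_sequentially)
    have "\<bar>V m t x - V m s x'\<bar> < e" if "m \<ge> m0" "dist (t, x) (s, x') < d" for m s x'
    proof -
      have "\<bar>t - s\<bar> < d" "\<bar>x - x'\<bar> < d"
        using that(2) dist_fst_le[of "(t, x)" "(s, x')"] dist_snd_le[of "(t, x)" "(s, x')"] by (auto simp: dist_real_def)
      moreover have "t \<le> T" "s \<le> T" "0 \<le> T" using \<open>\<bar>t - s\<bar> < d\<close> d by (auto simp: T_def)
      ultimately have "(V m t x - V m s x')\<^sup>2 \<le> 20 * B T * (\<bar>t - s\<bar> + \<tau>s m + \<bar>x - x'\<bar>)"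
        by (intro V_equicontinuous)
      also have "\<dots> \<le> C * (\<bar>t - s\<bar> + \<tau>s m + \<bar>x - x'\<bar>)" using \<tau>s_pos[of m] by (intro mult_right_mono) (auto simp: C_def)
      also have "\<dots> < C * (d + d + d)"
        using \<open>\<bar>t - s\<bar> < d\<close> \<open>\<bar>x - x'\<bar> < d\<close> m0[OF that(1)] C by (intro mult_strict_left_mono) auto
      also have "\<dots> \<le> C * (e\<^sup>2 / (3 * C) + e\<^sup>2 / (3 * C) + e\<^sup>2 / (3 * C))"
        using d(3) C by (intro mult_left_mono) auto
      also have "\<dots> = e\<^sup>2" using C by (simp add: field_simps)
      finally have "\<bar>V m t x - V m s x'\<bar>\<^sup>2 < e\<^sup>2" by simp
      then show ?thesis using \<open>e > 0\<close> by (intro power2_less_imp_less[of "\<bar>V m t x - V m s x'\<bar>" e]) auto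
    qed
    then show ?thesis using d(1) by (intro exI[of _ d] conjI exI[of _ m0]) (auto simp: z)
  qed
  have bd: "\<bar>case z of (t, x) \<Rightarrow> V m t x\<bar> \<le> M" for m z using V_props(3) by (cases z) auto
  obtain r w where r: "strict_mono (r :: nat \<Rightarrow> nat)" and w: "\<And>z. (\<lambda>i. case z of (t, x) \<Rightarrow> V (r i) t x) \<longlonglongrightarrow> w z" "continuous_on UNIV w"
    using pointwise_compactness[of "\<lambda>m z. case z of (t, x) \<Rightarrow> V m t x" M, OF bd eq] by metis
  show ?thesis
    by (rule that[of r "\<lambda>t x. w (t, x)"]) (use r w(2) w(1)[of "(_, _)"] in \<open>auto simp: case_prod_beta\<close>)
qed

end

section \<open>Bounds on the limit and strong convergence of the gradients\<close>

locale viscoplastic_limit = viscoplastic +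
  fixes r :: "nat \<Rightarrow> nat" and u :: "real \<Rightarrow> real \<Rightarrow> real"
  assumes r: "strict_mono r" and conv: "\<And>t x. (\<lambda>i. V (r i) t x) \<longlonglongrightarrow> u t x"
    and u_cont: "continuous_on UNIV (\<lambda>(t, x). u t x)"
begin

lemma r_large: "\<forall>\<^sub>F i in sequentially. k \<le> r i"
  using seq_suble[OF r] by (intro eventually_sequentiallyI[of k]) (meson le_trans)

lemma u_measurable [measurable]: "(\<lambda>z. u (fst z) (snd z)) \<in> borel_measurable borel"
  using borel_measurable_continuous_onI[OF u_cont] by (simp add: case_prod_beta')

lemma u_cont_x: "continuous_on UNIV (u t)"
proof -
  have "continuous_on UNIV (\<lambda>x. case (t, x) of (t, x) \<Rightarrow> u t x)"
    by (rule continuous_on_compose2[OF u_cont]) (auto intro!: continuous_intros)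
  then show ?thesis by simp
qed

lemma u_x_measurable [measurable]: "u t \<in> borel_measurable borel"
  by (rule borel_measurable_continuous_onI[OF u_cont_x])

lemma u_bound: "\<bar>u t x\<bar> \<le> M"
proof -
  have "(\<lambda>i. \<bar>V (r i) t x\<bar>) \<longlonglongrightarrow> \<bar>u t x\<bar>" by (intro tendsto_intros conv)
  then show ?thesis using V_props(3) by (intro LIMSEQ_le_const2) auto
qed

lemma u_nonpos: "t \<le> 0 \<Longrightarrow> u t x = u0 x"
  using conv[of t x] by (simp add: V_nonpos LIMSEQ_const_iff)

lemma conv_dq: "y \<noteq> 0 \<Longrightarrow> (\<lambda>i. dq y (V (r i) t) x) \<longlonglongrightarrow> dq y (u t) x"
  unfolding dq_eq by (intro tendsto_intros conv)

text \<open>For fixed \<open>j\<close> and \<open>k\<close> the level \<open>r i\<close> is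
  eventually finer than both, and both coarse steps are multiples of its step. Two applications of
  \<open>nr_dq_multiple_le\<close> then reduce the mixed second quotients to those with the scheme's
  own step.\<close>

lemma u_bounds:
  assumes t: "t \<le> T" "0 \<le> T"
  shows "L2R (u t)" and "nr (u t) \<le> B T" and "0 < y \<Longrightarrow> nr (dq y (u t)) \<le> B T"
    and "nr (dq (hs j) (dq (hs k) (u t))) \<le> B T"
proof -
  show "L2R (u t)" "nr (u t) \<le> B T"
    using L2_Fatou[of "u t" lborel "\<lambda>i. V (r i) t" "B T"] V_props(1) V_bounds(1)[OF t] conv by auto
  show "nr (dq y (u t)) \<le> B T" if "0 < y"
    using L2_Fatou(2)[of "dq y (u t)" lborel "\<lambda>i. dq y (V (r i) t)" "B T"] L2R_dqv[OF V_props(1)]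
      V_bounds(2)[OF t that] conv_dq[of y t] that by auto
  show "nr (dq (hs j) (dq (hs k) (u t))) \<le> B T"
  proof (rule L2_Fatou(2)[of _ lborel "\<lambda>i. dq (hs j) (dq (hs k) (V (r i) t))"])
    show "\<forall>\<^sub>F i in sequentially. L2R (dq (hs j) (dq (hs k) (V (r i) t))) \<and> nr (dq (hs j) (dq (hs k) (V (r i) t))) \<le> B T"
      using r_large[of "max j k"]
    proof eventually_elim
      case (elim i)
      define h where "h = hs (r i)"
      have h: "h > 0" "h \<noteq> 0" using hs_pos[of "r i"] by (auto simp: h_def)
      note L = V_props(1)[of "r i" t]
      have jk: "hs j = real (2 ^ (r i - j)) * h" "hs k = real (2 ^ (r i - k)) * h"
        unfolding h_def using elim by (intro hs_multiple; simp)+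
      have comm: "dq y (dq z f) = dq z (dq y f)" for y z f by (rule ext) (rule dq_commute)
      have "nr (dq (hs j) (dq (hs k) (V (r i) t))) \<le> nr (dq h (dq (hs k) (V (r i) t)))"
        unfolding jk(1) by (rule nr_dq_multiple_le[OF L2R_dqv[OF L]]) (use h in auto)
      also have "\<dots> = nr (dq (hs k) (dq h (V (r i) t)))" by (subst comm) simp
      also have "\<dots> \<le> nr (dq h (dq h (V (r i) t)))"
        unfolding jk(2) by (rule nr_dq_multiple_le[OF L2R_dqv[OF L]]) (use h in auto)
      also have "\<dots> \<le> B T" unfolding h_def by (rule V_bounds(3)[OF t])
      finally show ?case using L2R_dqv[OF L2R_dqv[OF L]] by blast
    qed
    show "AE x in lborel. (\<lambda>i. dq (hs j) (dq (hs k) (V (r i) t)) x) \<longlonglongrightarrow> dq (hs j) (dq (hs k) (u t)) x"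
      using hs_pos[of j] hs_pos[of k] unfolding dq_eq[of "hs j"] by (intro AE_I2 tendsto_intros conv_dq) auto
  qed measurable
qed

text \<open>The rounding error \<open>\<tau>s (r i)\<close> falls below every \<open>e > 0\<close>;
  letting \<open>e\<close> tend to 0 after Fatou leaves a Lipschitz bound without it.\<close>

lemma u_time_diff:
  assumes "s \<le> t" "t \<le> T" "0 \<le> T"
  shows "nr (\<lambda>x. u t x - u s x) \<le> (t - s)\<^sup>2 * B T"
proof -
  have lim: "(\<lambda>i. \<tau>s (r i)) \<longlonglongrightarrow> 0"
    using LIMSEQ_subseq_LIMSEQ[OF \<tau>s_tendsto r] by (simp add: o_def)
  have "nr (\<lambda>x. u t x - u s x) \<le> (t - s + e)\<^sup>2 * B T" if "e > 0" for e
  proof (rule L2_Fatou(2)[of _ lborel "\<lambda>i x. V (r i) t x - V (r i) s x"])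
    show "\<forall>\<^sub>F i in sequentially. L2R (\<lambda>x. V (r i) t x - V (r i) s x) \<and> nr (\<lambda>x. V (r i) t x - V (r i) s x) \<le> (t - s + e)\<^sup>2 * B T"
      using order_tendstoD(2)[OF lim that]
    proof eventually_elim
      case (elim i)
      have "nr (\<lambda>x. V (r i) t x - V (r i) s x) \<le> (t - s + \<tau>s (r i))\<^sup>2 * B T" by (rule V_time_diff[OF assms])
      also have "\<dots> \<le> (t - s + e)\<^sup>2 * B T"
        using elim assms(1) \<tau>s_pos[of "r i"] B_nonneg by (intro mult_right_mono power_mono) auto
      finally show ?case using L2_diff[OF V_props(1) V_props(1)] by blast
    qed
    show "AE x in lborel. (\<lambda>i. V (r i) t x - V (r i) s x) \<longlonglongrightarrow> u t x - u s x"
      by (intro AE_I2 tendsto_intros conv)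
  qed measurable
  then have *: "nr (\<lambda>x. u t x - u s x) \<le> (t - s + 1 / real (Suc n))\<^sup>2 * B T" for n by simp
  have "(\<lambda>n. (t - s + 1 / real (Suc n))\<^sup>2 * B T) \<longlonglongrightarrow> (t - s + 0)\<^sup>2 * B T"
    by (intro tendsto_intros LIMSEQ_Suc[OF lim_1_over_n])
  then show ?thesis using * by (intro LIMSEQ_le_const[of _ "(t - s)\<^sup>2 * B T"]) auto
qed

lemma u_Holder: "t \<le> T \<Longrightarrow> 0 \<le> T \<Longrightarrow> (u t b - u t a)\<^sup>2 \<le> B T * \<bar>b - a\<bar>"
  by (rule Holder_of_dq_bound[OF u_bounds(1) u_cont_x hs_pos hs_tendsto]) (auto intro: u_bounds(3) hs_pos)

text \<open>Defined as a limit of quotients of a continuous function, so that joint Borel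
  measurability is immediate; convergence at every point is part of \<open>ux_props\<close>.\<close>

definition ux :: "real \<Rightarrow> real \<Rightarrow> real" where "ux t x = lim (\<lambda>k. dq (hs k) (u t) x)"

lemma ux_props:
  assumes t: "t \<le> T" "0 \<le> T"
  shows "L2R (ux t)" "nr (ux t) \<le> B T" "continuous_on UNIV (ux t)" "nr (dq (hs k) (ux t)) \<le> B T"
    "\<bar>dq (hs k) (u t) x - ux t x\<bar> \<le> sqrt (B T * hs k)" "(ux t b - ux t a)\<^sup>2 \<le> B T * \<bar>b - a\<bar>"
    "(\<lambda>k. dq (hs k) (u t) x) \<longlonglongrightarrow> ux t x" "(ux t x)\<^sup>2 \<le> 4 * B T"
proof -
  obtain v where v: "L2R v" "nr v \<le> B T" "continuous_on UNIV v" "\<And>k. nr (dq (hs k) v) \<le> B T"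
    "\<And>k x. \<bar>dq (hs k) (u t) x - v x\<bar> \<le> sqrt (B T * hs k)" "\<And>a b. (v b - v a)\<^sup>2 \<le> B T * \<bar>b - a\<bar>"
    using C1_of_second_differences[where u="u t" and y=hs and ?C1.0="B T" and ?C2.0="B T",
      OF u_bounds(1)[OF t] u_cont_x hs_pos hs_tendsto u_bounds(3)[OF t hs_pos] u_bounds(4)[OF t]] by blast
  have lim: "(\<lambda>k. dq (hs k) (u t) x) \<longlonglongrightarrow> v x" for x
  proof -
    have "(\<lambda>k. sqrt (B T * hs k)) \<longlonglongrightarrow> sqrt (B T * 0)" by (intro tendsto_intros hs_tendsto)
    then have z: "(\<lambda>k. sqrt (B T * hs k)) \<longlonglongrightarrow> 0" by simp
    have "(\<lambda>k. dq (hs k) (u t) x - v x) \<longlonglongrightarrow> 0"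
      by (rule Lim_null_comparison[OF always_eventually z]) (simp add: v(5))
    then show ?thesis by (simp add: LIM_zero_iff)
  qed
  then have "ux t = v" unfolding ux_def by (intro ext limI)
  moreover have "(v x)\<^sup>2 \<le> 4 * B T"
    using sup_bound_of_L2_Holder[OF v(1) v(6), of 1 x] v(2) by simp
  ultimately show "L2R (ux t)" "nr (ux t) \<le> B T" "continuous_on UNIV (ux t)" "nr (dq (hs k) (ux t)) \<le> B T"
    "\<bar>dq (hs k) (u t) x - ux t x\<bar> \<le> sqrt (B T * hs k)" "(ux t b - ux t a)\<^sup>2 \<le> B T * \<bar>b - a\<bar>"
    "(\<lambda>k. dq (hs k) (u t) x) \<longlonglongrightarrow> ux t x" "(ux t x)\<^sup>2 \<le> 4 * B T"
    using v lim by auto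
qed

lemma ux_measurable [measurable]: "(\<lambda>z. ux (fst z) (snd z)) \<in> borel_measurable borel"
proof -
  have "(\<lambda>z. u (fst z) (snd z + hs k)) \<in> borel_measurable borel" for k
    using measurable_compose[of "\<lambda>z. (fst z, snd z + hs k)" borel borel "\<lambda>z. u (fst z) (snd z)" borel] by simp
  then show ?thesis
    unfolding ux_def dq_eq by (intro borel_measurable_lim_metric) simp
qed

lemma ux_x_measurable [measurable]: "ux t \<in> borel_measurable borel"
  using ux_props(3)[of t "max 0 t"] by (intro borel_measurable_continuous_onI) auto

text \<open>The step of the quotient varies with \<open>i\<close>, so a fixed coarse level
  \<open>k\<close> is inserted. The fine and coarse quotients of the numerical solution differ
  little by the second-difference bound (\<open>a\<close>), the coarse quotients converge pointwise
  and boundedly (\<open>b\<close>), and the coarse quotient of \<open>u\<close> is near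
  \<open>ux\<close> at a uniform rate (\<open>c\<close>).\<close>

lemma gradient_convergence:
  assumes t: "t \<le> T" "0 \<le> T" and "0 \<le> R"
  shows "(\<lambda>i. nr (\<lambda>x. indicator {-R..R} x * (dq (hs (r i)) (V (r i) t) x - ux t x))) \<longlonglongrightarrow> 0"
proof (rule LIMSEQ_I)
  fix e :: real assume "e > 0"
  define I :: "real \<Rightarrow> real" where "I = indicator {-R..R}"
  have I2: "I x * I x = I x" "0 \<le> I x" "I x \<le> 1" for x by (auto simp: I_def indicator_def)
  have [measurable]: "I \<in> borel_measurable borel" by (simp add: I_def)
  have lim0: "(\<lambda>k. 4 * (hs k)\<^sup>2 * B T + 4 * (2 * R * (B T * hs k))) \<longlonglongrightarrow> 4 * 0\<^sup>2 * B T + 4 * (2 * R * (B T * 0))"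
    by (intro tendsto_intros hs_tendsto)
  \<comment> \<open>The final bound is \<open>2 * nr a + 4 * nr b + 4 * nr c\<close>. This
    \<open>k\<close> makes the parts with \<open>a\<close> and \<open>c\<close> less than
    \<open>e / 2\<close> for all \<open>i\<close> with \<open>k \<le> r i\<close>; only then is
    \<open>i\<close> sent to infinity for \<open>b\<close>.\<close>
  then obtain k where k: "4 * (hs k)\<^sup>2 * B T + 4 * (2 * R * (B T * hs k)) < e / 2"
    using order_tendstoD(2)[of _ 0 sequentially "e / 2"] \<open>e > 0\<close> by (fastforce simp: eventually_sequentially)
  have L: "L2R (\<lambda>x. I x * f x)" if "f \<in> borel_measurable borel" "\<And>x. \<bar>f x\<bar> \<le> c" for f c
  proof (rule L2_le(1)[OF L2R_indicator_Icc(1)[of "-R" R], of _ "c\<^sup>2"])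
    show "AE x in lborel. (I x * f x)\<^sup>2 \<le> c\<^sup>2 * (indicator {-R..R} x)\<^sup>2"
      using that(2) by (auto simp: I_def indicator_def abs_le_square_iff[symmetric] intro!: AE_I2 order_trans[OF that(2) abs_ge_self])
  qed (use that in measurable)
  have dqb: "\<bar>dq (hs k) f x\<bar> \<le> 2 * M / hs k" if "\<And>x. \<bar>f x\<bar> \<le> M" for f x
    using that[of x] that[of "x + hs k"] hs_pos[of k] by (simp add: dq_eq abs_divide divide_right_mono)
  have mid0: "(\<lambda>i. nr (\<lambda>x. I x * (dq (hs k) (V (r i) t) x - dq (hs k) (u t) x))) \<longlonglongrightarrow> (LINT x|(lborel::real measure). 0)"
    unfolding nsq_def
  proof (rule integral_dominated_convergence[where w="\<lambda>x. I x * (4 * M / hs k)\<^sup>2"])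
    show "integrable lborel (\<lambda>x. I x * (4 * M / hs k)\<^sup>2)" unfolding I_def by (intro integrable_mult_left integrable_indicator_Icc)
    show "AE x in lborel. (\<lambda>i. (I x * (dq (hs k) (V (r i) t) x - dq (hs k) (u t) x))\<^sup>2) \<longlonglongrightarrow> 0"
    proof (rule AE_I2)
      fix x
      have "(\<lambda>i. (I x * (dq (hs k) (V (r i) t) x - dq (hs k) (u t) x))\<^sup>2) \<longlonglongrightarrow> (I x * (dq (hs k) (u t) x - dq (hs k) (u t) x))\<^sup>2"
        using hs_pos[of k] by (intro tendsto_intros conv_dq) auto
      then show "(\<lambda>i. (I x * (dq (hs k) (V (r i) t) x - dq (hs k) (u t) x))\<^sup>2) \<longlonglongrightarrow> 0" by simp
    qed
    show "AE x in lborel. norm ((I x * (dq (hs k) (V (r i) t) x - dq (hs k) (u t) x))\<^sup>2) \<le> I x * (4 * M / hs k)\<^sup>2" for i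
    proof (rule AE_I2)
      fix x
      have "\<bar>dq (hs k) (V (r i) t) x - dq (hs k) (u t) x\<bar> \<le> 4 * M / hs k"
        using dqb[of "V (r i) t" x, OF V_props(3)] dqb[of "u t" x, OF u_bound] by (simp add: add_divide_distrib[symmetric])
      then have "(dq (hs k) (V (r i) t) x - dq (hs k) (u t) x)\<^sup>2 \<le> (4 * M / hs k)\<^sup>2"
        using M hs_pos[of k] by (subst abs_le_square_iff[symmetric]) auto
      then show "norm ((I x * (dq (hs k) (V (r i) t) x - dq (hs k) (u t) x))\<^sup>2) \<le> I x * (4 * M / hs k)\<^sup>2"
        by (cases "x \<in> {-R..R}") (auto simp: I_def)
    qed
    have [measurable]: "V (r i) t \<in> borel_measurable borel" for i by (rule borel_measurable_continuous_onI[OF V_props(2)])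
    show "(\<lambda>x. (I x * (dq (hs k) (V (r i) t) x - dq (hs k) (u t) x))\<^sup>2) \<in> borel_measurable lborel" for i by measurable
  qed auto
  then have mid: "\<forall>\<^sub>F i in sequentially. nr (\<lambda>x. I x * (dq (hs k) (V (r i) t) x - dq (hs k) (u t) x)) < e / 8"
    using \<open>e > 0\<close> by (intro order_tendstoD(2)) auto
  have "\<forall>\<^sub>F i in sequentially. norm (nr (\<lambda>x. I x * (dq (hs (r i)) (V (r i) t) x - ux t x)) - 0) < e"
    using mid r_large[of k]
  proof eventually_elim
    case (elim i)
    define h where "h = hs (r i)"
    have h: "h > 0" using hs_pos[of "r i"] by (simp add: h_def)
    note VL = V_props(1)[of "r i" t]
    have [measurable]: "V (r i) t \<in> borel_measurable borel" using VL by auto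
    define a b c where "a = (\<lambda>x. dq h (V (r i) t) x - dq (hs k) (V (r i) t) x)"
      and "b = (\<lambda>x. I x * (dq (hs k) (V (r i) t) x - dq (hs k) (u t) x))"
      and "c = (\<lambda>x. I x * (dq (hs k) (u t) x - ux t x))"
    have aL: "L2R a" unfolding a_def by (intro L2_diff L2R_dqv VL)
    have bL: "L2R b" unfolding b_def
    proof (rule L[where c="4 * M / hs k"])
      show "\<bar>dq (hs k) (V (r i) t) x - dq (hs k) (u t) x\<bar> \<le> 4 * M / hs k" for x
        using dqb[of "V (r i) t" x, OF V_props(3)] dqb[of "u t" x, OF u_bound] by (simp add: add_divide_distrib[symmetric])
    qed measurable
    have cL: "L2R c" unfolding c_def
      by (rule L[where c="sqrt (B T * hs k)"]) (use ux_props(5)[OF t] in auto)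
    have na: "nr a \<le> (hs k)\<^sup>2 * B T"
    proof -
      have "hs k = real (2 ^ (r i - k)) * h" unfolding h_def by (rule hs_multiple[OF elim(2)])
      then have "nr a \<le> (hs k)\<^sup>2 * nr (dq h (dq h (V (r i) t)))"
        unfolding a_def using nr_dq_minus_dq_multiple[OF VL, of "2 ^ (r i - k)" h] h by simp
      also have "\<dots> \<le> (hs k)\<^sup>2 * B T" unfolding h_def by (intro mult_left_mono V_bounds(3)[OF t]) auto
      finally show ?thesis .
    qed
    have nc: "nr c \<le> 2 * R * (B T * hs k)"
    proof -
      have "nr c \<le> (B T * hs k) * nr (indicator {-R..R} :: real \<Rightarrow> real)"
      proof (rule L2_le(2)[OF L2R_indicator_Icc(1)])
        show "AE x in lborel. (c x)\<^sup>2 \<le> B T * hs k * (indicator {-R..R} x)\<^sup>2"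
        proof (rule AE_I2)
          fix x
          have "(dq (hs k) (u t) x - ux t x)\<^sup>2 \<le> B T * hs k"
            using ux_props(5)[OF t, of k x] B_nonneg[of T] hs_pos[of k]
            by (subst real_sqrt_le_iff[symmetric]) simp
          then show "(c x)\<^sup>2 \<le> B T * hs k * (indicator {-R..R} x)\<^sup>2" by (auto simp: c_def I_def indicator_def)
        qed
      qed (simp add: c_def)
      then show ?thesis using \<open>0 \<le> R\<close> by (simp add: L2R_indicator_Icc mult.commute)
    qed
    have Ia: "L2R (\<lambda>x. I x * a x)" "nr (\<lambda>x. I x * a x) \<le> 1 * nr a"
    proof -
      have m: "(\<lambda>x. I x * a x) \<in> borel_measurable lborel" using aL by measurable
      have "AE x in lborel. (I x * a x)\<^sup>2 \<le> 1 * (a x)\<^sup>2" by (auto simp: I_def indicator_def)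
      from L2_le[OF aL m this] show "L2R (\<lambda>x. I x * a x)" "nr (\<lambda>x. I x * a x) \<le> 1 * nr a" .
    qed
    have "(\<lambda>x. I x * (dq h (V (r i) t) x - ux t x)) = (\<lambda>x. I x * a x + (b x + c x))"
      by (auto simp: a_def b_def c_def algebra_simps)
    then have "nr (\<lambda>x. I x * (dq h (V (r i) t) x - ux t x)) \<le> 2 * nr (\<lambda>x. I x * a x) + 2 * nr (\<lambda>x. b x + c x)"
      using nsq_add_le[OF Ia(1) L2_add[OF bL cL]] by simp
    also have "\<dots> \<le> 2 * nr a + 2 * (2 * nr b + 2 * nr c)"
      using Ia(2) nsq_add_le[OF bL cL] by (intro add_mono mult_left_mono) auto
    also have "\<dots> < e"
      using na nc elim(1)[folded b_def] k nsq_nonneg[of lborel a] by argo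
    finally show ?case by (simp add: h_def)
  qed
  then show "\<exists>n0. \<forall>i\<ge>n0. norm (nr (\<lambda>x. indicator {-R..R} x * (dq (hs (r i)) (V (r i) t) x - ux t x)) - 0) < e"
    by (simp add: eventually_sequentially I_def)
qed

end

section \<open>The weak formulation\<close>

text \<open>Test functions and their derivatives are extended to negative times by their initial values, so that
  backward time differences are defined on the whole half plane.\<close>

locale half_plane_test_function =
  fixes \<phi> :: "real \<times> real \<Rightarrow> real" and D :: "real \<times> real \<Rightarrow> real \<times> real \<Rightarrow> real"
  assumes \<phi>: "C1_compact_support ({0..} \<times> UNIV) \<phi> D"
begin

definition "\<phi>c t x = \<phi> (max 0 t, x)"
definition "d1 t x = D (max 0 t, x) (1, 0)"
definition "d2 t x = D (max 0 t, x) (0, 1)"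

lemma derivative: "0 \<le> t \<Longrightarrow> (\<phi> has_derivative D (t, x)) (at (t, x) within {0..} \<times> UNIV)"
  using \<phi> by (auto simp: C1_compact_support_def)

lemma clamp_cont: "continuous_on UNIV (\<lambda>z. (max 0 (fst z), snd z) :: real \<times> real)"
  by (intro continuous_intros)

lemma \<phi>c_cont: "continuous_on UNIV (\<lambda>z. \<phi>c (fst z) (snd z))"
proof -
  have "continuous_on ({0..} \<times> UNIV) \<phi>"
    using \<phi> by (intro has_derivative_continuous_on) (auto simp: C1_compact_support_def)
  then show ?thesis unfolding \<phi>c_def
    by (rule continuous_on_compose2[OF _ clamp_cont]) auto
qed

lemma d_cont: "continuous_on UNIV (\<lambda>z. d1 (fst z) (snd z))" "continuous_on UNIV (\<lambda>z. d2 (fst z) (snd z))"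
proof -
  have "continuous_on ({0..} \<times> UNIV) (\<lambda>z. D z v)" for v
    using \<phi> unfolding C1_compact_support_def by blast
  note * = continuous_on_compose2[OF this clamp_cont]
  show "continuous_on UNIV (\<lambda>z. d1 (fst z) (snd z))" "continuous_on UNIV (\<lambda>z. d2 (fst z) (snd z))"
    unfolding d1_def d2_def by (rule *; auto)+
qed

lemma measurables [measurable]:
  "(\<lambda>z. \<phi>c (fst z) (snd z)) \<in> borel_measurable borel" "(\<lambda>z. d1 (fst z) (snd z)) \<in> borel_measurable borel"
  "(\<lambda>z. d2 (fst z) (snd z)) \<in> borel_measurable borel"
  by (intro borel_measurable_continuous_onI \<phi>c_cont d_cont)+

lemma x_cont: "continuous_on UNIV (\<phi>c t)" "continuous_on UNIV (d1 t)" "continuous_on UNIV (d2 t)"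
proof -
  have c: "continuous_on UNIV (\<lambda>x::real. (t, x))" by (intro continuous_intros)
  show "continuous_on UNIV (\<phi>c t)" "continuous_on UNIV (d1 t)" "continuous_on UNIV (d2 t)"
    using continuous_on_compose2[OF \<phi>c_cont c] continuous_on_compose2[OF d_cont(1) c] continuous_on_compose2[OF d_cont(2) c]
    by auto
qed

lemma x_measurables [measurable]:
  "\<phi>c t \<in> borel_measurable borel" "d1 t \<in> borel_measurable borel" "d2 t \<in> borel_measurable borel"
  by (intro borel_measurable_continuous_onI x_cont)+

lemma time_derivative: "0 \<le> t \<Longrightarrow> ((\<lambda>t. \<phi> (t, x)) has_real_derivative d1 t x) (at t within {0..})"
proof -
  assume t: "0 \<le> t"
  have "((\<lambda>t. \<phi> (t, x)) has_derivative (\<lambda>h. D (t, x) (h, 0))) (at t within {0..})"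
  proof -
    have 1: "((\<lambda>t. (t, x)) has_derivative (\<lambda>h. (h, 0))) (at t within {0..})" by (auto intro!: derivative_eq_intros)
    have 2: "(\<phi> has_derivative D (t, x)) (at (t, x) within (\<lambda>t. (t, x)) ` {0..})"
      by (rule has_derivative_subset[OF derivative[OF t]]) auto
    show ?thesis using has_derivative_in_compose[OF 1 2] by simp
  qed
  moreover have "D (t, x) (h, 0) = d1 t x * h" for h
  proof -
    have "D (t, x) (h *\<^sub>R (1, 0)) = h *\<^sub>R D (t, x) (1, 0)"
      by (rule linear_cmul[OF has_derivative_linear[OF derivative[OF t]]])
    then show ?thesis using t by (simp add: d1_def)
  qed
  ultimately show ?thesis by (simp add: has_field_derivative_def)
qed

lemma space_derivative: "0 \<le> t \<Longrightarrow> (\<phi>c t has_real_derivative d2 t x) (at x)"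
proof -
  assume t: "0 \<le> t"
  have "((\<lambda>x. \<phi> (t, x)) has_derivative (\<lambda>h. D (t, x) (0, h))) (at x)"
  proof -
    have 1: "((\<lambda>x. (t, x)) has_derivative (\<lambda>h. (0, h))) (at x)" by (auto intro!: derivative_eq_intros)
    have 2: "(\<phi> has_derivative D (t, x)) (at (t, x) within (\<lambda>x. (t, x)) ` UNIV)"
      by (rule has_derivative_subset[OF derivative[OF t]]) (use t in auto)
    show ?thesis using has_derivative_in_compose[OF 1 2] by simp
  qed
  moreover have "D (t, x) (0, h) = d2 t x * h" for h
  proof -
    have "D (t, x) (h *\<^sub>R (0, 1)) = h *\<^sub>R D (t, x) (0, 1)"
      by (rule linear_cmul[OF has_derivative_linear[OF derivative[OF t]]])
    then show ?thesis using t by (simp add: d2_def)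
  qed
  ultimately show ?thesis using t by (simp add: has_field_derivative_def \<phi>c_def[abs_def])
qed

text \<open>Mean value inequalities along coordinate lines. Clamping at time 0 is 1-Lipschitz, so
  backward time quotients stay bounded across the initial line.\<close>

lemma bounds:
  obtains R C where "R \<ge> 1" "C \<ge> 0" "\<And>t x. R < t \<or> R < \<bar>x\<bar> \<Longrightarrow> \<phi>c t x = 0" "\<And>t x. \<bar>\<phi>c t x\<bar> \<le> C"
    "\<And>t x s. 0 < s \<Longrightarrow> s \<le> 1 \<Longrightarrow> \<bar>(\<phi>c t x - \<phi>c (t - s) x) / s\<bar> \<le> C"
    "\<And>t x h. 0 \<le> t \<Longrightarrow> 0 < h \<Longrightarrow> h \<le> 1 \<Longrightarrow> \<bar>dq h (\<phi>c t) x\<bar> \<le> C"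
proof -
  obtain K where K: "compact K" "\<And>z. z \<in> {0..} \<times> UNIV \<Longrightarrow> z \<notin> K \<Longrightarrow> \<phi> z = 0"
    using \<phi> by (auto simp: C1_compact_support_def)
  obtain R0 where R0: "K \<subseteq> cball 0 R0" using compact_subset_cball_0[OF K(1)] by blast
  define R where "R = max 1 R0"
  have R: "R \<ge> 1" by (simp add: R_def)
  have z0: "\<phi>c t x = 0" if "R < t \<or> R < \<bar>x\<bar>" for t x
  proof -
    have "R < norm (max 0 t, x)"
      using that norm_fst_le[of "max 0 t" x] norm_snd_le[of x "max 0 t"] R by auto
    then have "(max 0 t, x) \<notin> K" using R0 by (auto simp: R_def)
    then show ?thesis unfolding \<phi>c_def by (intro K(2)) auto
  qed
  \<comment> \<open>The margin 1 covers all points that steps of size at most 1 can connect with the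
    support.\<close>
  define Z where "Z = {0..R + 1} \<times> {-(R + 1)..R + 1}"
  have "compact Z" unfolding Z_def by (intro compact_Times compact_Icc)
  then have "compact ((\<lambda>z. \<phi>c (fst z) (snd z)) ` Z \<union> (\<lambda>z. d1 (fst z) (snd z)) ` Z \<union> (\<lambda>z. d2 (fst z) (snd z)) ` Z)"
    by (intro compact_Un compact_continuous_image continuous_on_subset[OF \<phi>c_cont] continuous_on_subset[OF d_cont(1)]
        continuous_on_subset[OF d_cont(2)]) auto
  then obtain C where C: "C > 0" "\<And>w. w \<in> (\<lambda>z. \<phi>c (fst z) (snd z)) ` Z \<union> (\<lambda>z. d1 (fst z) (snd z)) ` Z \<union> (\<lambda>z. d2 (fst z) (snd z)) ` Z \<Longrightarrow> \<bar>w\<bar> \<le> C"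
    using compact_imp_bounded[of "(\<lambda>z. \<phi>c (fst z) (snd z)) ` Z \<union> (\<lambda>z. d1 (fst z) (snd z)) ` Z \<union> (\<lambda>z. d2 (fst z) (snd z)) ` Z"]
    unfolding bounded_pos real_norm_def by blast
  have Cz: "\<bar>\<phi>c t x\<bar> \<le> C" "\<bar>d1 t x\<bar> \<le> C" "\<bar>d2 t x\<bar> \<le> C" if "0 \<le> t" "t \<le> R + 1" "\<bar>x\<bar> \<le> R + 1" for t x
  proof -
    have "(t, x) \<in> Z" using that by (auto simp: Z_def)
    then show "\<bar>\<phi>c t x\<bar> \<le> C" "\<bar>d1 t x\<bar> \<le> C" "\<bar>d2 t x\<bar> \<le> C" by (auto intro!: C(2) rev_image_eqI)
  qed
  show ?thesis
  proof (rule that[of R C])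
    show "\<bar>\<phi>c t x\<bar> \<le> C" for t x
    proof (cases "R < t \<or> R < \<bar>x\<bar>")
      case True
      then show ?thesis using z0[of t x] C(1) by simp
    next
      case False
      have "\<phi>c t x = \<phi>c (max 0 t) x" by (simp add: \<phi>c_def)
      then show ?thesis using Cz(1)[of "max 0 t" x] False R by auto
    qed
    show "\<bar>(\<phi>c t x - \<phi>c (t - s) x) / s\<bar> \<le> C" if s: "0 < s" "s \<le> 1" for t x s
    proof (cases "R + 1 < t \<or> R < \<bar>x\<bar>")
      case True
      then have "\<phi>c t x = 0" "\<phi>c (t - s) x = 0" using s by (auto intro!: z0)
      then show ?thesis using C(1) by simp
    next
      case False
      have "norm (\<phi> (max 0 t, x) - \<phi> (max 0 (t - s), x)) \<le> C * norm (max 0 t - max 0 (t - s))"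
      proof (rule field_differentiable_bound[where S="{0..R + 1}" and f="\<lambda>t. \<phi> (t, x)" and f'="\<lambda>t. d1 t x"])
        show "((\<lambda>t. \<phi> (t, x)) has_real_derivative d1 z x) (at z within {0..R + 1})" if "z \<in> {0..R + 1}" for z
          using time_derivative[of z x] that by (auto intro: DERIV_subset)
        show "norm (d1 z x) \<le> C" if "z \<in> {0..R + 1}" for z
          using Cz(2)[of z x] that False by auto
      qed (use False s R in auto)
      also have "\<dots> \<le> C * s" using C(1) s by (intro mult_left_mono) auto
      finally show ?thesis using s by (simp add: \<phi>c_def abs_divide divide_le_eq)
    qed
    show "\<bar>dq h (\<phi>c t) x\<bar> \<le> C" if h: "0 \<le> t" "0 < h" "h \<le> 1" for t x h
    proof (cases "R < t \<or> R + 1 < \<bar>x\<bar>")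
      case True
      then have "\<phi>c t x = 0" "\<phi>c t (x + h) = 0" using h by (auto intro!: z0)
      then show ?thesis using C(1) by (simp add: dq_eq)
    next
      case False
      show ?thesis
      proof (cases "x + h \<le> R + 1")
        case True
        have "norm (\<phi>c t (x + h) - \<phi>c t x) \<le> C * norm ((x + h) - x)"
        proof (rule field_differentiable_bound[where S="{-(R + 1)..R + 1}" and f'="d2 t"])
          show "(\<phi>c t has_real_derivative d2 t z) (at z within {-(R + 1)..R + 1})" for z
            using space_derivative[OF h(1)] by (rule has_field_derivative_at_within)
          show "norm (d2 t z) \<le> C" if "z \<in> {-(R + 1)..R + 1}" for z
            using Cz(3)[of t z] that False h by auto
        qed (use False True h in auto)
        then show ?thesis using h by (simp add: dq_eq abs_divide divide_le_eq)
      next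
        case False
        then have "\<phi>c t x = 0" "\<phi>c t (x + h) = 0" using h by (auto intro!: z0)
        then show ?thesis using C(1) by (simp add: dq_eq)
      qed
    qed
  qed (use R C z0 in auto)
qed

text \<open>At \<open>t = 0\<close> the clamped backward quotient is 0 whatever the time derivative
  is; this time is excluded as a null set.\<close>

lemma time_quotient_tendsto:
  assumes t: "0 < t" and s: "\<And>n. s n > 0" "s \<longlonglongrightarrow> 0"
  shows "(\<lambda>n. (\<phi>c t x - \<phi>c (t - s n) x) / s n) \<longlonglongrightarrow> d1 t x"
proof -
  have "((\<lambda>t. \<phi> (t, x)) has_real_derivative d1 t x) (at t)"
  proof -
    have "{0..} \<inter> {0<..} - {t} = UNIV \<inter> {0<..} - {t}" by auto
    then have "at t within {0..} = at t" using t by (intro at_within_nhd[of t "{0<..}"]) auto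
    then show ?thesis using time_derivative[of t x] t by simp
  qed
  then have "((\<lambda>t. \<phi>c t x) has_real_derivative d1 t x) (at t)"
    by (rule has_field_derivative_transform_within_open[of _ _ _ "{0<..}"]) (use t in \<open>auto simp: \<phi>c_def\<close>)
  then have "((\<lambda>h. (\<phi>c (t + h) x - \<phi>c t x) / h) \<longlongrightarrow> d1 t x) (at 0)" by (simp add: DERIV_def)
  moreover have "filterlim (\<lambda>n. - s n) (at 0) sequentially"
    using s tendsto_minus[OF s(2)] by (auto simp: filterlim_at intro!: always_eventually) (metis less_irrefl)
  ultimately have "(\<lambda>n. (\<phi>c (t + - s n) x - \<phi>c t x) / - s n) \<longlonglongrightarrow> d1 t x" by (rule filterlim_compose)
  moreover have "(\<phi>c (t + - s n) x - \<phi>c t x) / - s n = (\<phi>c t x - \<phi>c (t - s n) x) / s n" for n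
  proof -
    have "\<phi>c (t + - s n) x - \<phi>c t x = - (\<phi>c t x - \<phi>c (t - s n) x)" by simp
    then show ?thesis by (simp only: minus_divide_divide)
  qed
  ultimately show ?thesis by simp
qed

lemma space_quotient_tendsto:
  assumes t: "0 \<le> t" and s: "\<And>n. s n > 0" "s \<longlonglongrightarrow> 0"
  shows "(\<lambda>n. dq (s n) (\<phi>c t) x) \<longlonglongrightarrow> d2 t x"
proof -
  have "((\<lambda>h. (\<phi>c t (x + h) - \<phi>c t x) / h) \<longlongrightarrow> d2 t x) (at 0)"
    using space_derivative[OF t, of x] by (simp add: DERIV_def)
  moreover have "filterlim s (at 0) sequentially"
    using s by (auto simp: filterlim_at intro!: always_eventually) (metis less_irrefl)
  ultimately show ?thesis unfolding dq_eq by (rule filterlim_compose)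
qed

end

lemma fst_snd_integral_measurable:
  fixes f :: "real \<times> real \<Rightarrow> real"
  assumes "f \<in> borel_measurable borel"
  shows "(\<lambda>t. LINT x|lborel. f (t, x)) \<in> borel_measurable borel"
proof -
  have "(\<lambda>(t, x). f (t, x)) \<in> borel_measurable (borel \<Otimes>\<^sub>M lborel)"
    using assms by (simp add: borel_prod[symmetric] cong: measurable_cong_sets)
  then show ?thesis by (rule lborel.borel_measurable_lebesgue_integral)
qed

lemma integral_bounded_support:
  fixes f :: "real \<Rightarrow> real"
  assumes [measurable]: "f \<in> borel_measurable borel" and "\<And>x. \<bar>f x\<bar> \<le> C * indicator {a..b} x" "a \<le> b"
  shows "integrable lborel f" "\<bar>LINT x|lborel. f x\<bar> \<le> C * (b - a)"
proof -
  have i: "integrable lborel (\<lambda>x. C * indicator {a..b} x)" by (intro integrable_mult_right integrable_indicator_Icc)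
  show f: "integrable lborel f"
    by (rule Bochner_Integration.integrable_bound[OF i]) (use assms in \<open>auto intro!: AE_I2 order_trans[OF assms(2)]\<close>)
  have "\<bar>LINT x|lborel. f x\<bar> \<le> (LINT x|lborel. C * indicator {a..b} x)"
    by (rule integral_abs_bound_integral[OF f i assms(2)])
  also have "\<dots> = C * (b - a)" using assms(3) by simp
  finally show "\<bar>LINT x|lborel. f x\<bar> \<le> C * (b - a)" .
qed

section \<open>The identity satisfied by the numerical solutions\<close>

locale viscoplastic_test = viscoplastic + half_plane_test_function
begin

text \<open>Summation by parts in time without a grid. Let \<open>c\<close> pair the solution with
  the test function one step earlier; one step of the scheme gives
  \<open>c (t + \<tau>) = b t - \<tau> * q t\<close>. So the integrand is a difference of
  \<open>c\<close> shifted and unshifted, and its integral reduces to the window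
  \<open>{0..<\<tau>}\<close>, where the solution is still the datum.\<close>

lemma discrete_weak_formulation:
  "integrable lborel (\<lambda>t. indicator {0..} t * ((LINT x|lborel. V m t x * ((\<phi>c t x - \<phi>c (t - \<tau>s m) x) / \<tau>s m))
      - (LINT x|lborel. sc.Q m (V m t) x * dq (hs m) (\<phi>c t) x)))"
  "(LINT t|lborel. indicator {0..} t * ((LINT x|lborel. V m t x * ((\<phi>c t x - \<phi>c (t - \<tau>s m) x) / \<tau>s m))
      - (LINT x|lborel. sc.Q m (V m t) x * dq (hs m) (\<phi>c t) x))) = - (LINT x|lborel. u0 x * \<phi>c 0 x)"
proof -
  obtain R C where R: "R \<ge> 1" "C \<ge> 0" "\<And>t x. R < t \<or> R < \<bar>x\<bar> \<Longrightarrow> \<phi>c t x = 0" "\<And>t x. \<bar>\<phi>c t x\<bar> \<le> C"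
    using bounds by metis
  define \<tau> h where "\<tau> = \<tau>s m" and "h = hs m"
  have \<tau>: "\<tau> > 0" "\<tau> \<le> 1" "\<tau> = sc.\<tau> m" using \<tau>s_pos \<tau>s_le_1 by (auto simp: \<tau>_def sc_consts)
  define b c q where "b t = (LINT x|lborel. V m t x * \<phi>c t x)" and "c t = (LINT x|lborel. V m t x * \<phi>c (t - \<tau>) x)"
    and "q t = (LINT x|lborel. sc.Q m (V m t) x * dq h (\<phi>c t) x)" for t
  have V\<phi>: "\<bar>V m t x * \<phi>c s x\<bar> \<le> (M * C) * indicator {-R..R} x" for t s x
  proof (cases "R < \<bar>x\<bar>")
    case False
    then show ?thesis
      using mult_mono[OF V_props(3)[of m t x] R(4)[of s x] M] by (auto simp: abs_mult indicator_def)
  qed (use R(3) in \<open>auto simp: indicator_def\<close>)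
  have [measurable]: "V m t \<in> borel_measurable borel" for t by (rule borel_measurable_continuous_onI[OF V_props(2)])
  have i: "integrable lborel (\<lambda>x. V m t x * \<phi>c s x)" "\<bar>LINT x|lborel. V m t x * \<phi>c s x\<bar> \<le> M * C * (2 * R)" for t s
    using integral_bounded_support[of "\<lambda>x. V m t x * \<phi>c s x" "M * C" "- R" R, OF _ V\<phi>] R(1) by auto
  have "(\<lambda>z. (fst z - \<tau>, snd z)) \<in> borel_measurable (borel :: (real \<times> real) measure)" by measurable
  from measurable_compose[OF this measurables(1)]
  have [measurable]: "(\<lambda>z. \<phi>c (fst z - \<tau>) (snd z)) \<in> borel_measurable borel" by simp
  have [measurable]: "b \<in> borel_measurable borel" "c \<in> borel_measurable borel"
    using fst_snd_integral_measurable[of "\<lambda>z. V m (fst z) (snd z) * \<phi>c (fst z) (snd z)"]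
      fst_snd_integral_measurable[of "\<lambda>z. V m (fst z) (snd z) * \<phi>c (fst z - \<tau>) (snd z)"]
    by (simp_all add: b_def[abs_def] c_def[abs_def])
  have bc0: "b t = 0" if "R < t" for t using R(3) that by (simp add: b_def)
  have cc0: "c t = 0" if "R + 1 < t" for t using R(3)[of "t - \<tau>"] that \<tau> by (simp add: c_def)
  have int_b: "integrable lborel (\<lambda>t. indicator {0..} t * b t)"
    by (rule integral_bounded_support(1)[where C="M * C * (2 * R)" and a=0 and b=R])
      (use i(2) bc0 R M in \<open>auto simp: indicator_def b_def[symmetric] not_le\<close>, (auto simp: b_def intro: i(2)))
  have int_c: "integrable lborel (\<lambda>t. indicator {0..} t * c t)"
    by (rule integral_bounded_support(1)[where C="M * C * (2 * R)" and a=0 and b="R + 1"])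
      (use i(2) cc0 R M in \<open>auto simp: indicator_def c_def[symmetric] not_le\<close>, (auto simp: c_def intro: i(2)))
  have step: "c (t + \<tau>) = b t - \<tau> * q t" if "0 \<le> t" for t
  proof -
    have L: "L2R (sc.Q m (V m t))" by (rule sc.L2R_Q[OF V_props(1,3)])
    have L\<phi>: "L2R (\<phi>c t)"
    proof (rule L2_le(1)[OF L2R_indicator_Icc(1)[of "-R" R], of _ "C\<^sup>2"])
      show "AE x in lborel. (\<phi>c t x)\<^sup>2 \<le> C\<^sup>2 * (indicator {-R..R} x)\<^sup>2"
      proof (rule AE_I2)
        fix x show "(\<phi>c t x)\<^sup>2 \<le> C\<^sup>2 * (indicator {-R..R} x)\<^sup>2"
          using R(3)[of t x] R(4)[of t x] R(2) by (cases "R < \<bar>x\<bar>") (auto simp: indicator_def abs_le_square_iff[symmetric])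
      qed
    qed measurable
    have "c (t + \<tau>) = (LINT x|lborel. V m t x * \<phi>c t x + \<tau> * (sc.F m (V m t) x * \<phi>c t x))"
      unfolding c_def using sc.U_step[OF u0 that, of m] \<tau>(3)
      by (intro Bochner_Integration.integral_cong) (auto simp: V_def algebra_simps)
    also have "\<dots> = b t + \<tau> * (LINT x|lborel. sc.F m (V m t) x * \<phi>c t x)"
      unfolding b_def using i(1) L2_mult_integrable[OF sc.L2R_F[OF V_props(1,3)] L\<phi>] by simp
    also have "(LINT x|lborel. sc.F m (V m t) x * \<phi>c t x) = - q t"
      unfolding q_def sc.F_def h_def using dqv_by_parts_L2[OF L L\<phi>, of 1 "- hs m"] by simp
    finally show ?thesis by simp
  qed
  \<comment> \<open>During the first step \<open>t - \<tau>\<close> is negative, where the test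
    function is frozen at its initial value.\<close>
  have init: "c t = (LINT x|lborel. u0 x * \<phi>c 0 x)" if "0 \<le> t" "t < \<tau>" for t
    using that V_initial[of t m] by (simp add: c_def \<tau>_def \<phi>c_def max_def)
  have J: "indicator {0..} t * ((LINT x|lborel. V m t x * ((\<phi>c t x - \<phi>c (t - \<tau>s m) x) / \<tau>s m)) - (LINT x|lborel. sc.Q m (V m t) x * dq (hs m) (\<phi>c t) x))
      = (indicator {0..} t * c (t + \<tau>) - indicator {0..} t * c t) / \<tau>" for t
  proof (cases "0 \<le> t")
    case True
    have "(LINT x|lborel. V m t x * ((\<phi>c t x - \<phi>c (t - \<tau>) x) / \<tau>)) = (LINT x|lborel. (V m t x * \<phi>c t x - V m t x * \<phi>c (t - \<tau>) x) / \<tau>)"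
      by (intro Bochner_Integration.integral_cong) (auto simp: field_simps)
    also have "\<dots> = (b t - c t) / \<tau>" using i(1) by (simp add: b_def c_def)
    finally have "(LINT x|lborel. V m t x * ((\<phi>c t x - \<phi>c (t - \<tau>) x) / \<tau>)) = (b t - c t) / \<tau>" .
    moreover have "(LINT x|lborel. sc.Q m (V m t) x * dq (hs m) (\<phi>c t) x) = (b t - c (t + \<tau>)) / \<tau>"
      using step[OF True] \<tau>(1) by (simp add: q_def h_def)
    ultimately show ?thesis using True \<tau>(1) by (simp add: \<tau>_def[symmetric] diff_divide_distrib)
  qed simp
  have sh: "(\<lambda>t. indicator {0..} t * c (t + \<tau>)) = (\<lambda>t. indicator {\<tau>..} (t + \<tau>) * c (t + \<tau>))" by (auto simp: indicator_def)
  have split: "indicator {0..} t * c t = indicator {0..<\<tau>} t * (LINT x|lborel. u0 x * \<phi>c 0 x) + indicator {\<tau>..} t * c t" for t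
    using init[of t] \<tau>(1) by (auto simp: indicator_def)
  have i0: "integrable lborel (indicator {0..<\<tau>} :: real \<Rightarrow> real)" by (intro integrable_real_indicator emeasure_bounded_finite) auto
  have i1: "integrable lborel (\<lambda>t. indicator {\<tau>..} t * c t)"
  proof -
    have "integrable lborel (\<lambda>t. indicator {0..} t * c t - indicator {0..<\<tau>} t * (LINT x|lborel. u0 x * \<phi>c 0 x))"
      using int_c i0 by simp
    then show ?thesis unfolding split by simp
  qed
  have i2: "integrable lborel (\<lambda>t. indicator {0..} t * c (t + \<tau>))"
    unfolding sh using integrable_translate[of "\<lambda>t. indicator {\<tau>..} t * c t" \<tau>] i1 by simp
  show "integrable lborel (\<lambda>t. indicator {0..} t * ((LINT x|lborel. V m t x * ((\<phi>c t x - \<phi>c (t - \<tau>s m) x) / \<tau>s m))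
      - (LINT x|lborel. sc.Q m (V m t) x * dq (hs m) (\<phi>c t) x)))"
    unfolding J using i2 int_c by simp
  have "(LINT t|lborel. (indicator {0..} t * c (t + \<tau>) - indicator {0..} t * c t) / \<tau>)
      = ((LINT t|lborel. indicator {0..} t * c (t + \<tau>)) - (LINT t|lborel. indicator {0..} t * c t)) / \<tau>"
    using i2 int_c by simp
  also have "(LINT t|lborel. indicator {0..} t * c (t + \<tau>)) = (LINT t|lborel. indicator {\<tau>..} t * c t)"
    unfolding sh by (rule integral_translate[of "\<lambda>t. indicator {\<tau>..} t * c t" \<tau>]) measurable
  also have "(LINT t|lborel. indicator {0..} t * c t) = \<tau> * (LINT x|lborel. u0 x * \<phi>c 0 x) + (LINT t|lborel. indicator {\<tau>..} t * c t)"
    unfolding split using i0 i1 \<tau>(1) by simp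
  finally show "(LINT t|lborel. indicator {0..} t * ((LINT x|lborel. V m t x * ((\<phi>c t x - \<phi>c (t - \<tau>s m) x) / \<tau>s m))
      - (LINT x|lborel. sc.Q m (V m t) x * dq (hs m) (\<phi>c t) x))) = - (LINT x|lborel. u0 x * \<phi>c 0 x)"
    unfolding J using \<tau>(1) by simp
qed

end

section \<open>Passage to the limit in the identity\<close>

locale viscoplastic_limit_test = viscoplastic_limit + half_plane_test_function
begin

sublocale viscoplastic_test ..

definition flux :: "real \<Rightarrow> real \<Rightarrow> real" where
  "flux t x = (u t x)\<^sup>2 / 2 - \<epsilon> * ux t x - plastic_stress \<epsilon> (ux t x)"

lemma plastic_stress_measurable [measurable]: "plastic_stress \<epsilon> \<in> borel_measurable borel"
  by (rule borel_measurable_continuous_onI[OF continuous_plastic_stress[OF eps(1)]])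

lemma hsr_tendsto: "(\<lambda>i. hs (r i)) \<longlonglongrightarrow> 0"
  using LIMSEQ_subseq_LIMSEQ[OF hs_tendsto r] by (simp add: o_def)

lemma \<tau>sr_tendsto: "(\<lambda>i. \<tau>s (r i)) \<longlonglongrightarrow> 0"
  using LIMSEQ_subseq_LIMSEQ[OF \<tau>s_tendsto r] by (simp add: o_def)

lemma flux_measurable [measurable]: "(\<lambda>z. flux (fst z) (snd z)) \<in> borel_measurable borel" "flux t \<in> borel_measurable borel"
  unfolding flux_def[abs_def] by measurable

text \<open>\<open>Q\<close> approximates minus the flux. Slopes of \<open>\<sigma>\<close> are at
  most \<open>\<Lambda>\<close>, which reduces the diffusive part to
  \<open>gradient_convergence\<close>; the convective error \<open>e\<close> converges pointwise and
  boundedly, the shift by \<open>hs (r i)\<close> being harmless by the Hoelder bound in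
  space.\<close>

lemma Q_flux_convergence:
  assumes "0 \<le> t" "0 \<le> R"
  shows "(\<lambda>i. nr (\<lambda>x. indicator {-R..R} x * (sc.Q (r i) (V (r i) t) x + flux t x))) \<longlonglongrightarrow> 0"
proof -
  define I :: "real \<Rightarrow> real" where "I = indicator {-R..R}"
  have [measurable]: "I \<in> borel_measurable borel" by (simp add: I_def)
  have [measurable]: "V m s \<in> borel_measurable borel" for m s by (rule borel_measurable_continuous_onI[OF V_props(2)])
  define p where "p i = dq (hs (r i)) (V (r i) t)" for i
  define e where "e i x = (u t x)\<^sup>2 / 2 - ((V (r i) t x)\<^sup>2 + (V (r i) t (x + hs (r i)))\<^sup>2) / 4" for i x
  have [measurable]: "p i \<in> borel_measurable borel" "e i \<in> borel_measurable borel" for i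
    unfolding p_def e_def[abs_def] by measurable
  have Lb: "L2R (\<lambda>x. I x * f x)" if "f \<in> borel_measurable borel" "\<And>x. \<bar>f x\<bar> \<le> c" for f c
  proof (rule L2_le(1)[OF L2R_indicator_Icc(1)[of "-R" R], of _ "c\<^sup>2"])
    show "AE x in lborel. (I x * f x)\<^sup>2 \<le> c\<^sup>2 * (indicator {-R..R} x)\<^sup>2"
      by (auto simp: I_def indicator_def abs_le_square_iff[symmetric] intro!: AE_I2 order_trans[OF that(2) abs_ge_self])
  qed (use that in measurable)
  have pL: "L2R (\<lambda>x. I x * (p i x - ux t x))" for i
  proof (rule L2_le(1)[OF L2_diff[OF L2R_dqv[OF V_props(1)[of "r i" t], of 1 "hs (r i)"] ux_props(1)[of t t]], of _ 1])
    show "AE x in lborel. (I x * (p i x - ux t x))\<^sup>2 \<le> 1 * (dq (hs (r i)) (V (r i) t) x - ux t x)\<^sup>2"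
      by (auto simp: I_def indicator_def p_def)
  qed (use assms in auto)
  have sq: "\<bar>a\<bar> \<le> M \<Longrightarrow> a\<^sup>2 \<le> M\<^sup>2" for a using M by (simp add: abs_le_square_iff[symmetric])
  have eb: "\<bar>e i x\<bar> \<le> M\<^sup>2" for i x
    using sq[OF u_bound[of t x]] sq[OF V_props(3)[of "r i" t x]] sq[OF V_props(3)[of "r i" t "x + hs (r i)"]]
      zero_le_power2[of "u t x"] zero_le_power2[of "V (r i) t x"] zero_le_power2[of "V (r i) t (x + hs (r i))"]
    unfolding e_def abs_le_iff by argo
  have eL: "L2R (\<lambda>x. I x * e i x)" for i by (rule Lb[OF _ eb]) measurable
  have le: "nr (\<lambda>x. I x * (sc.Q (r i) (V (r i) t) x + flux t x))
      \<le> (2 * \<Lambda>\<^sup>2) * nr (\<lambda>x. I x * (p i x - ux t x)) + 2 * nr (\<lambda>x. I x * e i x)" for i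
  proof (rule L2_le_sum(2)[OF pL eL])
    show "(\<lambda>x. I x * (sc.Q (r i) (V (r i) t) x + flux t x)) \<in> borel_measurable lborel"
      using L2R_borel[OF sc.L2R_Q[OF V_props(1,3)[of "r i" t]]] by measurable
    show "AE x in lborel. (I x * (sc.Q (r i) (V (r i) t) x + flux t x))\<^sup>2 \<le> 2 * \<Lambda>\<^sup>2 * (I x * (p i x - ux t x))\<^sup>2 + 2 * (I x * e i x)\<^sup>2"
    proof (rule AE_I2)
      fix x
      obtain a where a: "\<epsilon> \<le> a" "a \<le> sc.\<Lambda>" "sc.\<sigma> (p i x) - sc.\<sigma> (ux t x) = a * (p i x - ux t x)"
        using sc.\<sigma>_mean_value by blast
      have "sc.Q (r i) (V (r i) t) x + flux t x = (sc.\<sigma> (p i x) - sc.\<sigma> (ux t x)) + e i x"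
        by (simp add: sc.Q_def flux_def e_def p_def sc.\<sigma>_def)
      then have "(I x * (sc.Q (r i) (V (r i) t) x + flux t x))\<^sup>2 = (I x * (a * (p i x - ux t x)) + I x * e i x)\<^sup>2"
        by (simp add: a(3) distrib_left)
      also have "\<dots> \<le> 2 * (I x * (a * (p i x - ux t x)))\<^sup>2 + 2 * (I x * e i x)\<^sup>2" by (rule power2_add_le)
      also have "(I x * (a * (p i x - ux t x)))\<^sup>2 = a\<^sup>2 * (I x * (p i x - ux t x))\<^sup>2" by (simp add: power_mult_distrib)
      also have "a\<^sup>2 * (I x * (p i x - ux t x))\<^sup>2 \<le> \<Lambda>\<^sup>2 * (I x * (p i x - ux t x))\<^sup>2"
        using a eps by (intro mult_right_mono power_mono) (auto simp: sc_consts)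
      finally show "(I x * (sc.Q (r i) (V (r i) t) x + flux t x))\<^sup>2 \<le> 2 * \<Lambda>\<^sup>2 * (I x * (p i x - ux t x))\<^sup>2 + 2 * (I x * e i x)\<^sup>2"
        by simp
    qed
  qed
  have lim: "(\<lambda>i. (2 * \<Lambda>\<^sup>2) * nr (\<lambda>x. I x * (p i x - ux t x)) + 2 * nr (\<lambda>x. I x * e i x)) \<longlonglongrightarrow> (2 * \<Lambda>\<^sup>2) * 0 + 2 * (LINT x|(lborel::real measure). 0)"
  proof (intro tendsto_intros)
    show "(\<lambda>i. nr (\<lambda>x. I x * (p i x - ux t x))) \<longlonglongrightarrow> 0"
      unfolding I_def p_def by (rule gradient_convergence[of t t]) (use assms in auto)
    show "(\<lambda>i. nr (\<lambda>x. I x * e i x)) \<longlonglongrightarrow> (LINT x|(lborel::real measure). 0)"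
      unfolding nsq_def
    proof (rule integral_dominated_convergence[where w="\<lambda>x. I x * (M\<^sup>2)\<^sup>2"])
      show "integrable lborel (\<lambda>x. I x * (M\<^sup>2)\<^sup>2)" unfolding I_def by (intro integrable_mult_left integrable_indicator_Icc)
      show "AE x in lborel. (\<lambda>i. (I x * e i x)\<^sup>2) \<longlonglongrightarrow> 0"
      proof (rule AE_I2)
        fix x
        have "(\<lambda>i. V (r i) t (x + hs (r i)) - V (r i) t x) \<longlonglongrightarrow> 0"
        proof (rule Lim_null_comparison)
          show "\<forall>\<^sub>F i in sequentially. norm (V (r i) t (x + hs (r i)) - V (r i) t x) \<le> sqrt (B t * hs (r i))"
          proof (intro always_eventually allI)
            fix i
            show "norm (V (r i) t (x + hs (r i)) - V (r i) t x) \<le> sqrt (B t * hs (r i))"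
              using V_Holder_space[of t t "r i" "x + hs (r i)" x] assms hs_pos[of "r i"] by (intro real_le_rsqrt) simp
          qed
          have "(\<lambda>i. sqrt (B t * hs (r i))) \<longlonglongrightarrow> sqrt (B t * 0)" by (intro tendsto_intros hsr_tendsto)
          then show "(\<lambda>i. sqrt (B t * hs (r i))) \<longlonglongrightarrow> 0" by simp
        qed
        from tendsto_add[OF this conv[of t x]] have "(\<lambda>i. V (r i) t (x + hs (r i))) \<longlonglongrightarrow> u t x" by simp
        then have "(\<lambda>i. (I x * e i x)\<^sup>2) \<longlonglongrightarrow> (I x * ((u t x)\<^sup>2 / 2 - ((u t x)\<^sup>2 + (u t x)\<^sup>2) / 4))\<^sup>2"
          unfolding e_def by (intro tendsto_intros conv) simp_all
        then show "(\<lambda>i. (I x * e i x)\<^sup>2) \<longlonglongrightarrow> 0" by simp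
      qed
      show "AE x in lborel. norm ((I x * e i x)\<^sup>2) \<le> I x * (M\<^sup>2)\<^sup>2" for i
      proof (rule AE_I2)
        fix x
        have "(e i x)\<^sup>2 \<le> (M\<^sup>2)\<^sup>2" using eb[of i x] by (subst abs_le_square_iff[symmetric]) simp
        then show "norm ((I x * e i x)\<^sup>2) \<le> I x * (M\<^sup>2)\<^sup>2" by (cases "x \<in> {-R..R}") (auto simp: I_def)
      qed
    qed measurable
  qed
  show ?thesis
    unfolding I_def[symmetric]
  proof (rule Lim_null_comparison[OF always_eventually])
    show "\<forall>i. norm (nr (\<lambda>x. I x * (sc.Q (r i) (V (r i) t) x + flux t x)))
        \<le> (2 * \<Lambda>\<^sup>2) * nr (\<lambda>x. I x * (p i x - ux t x)) + 2 * nr (\<lambda>x. I x * e i x)"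
      using le by simp
    show "(\<lambda>i. (2 * \<Lambda>\<^sup>2) * nr (\<lambda>x. I x * (p i x - ux t x)) + 2 * nr (\<lambda>x. I x * e i x)) \<longlonglongrightarrow> 0"
      using lim by simp
  qed
qed

text \<open>The term with the time quotient \<open>a\<close> converges by domination in
  \<open>x\<close>. \<open>Q\<close> converges only in L^2 on bounded intervals, which suffices
  against the bounded quotients \<open>g\<close> with common support. Domination in \<open>t\<close>
  then needs the constant \<open>CJ\<close>, uniform in the step size.\<close>

lemma weak_formulation_lborel:
  "(LINT t|lborel. indicator {0..} t * (LINT x|lborel. u t x * d1 t x + flux t x * d2 t x)) = - (LINT x|lborel. u0 x * \<phi>c 0 x)"
proof -
  obtain R C where RC: "R \<ge> 1" "C \<ge> 0" "\<And>t x. R < t \<or> R < \<bar>x\<bar> \<Longrightarrow> \<phi>c t x = 0" "\<And>t x. \<bar>\<phi>c t x\<bar> \<le> C"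
    "\<And>t x s. 0 < s \<Longrightarrow> s \<le> 1 \<Longrightarrow> \<bar>(\<phi>c t x - \<phi>c (t - s) x) / s\<bar> \<le> C"
    "\<And>t x h. 0 \<le> t \<Longrightarrow> 0 < h \<Longrightarrow> h \<le> 1 \<Longrightarrow> \<bar>dq h (\<phi>c t) x\<bar> \<le> C"
    by (rule bounds) blast
  define R' where "R' = R + 1"
  define I :: "real \<Rightarrow> real" where "I = indicator {-R'..R'}"
  have [measurable]: "I \<in> borel_measurable borel" by (simp add: I_def)
  have [measurable]: "V m s \<in> borel_measurable borel" for m s by (rule borel_measurable_continuous_onI[OF V_props(2)])
  define a where "a i t x = (\<phi>c t x - \<phi>c (t - \<tau>s (r i)) x) / \<tau>s (r i)" for i t x
  define g where "g i t = dq (hs (r i)) (\<phi>c t)" for i t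
  have [measurable]: "a i t \<in> borel_measurable borel" "g i t \<in> borel_measurable borel" for i t
    unfolding a_def[abs_def] g_def by measurable
  have ab: "\<bar>a i t x\<bar> \<le> C * I x" for i t x
  proof (cases "R < \<bar>x\<bar>")
    case True
    then show ?thesis using RC(2,3) by (simp add: a_def I_def)
  next
    case False
    then have "I x = 1" by (auto simp: I_def R'_def indicator_def)
    then show ?thesis using RC(5)[OF \<tau>s_pos \<tau>s_le_1, of t x "r i"] by (simp add: a_def)
  qed
  have a0: "a i t x = 0" if "R' < t" for i t x
    using RC(3) that \<tau>s_le_1[of "r i"] by (simp add: a_def R'_def)
  have gb: "\<bar>g i t x\<bar> \<le> C * I x" if "0 \<le> t" for i t x
  proof (cases "R' < \<bar>x\<bar>")
    case True
    then have "\<phi>c t x = 0" "\<phi>c t (x + hs (r i)) = 0" using hs_le(2)[of "r i"] hs_pos[of "r i"] by (auto intro!: RC(3) simp: R'_def)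
    then show ?thesis using RC(2) by (simp add: g_def dq_eq I_def)
  next
    case False
    then have "I x = 1" by (auto simp: I_def indicator_def)
    then show ?thesis using RC(6)[OF that hs_pos hs_le(2), of "r i" x] by (simp add: g_def)
  qed
  have g0: "g i t x = 0" if "R' < t" for i t x using RC(3) that by (simp add: g_def dq_eq R'_def)
  have at: "(\<lambda>i. a i t x) \<longlonglongrightarrow> d1 t x" if "0 < t" for t x
    unfolding a_def by (rule time_quotient_tendsto[OF that \<tau>s_pos \<tau>sr_tendsto])
  have gt: "(\<lambda>i. g i t x) \<longlonglongrightarrow> d2 t x" if "0 \<le> t" for t x
    unfolding g_def by (rule space_quotient_tendsto[OF that hs_pos hsr_tendsto])
  have d1b: "\<bar>d1 t x\<bar> \<le> C * I x" if "0 < t" for t x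
    using tendsto_rabs[OF at[OF that, of x]] ab by (intro LIMSEQ_le_const2) auto
  have d2b: "\<bar>d2 t x\<bar> \<le> C * I x" if "0 \<le> t" for t x
    using tendsto_rabs[OF gt[OF that, of x]] gb[OF that] by (intro LIMSEQ_le_const2) auto
  have CI: "integrable lborel (\<lambda>x. c * (C * I x))" for c
    unfolding I_def by (intro integrable_mult_right integrable_indicator_Icc)
  have I2: "I x * I x = I x" "0 \<le> I x" for x by (auto simp: I_def indicator_def)
  have L2b: "L2R f \<and> nr f \<le> C\<^sup>2 * (2 * R')" if "f \<in> borel_measurable borel" "\<And>x. \<bar>f x\<bar> \<le> C * I x" for f
  proof -
    have *: "AE x in lborel. (f x)\<^sup>2 \<le> C\<^sup>2 * (indicator {-R'..R'} x)\<^sup>2"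
    proof (rule AE_I2)
      fix x
      have "\<bar>f x\<bar>\<^sup>2 \<le> (C * I x)\<^sup>2" using that(2)[of x] by (intro power_mono) auto
      then show "(f x)\<^sup>2 \<le> C\<^sup>2 * (indicator {-R'..R'} x)\<^sup>2" by (simp add: I_def power_mult_distrib)
    qed
    have m: "f \<in> borel_measurable lborel" using that(1) by simp
    show ?thesis
      using L2_le[OF L2R_indicator_Icc(1) m *] L2R_indicator_Icc(2)[of "-R'" R'] RC(1) by (auto simp: R'_def)
  qed
  define J where "J i t = indicator {0..} t * ((LINT x|lborel. V (r i) t x * a i t x) - (LINT x|lborel. sc.Q (r i) (V (r i) t) x * g i t x))" for i t
  have J_int: "integrable lborel (J i)" and J_val: "(LINT t|lborel. J i t) = - (LINT x|lborel. u0 x * \<phi>c 0 x)" for i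
    using discrete_weak_formulation[of "r i"] by (simp_all add: J_def[abs_def] a_def g_def)
  define J' where "J' t = indicator {0..} t * (LINT x|lborel. u t x * d1 t x + flux t x * d2 t x)" for t
  have J'_meas [measurable]: "J' \<in> borel_measurable borel"
    using fst_snd_integral_measurable[of "\<lambda>z. u (fst z) (snd z) * d1 (fst z) (snd z) + flux (fst z) (snd z) * d2 (fst z) (snd z)"]
    unfolding J'_def[abs_def] by simp
  have QL: "L2R (sc.Q m (V m t))" for m t by (rule sc.L2R_Q[OF V_props(1,3)])
  have V_lim: "(\<lambda>i. LINT x|lborel. V (r i) t x * a i t x) \<longlonglongrightarrow> (LINT x|lborel. u t x * d1 t x)" if "0 < t" for t
  proof (rule integral_dominated_convergence[where w="\<lambda>x. M * (C * I x)"])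
    show "AE x in lborel. (\<lambda>i. V (r i) t x * a i t x) \<longlonglongrightarrow> u t x * d1 t x"
      by (intro AE_I2 tendsto_mult conv at that)
    show "AE x in lborel. norm (V (r i) t x * a i t x) \<le> M * (C * I x)" for i
      using V_props(3) ab M by (auto simp: abs_mult intro!: mult_mono)
  qed (use CI in auto)
  have fluxb: "\<bar>flux t x\<bar> \<le> M\<^sup>2 + \<epsilon> * sqrt (4 * B t) + 1" if "0 \<le> t" for t x
  proof -
    have "\<bar>ux t x\<bar> \<le> sqrt (4 * B t)" using ux_props(8)[of t t x] that by (intro real_le_rsqrt) auto
    then have "\<bar>\<epsilon> * ux t x\<bar> \<le> \<epsilon> * sqrt (4 * B t)" using eps by (simp add: abs_mult)
    moreover have "(u t x)\<^sup>2 \<le> M\<^sup>2" using u_bound[of t x] M by (simp add: abs_le_square_iff[symmetric])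
    ultimately show ?thesis
      using abs_plastic_stress_le[of \<epsilon> "ux t x"] zero_le_power2[of "u t x"] unfolding flux_def abs_le_iff by linarith
  qed
  have Q_lim: "(\<lambda>i. LINT x|lborel. sc.Q (r i) (V (r i) t) x * g i t x) \<longlonglongrightarrow> - (LINT x|lborel. flux t x * d2 t x)" if "0 \<le> t" for t
  proof -
    define F where "F = M\<^sup>2 + \<epsilon> * sqrt (4 * B t) + 1"
    have F0: "0 \<le> F" using fluxb[OF that, of 0] abs_ge_zero[of "flux t 0"] unfolding F_def by linarith
    have i_flux: "integrable lborel (\<lambda>x. flux t x * g i t x)" for i
    proof (rule Bochner_Integration.integrable_bound[OF CI[of F]])
      show "AE x in lborel. norm (flux t x * g i t x) \<le> norm (F * (C * I x))"
      proof (rule AE_I2)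
        fix x
        have "\<bar>flux t x\<bar> * \<bar>g i t x\<bar> \<le> F * (C * I x)"
          using fluxb[OF that, of x] gb[OF that, of i x] F0 unfolding F_def by (intro mult_mono) auto
        from order_trans[OF this abs_ge_self] show "norm (flux t x * g i t x) \<le> norm (F * (C * I x))" by (simp only: real_norm_def abs_mult)
      qed
    qed measurable
    have 1: "(\<lambda>i. LINT x|lborel. flux t x * g i t x) \<longlonglongrightarrow> (LINT x|lborel. flux t x * d2 t x)"
    proof (rule integral_dominated_convergence[where w="\<lambda>x. F * (C * I x)"])
      show "AE x in lborel. (\<lambda>i. flux t x * g i t x) \<longlonglongrightarrow> flux t x * d2 t x"
        by (intro AE_I2 tendsto_mult tendsto_const gt that)
      show "AE x in lborel. norm (flux t x * g i t x) \<le> F * (C * I x)" for i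
        using fluxb[OF that] gb[OF that] F0 unfolding F_def[symmetric] by (auto simp: abs_mult intro!: mult_mono)
    qed (use CI in auto)
    have 2: "(\<lambda>i. LINT x|lborel. (sc.Q (r i) (V (r i) t) x + flux t x) * g i t x) \<longlonglongrightarrow> 0"
    proof (rule Lim_null_comparison)
      define z where "z i = nr (\<lambda>x. I x * (sc.Q (r i) (V (r i) t) x + flux t x))" for i
      have "(\<lambda>i. sqrt (z i * (C\<^sup>2 * (2 * R')))) \<longlonglongrightarrow> sqrt (0 * (C\<^sup>2 * (2 * R')))"
        unfolding z_def I_def by (intro tendsto_intros Q_flux_convergence that) (use RC(1) in \<open>simp add: R'_def\<close>)
      then show "(\<lambda>i. sqrt (z i * (C\<^sup>2 * (2 * R')))) \<longlonglongrightarrow> 0" by simp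
      have "norm (LINT x|lborel. (sc.Q (r i) (V (r i) t) x + flux t x) * g i t x) \<le> sqrt (z i * (C\<^sup>2 * (2 * R')))" for i
      proof -
        have gL: "L2R (g i t)" "nr (g i t) \<le> C\<^sup>2 * (2 * R')" using L2b[of "g i t"] gb[OF that] by auto
        have fL: "L2R (\<lambda>x. I x * flux t x)"
        proof (rule L2_le(1)[OF L2R_indicator_Icc(1)[of "-R'" R'], of _ "F\<^sup>2"])
          show "AE x in lborel. (I x * flux t x)\<^sup>2 \<le> F\<^sup>2 * (indicator {-R'..R'} x)\<^sup>2"
            using fluxb[OF that] F0 by (auto simp: I_def indicator_def F_def[symmetric] abs_le_square_iff[symmetric])
        qed measurable
        have IL: "L2R (\<lambda>x. I x * sc.Q (r i) (V (r i) t) x)"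
          by (rule L2_le(1)[OF QL[of "r i" t], of _ 1]) (use L2R_borel[OF QL[of "r i" t]] in \<open>auto simp: I_def indicator_def\<close>)
        have L: "L2R (\<lambda>x. I x * (sc.Q (r i) (V (r i) t) x + flux t x))"
          using L2_add[OF IL fL] by (simp add: distrib_left)
        have "(sc.Q (r i) (V (r i) t) x + flux t x) * g i t x = (I x * (sc.Q (r i) (V (r i) t) x + flux t x)) * g i t x" for x
          using gb[OF that, of i x] by (cases "I x = 0") (auto simp: I_def indicator_def split: if_splits)
        then have "(LINT x|lborel. (sc.Q (r i) (V (r i) t) x + flux t x) * g i t x)
            = (LINT x|lborel. (I x * (sc.Q (r i) (V (r i) t) x + flux t x)) * g i t x)" by presburger
        moreover have "\<dots>\<^sup>2 \<le> z i * nr (g i t)" unfolding z_def by (rule Cauchy_Schwarz_L2[OF L gL(1)])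
        moreover have "\<dots> \<le> z i * (C\<^sup>2 * (2 * R'))" using gL(2) by (intro mult_left_mono) (auto simp: z_def)
        ultimately show ?thesis by (intro real_le_rsqrt) simp
      qed
      then show "\<forall>\<^sub>F i in sequentially. norm (LINT x|lborel. (sc.Q (r i) (V (r i) t) x + flux t x) * g i t x) \<le> sqrt (z i * (C\<^sup>2 * (2 * R')))"
        by simp
    qed
    have "(LINT x|lborel. sc.Q (r i) (V (r i) t) x * g i t x) =
        (LINT x|lborel. (sc.Q (r i) (V (r i) t) x + flux t x) * g i t x) - (LINT x|lborel. flux t x * g i t x)" for i
    proof -
      have "integrable lborel (\<lambda>x. sc.Q (r i) (V (r i) t) x * g i t x)"
        by (rule L2_mult_integrable[OF QL]) (use L2b[of "g i t"] gb[OF that] in auto)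
      then show ?thesis using i_flux[of i] by (simp add: distrib_right)
    qed
    then show ?thesis using tendsto_diff[OF 2 1] by simp
  qed
  have "(\<lambda>i. LINT t|lborel. J i t) \<longlonglongrightarrow> (LINT t|lborel. J' t)"
  proof (rule integral_dominated_convergence)
    define CJ where "CJ = M * C * (2 * R') + (2 * (2 * \<Lambda>\<^sup>2 * B R') + 2 * ((M\<^sup>2)\<^sup>2 * (2 * R')) + C\<^sup>2 * (2 * R'))"
    show "integrable lborel (\<lambda>t. CJ * indicator {0..R'} t)" by (intro integrable_mult_right integrable_indicator_Icc)
    have "AE t in lborel. t \<noteq> (0::real)" by (rule AE_lborel_singleton)
    then show "AE t in lborel. (\<lambda>i. J i t) \<longlonglongrightarrow> J' t"
    proof eventually_elim
      case (elim t)
      show ?case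
      proof (cases "0 < t")
        case True
        have "(\<lambda>i. indicator {0..} t * ((LINT x|lborel. V (r i) t x * a i t x) - (LINT x|lborel. sc.Q (r i) (V (r i) t) x * g i t x)))
            \<longlonglongrightarrow> indicator {0..} t * ((LINT x|lborel. u t x * d1 t x) - - (LINT x|lborel. flux t x * d2 t x))"
          using True by (intro tendsto_mult tendsto_diff tendsto_const V_lim Q_lim) auto
        moreover have "(LINT x|lborel. u t x * d1 t x + flux t x * d2 t x) = (LINT x|lborel. u t x * d1 t x) + (LINT x|lborel. flux t x * d2 t x)"
        proof (rule Bochner_Integration.integral_add)
          show "integrable lborel (\<lambda>x. u t x * d1 t x)"
          proof (rule Bochner_Integration.integrable_bound[OF CI[of M]])
            show "AE x in lborel. norm (u t x * d1 t x) \<le> norm (M * (C * I x))"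
            proof (rule AE_I2)
              fix x
              have "\<bar>u t x\<bar> * \<bar>d1 t x\<bar> \<le> M * (C * I x)" using u_bound[of t x] d1b[OF True, of x] M by (intro mult_mono) auto
              from order_trans[OF this abs_ge_self] show "norm (u t x * d1 t x) \<le> norm (M * (C * I x))" by (simp only: real_norm_def abs_mult)
            qed
          qed measurable
          show "integrable lborel (\<lambda>x. flux t x * d2 t x)"
          proof (rule Bochner_Integration.integrable_bound[OF CI[of "M\<^sup>2 + \<epsilon> * sqrt (4 * B t) + 1"]])
            show "AE x in lborel. norm (flux t x * d2 t x) \<le> norm ((M\<^sup>2 + \<epsilon> * sqrt (4 * B t) + 1) * (C * I x))"
            proof (rule AE_I2)
              fix x
              have "\<bar>flux t x\<bar> * \<bar>d2 t x\<bar> \<le> (M\<^sup>2 + \<epsilon> * sqrt (4 * B t) + 1) * (C * I x)"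
                using fluxb[of t x] d2b[of t x] True by (intro mult_mono) (auto intro: order_trans[OF abs_ge_zero])
              from order_trans[OF this abs_ge_self] show "norm (flux t x * d2 t x) \<le> norm ((M\<^sup>2 + \<epsilon> * sqrt (4 * B t) + 1) * (C * I x))" by (simp only: real_norm_def abs_mult)
            qed
          qed measurable
        qed
        ultimately show ?thesis by (simp add: J_def J'_def)
      qed (use elim in \<open>auto simp: J_def J'_def\<close>)
    qed
    show "AE t in lborel. norm (J i t) \<le> CJ * indicator {0..R'} t" for i
    proof (rule AE_I2)
      fix t
      show "norm (J i t) \<le> CJ * indicator {0..R'} t"
      proof (cases "t \<in> {0..R'}")
        case True
        have 1: "\<bar>LINT x|lborel. V (r i) t x * a i t x\<bar> \<le> M * C * (2 * R')"
        proof -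
          have "\<bar>V (r i) t x * a i t x\<bar> \<le> (M * C) * indicator {-R'..R'} x" for x
            using mult_mono[OF V_props(3)[of "r i" t x] ab[of i t x] M] by (simp add: abs_mult I_def mult.assoc)
          from integral_bounded_support(2)[OF _ this] show ?thesis using RC(1) by (simp add: R'_def)
        qed
        have 2: "\<bar>LINT x|lborel. sc.Q (r i) (V (r i) t) x * g i t x\<bar> \<le> 2 * (2 * \<Lambda>\<^sup>2 * B R') + 2 * ((M\<^sup>2)\<^sup>2 * (2 * R')) + C\<^sup>2 * (2 * R')"
        proof -
          have gL: "L2R (g i t)" "nr (g i t) \<le> C\<^sup>2 * (2 * R')" using L2b[of "g i t"] gb[of t i] True by auto
          have IL: "L2R (\<lambda>x. I x * sc.Q (r i) (V (r i) t) x)"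
            by (rule L2_le(1)[OF QL[of "r i" t], of _ 1]) (use L2R_borel[OF QL[of "r i" t]] in \<open>auto simp: I_def indicator_def\<close>)
          have nI: "nr (\<lambda>x. I x * sc.Q (r i) (V (r i) t) x) \<le> (2 * \<Lambda>\<^sup>2) * nr (dq (hs (r i)) (V (r i) t)) + (2 * (M\<^sup>2)\<^sup>2) * nr (indicator {-R'..R'} :: real \<Rightarrow> real)"
          proof (rule L2_le_sum(2)[OF L2R_dqv[OF V_props(1)] L2R_indicator_Icc(1)])
            show "AE x in lborel. (I x * sc.Q (r i) (V (r i) t) x)\<^sup>2 \<le> 2 * \<Lambda>\<^sup>2 * (dq (hs (r i)) (V (r i) t) x)\<^sup>2 + 2 * (M\<^sup>2)\<^sup>2 * (indicator {-R'..R'} x)\<^sup>2"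
            proof (rule AE_I2)
              fix x
              define p e where "p = dq (hs (r i)) (V (r i) t) x" and "e = ((V (r i) t x)\<^sup>2 + (V (r i) t (x + hs (r i)))\<^sup>2) / 4"
              obtain b where b: "\<epsilon> \<le> b" "b \<le> sc.\<Lambda>" "sc.\<sigma> p - sc.\<sigma> 0 = b * (p - 0)" using sc.\<sigma>_mean_value by blast
              have "(sc.Q (r i) (V (r i) t) x)\<^sup>2 = (b * p - e)\<^sup>2" using b(3) by (simp add: sc.Q_def p_def e_def)
              also have "\<dots> \<le> 2 * (b * p)\<^sup>2 + 2 * e\<^sup>2" by (rule power2_diff_le)
              also have "(b * p)\<^sup>2 \<le> \<Lambda>\<^sup>2 * p\<^sup>2"
                unfolding power_mult_distrib using b eps by (intro mult_right_mono power_mono) (auto simp: sc_consts)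
              also have "e\<^sup>2 \<le> (M\<^sup>2)\<^sup>2"
              proof (rule power_mono)
                have "(V (r i) t y)\<^sup>2 \<le> M\<^sup>2" for y using V_props(3)[of "r i" t y] M by (simp add: abs_le_square_iff[symmetric])
                from this[of x] this[of "x + hs (r i)"] show "e \<le> M\<^sup>2"
                  unfolding e_def using zero_le_power2[of M] by argo
              qed (simp add: e_def)
              finally show "(I x * sc.Q (r i) (V (r i) t) x)\<^sup>2 \<le> 2 * \<Lambda>\<^sup>2 * (dq (hs (r i)) (V (r i) t) x)\<^sup>2 + 2 * (M\<^sup>2)\<^sup>2 * (indicator {-R'..R'} x)\<^sup>2"
                by (cases "x \<in> {-R'..R'}") (auto simp: I_def p_def)
            qed
          qed (use IL in auto)
          have "nr (dq (hs (r i)) (V (r i) t)) \<le> B R'" by (rule V_bounds(2)[OF _ _ hs_pos]) (use True RC(1) in \<open>auto simp: R'_def\<close>)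
          then have nI': "nr (\<lambda>x. I x * sc.Q (r i) (V (r i) t) x) \<le> 2 * \<Lambda>\<^sup>2 * B R' + 2 * ((M\<^sup>2)\<^sup>2 * (2 * R'))"
            using nI RC(1) L2R_indicator_Icc(2)[of "-R'" R'] mult_left_mono[of "nr (dq (hs (r i)) (V (r i) t))" "B R'" "2 * \<Lambda>\<^sup>2"]
            by (simp add: R'_def)
          have "sc.Q (r i) (V (r i) t) x * g i t x = (I x * sc.Q (r i) (V (r i) t) x) * g i t x" for x
            using gb[of t i x] True by (cases "I x = 0") (auto simp: I_def indicator_def split: if_splits)
          then have "\<bar>LINT x|lborel. sc.Q (r i) (V (r i) t) x * g i t x\<bar> = \<bar>LINT x|lborel. (I x * sc.Q (r i) (V (r i) t) x) * g i t x\<bar>" by presburger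
          also have "\<dots> \<le> (1 * nr (\<lambda>x. I x * sc.Q (r i) (V (r i) t) x) + nr (g i t) / 1) / 2"
            by (rule L2_mult_le[OF IL gL(1)]) simp
          also have "\<dots> \<le> nr (\<lambda>x. I x * sc.Q (r i) (V (r i) t) x) + nr (g i t)"
            using nsq_nonneg[of lborel "\<lambda>x. I x * sc.Q (r i) (V (r i) t) x"] nsq_nonneg[of lborel "g i t"] by argo
          also have "\<dots> \<le> 2 * \<Lambda>\<^sup>2 * B R' + 2 * ((M\<^sup>2)\<^sup>2 * (2 * R')) + C\<^sup>2 * (2 * R')"
            using nI' gL(2) by (rule add_mono)
          also have "\<dots> \<le> 2 * (2 * \<Lambda>\<^sup>2 * B R') + 2 * ((M\<^sup>2)\<^sup>2 * (2 * R')) + C\<^sup>2 * (2 * R')"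
            using B_nonneg[of R'] by simp
          finally show ?thesis .
        qed
        show ?thesis using 1 2 True by (simp add: J_def CJ_def)
      next
        case False
        then show ?thesis using a0 g0 by (cases "t < 0") (auto simp: J_def indicator_def)
      qed
    qed
  qed (use J_int in auto)
  then have "(LINT t|lborel. J' t) = - (LINT x|lborel. u0 x * \<phi>c 0 x)"
    by (simp add: J_val LIMSEQ_const_iff)
  then show ?thesis by (simp add: J'_def)
qed

lemma weak_formulation:
  "(LINT t|lebesgue_on {0..}. LINT x|lebesgue. u t x * D (t, x) (1, 0)
      + ((u t x)\<^sup>2 / 2 - \<epsilon> * ux t x - plastic_stress \<epsilon> (ux t x)) * D (t, x) (0, 1))
    + (LINT x|lebesgue. u0 x * \<phi> (0, x)) = 0"
proof -
  define h where "h t = (LINT x|lborel. u t x * d1 t x + flux t x * d2 t x)" for t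
  have [measurable]: "h \<in> borel_measurable borel"
    using fst_snd_integral_measurable[of "\<lambda>z. u (fst z) (snd z) * d1 (fst z) (snd z) + flux (fst z) (snd z) * d2 (fst z) (snd z)"]
    unfolding h_def[abs_def] by simp
  have "(LINT t|lebesgue_on {0..}. LINT x|lebesgue. u t x * D (t, x) (1, 0)
      + ((u t x)\<^sup>2 / 2 - \<epsilon> * ux t x - plastic_stress \<epsilon> (ux t x)) * D (t, x) (0, 1)) = (LINT t|lborel. indicator {0..} t * h t)"
  proof (rule integral_lebesgue_on_eq)
    fix t :: real assume "t \<in> {0..}"
    then have "(LINT x|lebesgue. u t x * D (t, x) (1, 0) + ((u t x)\<^sup>2 / 2 - \<epsilon> * ux t x - plastic_stress \<epsilon> (ux t x)) * D (t, x) (0, 1))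
        = (LINT x|lebesgue. u t x * d1 t x + flux t x * d2 t x)"
      by (simp add: d1_def d2_def flux_def)
    also have "\<dots> = h t" unfolding h_def by (rule integral_completion) measurable
    finally show "(LINT x|lebesgue. u t x * D (t, x) (1, 0) + ((u t x)\<^sup>2 / 2 - \<epsilon> * ux t x - plastic_stress \<epsilon> (ux t x)) * D (t, x) (0, 1)) = h t" .
  qed measurable
  also have "\<dots> = - (LINT x|lborel. u0 x * \<phi>c 0 x)" unfolding h_def by (rule weak_formulation_lborel)
  also have "(LINT x|lborel. u0 x * \<phi>c 0 x) = (LINT x|lebesgue. u0 x * \<phi>c 0 x)"
    using u0(1) by (intro integral_completion[symmetric]) auto
  finally show ?thesis by (simp add: \<phi>c_def)
qed

end

section \<open>Sobolev norms and Bochner measurability\<close>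

text \<open>Step functions with rational data, coded by lists so that their countability is that of
  a type; the intervals may overlap or be empty.\<close>

definition stepf :: "(rat \<times> rat \<times> rat) list \<Rightarrow> real \<Rightarrow> real" where
  "stepf l x = (\<Sum>(q, a, b)\<leftarrow>l. of_rat q * indicator {of_rat a..of_rat b} x)"

lemma stepf_simps: "stepf [] x = 0" "stepf ((q, a, b) # l) x = of_rat q * indicator {of_rat a..of_rat b} x + stepf l x"
  by (simp_all add: stepf_def)

lemma stepf_append: "stepf (l @ m) x = stepf l x + stepf m x"
  by (simp add: stepf_def)

lemma stepf_scale: "stepf (map (\<lambda>(p, a, b). (q * p, a, b)) l) x = of_rat q * stepf l x"
  by (induction l) (auto simp: stepf_simps of_rat_mult algebra_simps)

lemma L2R_stepf: "L2R (stepf l)"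
proof (induction l)
  case (Cons p l)
  obtain q a b where p: "p = (q, a, b)" by (cases p)
  show ?case using L2_add[OF L2_cmult[OF L2R_indicator_Icc(1)] Cons] by (simp add: p stepf_simps[abs_def])
qed (simp add: stepf_simps[abs_def])

text \<open>Membership in the L^2 closure of the step functions; its closure properties let an
  induction over measurable functions run inside it.\<close>

definition approx :: "(real \<Rightarrow> real) \<Rightarrow> bool" where
  "approx f \<longleftrightarrow> L2R f \<and> (\<forall>e>0. \<exists>l. nr (\<lambda>x. f x - stepf l x) < e)"

lemma approx_closed:
  assumes f: "L2R f" and g: "\<And>e. e > 0 \<Longrightarrow> \<exists>g. approx g \<and> nr (\<lambda>x. f x - g x) < e"
  shows "approx f"
  unfolding approx_def
proof (intro conjI allI impI f)
  fix e :: real assume "e > 0"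
  then obtain g where g: "approx g" "nr (\<lambda>x. f x - g x) < e / 4" using g[of "e / 4"] by auto
  moreover have "e / 4 > 0" using \<open>e > 0\<close> by simp
  ultimately obtain l where l: "nr (\<lambda>x. g x - stepf l x) < e / 4" unfolding approx_def by blast
  have "nr (\<lambda>x. (f x - g x) + (g x - stepf l x)) \<le> 2 * nr (\<lambda>x. f x - g x) + 2 * nr (\<lambda>x. g x - stepf l x)"
    using f g(1) by (intro nsq_add_le L2_diff L2R_stepf) (auto simp: approx_def)
  then show "\<exists>l. nr (\<lambda>x. f x - stepf l x) < e" using g(2) l by (intro exI[of _ l]) simp
qed

lemma approx_limit:
  assumes f: "L2R f" and g: "\<And>n. approx (g n)" and lim: "(\<lambda>n. nr (\<lambda>x. f x - g n x)) \<longlonglongrightarrow> 0"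
  shows "approx f"
proof (rule approx_closed[OF f])
  fix e :: real assume "e > 0"
  from order_tendstoD(2)[OF lim this] obtain n where "nr (\<lambda>x. f x - g n x) < e" by (auto simp: eventually_sequentially)
  then show "\<exists>g. approx g \<and> nr (\<lambda>x. f x - g x) < e" using g by blast
qed

lemma approx_add:
  assumes "approx f" "approx g" shows "approx (\<lambda>x. f x + g x)"
  unfolding approx_def
proof (intro conjI allI impI)
  show "L2R (\<lambda>x. f x + g x)" using assms by (auto simp: approx_def intro: L2_add)
  fix e :: real assume "e > 0"
  then obtain l m where lm: "nr (\<lambda>x. f x - stepf l x) < e / 4" "nr (\<lambda>x. g x - stepf m x) < e / 4"
    using assms unfolding approx_def by (metis divide_pos_pos zero_less_numeral)
  have "nr (\<lambda>x. (f x - stepf l x) + (g x - stepf m x)) \<le> 2 * nr (\<lambda>x. f x - stepf l x) + 2 * nr (\<lambda>x. g x - stepf m x)"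
    using assms by (intro nsq_add_le L2_diff L2R_stepf) (auto simp: approx_def)
  moreover have "(\<lambda>x. (f x - stepf l x) + (g x - stepf m x)) = (\<lambda>x. f x + g x - stepf (l @ m) x)"
    by (auto simp: stepf_append)
  ultimately show "\<exists>l. nr (\<lambda>x. f x + g x - stepf l x) < e" using lm by (intro exI[of _ "l @ m"]) simp
qed

lemma approx_stepf: "approx (stepf l)"
  unfolding approx_def using L2R_stepf by (auto intro!: exI[of _ l])

lemma approx_cmult:
  assumes "approx f" shows "approx (\<lambda>x. c * f x)"
proof -
  have step: "approx (\<lambda>x. c * stepf l x)" for l
  proof (rule approx_closed)
    show "L2R (\<lambda>x. c * stepf l x)" by (intro L2_cmult L2R_stepf)
    fix e :: real assume "e > 0"
    \<comment> \<open>Chosen so that \<open>d\<^sup>2 * nr (stepf l) < e\<close>; the added 1 avoids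
      division by zero.\<close>
    define d where "d = sqrt (e / (nr (stepf l) + 1))"
    have n: "nr (stepf l) + 1 > 0" using nsq_nonneg[of lborel "stepf l"] by linarith
    then have d: "d > 0" using \<open>e > 0\<close> by (simp add: d_def)
    obtain q where q: "c - d < of_rat q" "of_rat q < c + d" using of_rat_dense[of "c - d" "c + d"] d by auto
    have "(\<lambda>x. c * stepf l x - stepf (map (\<lambda>(p, a, b). (q * p, a, b)) l) x) = (\<lambda>x. (c - of_rat q) * stepf l x)"
      unfolding stepf_scale by (auto simp: algebra_simps)
    then have "nr (\<lambda>x. c * stepf l x - stepf (map (\<lambda>(p, a, b). (q * p, a, b)) l) x) = (c - of_rat q)\<^sup>2 * nr (stepf l)"
      by (simp only: nsq_cmult)
    also have "\<dots> \<le> d\<^sup>2 * nr (stepf l)"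
      using q d by (intro mult_right_mono) (auto simp: abs_le_square_iff[symmetric])
    also have "\<dots> = e * (nr (stepf l) / (nr (stepf l) + 1))" using \<open>e > 0\<close> n by (simp add: d_def)
    also have "\<dots> < e * 1" using \<open>e > 0\<close> n by (intro mult_strict_left_mono) (simp_all add: divide_less_eq_1)
    finally show "\<exists>g. approx g \<and> nr (\<lambda>x. c * stepf l x - g x) < e" using approx_stepf by auto
  qed
  show ?thesis
  proof (rule approx_closed)
    show "L2R (\<lambda>x. c * f x)" using assms by (auto simp: approx_def intro: L2_cmult)
    fix e :: real assume "e > 0"
    have "e / (c\<^sup>2 + 1) > 0" using \<open>e > 0\<close> by (intro divide_pos_pos add_nonneg_pos) auto
    then obtain l where l: "nr (\<lambda>x. f x - stepf l x) < e / (c\<^sup>2 + 1)" using assms unfolding approx_def by blast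
    have "(\<lambda>x. c * f x - c * stepf l x) = (\<lambda>x. c * (f x - stepf l x))" by (auto simp: algebra_simps)
    then have "nr (\<lambda>x. c * f x - c * stepf l x) = c\<^sup>2 * nr (\<lambda>x. f x - stepf l x)" by (simp only: nsq_cmult)
    also have "\<dots> \<le> c\<^sup>2 * (e / (c\<^sup>2 + 1))" using l by (intro mult_left_mono) auto
    also have "\<dots> = e - e / (c\<^sup>2 + 1)"
    proof -
      have "c\<^sup>2 + 1 > 0" using zero_le_power2[of c] by linarith
      then have "c\<^sup>2 + 1 \<noteq> 0" by simp
      then show ?thesis by (simp add: field_simps)
    qed
    also have "\<dots> < e" using \<open>e / (c\<^sup>2 + 1) > 0\<close> by simp
    finally show "\<exists>g. approx g \<and> nr (\<lambda>x. c * f x - g x) < e" using step by blast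
  qed
qed

lemma approx_indicator_Icc: "approx (indicator {a..b::real})"
proof (cases "a \<le> b")
  case True
  show ?thesis
  proof (rule approx_closed[OF L2R_indicator_Icc(1)])
    fix e :: real assume "e > 0"
    obtain p where p: "a - e / 4 < of_rat p" "of_rat p < a" using of_rat_dense[of "a - e / 4" a] \<open>e > 0\<close> by auto
    obtain q where q: "b < of_rat q" "of_rat q < b + e / 4" using of_rat_dense[of b "b + e / 4"] \<open>e > 0\<close> by auto
    have "nr (\<lambda>x. indicator {a..b} x - stepf [(1, p, q)] x) \<le> 1 * nr (indicator {of_rat p..a}) + 1 * nr (indicator {b..of_rat q} :: real \<Rightarrow> real)"
    proof (rule L2_le_sum(2)[OF L2R_indicator_Icc(1) L2R_indicator_Icc(1)])
      show "AE x in lborel. (indicator {a..b} x - stepf [(1, p, q)] x)\<^sup>2 \<le> 1 * (indicator {of_rat p..a} x)\<^sup>2 + 1 * (indicator {b..of_rat q} x)\<^sup>2"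
        using p q True by (auto simp: stepf_simps indicator_def)
    qed (use L2R_borel[OF L2R_stepf] in measurable)
    also have "\<dots> < e" using p q \<open>e > 0\<close> by (simp add: L2R_indicator_Icc)
    finally show "\<exists>g. approx g \<and> nr (\<lambda>x. indicator {a..b} x - g x) < e" using approx_stepf by blast
  qed
next
  case False
  then have "indicator {a..b} = stepf []" by (auto simp: stepf_simps)
  then show ?thesis using approx_stepf[of "[]"] by simp
qed

text \<open>A Dynkin argument starting from closed intervals. Intersecting with
  \<open>{a..b}\<close> keeps complements in L^2.\<close>

lemma approx_indicator_bounded:
  assumes "A \<in> sets borel" shows "approx (indicator (A \<inter> {a..b::real}))"
proof -
  let ?E = "range (\<lambda>(a, b). {a..b::real})"
  have fin: "L2R (indicator (A \<inter> {a..b}))" if "A \<in> sets borel" for A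
    by (rule L2_le(1)[OF L2R_indicator_Icc(1)[of a b], of _ 1]) (use that in \<open>auto simp: indicator_def\<close>)
  have "Int_stable ?E" by (auto simp: Int_stable_def)
  moreover have "?E \<subseteq> Pow UNIV" by simp
  moreover have "A \<in> sigma_sets UNIV ?E" using assms by (simp add: borel_eq_atLeastAtMost)
  ultimately show ?thesis
  proof (induction rule: sigma_sets_induct_disjoint)
    case (basic A)
    then obtain c d where "A = {c..d}" by auto
    then have "A \<inter> {a..b} = {max a c..min b d}" by auto
    then show ?case by (simp add: approx_indicator_Icc)
  next
    case empty
    show ?case using approx_stepf[of "[]"] by (simp add: stepf_simps[abs_def])
  next
    case (compl A)
    have "(indicator ((UNIV - A) \<inter> {a..b}) :: real \<Rightarrow> real) = (\<lambda>x. indicator {a..b} x + -1 * indicator (A \<inter> {a..b}) x)"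
      by (auto simp: indicator_def)
    then show ?case using approx_add[OF approx_indicator_Icc approx_cmult[OF compl(2), of "-1"]] by simp
  next
    case (union A)
    have A: "A i \<in> sets borel" for i using union(2) by (auto simp: borel_eq_atLeastAtMost)
    define B where "B n = (\<Union>i<n. A i)" for n
    have apB: "approx (indicator (B n \<inter> {a..b}))" for n
    proof (induction n)
      case 0
      show ?case using approx_stepf[of "[]"] by (simp add: stepf_simps[abs_def] B_def)
    next
      case (Suc n)
      have "A i \<inter> A n = {}" if "i < n" for i
        by (rule disjoint_family_onD[OF union(1)]) (use that in auto)
      then have "B n \<inter> A n = {}" unfolding B_def by blast
      note disj = this
      have eq: "indicator (B (Suc n) \<inter> {a..b}) = (\<lambda>x. indicator (B n \<inter> {a..b}) x + indicator (A n \<inter> {a..b}) x :: real)"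
      proof (intro ext)
        fix x
        have "B (Suc n) = B n \<union> A n" by (auto simp: B_def lessThan_Suc)
        then show "indicator (B (Suc n) \<inter> {a..b}) x = (indicator (B n \<inter> {a..b}) x + indicator (A n \<inter> {a..b}) x :: real)"
          using disj by (cases "x \<in> B n"; cases "x \<in> A n") (auto simp: indicator_def)
      qed
      then show ?case using approx_add[OF Suc union(3)] eq by simp
    qed
    have Bm [measurable]: "B n \<in> sets borel" for n using A by (auto simp: B_def)
    show ?case
    proof (rule approx_limit[OF fin apB])
      have "(\<lambda>n. nr (\<lambda>x. indicator ((\<Union>i. A i) \<inter> {a..b}) x - indicator (B n \<inter> {a..b}) x)) \<longlonglongrightarrow> (LINT x|(lborel::real measure). 0)"
        unfolding nsq_def
      proof (rule integral_dominated_convergence[where w="\<lambda>x. indicator {a..b} x :: real"])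
        show "AE x in lborel. (\<lambda>n. (indicator ((\<Union>i. A i) \<inter> {a..b}) x - indicator (B n \<inter> {a..b}) x :: real)\<^sup>2) \<longlonglongrightarrow> 0"
        proof (rule AE_I2)
          fix x
          show "(\<lambda>n. (indicator ((\<Union>i. A i) \<inter> {a..b}) x - indicator (B n \<inter> {a..b}) x :: real)\<^sup>2) \<longlonglongrightarrow> 0"
          proof (cases "x \<in> (\<Union>i. A i)")
            case True
            then obtain i where i: "x \<in> A i" by auto
            have "\<forall>n\<ge>Suc i. x \<in> B n" using i by (auto simp: B_def)
            then have "\<forall>n\<ge>Suc i. (indicator ((\<Union>i. A i) \<inter> {a..b}) x - indicator (B n \<inter> {a..b}) x :: real)\<^sup>2 = 0"
              using True by (auto simp: indicator_def)
            then show ?thesis by (intro tendsto_eventually) (auto simp: eventually_sequentially)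
          qed (auto simp: B_def indicator_def)
        qed
        show "AE x in lborel. norm ((indicator ((\<Union>i. A i) \<inter> {a..b}) x - indicator (B n \<inter> {a..b}) x :: real)\<^sup>2) \<le> indicator {a..b} x" for n
          by (auto simp: indicator_def)
      qed (use A in \<open>auto intro: integrable_indicator_Icc\<close>)
      then show "(\<lambda>n. nr (\<lambda>x. indicator ((\<Union>i. A i) \<inter> {a..b}) x - indicator (B n \<inter> {a..b}) x)) \<longlonglongrightarrow> 0" by simp
    qed (use A in auto)
  qed
qed

text \<open>Induction over nonnegative measurable functions. Square integrability is a premise
  inside the induction, since in each case the smaller functions inherit it from the larger
  one.\<close>

lemma approx_nonneg:
  assumes "u \<in> borel_measurable borel" "\<And>x. 0 \<le> u x"
  shows "L2R u \<longrightarrow> approx u"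
  using assms
proof (induction rule: borel_measurable_induct_real)
  case (set A)
  show ?case
  proof
    assume L: "L2R (indicator A)"
    show "approx (indicator A)"
    proof (rule approx_limit[OF L approx_indicator_bounded[OF set]])
      have "(\<lambda>n. nr (\<lambda>x. indicator A x - indicator (A \<inter> {- real n..real n}) x)) \<longlonglongrightarrow> (LINT x|(lborel::real measure). 0)"
        unfolding nsq_def
      proof (rule integral_dominated_convergence[where w="\<lambda>x. (indicator A x)\<^sup>2 :: real"])
        show "AE x in lborel. (\<lambda>n. (indicator A x - indicator (A \<inter> {- real n..real n}) x :: real)\<^sup>2) \<longlonglongrightarrow> 0"
        proof (rule AE_I2)
          fix x :: real
          obtain n0 :: nat where "\<bar>x\<bar> < real n0" using reals_Archimedean2 by blast
          then have "\<forall>n\<ge>n0. (indicator A x - indicator (A \<inter> {- real n..real n}) x :: real)\<^sup>2 = 0" by (auto simp: indicator_def)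
          then show "(\<lambda>n. (indicator A x - indicator (A \<inter> {- real n..real n}) x :: real)\<^sup>2) \<longlonglongrightarrow> 0"
            by (intro tendsto_eventually) (auto simp: eventually_sequentially)
        qed
      qed (use set L in \<open>auto simp: indicator_def L2_def\<close>)
      then show "(\<lambda>n. nr (\<lambda>x. indicator A x - indicator (A \<inter> {- real n..real n}) x)) \<longlonglongrightarrow> 0" by simp
    qed
  qed
next
  case (mult u c)
  show ?case
  proof (cases "c = 0")
    case True
    then show ?thesis using approx_stepf[of "[]"] by (simp add: stepf_simps[abs_def])
  next
    case False
    show ?thesis
    proof
      assume "L2R (\<lambda>x. c * u x)"
      from L2_cmult[OF this, of "1 / c"] have "L2R u" using False by simp
      then show "approx (\<lambda>x. c * u x)" using mult by (intro approx_cmult) simp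
    qed
  qed
next
  case (add u v)
  show ?case
  proof
    assume L: "L2R (\<lambda>x. v x + u x)"
    have *: "AE x in lborel. (u x)\<^sup>2 \<le> 1 * (v x + u x)\<^sup>2" "AE x in lborel. (v x)\<^sup>2 \<le> 1 * (v x + u x)\<^sup>2"
      using add by (auto intro!: AE_I2 power_mono)
    have "L2R u" "L2R v" using L2_le(1)[OF L _ *(1)] L2_le(1)[OF L _ *(2)] add by auto
    then show "approx (\<lambda>x. v x + u x)" using add by (intro approx_add) auto
  qed
next
  case (seq U)
  show ?case
  proof
    assume L: "L2R u"
    have le: "U i x \<le> u x" for i x
      using seq(3,4) by (intro incseq_le) (auto simp: mono_def le_fun_def)
    have UL: "L2R (U i)" for i
      by (rule L2_le(1)[OF L, of _ 1]) (use seq le in \<open>auto intro!: AE_I2 power_mono\<close>)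
    show "approx u"
    proof (rule approx_limit[OF L])
      show "approx (U i)" for i using seq UL by auto
      have [measurable]: "U i \<in> borel_measurable borel" "u \<in> borel_measurable borel" for i using seq(1) L by auto
      have "(\<lambda>n. nr (\<lambda>x. u x - U n x)) \<longlonglongrightarrow> (LINT x|(lborel::real measure). 0)"
        unfolding nsq_def
      proof (rule integral_dominated_convergence[where w="\<lambda>x. (u x)\<^sup>2"])
        show "AE x in lborel. (\<lambda>n. (u x - U n x)\<^sup>2) \<longlonglongrightarrow> 0"
        proof (rule AE_I2)
          fix x
          have "(\<lambda>n. (u x - U n x)\<^sup>2) \<longlonglongrightarrow> (u x - u x)\<^sup>2" using seq(4) by (intro tendsto_intros) auto
          then show "(\<lambda>n. (u x - U n x)\<^sup>2) \<longlonglongrightarrow> 0" by simp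
        qed
        show "AE x in lborel. norm ((u x - U n x)\<^sup>2) \<le> (u x)\<^sup>2" for n
        proof (rule AE_I2)
          fix x
          have "(u x - U n x)\<^sup>2 \<le> (u x)\<^sup>2" using le[of n x] seq(2)[of n x] by (intro power_mono) auto
          then show "norm ((u x - U n x)\<^sup>2) \<le> (u x)\<^sup>2" by simp
        qed
      qed (use L in \<open>auto simp: L2_def\<close>)
      then show "(\<lambda>n. nr (\<lambda>x. u x - U n x)) \<longlonglongrightarrow> 0" by simp
    qed
  qed
qed

lemma approx_L2R:
  assumes f: "L2R f" shows "approx f"
proof -
  have "L2R (\<lambda>x. max 0 (f x))" "L2R (\<lambda>x. max 0 (- f x))"
    by (rule L2_le(1)[OF f, of _ 1]; use f in \<open>auto simp: max_def\<close>)+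
  then have "approx (\<lambda>x. max 0 (f x) + -1 * max 0 (- f x))"
    using approx_nonneg[of "\<lambda>x. max 0 (f x)"] approx_nonneg[of "\<lambda>x. max 0 (- f x)"] by (intro approx_add approx_cmult) auto
  moreover have "(\<lambda>x. max 0 (f x) + -1 * max 0 (- f x)) = f" by (auto simp: max_def)
  ultimately show ?thesis by simp
qed

text \<open>Separability of \<open>L\<^sup>2\<close>, in a form that passes to subsets and products.\<close>

lemma L2R_countable_cover:
  assumes "e > 0"
  obtains C :: "nat \<Rightarrow> (real \<Rightarrow> real) set"
    where "\<And>f. L2R f \<Longrightarrow> \<exists>i. f \<in> C i" "\<And>i f g. f \<in> C i \<Longrightarrow> g \<in> C i \<Longrightarrow> nr (\<lambda>x. f x - g x) < e"
proof -
  define L :: "nat \<Rightarrow> (rat \<times> rat \<times> rat) list" where "L = from_nat_into UNIV"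
  \<comment> \<open>The squared triangle inequality has the constant 2 and two terms, hence the
    squared radius \<open>e / 4\<close>.\<close>
  define C where "C i = {f. L2R f \<and> nr (\<lambda>x. f x - stepf (L i) x) < e / 4}" for i
  have "\<exists>i. f \<in> C i" if fL: "L2R f" for f
  proof -
    have "e / 4 > 0" using assms by simp
    then obtain l where "nr (\<lambda>x. f x - stepf l x) < e / 4" using approx_L2R[OF fL] unfolding approx_def by blast
    moreover obtain i where "L i = l" unfolding L_def by (meson UNIV_I countableI_type from_nat_into_surj)
    ultimately show ?thesis using fL by (auto simp: C_def)
  qed
  moreover have "nr (\<lambda>x. f x - g x) < e" if "f \<in> C i" "g \<in> C i" for i f g
  proof -
    have "nr (\<lambda>x. (f x - stepf (L i) x) - (g x - stepf (L i) x)) \<le> 2 * nr (\<lambda>x. f x - stepf (L i) x) + 2 * nr (\<lambda>x. g x - stepf (L i) x)"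
      using that by (intro nsq_diff_le L2_diff L2R_stepf) (auto simp: C_def)
    then show ?thesis using that by (simp add: C_def)
  qed
  ultimately show ?thesis using that by blast
qed

section \<open>Sobolev norms through difference quotients\<close>

text \<open>A primitive of \<open>g\<close> equals \<open>f\<close> almost everywhere, and quotients
  of the primitive are averages of \<open>g\<close>.\<close>

lemma nr_dq_le_weak_derivative:
  assumes wd: "weak_derivative UNIV 1 f g" and f: "L2R f" and g: "L2R g" and "y > 0"
  shows "nr (dq y f) \<le> nr g"
proof -
  obtain F where F: "prim F g" "AE x in lborel. f x = F x" using weak_derivative_primitive[OF wd f g] .
  have "continuous_on UNIV F"
    by (rule Holder_half_continuous[of _ "nr g"]) (use prim_diff_sq[OF F(1) g] in \<open>simp add: mult.commute\<close>)
  then have [measurable]: "F \<in> borel_measurable borel" by (rule borel_measurable_continuous_onI)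
  have [measurable]: "f \<in> borel_measurable borel" using f by auto
  note dF = nr_dq_prim_le[OF F(1) g _ \<open>y > 0\<close>]
  have "nr (dq y f) \<le> 1 * nr (dq y F)"
  proof (rule L2_le(2))
    have "AE x in lborel. f (x + y) = F (x + y)"
      by (rule AE_translate[of "\<lambda>x. f x = F x"]) (use F(2) in auto)
    then show "AE x in lborel. (dq y f x)\<^sup>2 \<le> 1 * (dq y F x)\<^sup>2"
      using F(2) by eventually_elim (simp add: dq_eq)
  qed (use dF in auto)
  then show ?thesis using dF by simp
qed

lemma nr_AE_cong:
  assumes "AE x in lborel. f x = g x" "f \<in> borel_measurable borel" "g \<in> borel_measurable borel"
  shows "nr f = nr g"
  unfolding nsq_def using assms by (intro integral_cong_AE) auto

text \<open>This makes the norm of the weak derivative a measurable function of parameters.\<close>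

lemma nr_weak_derivative_SUP:
  assumes wd: "weak_derivative UNIV 1 f g" and f: "L2R f" and g: "L2R g"
    and y: "\<And>k. y k > 0" "y \<longlonglongrightarrow> 0"
  shows "nr g = enn2real (SUP k. ennreal (nr (dq (y k) f)))"
proof -
  define C where "C = (SUP k. ennreal (nr (dq (y k) f)))"
  have "C \<le> ennreal (nr g)"
    unfolding C_def using nr_dq_le_weak_derivative[OF wd f g y(1)] by (intro SUP_least ennreal_leI)
  then obtain c where c: "C = ennreal c" "c \<ge> 0" "c \<le> nr g"
    by (cases C) (auto simp: top_unique)
  have "ennreal (nr (dq (y k) f)) \<le> ennreal c" for k
    unfolding c(1)[symmetric] C_def by (rule SUP_upper) simp
  then have "nr (dq (y k) f) \<le> c" for k using c(2) by simp
  \<comment> \<open>The reverse inequality: bounded quotients produce a weak derivative of norm at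
    most \<open>c\<close>, and by uniqueness it is \<open>g\<close>.\<close>
  then obtain h where h: "L2R h" "nr h \<le> c" "weak_derivative UNIV 1 f h"
    using weak_derivative_of_bounded_dqv[OF f, of y 1 c] y by (metis less_irrefl)
  have "AE x in lebesgue. g x = h x" by (rule weak_derivative_unique_AE[OF wd h(3)])
  then have "AE x in lborel. g x = h x" using g h by (intro AE_lborel_of_lebesgue) auto
  then have "nr g = nr h" using g h by (intro nr_AE_cong) auto
  then have "nr g = c" using h(2) c(3) by linarith
  then show ?thesis using c by (simp add: C_def[symmetric])
qed

lemma L2R_square_integrable: "L2R f \<Longrightarrow> square_integrable f"
  unfolding square_integrable_def L2_def by (auto simp: integrable_completion intro: measurable_completion)

lemma lebesgue_nr: "f \<in> borel_measurable borel \<Longrightarrow> (LINT x|lebesgue. (f x)\<^sup>2) = nr f"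
  unfolding nsq_def by (rule integral_completion) auto

lemma lebesgue_nr_AE:
  assumes "AE x in lebesgue. h x = g x" "locally_integrable UNIV h" "g \<in> borel_measurable borel"
  shows "(LINT x|lebesgue. (h x)\<^sup>2) = nr g"
proof -
  have [measurable]: "h \<in> borel_measurable lebesgue" by (rule locally_integrable_UNIV_measurable[OF assms(2)])
  have [measurable]: "g \<in> borel_measurable lebesgue" using assms(3) by (intro measurable_completion) simp
  have "(LINT x|lebesgue. (h x)\<^sup>2) = (LINT x|lebesgue. (g x)\<^sup>2)"
  proof (rule integral_cong_AE)
    show "AE x in lebesgue. (h x)\<^sup>2 = (g x)\<^sup>2" using assms(1) by eventually_elim simp
  qed measurable
  then show ?thesis using lebesgue_nr[OF assms(3)] by simp
qed

lemma sobolev_0: "L2R f \<Longrightarrow> f \<in> sobolev 0" "L2R f \<Longrightarrow> sobolev_norm 0 f = sqrt (nr f)"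
  by (auto simp: L2R_square_integrable sobolev_norm_def lebesgue_nr)

text \<open>Any square integrable weak derivative may be used to compute the norm, since the one
  chosen by \<open>SOME\<close> agrees with it almost everywhere.\<close>

lemma sobolev_1:
  assumes wd: "weak_derivative UNIV 1 f g" and f: "L2R f" and g: "L2R g"
  shows "f \<in> sobolev 1" "sobolev_norm_sq 1 f = nr f + nr g" "sobolev_norm 1 f = sqrt (nr f + nr g)"
proof -
  show "f \<in> sobolev 1"
    unfolding One_nat_def sobolev.simps using assms L2R_square_integrable by blast
  define h where "h = (SOME h. weak_derivative UNIV 1 f h)"
  have h: "weak_derivative UNIV 1 f h" unfolding h_def using wd by (rule someI[of "weak_derivative UNIV 1 f"])
  then have "(LINT x|lebesgue. (h x)\<^sup>2) = nr g"
    using weak_derivative_unique_AE[OF h wd] g by (intro lebesgue_nr_AE) (auto simp: weak_derivative_def)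
  then show s: "sobolev_norm_sq 1 f = nr f + nr g"
    using f by (simp add: h_def[symmetric] lebesgue_nr)
  then show "sobolev_norm 1 f = sqrt (nr f + nr g)" by (simp add: sobolev_norm_def)
qed

text \<open>The second \<open>SOME\<close> in the norm differentiates the first chosen derivative
  \<open>h\<close>, not \<open>g\<close>; therefore \<open>k\<close> is first recognised as a weak
  derivative of \<open>h\<close>.\<close>

lemma sobolev_2:
  assumes wd1: "weak_derivative UNIV 1 f g" and wd2: "weak_derivative UNIV 1 g k" and f: "L2R f" and g: "L2R g" and k: "L2R k"
  shows "f \<in> sobolev 2" "sobolev_norm 2 f = sqrt (nr f + nr g + nr k)"
proof -
  show "f \<in> sobolev 2"
    unfolding numeral_2_eq_2 sobolev.simps using assms L2R_square_integrable by blast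
  define h where "h = (SOME h. weak_derivative UNIV 1 f h)"
  have h: "weak_derivative UNIV 1 f h" unfolding h_def using wd1 by (rule someI[of "weak_derivative UNIV 1 f"])
  have hg: "AE x in lebesgue. h x = g x" by (rule weak_derivative_unique_AE[OF h wd1])
  have li: "locally_integrable UNIV h" "locally_integrable UNIV g" "locally_integrable UNIV k"
    using h wd1 wd2 by (auto simp: weak_derivative_def)
  have hk: "weak_derivative UNIV 1 h k"
    by (rule weak_derivative_AE_cong[OF wd2]) (use hg li in auto)
  define m where "m = (SOME m. weak_derivative UNIV 1 h m)"
  have m: "weak_derivative UNIV 1 h m" unfolding m_def using hk by (rule someI[of "weak_derivative UNIV 1 h"])
  have "(LINT x|lebesgue. (h x)\<^sup>2) = nr g" using hg li(1) g by (intro lebesgue_nr_AE) auto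
  moreover have "(LINT x|lebesgue. (m x)\<^sup>2) = nr k"
    using weak_derivative_unique_AE[OF m hk] m k by (intro lebesgue_nr_AE) (auto simp: weak_derivative_def)
  moreover have "sobolev_norm 2 f = sqrt (sobolev_norm_sq (Suc (Suc 0)) f)"
    by (simp only: sobolev_norm_def numeral_2_eq_2)
  ultimately show "sobolev_norm 2 f = sqrt (nr f + nr g + nr k)"
    using f by (simp add: h_def[symmetric] m_def[symmetric] lebesgue_nr)
qed

lemma weak_derivative_diff:
  fixes f :: "real \<Rightarrow> real"
  assumes w: "weak_derivative UNIV 1 f g" "weak_derivative UNIV 1 f' g'" and L: "L2R f" "L2R g" "L2R f'" "L2R g'"
  shows "weak_derivative UNIV 1 (\<lambda>x. f x - f' x) (\<lambda>x. g x - g' x)"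
proof (rule weak_derivativeI[OF open_UNIV loc_int_L2[OF L2_diff[OF L(1,3)]] loc_int_L2[OF L2_diff[OF L(2,4)]], of "\<lambda>n. 1 / real (Suc n)"])
  show "(\<lambda>n. 1 / real (Suc n)) \<longlonglongrightarrow> 0" by (rule LIMSEQ_Suc[OF lim_1_over_n])
  then have s: "(\<lambda>n. 1 / real (Suc n)) \<longlonglongrightarrow> 0" .
  fix \<phi> :: "real \<Rightarrow> real" and D assume \<phi>: "C1_compact_support UNIV \<phi> D"
  note p = L2R_C1_compact_support[OF \<phi>]
  have "(\<lambda>n. LINT z|lborel. dqv 1 (1 / real (Suc n)) (\<lambda>x. f x - f' x) z * \<phi> z) \<longlonglongrightarrow> - (LINT z|lborel. (f z - f' z) * D z 1)"
    by (rule dqv_pairing_tendsto[OF \<phi> loc_int_L2[OF L2_diff[OF L(1,3)]] _ s]) simp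
  also have "- (LINT z|lborel. (f z - f' z) * D z 1) = (LINT z|lborel. (g z - g' z) * \<phi> z)"
    using weak_derivativeD_lborel[OF w(1) _ _ \<phi>] weak_derivativeD_lborel[OF w(2) _ _ \<phi>] L
      L2_mult_integrable[OF L(1) p(2)[of 1]] L2_mult_integrable[OF L(3) p(2)[of 1]] L2_mult_integrable[OF L(2) p(1)] L2_mult_integrable[OF L(4) p(1)]
    by (simp add: left_diff_distrib)
  finally show "(\<lambda>n. LINT z|lborel. dqv 1 (1 / real (Suc n)) (\<lambda>x. f x - f' x) z * \<phi> z) \<longlonglongrightarrow> (LINT z|lborel. (g z - g' z) * \<phi> z)" .
qed simp

section \<open>Bochner measurability\<close>

text \<open>The sets of the cover need not be measurable: they only supply countably many times
  \<open>e j\<close> at which the values of \<open>f\<close> are dense in its range. The simple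
  functions project \<open>f t\<close> to the nearest of the first such values, and this choice is
  measurable because the distance \<open>N s\<close> to a fixed value is measurable in
  \<open>t\<close>.\<close>

lemma bochner_measurableI:
  fixes f :: "real \<Rightarrow> real \<Rightarrow> real"
  assumes S: "\<And>t. t \<in> {0<..<T} \<Longrightarrow> f t \<in> sobolev k"
    and cover: "\<And>e. e > 0 \<Longrightarrow> \<exists>A :: nat \<Rightarrow> real set. {0<..<T} \<subseteq> (\<Union>i. A i) \<and>
       (\<forall>i. \<forall>s\<in>A i \<inter> {0<..<T}. \<forall>t\<in>A i \<inter> {0<..<T}. sobolev_norm k (\<lambda>x. f s x - f t x) < e)"
    and N: "\<And>s. N s \<in> borel_measurable borel" "\<And>s t. s \<in> {0<..<T} \<Longrightarrow> t \<in> {0<..<T} \<Longrightarrow> sobolev_norm k (\<lambda>x. f s x - f t x) = N s t"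
    and N0: "\<And>s t. 0 \<le> N s t" and "T > 0"
  shows "bochner_measurable T k f"
proof -
  define G where "G = {0<..<T}"
  have "\<exists>A :: nat \<Rightarrow> real set. G \<subseteq> (\<Union>i. A i) \<and> (\<forall>i. \<forall>s\<in>A i \<inter> G. \<forall>t\<in>A i \<inter> G. sobolev_norm k (\<lambda>x. f s x - f t x) < 1 / real (Suc m))" for m
    using cover[of "1 / real (Suc m)"] by (simp add: G_def)
  then have "\<exists>A :: nat \<Rightarrow> nat \<Rightarrow> real set. \<forall>m. G \<subseteq> (\<Union>i. A m i) \<and> (\<forall>i. \<forall>s\<in>A m i \<inter> G. \<forall>t\<in>A m i \<inter> G. sobolev_norm k (\<lambda>x. f s x - f t x) < 1 / real (Suc m))"
    by (intro choice allI)
  then obtain A :: "nat \<Rightarrow> nat \<Rightarrow> real set" where A: "\<And>m. G \<subseteq> (\<Union>i. A m i)"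
    "\<And>m i s t. s \<in> A m i \<inter> G \<Longrightarrow> t \<in> A m i \<inter> G \<Longrightarrow> sobolev_norm k (\<lambda>x. f s x - f t x) < 1 / real (Suc m)"
    by blast
  have TG: "T / 2 \<in> G" using \<open>T > 0\<close> by (simp add: G_def)
  \<comment> \<open>The default \<open>T / 2\<close> keeps every centre inside the interval when the
    set of the cover does not meet it.\<close>
  define d where "d m i = (if A m i \<inter> G = {} then T / 2 else (SOME s. s \<in> A m i \<inter> G))" for m i
  have d: "d m i \<in> G" "A m i \<inter> G \<noteq> {} \<Longrightarrow> d m i \<in> A m i \<inter> G" for m i
    using TG some_in_eq[of "A m i \<inter> G"] by (auto simp: d_def)
  define e where "e j = (case prod_decode j of (m, i) \<Rightarrow> d m i)" for j
  have eG: "e j \<in> G" for j using d(1) by (auto simp: e_def split: prod.split)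
  have close: "\<exists>j. N (e j) t < c" if "t \<in> G" "c > 0" for t c
  proof -
    obtain m where m: "1 / real (Suc m) < c" using nat_approx_posE[OF \<open>c > 0\<close>] .
    obtain i where i: "t \<in> A m i" using A(1)[of m] \<open>t \<in> G\<close> by auto
    then have "d m i \<in> A m i \<inter> G" using d(2)[of m i] \<open>t \<in> G\<close> by auto
    then have "sobolev_norm k (\<lambda>x. f (d m i) x - f t x) < 1 / real (Suc m)" using A(2)[of "d m i" m i t] i \<open>t \<in> G\<close> by auto
    then have "N (d m i) t < c" using N(2)[of "d m i" t] d(1)[of m i] \<open>t \<in> G\<close> m by (simp add: G_def)
    then show ?thesis by (intro exI[of _ "prod_encode (m, i)"]) (simp add: e_def)
  qed
  \<comment> \<open>\<open>LEAST\<close> breaks ties, so that \<open>J n\<close> is a measurable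
    function with values at most \<open>n\<close>.\<close>
  define J where "J n t = (LEAST j. j \<le> n \<and> (\<forall>i\<in>{..n}. N (e j) t \<le> N (e i) t))" for n t
  have ex: "\<exists>j. j \<le> n \<and> (\<forall>i\<in>{..n}. N (e j) t \<le> N (e i) t)" for n t
  proof -
    have "Min ((\<lambda>i. N (e i) t) ` {..n}) \<in> (\<lambda>i. N (e i) t) ` {..n}" by (intro Min_in) auto
    then obtain j where "Min ((\<lambda>i. N (e i) t) ` {..n}) = N (e j) t" "j \<in> {..n}" by (rule imageE)
    moreover have "Min ((\<lambda>i. N (e i) t) ` {..n}) \<le> N (e i) t" if "i \<in> {..n}" for i using that by (intro Min_le) auto
    ultimately show ?thesis by (intro exI[of _ j]) simp
  qed
  have J: "J n t \<le> n" "\<And>i. i \<le> n \<Longrightarrow> N (e (J n t)) t \<le> N (e i) t" for n t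
    using LeastI_ex[OF ex[of n t]] by (auto simp: J_def)
  have [measurable]: "J n \<in> measurable borel (count_space UNIV)" for n
    unfolding J_def[abs_def] using N(1) by measurable
  have J_lborel: "J n \<in> measurable (lebesgue_on {0<..<T}) (count_space UNIV)" for n
    by (rule measurable_restrict_space1) (rule measurable_completion, simp)
  show ?thesis
    unfolding bochner_measurable_def
  proof (intro exI[of _ "\<lambda>n t. f (e (J n t))"] conjI allI ballI)
    fix n
    have "simple_function (lebesgue_on {0<..<T}) (J n)"
      unfolding simple_function_eq_measurable
      using J_lborel[of n] J(1)[of n] by (auto intro!: finite_subset[of "J n ` _" "{..n}"])
    then show "simple_function (lebesgue_on {0<..<T}) (\<lambda>t. f (e (J n t)))" by (rule simple_function_compose1)
    show "f (e (J n t)) \<in> sobolev k" for t using S eG by (auto simp: G_def)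
  next
    have conv: "(\<lambda>n. sobolev_norm k (\<lambda>x. f (e (J n t)) x - f t x)) \<longlonglongrightarrow> 0" if t: "t \<in> G" for t
    proof (rule LIMSEQ_I)
      fix c :: real assume "c > 0"
      then obtain j where j: "N (e j) t < c" using close[OF t] by blast
      have "norm (sobolev_norm k (\<lambda>x. f (e (J n t)) x - f t x) - 0) < c" if "n \<ge> j" for n
        using J(2)[OF that, of t] j N(2)[of "e (J n t)" t] eG t N0[of "e (J n t)" t] by (auto simp: G_def)
      then show "\<exists>n0. \<forall>n\<ge>n0. norm (sobolev_norm k (\<lambda>x. f (e (J n t)) x - f t x) - 0) < c" by blast
    qed
    show "AE t in lebesgue_on {0<..<T}. f t \<in> sobolev k \<and> (\<lambda>n. sobolev_norm k (\<lambda>x. f (e (J n t)) x - f t x)) \<longlonglongrightarrow> 0"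
      using S conv by (intro AE_I2) (auto simp: G_def space_restrict_space)
  qed
qed

lemma shift_measurable:
  fixes h :: "real \<times> real \<Rightarrow> real"
  assumes "h \<in> borel_measurable borel"
  shows "(\<lambda>z. h (fst z + a, snd z + b)) \<in> borel_measurable borel" "(\<lambda>z. h (fst z, snd z + b)) \<in> borel_measurable borel"
  using measurable_compose[of "\<lambda>z. (fst z + a, snd z + b)" borel borel h borel] assms
    measurable_compose[of "\<lambda>z. (fst z, snd z + b)" borel borel h borel] by simp_all

lemma slice_measurable:
  fixes h :: "real \<times> real \<Rightarrow> real"
  assumes "h \<in> borel_measurable borel" shows "(\<lambda>x. h (t, x)) \<in> borel_measurable borel"
  using measurable_compose[of "\<lambda>x. (t, x)" borel borel h borel] assms by simp

lemma nr_measurable: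
  fixes f :: "real \<times> real \<Rightarrow> real"
  assumes [measurable]: "f \<in> borel_measurable borel"
  shows "(\<lambda>t. nr (\<lambda>x. f (t, x))) \<in> borel_measurable borel"
  using fst_snd_integral_measurable[of "\<lambda>z. (f z)\<^sup>2"] by (simp add: nsq_def)

lemma nr_dq_measurable:
  fixes f :: "real \<times> real \<Rightarrow> real"
  assumes [measurable]: "f \<in> borel_measurable borel"
  shows "(\<lambda>t. nr (dq y (\<lambda>x. f (t, x)))) \<in> borel_measurable borel"
proof -
  have "(\<lambda>z. (f (fst z, snd z + y) - f z) / y) \<in> borel_measurable borel"
    using measurable_compose[of "\<lambda>z. (fst z, snd z + y)" borel borel f borel] by simp
  from nr_measurable[OF this] show ?thesis by (simp add: dq_eq[abs_def])
qed

lemma nn_integral_iterated: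
  fixes h :: "real \<times> real \<Rightarrow> ennreal"
  assumes "h \<in> borel_measurable borel"
  shows "(\<integral>\<^sup>+z. h z \<partial>lborel) = (\<integral>\<^sup>+t. \<integral>\<^sup>+x. h (t, x) \<partial>lborel \<partial>lborel)"
proof -
  have "h \<in> borel_measurable (lborel \<Otimes>\<^sub>M lborel)" using assms by (simp add: lborel_prod)
  from lborel.nn_integral_fst[OF this] show ?thesis by (simp add: lborel_prod)
qed

lemma L2R_iterated:
  fixes h :: "real \<times> real \<Rightarrow> real"
  assumes [measurable]: "h \<in> borel_measurable borel" and "0 \<le> C"
    and "(\<integral>\<^sup>+t. \<integral>\<^sup>+x. ennreal ((h (t, x))\<^sup>2) \<partial>lborel \<partial>lborel) \<le> ennreal C"
  shows "L2R h \<and> nr h \<le> C"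
  using assms nn_integral_iterated[of "\<lambda>z. ennreal ((h z)\<^sup>2)"] by (auto simp: L2_nn)

lemma nn_slice_measurable:
  fixes h :: "real \<times> real \<Rightarrow> real"
  assumes [measurable]: "h \<in> borel_measurable borel"
  shows "(\<lambda>t. \<integral>\<^sup>+x. ennreal ((h (t, x))\<^sup>2) \<partial>lborel) \<in> borel_measurable borel"
proof -
  have "(\<lambda>(t, x). ennreal ((h (t, x))\<^sup>2)) \<in> borel_measurable (borel \<Otimes>\<^sub>M lborel)"
    by (simp add: borel_prod[symmetric] cong: measurable_cong_sets)
  then show ?thesis by (rule lborel.borel_measurable_nn_integral)
qed

lemma open_half_plane: "open ({0<..} \<times> UNIV :: (real \<times> real) set)"
  by (intro open_Times open_greaterThan open_UNIV)

text \<open>The weak derivatives \<open>dv\<close> are chosen slice by slice, without measurability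
  in \<open>t\<close>. Their norms are nevertheless measurable, as suprema of norms of quotients;
  and the cover for H^1 consists of pairs of cells, one for \<open>v t\<close> and one for
  \<open>dv t\<close>.\<close>

lemma Linf_L2_sobolevI:
  fixes v :: "real \<Rightarrow> real \<Rightarrow> real" and y :: "nat \<Rightarrow> real"
  assumes v [measurable]: "(\<lambda>z. v (fst z) (snd z)) \<in> borel_measurable borel" and L: "\<And>t. L2R (v t)"
    and wd: "\<And>t. \<exists>g. L2R g \<and> weak_derivative UNIV 1 (v t) g"
    and bd: "\<And>t. 0 < t \<Longrightarrow> t < T \<Longrightarrow> nr (v t) \<le> C"
    and fin: "(\<integral>\<^sup>+t. indicator {0<..<T} t * (SUP k. ennreal (nr (dq (y k) (v t)))) \<partial>lborel) < \<infinity>"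
    and y: "\<And>k. y k > 0" "y \<longlonglongrightarrow> 0" and "T > 0"
  shows "v \<in> Linf_sobolev T 0" "v \<in> L2_sobolev T 1"
proof -
  define dv where "dv t = (SOME g. L2R g \<and> weak_derivative UNIV 1 (v t) g)" for t
  have dv: "L2R (dv t)" "weak_derivative UNIV 1 (v t) (dv t)" for t
    using someI_ex[OF wd[of t]] by (auto simp: dv_def)
  define S where "S f = (SUP k. ennreal (nr (dq (y k) f)))" for f
  have slice [measurable]: "v s \<in> borel_measurable borel" for s
    using slice_measurable[OF v, of s] by simp
  have [measurable]: "(\<lambda>z::real \<times> real. v s (snd z)) \<in> borel_measurable borel" for s
    using measurable_compose[OF fst_snd_borel(2) slice] .
  have m0: "(\<lambda>t. nr (\<lambda>x. v s x - v t x)) \<in> borel_measurable borel" "(\<lambda>t. nr (v t)) \<in> borel_measurable borel" for s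
    using nr_measurable[of "\<lambda>z. v s (snd z) - v (fst z) (snd z)"] nr_measurable[OF v] by simp_all
  have m1: "(\<lambda>t. S (\<lambda>x. v s x - v t x)) \<in> borel_measurable borel" "(\<lambda>t. S (v t)) \<in> borel_measurable borel" for s
    using nr_dq_measurable[of "\<lambda>z. v s (snd z) - v (fst z) (snd z)"] nr_dq_measurable[OF v] unfolding S_def by simp_all
  have n0: "sobolev_norm 0 (\<lambda>x. v s x - v t x) = sqrt (nr (\<lambda>x. v s x - v t x))" for s t
    by (intro sobolev_0 L2_diff L)
  have n1: "sobolev_norm 1 (\<lambda>x. v s x - v t x) = sqrt (nr (\<lambda>x. v s x - v t x) + nr (\<lambda>x. dv s x - dv t x))" for s t
    by (intro sobolev_1(3) weak_derivative_diff L2_diff L dv)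
  have n1S: "nr (\<lambda>x. dv s x - dv t x) = enn2real (S (\<lambda>x. v s x - v t x))" for s t
    unfolding S_def by (intro nr_weak_derivative_SUP weak_derivative_diff L2_diff L dv y)
  have cover0: "\<exists>A :: nat \<Rightarrow> real set. {0<..<T} \<subseteq> (\<Union>i. A i) \<and>
       (\<forall>i. \<forall>s\<in>A i \<inter> {0<..<T}. \<forall>t\<in>A i \<inter> {0<..<T}. sobolev_norm 0 (\<lambda>x. v s x - v t x) < e)" if "e > 0" for e
  proof -
    have "e\<^sup>2 > 0" using that by simp
    obtain C :: "nat \<Rightarrow> (real \<Rightarrow> real) set" where C: "\<And>f. L2R f \<Longrightarrow> \<exists>i. f \<in> C i" "\<And>i f g. f \<in> C i \<Longrightarrow> g \<in> C i \<Longrightarrow> nr (\<lambda>x. f x - g x) < e\<^sup>2"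
      using L2R_countable_cover[OF \<open>e\<^sup>2 > 0\<close>] by blast
    have "sobolev_norm 0 (\<lambda>x. v s x - v t x) < e" if "v s \<in> C i" "v t \<in> C i" for s t i
      using real_sqrt_less_mono[OF C(2)[OF that]] \<open>e > 0\<close> by (simp add: n0)
    moreover have "\<exists>i. v t \<in> C i" for t by (rule C(1)[OF L])
    ultimately show ?thesis by (intro exI[of _ "\<lambda>i. {t. v t \<in> C i}"]) auto
  qed
  have cover1: "\<exists>A :: nat \<Rightarrow> real set. {0<..<T} \<subseteq> (\<Union>i. A i) \<and>
       (\<forall>i. \<forall>s\<in>A i \<inter> {0<..<T}. \<forall>t\<in>A i \<inter> {0<..<T}. sobolev_norm 1 (\<lambda>x. v s x - v t x) < e)" if "e > 0" for e
  proof -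
    have "e\<^sup>2 / 2 > 0" using that by simp
    obtain C :: "nat \<Rightarrow> (real \<Rightarrow> real) set" where C: "\<And>f. L2R f \<Longrightarrow> \<exists>i. f \<in> C i" "\<And>i f g. f \<in> C i \<Longrightarrow> g \<in> C i \<Longrightarrow> nr (\<lambda>x. f x - g x) < e\<^sup>2 / 2"
      using L2R_countable_cover[OF \<open>e\<^sup>2 / 2 > 0\<close>] by blast
    define A where "A n = {t. v t \<in> C (fst (prod_decode n)) \<and> dv t \<in> C (snd (prod_decode n))}" for n
    have norm: "sobolev_norm 1 (\<lambda>x. v s x - v t x) < e" if "v s \<in> C i" "v t \<in> C i" "dv s \<in> C j" "dv t \<in> C j" for s t i j
    proof -
      have "nr (\<lambda>x. v s x - v t x) + nr (\<lambda>x. dv s x - dv t x) < e\<^sup>2"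
        using C(2)[OF that(1,2)] C(2)[OF that(3,4)] by linarith
      from real_sqrt_less_mono[OF this] show ?thesis unfolding n1 using \<open>e > 0\<close> by simp
    qed
    have "sobolev_norm 1 (\<lambda>x. v s x - v t x) < e" if "s \<in> A n" "t \<in> A n" for n s t
      using that norm[of s "fst (prod_decode n)" t "snd (prod_decode n)"] by (simp add: A_def)
    moreover have "\<exists>n. t \<in> A n" for t
    proof -
      obtain i j where "v t \<in> C i" "dv t \<in> C j" using C(1)[OF L] C(1)[OF dv(1)] by metis
      then show ?thesis by (intro exI[of _ "prod_encode (i, j)"]) (simp add: A_def)
    qed
    ultimately show ?thesis by (intro exI[of _ A]) auto
  qed
  have "bochner_measurable T 0 v"
  proof (rule bochner_measurableI[where N="\<lambda>s t. sqrt (nr (\<lambda>x. v s x - v t x))"])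
    show "v t \<in> sobolev 0" for t by (rule sobolev_0(1)[OF L])
    show "(\<lambda>t. sqrt (nr (\<lambda>x. v s x - v t x))) \<in> borel_measurable borel" for s using m0(1)[of s] by simp
  qed (use cover0 n0 \<open>T > 0\<close> in auto)
  moreover have "AE t in lebesgue_on {0<..<T}. sobolev_norm 0 (v t) \<le> sqrt C"
    using bd L by (intro AE_I2) (auto simp: space_restrict_space sobolev_0)
  ultimately show "v \<in> Linf_sobolev T 0" by (auto simp: Linf_sobolev_def)
  have "bochner_measurable T 1 v"
  proof (rule bochner_measurableI[where N="\<lambda>s t. sqrt (nr (\<lambda>x. v s x - v t x) + enn2real (S (\<lambda>x. v s x - v t x)))"])
    show "v t \<in> sobolev 1" for t by (rule sobolev_1(1)[OF dv(2) L dv(1)])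
    show "(\<lambda>t. sqrt (nr (\<lambda>x. v s x - v t x) + enn2real (S (\<lambda>x. v s x - v t x)))) \<in> borel_measurable borel" for s
      using m0(1)[of s] m1(1)[of s] by simp
    show "sobolev_norm 1 (\<lambda>x. v s x - v t x) = sqrt (nr (\<lambda>x. v s x - v t x) + enn2real (S (\<lambda>x. v s x - v t x)))" for s t
      by (simp only: n1 n1S)
  qed (use cover1 \<open>T > 0\<close> in auto)
  moreover have "integrable (lebesgue_on {0<..<T}) (\<lambda>t. (sobolev_norm 1 (v t))\<^sup>2)"
  proof (subst integrable_lebesgue_on_eq)
    have "enn2real (S (v t)) = nr (dv t)" for t
      unfolding S_def by (intro nr_weak_derivative_SUP[symmetric] L dv y)
    then show "(sobolev_norm 1 (v t))\<^sup>2 = nr (v t) + enn2real (S (v t))" for t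
      using sobolev_1(3)[OF dv(2) L dv(1), of t] by simp
    show m: "(\<lambda>t. nr (v t) + enn2real (S (v t))) \<in> borel_measurable borel" using m0(2) m1(2) by simp
    show "integrable lborel (\<lambda>t. indicator {0<..<T} t * (nr (v t) + enn2real (S (v t))))"
    proof (rule integrableI_nonneg)
      show "(\<lambda>t. indicator {0<..<T} t * (nr (v t) + enn2real (S (v t)))) \<in> borel_measurable lborel" using m by simp
      show "AE t in lborel. 0 \<le> indicator {0<..<T} t * (nr (v t) + enn2real (S (v t)))" by simp
      have "(\<integral>\<^sup>+t. ennreal (indicator {0<..<T} t * (nr (v t) + enn2real (S (v t)))) \<partial>lborel)
          \<le> (\<integral>\<^sup>+t. ennreal C * indicator {0<..<T} t + indicator {0<..<T} t * S (v t) \<partial>lborel)"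
      proof (rule nn_integral_mono)
        fix t :: real
        have "ennreal (nr (v t) + enn2real (S (v t))) \<le> ennreal C + S (v t)" if "0 < t" "t < T"
        proof -
          have "ennreal (nr (v t) + enn2real (S (v t))) = ennreal (nr (v t)) + ennreal (enn2real (S (v t)))"
            by (intro ennreal_plus) auto
          also have "\<dots> \<le> ennreal C + S (v t)"
            using bd[OF that] by (intro add_mono ennreal_leI) (auto simp: ennreal_enn2real_if)
          finally show ?thesis .
        qed
        then show "ennreal (indicator {0<..<T} t * (nr (v t) + enn2real (S (v t)))) \<le> ennreal C * indicator {0<..<T} t + indicator {0<..<T} t * S (v t)"
          by (simp add: indicator_def)
      qed
      also have "\<dots> = ennreal C * ennreal T + (\<integral>\<^sup>+t. indicator {0<..<T} t * S (v t) \<partial>lborel)"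
        using m1(2) \<open>T > 0\<close> by (subst nn_integral_add) (auto simp: nn_integral_cmult_indicator)
      also have "\<dots> < \<infinity>" using fin by (simp add: S_def ennreal_mult_less_top)
      finally show "(\<integral>\<^sup>+t. ennreal (indicator {0<..<T} t * (nr (v t) + enn2real (S (v t)))) \<partial>lborel) < \<infinity>" .
    qed
  qed simp
  ultimately show "v \<in> L2_sobolev T 1" by (auto simp: L2_sobolev_def)
qed

section \<open>Regularity of the limit\<close>

context viscoplastic_limit
begin

lemma weak_dx_slice:
  assumes t: "t \<le> T" "0 \<le> T"
  shows "weak_derivative UNIV 1 (u t) (ux t)"
proof (rule weak_derivativeI[OF open_UNIV loc_int_L2[OF u_bounds(1)[OF t]] loc_int_L2[OF ux_props(1)[OF t]], of hs])
  show "hs k \<noteq> 0" for k using hs_pos[of k] by simp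
  show "hs \<longlonglongrightarrow> 0" by (rule hs_tendsto)
  fix \<phi> :: "real \<Rightarrow> real" and D assume \<phi>: "C1_compact_support UNIV \<phi> D"
  obtain C R where CR: "\<And>z. \<bar>\<phi> z\<bar> \<le> C" "\<And>z. norm z > R \<Longrightarrow> \<phi> z = 0"
    using C1_compact_support_bounded[OF \<phi>] by metis
  have [measurable]: "\<phi> \<in> borel_measurable borel" by (rule C1_compact_support_borel[OF \<phi>])
  define I :: "real \<Rightarrow> real" where "I = indicator {-R..R}"
  have pb: "\<bar>\<phi> z\<bar> \<le> C * I z" for z
    using CR(1)[of z] CR(2)[of z] by (cases "norm z > R") (auto simp: I_def indicator_def abs_le_iff)
  define c where "c = sqrt (4 * B T) + sqrt (B T)"
  have bd: "\<bar>dq (hs k) (u t) x\<bar> \<le> c" for k x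
  proof -
    have "\<bar>ux t x\<bar> \<le> sqrt (4 * B T)" using ux_props(8)[OF t, of x] by (intro real_le_rsqrt) simp
    moreover have "sqrt (B T * hs k) \<le> sqrt (B T)"
      using hs_le(2)[of k] B_nonneg[of T] by (simp add: mult_left_le)
    ultimately show ?thesis using ux_props(5)[OF t, of k x] unfolding c_def abs_le_iff by linarith
  qed
  show "(\<lambda>k. LINT z|lborel. dqv 1 (hs k) (u t) z * \<phi> z) \<longlonglongrightarrow> (LINT z|lborel. ux t z * \<phi> z)"
  proof (rule integral_dominated_convergence[where w="\<lambda>z. c * (C * I z)"])
    show "integrable lborel (\<lambda>z. c * (C * I z))"
      unfolding I_def by (intro integrable_mult_right integrable_indicator_Icc)
    show "AE z in lborel. (\<lambda>k. dqv 1 (hs k) (u t) z * \<phi> z) \<longlonglongrightarrow> ux t z * \<phi> z"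
      by (intro AE_I2 tendsto_mult_right ux_props(7)[OF t])
    show "AE z in lborel. norm (dqv 1 (hs k) (u t) z * \<phi> z) \<le> c * (C * I z)" for k
    proof (rule AE_I2)
      fix z
      show "norm (dqv 1 (hs k) (u t) z * \<phi> z) \<le> c * (C * I z)"
        unfolding real_norm_def abs_mult
        using bd[of k z] by (intro mult_mono bd pb) (auto intro: order_trans[OF abs_ge_zero])
    qed
  qed measurable
qed

lemma uxx_exists:
  assumes t: "t \<le> T" "0 \<le> T"
  obtains g where "L2R g" "nr g \<le> B T" "weak_derivative UNIV 1 (ux t) g"
proof -
  have "\<And>k. hs k \<noteq> 0" using hs_pos by (metis less_irrefl)
  from weak_derivative_of_bounded_dqv[OF ux_props(1)[OF t] this hs_tendsto ux_props(4)[OF t]]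
  show ?thesis using that by blast
qed

lemma u_sobolev_norm_diff:
  fixes s t :: real
  obtains gs gt where "L2R gs" "L2R gt" "weak_derivative UNIV 1 (ux s) gs" "weak_derivative UNIV 1 (ux t) gt"
    "sobolev_norm 2 (\<lambda>x. u s x - u t x) = sqrt (nr (\<lambda>x. u s x - u t x) + nr (\<lambda>x. ux s x - ux t x) + nr (\<lambda>x. gs x - gt x))"
proof -
  have T: "s \<le> max 0 s" "0 \<le> max 0 s" "t \<le> max 0 t" "0 \<le> max 0 t" by auto
  obtain gs where gs: "L2R gs" "weak_derivative UNIV 1 (ux s) gs" using uxx_exists[OF T(1,2)] by blast
  obtain gt where gt: "L2R gt" "weak_derivative UNIV 1 (ux t) gt" using uxx_exists[OF T(3,4)] by blast
  note us = u_bounds(1)[OF T(1,2)] u_bounds(1)[OF T(3,4)] ux_props(1)[OF T(1,2)] ux_props(1)[OF T(3,4)]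
  have "sobolev_norm 2 (\<lambda>x. u s x - u t x) = sqrt (nr (\<lambda>x. u s x - u t x) + nr (\<lambda>x. ux s x - ux t x) + nr (\<lambda>x. gs x - gt x))"
    by (rule sobolev_2(2)[OF weak_derivative_diff[OF weak_dx_slice[OF T(1,2)] weak_dx_slice[OF T(3,4)]] weak_derivative_diff[OF gs(2) gt(2)]])
      (intro us gs gt L2_diff)+
  then show ?thesis using that gs gt by blast
qed

text \<open>As in \<open>Linf_L2_sobolevI\<close>, with triples of cells for \<open>u\<close>,
  \<open>ux\<close> and a chosen second derivative. Only the latter needs the supremum formula,
  because \<open>ux\<close> is jointly measurable.\<close>

lemma u_bochner:
  assumes "T > 0" shows "bochner_measurable T 2 u"
proof -
  define N where "N s t = sqrt (nr (\<lambda>x. u s x - u t x) + nr (\<lambda>x. ux s x - ux t x)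
      + enn2real (SUP k. ennreal (nr (dq (hs k) (\<lambda>x. ux s x - ux t x)))))" for s t
  have T: "t \<le> max 0 t" "0 \<le> max 0 t" for t :: real by auto
  note L = u_bounds(1)[OF T] ux_props(1)[OF T]
  have Neq: "sobolev_norm 2 (\<lambda>x. u s x - u t x) = N s t" for s t
  proof -
    obtain gs gt where g: "L2R gs" "L2R gt" "weak_derivative UNIV 1 (ux s) gs" "weak_derivative UNIV 1 (ux t) gt"
      "sobolev_norm 2 (\<lambda>x. u s x - u t x) = sqrt (nr (\<lambda>x. u s x - u t x) + nr (\<lambda>x. ux s x - ux t x) + nr (\<lambda>x. gs x - gt x))"
      by (rule u_sobolev_norm_diff)
    have "nr (\<lambda>x. gs x - gt x) = enn2real (SUP k. ennreal (nr (dq (hs k) (\<lambda>x. ux s x - ux t x))))"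
      by (rule nr_weak_derivative_SUP[OF weak_derivative_diff[OF g(3,4) L(2) g(1) L(2) g(2)] L2_diff[OF L(2,2)] L2_diff[OF g(1,2)] hs_pos hs_tendsto])
    then show ?thesis using g(5) by (simp add: N_def)
  qed
  show ?thesis
  proof (rule bochner_measurableI[where N=N])
    show "u t \<in> sobolev 2" for t
    proof -
      obtain g where g: "L2R g" "weak_derivative UNIV 1 (ux t) g" using uxx_exists[OF T[of t]] by blast
      show ?thesis by (rule sobolev_2(1)[OF weak_dx_slice[OF T] g(2) L g(1)])
    qed
    have [measurable]: "(\<lambda>z::real \<times> real. u s (snd z)) \<in> borel_measurable borel" for s
      using measurable_compose[OF fst_snd_borel(2) u_x_measurable] .
    have [measurable]: "(\<lambda>z::real \<times> real. ux s (snd z)) \<in> borel_measurable borel" for s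
      using measurable_compose[OF fst_snd_borel(2) ux_x_measurable] .
    have "(\<lambda>t. nr (\<lambda>x. u s x - u t x)) \<in> borel_measurable borel" for s
      using nr_measurable[of "\<lambda>z. u s (snd z) - u (fst z) (snd z)"] by simp
    moreover have "(\<lambda>t. nr (\<lambda>x. ux s x - ux t x)) \<in> borel_measurable borel" for s
      using nr_measurable[of "\<lambda>z. ux s (snd z) - ux (fst z) (snd z)"] by simp
    moreover have "(\<lambda>t. nr (dq y (\<lambda>x. ux s x - ux t x))) \<in> borel_measurable borel" for s y
      using nr_dq_measurable[of "\<lambda>z. ux s (snd z) - ux (fst z) (snd z)"] by simp
    ultimately show "N s \<in> borel_measurable borel" for s
      unfolding N_def[abs_def] by measurable
    show "sobolev_norm 2 (\<lambda>x. u s x - u t x) = N s t" for s t by (rule Neq)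
    show "0 \<le> N s t" for s t by (simp add: N_def)
    fix e :: real assume "e > 0"
    define d where "d = e\<^sup>2 / 3"
    have d: "d > 0" using \<open>e > 0\<close> by (simp add: d_def)
    obtain C :: "nat \<Rightarrow> (real \<Rightarrow> real) set" where C: "\<And>f. L2R f \<Longrightarrow> \<exists>i. f \<in> C i" "\<And>i f g. f \<in> C i \<Longrightarrow> g \<in> C i \<Longrightarrow> nr (\<lambda>x. f x - g x) < d"
      using L2R_countable_cover[OF d] by blast
    define gg where "gg t = (SOME g. L2R g \<and> weak_derivative UNIV 1 (ux t) g)" for t
    have gg: "L2R (gg t)" "weak_derivative UNIV 1 (ux t) (gg t)" for t
    proof -
      have "\<exists>g. L2R g \<and> weak_derivative UNIV 1 (ux t) g" using uxx_exists[OF T[of t]] by blast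
      from someI_ex[OF this] show "L2R (gg t)" "weak_derivative UNIV 1 (ux t) (gg t)" by (auto simp: gg_def)
    qed
    define A where "A n = (case prod_decode n of (i, m) \<Rightarrow> (case prod_decode m of (j, k) \<Rightarrow> {t. u t \<in> C i \<and> ux t \<in> C j \<and> gg t \<in> C k}))" for n
    have "\<exists>n. t \<in> A n" for t
    proof -
      obtain i j k where "u t \<in> C i" "ux t \<in> C j" "gg t \<in> C k" using C(1)[OF L(1)] C(1)[OF L(2)] C(1)[OF gg(1)] by metis
      then show ?thesis by (intro exI[of _ "prod_encode (i, prod_encode (j, k))"]) (simp add: A_def)
    qed
    moreover have "sobolev_norm 2 (\<lambda>x. u s x - u t x) < e" if "s \<in> A n" "t \<in> A n" for n s t
    proof -
      obtain i j k where ijk: "u s \<in> C i" "u t \<in> C i" "ux s \<in> C j" "ux t \<in> C j" "gg s \<in> C k" "gg t \<in> C k"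
      proof -
        obtain i m where "prod_decode n = (i, m)" by (cases "prod_decode n")
        moreover obtain j k where "prod_decode m = (j, k)" by (cases "prod_decode m")
        ultimately show ?thesis using that(1)[of i j k] \<open>s \<in> A n\<close> \<open>t \<in> A n\<close> by (simp add: A_def)
      qed
      have "sobolev_norm 2 (\<lambda>x. u s x - u t x) = sqrt (nr (\<lambda>x. u s x - u t x) + nr (\<lambda>x. ux s x - ux t x) + nr (\<lambda>x. gg s x - gg t x))"
        by (rule sobolev_2(2)[OF weak_derivative_diff[OF weak_dx_slice[OF T] weak_dx_slice[OF T]] weak_derivative_diff[OF gg(2) gg(2)]])
          (intro L gg L2_diff)+
      also have "\<dots> < sqrt (e\<^sup>2)"
        using C(2)[OF ijk(1,2)] C(2)[OF ijk(3,4)] C(2)[OF ijk(5,6)] by (intro real_sqrt_less_mono) (simp add: d_def)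
      finally show ?thesis using \<open>e > 0\<close> by simp
    qed
    ultimately show "\<exists>A :: nat \<Rightarrow> real set. {0<..<T} \<subseteq> (\<Union>i. A i) \<and>
       (\<forall>i. \<forall>s\<in>A i \<inter> {0<..<T}. \<forall>t\<in>A i \<inter> {0<..<T}. sobolev_norm 2 (\<lambda>x. u s x - u t x) < e)"
      by (intro exI[of _ A]) auto
  qed (use assms in auto)
qed

lemma u_Linf:
  assumes "T > 0" shows "u \<in> Linf_sobolev T 2"
proof -
  have "sobolev_norm 2 (u t) \<le> sqrt (3 * B T)" if "t \<in> {0<..<T}" for t
  proof -
    have t: "t \<le> T" "0 \<le> T" using that by auto
    obtain g where g: "L2R g" "nr g \<le> B T" "weak_derivative UNIV 1 (ux t) g" using uxx_exists[OF t] by blast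
    show ?thesis
      unfolding sobolev_2(2)[OF weak_dx_slice[OF t] g(3) u_bounds(1)[OF t] ux_props(1)[OF t] g(1)]
      using g(2) u_bounds(2)[OF t] ux_props(2)[OF t] by simp
  qed
  then have "AE t in lebesgue_on {0<..<T}. sobolev_norm 2 (u t) \<le> sqrt (3 * B T)"
    by (intro AE_I2) (auto simp: space_restrict_space)
  then show ?thesis using u_bochner[OF assms] by (auto simp: Linf_sobolev_def)
qed

lemma u_tendsto_0: "(u t \<longlongrightarrow> 0) at_infinity"
proof -
  have t: "t \<le> max 0 t" "0 \<le> max 0 t" by auto
  show ?thesis by (rule L2_Holder_tendsto_0[OF u_bounds(1)[OF t] u_Holder[OF t]])
qed

text \<open>Each of the three fluxes is \<open>u\<close> times a factor bounded up to time
  \<open>T\<close>. For every \<open>t\<close> the function \<open>u t\<close> vanishes at infinity,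
  and dominated convergence in \<open>t\<close> passes this to the integrals.\<close>

lemma vanishing_fluxI:
  assumes F: "\<And>t x. F t x = u t x * G t x" and [measurable]: "(\<lambda>z. G (fst z) (snd z)) \<in> borel_measurable borel"
    and C: "\<And>t x. 0 \<le> t \<Longrightarrow> t \<le> T \<Longrightarrow> \<bar>G t x\<bar> \<le> C" and "T > 0"
  shows "vanishing_flux T F"
proof -
  have Gx [measurable]: "(\<lambda>t. G t x) \<in> borel_measurable borel" for x
    using measurable_compose[of "\<lambda>t. (t, x)" borel borel "\<lambda>z. G (fst z) (snd z)" borel] by simp
  have ux' [measurable]: "(\<lambda>t. u t x) \<in> borel_measurable borel" for x
    using measurable_compose[of "\<lambda>t. (t, x)" borel borel "\<lambda>z. u (fst z) (snd z)" borel] by simp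
  have C0: "0 \<le> C" using C[of 0 0] \<open>T > 0\<close> by (intro order_trans[OF abs_ge_zero[of "G 0 0"]]) auto
  have bd: "\<bar>indicator {0<..<T} t * (u t x * G t x)\<bar> \<le> (M * C) * indicator {0..T} t" for t x
  proof (cases "t \<in> {0<..<T}")
    case True
    then have "\<bar>u t x\<bar> * \<bar>G t x\<bar> \<le> M * C" using u_bound M by (intro mult_mono C) auto
    then show ?thesis using True by (simp add: abs_mult)
  next
    case False
    then have "indicator {0<..<T} t = (0::real)" by simp
    then show ?thesis using M C0 by simp
  qed
  have eq: "(LINT t|lebesgue_on {0<..<T}. F t x) = (LINT t|lborel. indicator {0<..<T} t * (u t x * G t x))" for x
    by (rule integral_lebesgue_on_eq) (auto simp: F)
  have int: "integrable lborel (\<lambda>t. indicator {0<..<T} t * (u t x * G t x))" for x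
    using \<open>T > 0\<close> by (intro integral_bounded_support(1)[OF _ bd]) auto
  have lim: "((\<lambda>r. LINT t|lborel. indicator {0<..<T} t * (u t (c * r) * G t (c * r))) \<longlongrightarrow> 0) at_top" if c: "c = 1 \<or> c = -1" for c :: real
  proof -
    have "((\<lambda>r. LINT t|lborel. indicator {0<..<T} t * (u t (c * r) * G t (c * r))) \<longlongrightarrow> (LINT t|(lborel::real measure). 0)) at_top"
    proof (rule integral_dominated_convergence_at_top[where w="\<lambda>t. (M * C) * indicator {0..T} t"])
      show "integrable lborel (\<lambda>t. (M * C) * indicator {0..T} t)" by (intro integrable_mult_right integrable_indicator_Icc)
      show "\<forall>\<^sub>F r in at_top. AE t in lborel. norm (indicator {0<..<T} t * (u t (c * r) * G t (c * r))) \<le> M * C * indicator {0..T} t"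
        using bd by (auto intro!: always_eventually)
      have inf: "filterlim (\<lambda>r. c * r) at_infinity at_top"
      proof (cases "c = 1")
        case True
        then show ?thesis using filterlim_mono[OF filterlim_ident at_top_le_at_infinity order_refl] by simp
      next
        case False
        then have "c = -1" using c by simp
        then show ?thesis
          using filterlim_mono[OF filterlim_uminus_at_bot_at_top at_bot_le_at_infinity order_refl] by simp
      qed
      show "AE t in lborel. ((\<lambda>r. indicator {0<..<T} t * (u t (c * r) * G t (c * r))) \<longlongrightarrow> 0) at_top"
      proof (rule AE_I2)
        fix t
        show "((\<lambda>r. indicator {0<..<T} t * (u t (c * r) * G t (c * r))) \<longlongrightarrow> 0) at_top"
        proof (cases "t \<in> {0<..<T}")
          case True
          have "((\<lambda>r. u t (c * r)) \<longlongrightarrow> 0) at_top" by (rule filterlim_compose[OF u_tendsto_0 inf])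
          then have "((\<lambda>r. C * \<bar>u t (c * r)\<bar>) \<longlongrightarrow> C * \<bar>0\<bar>) at_top" by (intro tendsto_intros)
          then have z: "((\<lambda>r. C * \<bar>u t (c * r)\<bar>) \<longlongrightarrow> 0) at_top" by simp
          have "\<bar>u t x * G t x\<bar> \<le> C * \<bar>u t x\<bar>" for x
            unfolding abs_mult using mult_left_mono[OF C[of t x] abs_ge_zero[of "u t x"]] True by (simp add: mult.commute)
          then have "((\<lambda>r. u t (c * r) * G t (c * r)) \<longlongrightarrow> 0) at_top"
            by (intro Lim_null_comparison[OF always_eventually z]) simp
          then show ?thesis using True by simp
        qed simp
      qed
    qed measurable
    then show ?thesis by simp
  qed
  show ?thesis
    unfolding vanishing_flux_def eq
    using lim[of 1] lim[of "-1"] int integrable_lebesgue_on_eq[of "\<lambda>t. u t x * G t x" "{0<..<T}" "\<lambda>t. F t x" for x] by (simp add: F)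
qed

lemma B_mono: "S \<le> T \<Longrightarrow> B S \<le> B T"
  unfolding B_def using \<kappa>_nonneg B0_ge(6) by (intro mult_right_mono) (auto intro: mult_left_mono)

lemma loc_int_u: "loc_int (\<lambda>(t, x). u t x)"
  by (rule loc_int_bounded) (use u_bound u_measurable in \<open>auto simp: case_prod_beta'\<close>)

lemma ux_abs_le: "t \<le> T \<Longrightarrow> 0 \<le> T \<Longrightarrow> \<bar>ux t x\<bar> \<le> sqrt (4 * B T)"
  using ux_props(8)[of t T x] by (intro real_le_rsqrt) simp

lemma weak_dx_u: "weak_dx u ux"
proof (rule weak_derivativeI[OF open_half_plane loc_int_u, of _ hs])
  show g: "loc_int (\<lambda>(t, x). ux t x)"
  proof (rule loc_int_bounded)
    show "(\<lambda>(t, x). ux t x) \<in> borel_measurable borel" using ux_measurable by (simp add: case_prod_beta')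
    fix R
    show "\<exists>b. \<forall>z\<in>cball 0 R. \<bar>case z of (t, x) \<Rightarrow> ux t x\<bar> \<le> b"
    proof (intro exI[of _ "sqrt (4 * B \<bar>R\<bar>)"] ballI)
      fix z :: "real \<times> real" assume z: "z \<in> cball 0 R"
      obtain t x where tx: "z = (t, x)" by (cases z)
      have "t \<le> \<bar>R\<bar>" using z norm_fst_le[of t x] by (simp add: tx)
      then show "\<bar>case z of (t, x) \<Rightarrow> ux t x\<bar> \<le> sqrt (4 * B \<bar>R\<bar>)" using ux_abs_le[of t "\<bar>R\<bar>" x] by (simp add: tx)
    qed
  qed
  show "hs k \<noteq> 0" for k using hs_pos[of k] by simp
  show "hs \<longlonglongrightarrow> 0" by (rule hs_tendsto)
  fix \<phi> :: "real \<times> real \<Rightarrow> real" and D K assume \<phi>: "C1_compact_support UNIV \<phi> D"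
  obtain C R where CR: "\<And>z. \<bar>\<phi> z\<bar> \<le> C" "\<And>z. norm z > R \<Longrightarrow> \<phi> z = 0"
    using C1_compact_support_bounded[OF \<phi>] by metis
  have [measurable]: "\<phi> \<in> borel_measurable borel" by (rule C1_compact_support_borel[OF \<phi>])
  have [measurable]: "(\<lambda>(t, x). u t x) \<in> borel_measurable borel" "(\<lambda>(t, x). ux t x) \<in> borel_measurable borel"
    using u_measurable ux_measurable by (simp_all add: case_prod_beta')
  define c where "c = sqrt (4 * B \<bar>R\<bar>) + sqrt (B \<bar>R\<bar>)"
  have dqv: "dqv (0, 1) (hs k) (\<lambda>(t, x). u t x) z = dq (hs k) (u (fst z)) (snd z)" for k z
    by (simp add: dqv_def case_prod_beta')
  have bd: "\<bar>dq (hs k) (u t) x\<bar> \<le> c" if "t \<le> \<bar>R\<bar>" for k t x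
  proof -
    have "sqrt (B \<bar>R\<bar> * hs k) \<le> sqrt (B \<bar>R\<bar>)"
      using hs_le(2)[of k] B_nonneg[of "\<bar>R\<bar>"] by (simp add: mult_left_le)
    moreover have "\<bar>dq (hs k) (u t) x - ux t x\<bar> \<le> sqrt (B \<bar>R\<bar> * hs k)" "\<bar>ux t x\<bar> \<le> sqrt (4 * B \<bar>R\<bar>)"
      by (rule ux_props(5)[OF that abs_ge_zero], rule ux_abs_le[OF that abs_ge_zero])
    ultimately show ?thesis unfolding c_def by argo
  qed
  show "(\<lambda>k. LINT z|lborel. dqv (0, 1) (hs k) (\<lambda>(t, x). u t x) z * \<phi> z) \<longlonglongrightarrow> (LINT z|lborel. (case z of (t, x) \<Rightarrow> ux t x) * \<phi> z)"
  proof (rule integral_dominated_convergence[where w="\<lambda>z. c * (C * indicator (cball 0 R) z)"])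
    show "integrable lborel (\<lambda>z. c * (C * indicator (cball 0 R) z) :: real)"
      by (intro integrable_mult_right integrable_real_indicator emeasure_bounded_finite) auto
    show "AE z in lborel. (\<lambda>k. dqv (0, 1) (hs k) (\<lambda>(t, x). u t x) z * \<phi> z) \<longlonglongrightarrow> (case z of (t, x) \<Rightarrow> ux t x) * \<phi> z"
    proof (rule AE_I2)
      fix z :: "real \<times> real"
      have "(\<lambda>k. dq (hs k) (u (fst z)) (snd z)) \<longlonglongrightarrow> ux (fst z) (snd z)"
        by (rule ux_props(7)[of _ "max 0 (fst z)"]) auto
      then show "(\<lambda>k. dqv (0, 1) (hs k) (\<lambda>(t, x). u t x) z * \<phi> z) \<longlonglongrightarrow> (case z of (t, x) \<Rightarrow> ux t x) * \<phi> z"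
          unfolding dqv by (cases z) (auto intro: tendsto_mult_right)
    qed
    show "AE z in lborel. norm (dqv (0, 1) (hs k) (\<lambda>(t, x). u t x) z * \<phi> z) \<le> c * (C * indicator (cball 0 R) z)" for k
    proof (rule AE_I2)
      fix z :: "real \<times> real"
      show "norm (dqv (0, 1) (hs k) (\<lambda>(t, x). u t x) z * \<phi> z) \<le> c * (C * indicator (cball 0 R) z)"
      proof (cases "norm z > R")
        case False
        then have "fst z \<le> \<bar>R\<bar>" using norm_fst_le[of "fst z" "snd z"] by simp
        from bd[OF this, of k "snd z"] have "\<bar>dq (hs k) (u (fst z)) (snd z)\<bar> * \<bar>\<phi> z\<bar> \<le> c * C"
          using CR(1)[of z] by (intro mult_mono) (auto intro: order_trans[OF abs_ge_zero])
        then show ?thesis using False by (simp add: dqv abs_mult)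
      qed (simp add: CR(2))
    qed
  qed measurable
qed

section \<open>The weak time derivative\<close>

definition tq :: "nat \<Rightarrow> real \<times> real \<Rightarrow> real" where
  "tq k z = (u (fst z + \<tau>s k) (snd z) - u (fst z) (snd z)) / \<tau>s k"

text \<open>The space quotient cut off to a time window, as a linear operation on functions of the
  plane: bounds on it survive midpoints and limits.\<close>

definition \<Psi> :: "real \<Rightarrow> nat \<Rightarrow> (real \<times> real \<Rightarrow> real) \<Rightarrow> real \<times> real \<Rightarrow> real" where
  "\<Psi> T j h z = indicator {0..<T} (fst z) * ((h (fst z, snd z + hs j) - h z) / hs j)"

lemma \<Psi>_measurable [measurable]:
  assumes [measurable]: "h \<in> borel_measurable borel" shows "\<Psi> T j h \<in> borel_measurable borel"
proof -
  note [measurable] = shift_measurable(2)[OF assms]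
  show ?thesis unfolding \<Psi>_def[abs_def] by measurable
qed

lemma tq_measurable [measurable]: "tq k \<in> borel_measurable borel"
proof -
  note [measurable] = shift_measurable(1)[OF u_measurable, of "\<tau>s k" 0, simplified]
  show ?thesis unfolding tq_def[abs_def] by measurable
qed

text \<open>Before the limit, \<open>\<tau>s k\<close> and \<open>hs j\<close> are
  \<open>4 ^ (r i - k)\<close> time steps and \<open>2 ^ (r i - j)\<close> space steps of level
  \<open>r i\<close>, so \<open>time_quotient_dissipation\<close> applies; Fatou then removes
  \<open>i\<close>.\<close>

lemma \<Psi>_tq: "L2R (\<Psi> T j (tq k)) \<and> nr (\<Psi> T j (tq k)) \<le> B T" if "0 \<le> T"
proof -
  define q where "q i z = (V (r i) (fst z + \<tau>s k) (snd z) - V (r i) (fst z) (snd z)) / \<tau>s k" for i z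
  have qm [measurable]: "q i \<in> borel_measurable borel" for i
  proof -
    note [measurable] = shift_measurable(1)[OF V_measurable[of "r i"], of "\<tau>s k" 0, simplified]
    show ?thesis unfolding q_def[abs_def] by measurable
  qed
  have "\<forall>\<^sub>F i in sequentially. L2R (\<Psi> T j (q i)) \<and> nr (\<Psi> T j (q i)) \<le> B T"
    using r_large[of "max j k"]
  proof eventually_elim
    case (elim i)
    define n l where "n = (4::nat) ^ (r i - k)" and "l = (2::nat) ^ (r i - j)"
    have nl: "\<tau>s k = real n * sc.\<tau> (r i)" "hs j = real l * hs (r i)" "0 < n" "0 < l"
      using \<tau>s_multiple[of k "r i"] hs_multiple[of j "r i"] elim by (auto simp: n_def l_def sc_consts)
    have qL: "L2R (\<lambda>x. q i (t, x))" for t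
      using L2_cmult[OF L2_diff[OF V_props(1)[of "r i" "t + \<tau>s k"] V_props(1)[of "r i" t]], of "1 / \<tau>s k"] by (simp add: q_def)
    have "(\<integral>\<^sup>+x. ennreal ((\<Psi> T j (q i) (t, x))\<^sup>2) \<partial>lborel) = indicator {0..<T} t * ennreal (nr (dq (hs j) (\<lambda>x. q i (t, x))))" for t
    proof -
      have "\<Psi> T j (q i) (t, x) = indicator {0..<T} t * dq (hs j) (\<lambda>x. q i (t, x)) x" for x
        by (simp add: \<Psi>_def dq_eq)
      then show ?thesis using nn_integral_square_eq[OF L2R_dqv[OF qL[of t], of 1 "hs j"]] by (simp add: indicator_def)
    qed
    then have "(\<integral>\<^sup>+t. \<integral>\<^sup>+x. ennreal ((\<Psi> T j (q i) (t, x))\<^sup>2) \<partial>lborel \<partial>lborel)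
        = (\<integral>\<^sup>+t. indicator {0..<T} t * ennreal (nr (dq (real l * hs (r i)) (\<lambda>x. (sc.U (r i) u0 (t + real n * sc.\<tau> (r i)) x - sc.U (r i) u0 t x) / (real n * sc.\<tau> (r i))))) \<partial>lborel)"
      by (simp add: q_def V_def nl(1)[symmetric] nl(2)[symmetric])
    also have "\<dots> \<le> ennreal (2 / \<epsilon> * (exp (sc.K * (T + real n * sc.\<tau> (r i) + sc.\<tau> (r i))) * nr (sc.F (r i) u0)))"
      by (rule sc.time_quotient_dissipation[OF u0 that nl(3,4)])
    also have "\<dots> \<le> ennreal (B T)"
    proof (rule ennreal_leI)
      have e: "T + \<tau>s k + \<tau>s (r i) \<le> T + 2" using \<tau>s_le_1[of k] \<tau>s_le_1[of "r i"] by linarith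
      have "2 / \<epsilon> * (exp (sc.K * (T + real n * sc.\<tau> (r i) + sc.\<tau> (r i))) * nr (sc.F (r i) u0))
          = exp (\<kappa> * (T + \<tau>s k + \<tau>s (r i))) * (2 / \<epsilon> * nr (sc.F (r i) u0))"
        unfolding nl(1)[symmetric] by (simp add: sc_consts)
      also have "\<dots> \<le> exp (\<kappa> * (T + \<tau>s k + \<tau>s (r i))) * (2 / \<epsilon> * W0)"
        using nr_F_u0[of "r i"] eps by (intro mult_left_mono divide_right_mono) auto
      also have "\<dots> \<le> B T"
        by (rule B_ge[OF e B0_ge(5)]) (use W0_nonneg eps in auto)
      finally show "2 / \<epsilon> * (exp (sc.K * (T + real n * sc.\<tau> (r i) + sc.\<tau> (r i))) * nr (sc.F (r i) u0)) \<le> B T" .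
    qed
    finally show ?case by (intro L2R_iterated B_nonneg) measurable
  qed
  moreover have "AE z in lborel. (\<lambda>i. \<Psi> T j (q i) z) \<longlonglongrightarrow> \<Psi> T j (tq k) z"
    unfolding \<Psi>_def q_def tq_def using hs_pos[of j] \<tau>s_pos[of k]
    by (intro AE_I2 tendsto_intros conv) auto
  ultimately show ?thesis
    using L2_Fatou[of "\<Psi> T j (tq k)" lborel "\<lambda>i. \<Psi> T j (q i)" "B T"] by simp
qed

lemma tq_slice: "0 \<le> t \<Longrightarrow> L2R (\<lambda>x. tq k (t, x)) \<and> nr (\<lambda>x. tq k (t, x)) \<le> B (t + 1)"
proof -
  assume t: "0 \<le> t"
  have L: "L2R (\<lambda>x. u (t + \<tau>s k) x - u t x)"
    using u_bounds(1)[of "t + \<tau>s k" "t + \<tau>s k"] u_bounds(1)[of t t] t \<tau>s_pos[of k] by (intro L2_diff) auto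
  have eq: "(\<lambda>x. tq k (t, x)) = (\<lambda>x. (1 / \<tau>s k) * (u (t + \<tau>s k) x - u t x))" by (simp add: tq_def)
  have "nr (\<lambda>x. u (t + \<tau>s k) x - u t x) \<le> (t + \<tau>s k - t)\<^sup>2 * B (t + 1)"
    by (rule u_time_diff) (use t \<tau>s_pos[of k] \<tau>s_le_1[of k] in auto)
  then have "(1 / \<tau>s k)\<^sup>2 * nr (\<lambda>x. u (t + \<tau>s k) x - u t x) \<le> (1 / \<tau>s k)\<^sup>2 * ((\<tau>s k)\<^sup>2 * B (t + 1))"
    by (intro mult_left_mono) auto
  then show ?thesis unfolding eq nsq_cmult using L2_cmult[OF L, of "1 / \<tau>s k"] \<tau>s_pos[of k]
    by (intro conjI) (assumption, simp add: power_divide)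
qed

text \<open>The weight makes the difference quotients in time bounded in \<open>L\<^sup>2\<close> of the whole half plane, so that
  a single weak limit serves all \<open>T\<close>.\<close>

definition "wt t = exp (- (\<kappa> + 1) * t)"
definition gk :: "nat \<Rightarrow> real \<times> real \<Rightarrow> real" where "gk k z = indicator {0<..} (fst z) * (wt (fst z) * tq k z)"
text \<open>A bound for each time slice of \<open>gk\<close> is recorded separately, because an
  essential bound in time cannot be recovered from the norm on the half plane.\<close>

definition "\<beta> t = indicator {0<..} t * ((wt t)\<^sup>2 * B (t + 1))"

lemma wt_measurable [measurable]: "wt \<in> borel_measurable borel"
  unfolding wt_def[abs_def] by measurable

lemma gk_measurable [measurable]: "gk k \<in> borel_measurable borel"
  unfolding gk_def[abs_def] by measurable

lemma wt_le_1: "0 \<le> t \<Longrightarrow> wt t \<le> 1" "0 < wt t"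
proof -
  have "- (\<kappa> + 1) * t \<le> 0" if "0 \<le> t" using mult_nonneg_nonneg[of "\<kappa> + 1" t] \<kappa>_nonneg that by linarith
  then show "0 \<le> t \<Longrightarrow> wt t \<le> 1" "0 < wt t" unfolding wt_def by (simp_all only: exp_le_one_iff exp_gt_zero)
qed

lemma gk_slice: "L2R (\<lambda>x. gk k (t, x)) \<and> nr (\<lambda>x. gk k (t, x)) \<le> \<beta> t"
proof (cases "0 < t")
  case True
  have eq: "(\<lambda>x. gk k (t, x)) = (\<lambda>x. wt t * tq k (t, x))" using True by (simp add: gk_def)
  show ?thesis unfolding eq nsq_cmult \<beta>_def using tq_slice[of t k] True L2_cmult[of lborel "\<lambda>x. tq k (t, x)" "wt t"]
    by (simp add: mult_left_mono)
qed (simp add: gk_def \<beta>_def)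

lemma \<beta>_nonneg: "0 \<le> \<beta> t" using B_nonneg by (simp add: \<beta>_def)

text \<open>The squared weight contributes \<open>exp (- 2 * (\<kappa> + 1) * t)\<close> against the
  growth \<open>exp (\<kappa> * (t + 3))\<close> of \<open>B (t + 1)\<close>; at least the
  integrable decay \<open>exp (- t)\<close> remains.\<close>

lemma \<beta>_integral: "(\<integral>\<^sup>+t. ennreal (\<beta> t) \<partial>lborel) \<le> ennreal (exp (3 * \<kappa>) * B0)"
proof -
  have "(\<integral>\<^sup>+t. ennreal (\<beta> t) \<partial>lborel) \<le> (\<integral>\<^sup>+t. ennreal (exp (3 * \<kappa>) * B0) * (ennreal (exp (- t)) * indicator {0..} t) \<partial>lborel)"
  proof (rule nn_integral_mono)
    fix t :: real
    show "ennreal (\<beta> t) \<le> ennreal (exp (3 * \<kappa>) * B0) * (ennreal (exp (- t)) * indicator {0..} t)"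
    proof (cases "0 < t")
      case True
      have "\<beta> t = exp (2 * (- (\<kappa> + 1) * t) + \<kappa> * (t + 1 + 2)) * B0"
        using True by (simp add: \<beta>_def wt_def B_def exp_add exp_double)
      also have "2 * (- (\<kappa> + 1) * t) + \<kappa> * (t + 1 + 2) = 3 * \<kappa> + (- t - (\<kappa> * t + t))" by (simp add: algebra_simps)
      also have "exp (3 * \<kappa> + (- t - (\<kappa> * t + t))) * B0 \<le> exp (3 * \<kappa> + (- t)) * B0"
        using True mult_nonneg_nonneg[OF \<kappa>_nonneg, of t] B0_ge(6) by (intro mult_right_mono) auto
      also have "\<dots> = exp (3 * \<kappa>) * B0 * exp (- t)" unfolding exp_add by (simp only: ac_simps)
      finally show ?thesis using True B0_ge(6) by (simp add: ennreal_mult[symmetric] ennreal_leI)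
    qed (simp add: \<beta>_def)
  qed
  also have "\<dots> = ennreal (exp (3 * \<kappa>) * B0) * (\<integral>\<^sup>+t. ennreal (exp (- t)) * indicator {0..} t \<partial>lborel)"
    by (rule nn_integral_cmult) measurable
  also have "(\<integral>\<^sup>+t. ennreal (exp (- t)) * indicator {0..} t \<partial>lborel) = ennreal (0 - (- exp (- 0)))"
  proof (rule nn_integral_FTC_atLeast)
    show "((\<lambda>t. - exp (- t)) has_real_derivative exp (- x)) (at x)" for x :: real
      by (auto intro!: derivative_eq_intros)
    have "((\<lambda>t. exp (- t)) \<longlongrightarrow> (0::real)) at_top"
      by (rule filterlim_compose[OF exp_at_bot filterlim_uminus_at_bot_at_top])
    from tendsto_minus[OF this] show "((\<lambda>t. - exp (- t)) \<longlongrightarrow> (0::real)) at_top" by simp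
  qed auto
  finally show ?thesis by simp
qed

lemma gk_L2: "L2R (gk k) \<and> nr (gk k) \<le> exp (3 * \<kappa>) * B0"
proof (rule L2R_iterated)
  have "(\<integral>\<^sup>+t. \<integral>\<^sup>+x. ennreal ((gk k (t, x))\<^sup>2) \<partial>lborel \<partial>lborel) \<le> (\<integral>\<^sup>+t. ennreal (\<beta> t) \<partial>lborel)"
    using gk_slice[of k] by (intro nn_integral_mono) (simp add: nn_integral_square_eq ennreal_leI)
  also note \<beta>_integral
  finally show "(\<integral>\<^sup>+t. \<integral>\<^sup>+x. ennreal ((gk k (t, x))\<^sup>2) \<partial>lborel \<partial>lborel) \<le> ennreal (exp (3 * \<kappa>) * B0)" .
qed (use B0_ge(6) in auto)

lemma \<Psi>_gk: assumes "0 \<le> T" shows "L2R (\<Psi> T j (gk k)) \<and> nr (\<Psi> T j (gk k)) \<le> B T"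
proof -
  have *: "AE z in lborel. (\<Psi> T j (gk k) z)\<^sup>2 \<le> 1 * (\<Psi> T j (tq k) z)\<^sup>2"
  proof (rule AE_I2)
    fix z
    have "\<Psi> T j (gk k) z = (indicator {0<..} (fst z) * wt (fst z)) * \<Psi> T j (tq k) z"
      by (simp add: \<Psi>_def gk_def algebra_simps)
    moreover have "(indicator {0<..} (fst z) * wt (fst z))\<^sup>2 * (\<Psi> T j (tq k) z)\<^sup>2 \<le> 1 * (\<Psi> T j (tq k) z)\<^sup>2"
      using wt_le_1[of "fst z"] by (intro mult_right_mono) (auto simp: indicator_def power_le_one)
    ultimately show "(\<Psi> T j (gk k) z)\<^sup>2 \<le> 1 * (\<Psi> T j (tq k) z)\<^sup>2" by (simp add: power_mult_distrib)
  qed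
  have m: "\<Psi> T j (gk k) \<in> borel_measurable lborel" by measurable
  show ?thesis using L2_le[OF conjunct1[OF \<Psi>_tq[OF assms]] m *] \<Psi>_tq[OF assms, of j k] by auto
qed

text \<open>The bounds on slices and on \<open>\<Psi>\<close> are convex conditions, so they hold
  for all midpoint combinations of the \<open>gk\<close> and, by Fatou, for the Mazur limit. The
  last clause keeps the weak convergence in the form that \<open>weak_derivativeI\<close> can
  use.\<close>

lemma time_derivative_limit:
  obtains f where "f \<in> borel_measurable borel"
    "AE t in lborel. L2R (\<lambda>x. f (t, x)) \<and> nr (\<lambda>x. f (t, x)) \<le> \<beta> t"
    "\<And>T j. 0 \<le> T \<Longrightarrow> L2R (\<Psi> T j f) \<and> nr (\<Psi> T j f) \<le> B T"
    "\<And>\<psi> l. L2R \<psi> \<Longrightarrow> (\<lambda>k. LINT z|lborel. gk k z * \<psi> z) \<longlonglongrightarrow> l \<Longrightarrow> (LINT z|lborel. f z * \<psi> z) = l"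
proof -
  obtain s f where s: "\<And>n. s n \<in> mid (gk ` {n..})" and f: "L2R f" and "nr f \<le> exp (3 * \<kappa>) * B0"
    and ae: "AE z in lborel. (\<lambda>n. s n z) \<longlonglongrightarrow> f z" and nlim: "(\<lambda>n. nr (\<lambda>z. s n z - f z)) \<longlonglongrightarrow> 0"
    by (rule Mazur[of lborel gk "exp (3 * \<kappa>) * B0", OF conjunct1[OF gk_L2] conjunct2[OF gk_L2]]) (rule that)
  have fm [measurable]: "f \<in> borel_measurable borel" using f by auto
  have mid_props: "h \<in> borel_measurable borel \<and> (\<forall>t. L2R (\<lambda>x. h (t, x)) \<and> nr (\<lambda>x. h (t, x)) \<le> \<beta> t) \<and>
      (\<forall>T j. 0 \<le> T \<longrightarrow> L2R (\<Psi> T j h) \<and> nr (\<Psi> T j h) \<le> B T)" if "h \<in> mid G" "G \<subseteq> range gk" for h G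
    using that
  proof (induction rule: mid.induct)
    case (base h)
    then obtain k where "h = gk k" by auto
    then show ?case using gk_slice[of k] \<Psi>_gk[of _ _ k] by auto
  next
    case (step h g)
    have avg: "L2R (\<lambda>x. (a x + b x) / 2) \<and> nr (\<lambda>x. (a x + b x) / 2) \<le> c" if "L2R a \<and> nr a \<le> c" "L2R b \<and> nr b \<le> c" for a b :: "'c::euclidean_space \<Rightarrow> real" and c
    proof
      show "L2R (\<lambda>x. (a x + b x) / 2)" by (rule L2_midpoint(1)) (use that in auto)
      have "4 * nr (\<lambda>x. (a x + b x) / 2) + nr (\<lambda>x. a x - b x) = 2 * nr a + 2 * nr b"
        by (rule L2_midpoint(2)) (use that in auto)
      then show "nr (\<lambda>x. (a x + b x) / 2) \<le> c" using that nsq_nonneg[of lborel "\<lambda>x. a x - b x"] by linarith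
    qed
    have "\<Psi> T j (\<lambda>z. (h z + g z) / 2) = (\<lambda>z. (\<Psi> T j h z + \<Psi> T j g z) / 2)" for T j
      by (auto simp: \<Psi>_def algebra_simps add_divide_distrib diff_divide_distrib)
    moreover have "L2R (\<lambda>x. h (t, x)) \<and> nr (\<lambda>x. h (t, x)) \<le> \<beta> t" "L2R (\<lambda>x. g (t, x)) \<and> nr (\<lambda>x. g (t, x)) \<le> \<beta> t" for t
      using step by blast+
    then have "L2R (\<lambda>x. (h (t, x) + g (t, x)) / 2) \<and> nr (\<lambda>x. (h (t, x) + g (t, x)) / 2) \<le> \<beta> t" for t
      by (intro avg)
    moreover have "L2R (\<lambda>z. (\<Psi> T j h z + \<Psi> T j g z) / 2) \<and> nr (\<lambda>z. (\<Psi> T j h z + \<Psi> T j g z) / 2) \<le> B T" if "0 \<le> T" for T j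
      using step that by (intro avg) blast+
    moreover have "(\<lambda>z. (h z + g z) / 2) \<in> borel_measurable borel"
    proof -
      have [measurable]: "h \<in> borel_measurable borel" "g \<in> borel_measurable borel" using step by blast+
      show ?thesis by measurable
    qed
    ultimately show ?case by simp
  qed
  have s_props: "s n \<in> borel_measurable borel" "L2R (\<lambda>x. s n (t, x)) \<and> nr (\<lambda>x. s n (t, x)) \<le> \<beta> t"
    "0 \<le> T \<Longrightarrow> L2R (\<Psi> T j (s n)) \<and> nr (\<Psi> T j (s n)) \<le> B T" for n t T j
    using mid_props[OF s[of n]] by auto
  have "AE z in lborel \<Otimes>\<^sub>M lborel. (\<lambda>n. s n z) \<longlonglongrightarrow> f z" using ae unfolding lborel_prod .
  then have "AE t in lborel. AE x in lborel. (\<lambda>n. s n (t, x)) \<longlonglongrightarrow> f (t, x)"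
    by (rule lborel_pair.AE_pair)
  then have 1: "AE t in lborel. L2R (\<lambda>x. f (t, x)) \<and> nr (\<lambda>x. f (t, x)) \<le> \<beta> t"
  proof eventually_elim
    case (elim t)
    show ?case
      using L2_Fatou[of "\<lambda>x. f (t, x)" lborel "\<lambda>n x. s n (t, x)" "\<beta> t"] slice_measurable[OF fm, of t] s_props(2)[of _ t] elim by simp
  qed
  have 2: "L2R (\<Psi> T j f) \<and> nr (\<Psi> T j f) \<le> B T" if "0 \<le> T" for T j
  proof -
    \<comment> \<open>The quotient in \<open>\<Psi>\<close> involves a point and its translate;
      convergence almost everywhere is needed at both.\<close>
    have "AE z in distr lborel borel (\<lambda>z. z + (0, hs j)). (\<lambda>n. s n z) \<longlonglongrightarrow> f z"
      unfolding lborel_distr_translate by (rule ae)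
    then have "AE z in lborel. (\<lambda>n. s n (z + (0, hs j))) \<longlonglongrightarrow> f (z + (0, hs j))"
      by (rule AE_distrD[rotated]) simp
    with ae have "AE z in lborel. (\<lambda>n. \<Psi> T j (s n) z) \<longlonglongrightarrow> \<Psi> T j f z"
    proof eventually_elim
      case (elim z)
      have "z + (0, hs j) = (fst z, snd z + hs j)" by (simp add: prod_eq_iff)
      then show ?case unfolding \<Psi>_def using elim hs_pos[of j] by (intro tendsto_intros) auto
    qed
    then show ?thesis
      using L2_Fatou[of "\<Psi> T j f" lborel "\<lambda>n. \<Psi> T j (s n)" "B T"] s_props(3)[OF that, of j] by simp
  qed
  have 3: "(LINT z|lborel. f z * \<psi> z) = l" if "L2R \<psi>" "(\<lambda>k. LINT z|lborel. gk k z * \<psi> z) \<longlonglongrightarrow> l" for \<psi> l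
    by (rule weak_limit_pairing[OF conjunct1[OF gk_L2] s f nlim that])
  show ?thesis using that[OF fm 1 2 3] by blast
qed

lemma nr_dq_hs_mono:
  assumes "L2R f" "j \<le> k" shows "nr (dq (hs j) f) \<le> nr (dq (hs k) f)"
  unfolding hs_multiple[OF assms(2)] using nr_dq_multiple_le[OF assms(1), of "2 ^ (k - j)" "hs k"] hs_pos[of k] by simp

text \<open>The weight is divided out again. The properties of the slices of \<open>f\<close> hold
  for almost every time only; setting \<open>v\<close> to 0 off the Borel set \<open>G\<close> of
  good times gives every slice an L^2 weak derivative and changes \<open>v\<close> only on a null
  set of positive times.\<close>

lemma time_derivative:
  obtains v where "weak_dt u v" "\<And>T. T > 0 \<Longrightarrow> v \<in> Linf_sobolev T 0" "\<And>T. T > 0 \<Longrightarrow> v \<in> L2_sobolev T 1"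
proof -
  obtain f where fm [measurable]: "f \<in> borel_measurable borel"
    and f1: "AE t in lborel. L2R (\<lambda>x. f (t, x)) \<and> nr (\<lambda>x. f (t, x)) \<le> \<beta> t"
    and f2: "\<And>T j. 0 \<le> T \<Longrightarrow> L2R (\<Psi> T j f) \<and> nr (\<Psi> T j f) \<le> B T"
    and f3: "\<And>\<psi> l. L2R \<psi> \<Longrightarrow> (\<lambda>k. LINT z|lborel. gk k z * \<psi> z) \<longlonglongrightarrow> l \<Longrightarrow> (LINT z|lborel. f z * \<psi> z) = l"
    by (rule time_derivative_limit) blast
  define X where "X t = (\<integral>\<^sup>+x. ennreal ((f (t, x))\<^sup>2) \<partial>lborel)" for t
  define Y where "Y j t = (\<integral>\<^sup>+x. ennreal ((dq (hs j) (\<lambda>x. f (t, x)) x)\<^sup>2) \<partial>lborel)" for j t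
  have [measurable]: "X \<in> borel_measurable borel" unfolding X_def[abs_def] by (rule nn_slice_measurable[OF fm])
  have [measurable]: "Y j \<in> borel_measurable borel" for j
  proof -
    note [measurable] = shift_measurable(2)[OF fm, of "hs j"]
    have "(\<lambda>z. (f (fst z, snd z + hs j) - f z) / hs j) \<in> borel_measurable borel" by measurable
    from nn_slice_measurable[OF this] show ?thesis unfolding Y_def[abs_def] by (simp add: dq_eq)
  qed
  have [measurable]: "\<beta> \<in> borel_measurable borel" unfolding \<beta>_def[abs_def] B_def[abs_def] by measurable
  define I :: "real \<Rightarrow> real \<Rightarrow> ennreal" where "I T = indicator {0..<T}" for T
  have [measurable]: "I T \<in> borel_measurable borel" for T unfolding I_def by measurable
  define G where "G = {t. 0 < t \<and> X t \<le> ennreal (\<beta> t) \<and> (SUP j. Y j t) < \<infinity>}"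
  have G [measurable]: "G \<in> sets borel" unfolding G_def by measurable
  have Y_eq: "Y j t = ennreal (nr (dq (hs j) (\<lambda>x. f (t, x))))" if "L2R (\<lambda>x. f (t, x))" for j t
    unfolding Y_def by (rule nn_integral_square_eq[OF L2R_dqv[OF that]])
  have SUP_Y: "(\<integral>\<^sup>+t. (SUP j. I T t * Y j t) \<partial>lborel) \<le> ennreal (B T)" if "0 \<le> T" for T
  proof -
    \<comment> \<open>The steps are dyadic, so the norms of the quotients increase with
      \<open>j\<close>, and monotone convergence turns the bounds for single \<open>j\<close> into
      one for the supremum.\<close>
    have "(\<integral>\<^sup>+t. (SUP j. I T t * Y j t) \<partial>lborel) = (SUP j. \<integral>\<^sup>+t. I T t * Y j t \<partial>lborel)"
    proof (rule nn_integral_monotone_convergence_SUP_AE)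
      show "AE t in lborel. I T t * Y j t \<le> I T t * Y (Suc j) t" for j
        using f1
      proof eventually_elim
        case (elim t)
        then show ?case
          using nr_dq_hs_mono[of "\<lambda>x. f (t, x)" j "Suc j"] by (intro mult_left_mono) (auto simp: Y_eq ennreal_leI)
      qed
    qed measurable
    also have "\<dots> \<le> ennreal (B T)"
    proof (rule SUP_least)
      fix j
      have "(\<integral>\<^sup>+t. I T t * Y j t \<partial>lborel) = (\<integral>\<^sup>+t. \<integral>\<^sup>+x. ennreal ((\<Psi> T j f (t, x))\<^sup>2) \<partial>lborel \<partial>lborel)"
        by (intro nn_integral_cong) (auto simp: I_def Y_def \<Psi>_def dq_eq indicator_def)
      also have "\<dots> = (\<integral>\<^sup>+z. ennreal ((\<Psi> T j f z)\<^sup>2) \<partial>lborel)"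
        by (rule nn_integral_iterated[symmetric]) measurable
      also have "\<dots> \<le> ennreal (B T)"
        using f2[OF that, of j] nn_integral_square_eq[of lborel "\<Psi> T j f"] by (simp add: ennreal_leI)
      finally show "(\<integral>\<^sup>+t. I T t * Y j t \<partial>lborel) \<le> ennreal (B T)" .
    qed
    finally show ?thesis .
  qed
  have "AE t in lborel. \<forall>n::nat. (SUP j. I (real n) t * Y j t) \<noteq> \<infinity>"
    unfolding AE_all_countable
  proof
    fix n :: nat
    show "AE t in lborel. (SUP j. I (real n) t * Y j t) \<noteq> \<infinity>"
      by (rule nn_integral_PInf_AE) (use SUP_Y[of "real n"] in \<open>auto simp: top_unique\<close>)
  qed
  with f1 have AE_G: "AE t in lborel. 0 < t \<longrightarrow> t \<in> G"
  proof eventually_elim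
    case (elim t)
    show ?case
    proof
      assume "0 < t"
      obtain n where n: "t < real n" using reals_Archimedean2 by blast
      then have "I (real n) t = 1" using \<open>0 < t\<close> by (simp add: I_def)
      then have "(SUP j. Y j t) = (SUP j. I (real n) t * Y j t)" by simp
      also have "\<dots> < \<infinity>" using elim(2) unfolding infinity_ennreal_def less_top[symmetric] by blast
      finally have "(SUP j. Y j t) < \<infinity>" .
      moreover have "X t \<le> ennreal (\<beta> t)"
        unfolding X_def using elim(1) nn_integral_square_eq[of lborel "\<lambda>x. f (t, x)"] by (simp add: ennreal_leI)
      ultimately show "t \<in> G" using \<open>0 < t\<close> unfolding G_def by blast
    qed
  qed
  define v where "v t x = indicator G t * (exp ((\<kappa> + 1) * t) * f (t, x))" for t x
  have vm [measurable]: "(\<lambda>z. v (fst z) (snd z)) \<in> borel_measurable borel"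
    unfolding v_def by measurable
  have fG: "L2R (\<lambda>x. f (t, x)) \<and> nr (\<lambda>x. f (t, x)) \<le> \<beta> t" if "t \<in> G" for t
    using that slice_measurable[OF fm, of t] \<beta>_nonneg[of t] by (auto simp: L2_nn G_def X_def)
  have vG: "v t = (\<lambda>x. exp ((\<kappa> + 1) * t) * f (t, x))" if "t \<in> G" for t using that by (intro ext) (simp add: v_def)
  have v0: "v t = (\<lambda>x. 0)" if "t \<notin> G" for t using that by (intro ext) (simp add: v_def)
  have vL: "L2R (v t)" for t
    by (cases "t \<in> G") (auto simp: vG v0 fG intro: L2_cmult)
  have v_le: "nr (v t) \<le> B (t + 1)" for t
  proof (cases "t \<in> G")
    case True
    then have "0 < t" by (simp add: G_def)
    have e: "(exp ((\<kappa> + 1) * t))\<^sup>2 * (wt t)\<^sup>2 = 1"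
      by (simp add: wt_def power_mult_distrib[symmetric] exp_add[symmetric] algebra_simps)
    have "nr (v t) \<le> (exp ((\<kappa> + 1) * t))\<^sup>2 * \<beta> t"
      unfolding vG[OF True] nsq_cmult using fG[OF True] by (intro mult_left_mono) auto
    also have "\<dots> = ((exp ((\<kappa> + 1) * t))\<^sup>2 * (wt t)\<^sup>2) * B (t + 1)" using \<open>0 < t\<close> by (simp add: \<beta>_def)
    finally show ?thesis unfolding e by simp
  next
    case False
    then show ?thesis using B_nonneg by (simp add: v0 nsq_def)
  qed
  have dq_v: "nr (dq y (v t)) = (exp ((\<kappa> + 1) * t))\<^sup>2 * nr (dq y (\<lambda>x. f (t, x)))" if "t \<in> G" for t y
  proof -
    have "dq y (v t) = (\<lambda>x. exp ((\<kappa> + 1) * t) * dq y (\<lambda>x. f (t, x)) x)"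
      by (auto simp: vG[OF that] dq_eq algebra_simps diff_divide_distrib)
    then show ?thesis by (simp add: nsq_cmult)
  qed
  have dq_v0: "nr (dq y (v t)) = 0" if "t \<notin> G" for t y
    using that by (simp add: v0 nsq_def dq_eq)
  have wd: "\<exists>g. L2R g \<and> weak_derivative UNIV 1 (v t) g" for t
  proof -
    have "\<exists>C. \<forall>k. nr (dq (hs k) (v t)) \<le> C"
    proof (cases "t \<in> G")
      case True
      then obtain c where c: "(SUP j. Y j t) = ennreal c" "0 \<le> c"
        by (cases "SUP j. Y j t") (auto simp: G_def)
      have "nr (dq (hs k) (\<lambda>x. f (t, x))) \<le> c" for k
      proof -
        have "Y k t \<le> ennreal c" unfolding c(1)[symmetric] by (rule SUP_upper) simp
        then show ?thesis using c(2) Y_eq[OF conjunct1[OF fG[OF True]], of k] by simp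
      qed
      then show ?thesis unfolding dq_v[OF True] by (intro exI[of _ "(exp ((\<kappa> + 1) * t))\<^sup>2 * c"] allI mult_left_mono) auto
    qed (auto simp: dq_v0)
    then obtain C where C: "\<And>k. nr (dq (hs k) (v t)) \<le> C" by blast
    have "\<And>k. hs k \<noteq> 0" using hs_pos by (metis less_irrefl)
    from weak_derivative_of_bounded_dqv[OF vL this hs_tendsto C] show ?thesis by blast
  qed
  have fin: "(\<integral>\<^sup>+t. indicator {0<..<T} t * (SUP k. ennreal (nr (dq (hs k) (v t)))) \<partial>lborel) < \<infinity>" if "T > 0" for T
  proof -
    have "(\<integral>\<^sup>+t. indicator {0<..<T} t * (SUP k. ennreal (nr (dq (hs k) (v t)))) \<partial>lborel)
        \<le> (\<integral>\<^sup>+t. ennreal ((exp ((\<kappa> + 1) * T))\<^sup>2) * (SUP j. I T t * Y j t) \<partial>lborel)"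
    proof (rule nn_integral_mono)
      fix t :: real
      show "indicator {0<..<T} t * (SUP k. ennreal (nr (dq (hs k) (v t)))) \<le> ennreal ((exp ((\<kappa> + 1) * T))\<^sup>2) * (SUP j. I T t * Y j t)"
      proof (cases "t \<in> G \<and> t < T")
        case True
        then have t: "0 < t" "t < T" "t \<in> G" by (auto simp: G_def)
        have "ennreal (nr (dq (hs k) (v t))) \<le> ennreal ((exp ((\<kappa> + 1) * T))\<^sup>2) * (SUP j. I T t * Y j t)" for k
        proof -
          have "ennreal (nr (dq (hs k) (v t))) = ennreal ((exp ((\<kappa> + 1) * t))\<^sup>2) * Y k t"
            using Y_eq[OF conjunct1[OF fG[OF t(3)]], of k] by (simp add: dq_v[OF t(3)] ennreal_mult)
          also have "\<dots> \<le> ennreal ((exp ((\<kappa> + 1) * T))\<^sup>2) * Y k t"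
            using t \<kappa>_nonneg by (intro mult_right_mono ennreal_leI power_mono) auto
          also have "Y k t = I T t * Y k t" using t by (simp add: I_def)
          also have "\<dots> \<le> (SUP j. I T t * Y j t)" by (rule SUP_upper) simp
          finally show ?thesis by (simp add: mult_left_mono)
        qed
        then have "(SUP k. ennreal (nr (dq (hs k) (v t)))) \<le> ennreal ((exp ((\<kappa> + 1) * T))\<^sup>2) * (SUP j. I T t * Y j t)"
          by (rule SUP_least)
        then show ?thesis using t by simp
      next
        case False
        then show ?thesis by (cases "t \<in> G") (auto simp: dq_v0)
      qed
    qed
    also have "\<dots> = ennreal ((exp ((\<kappa> + 1) * T))\<^sup>2) * (\<integral>\<^sup>+t. (SUP j. I T t * Y j t) \<partial>lborel)"
      by (rule nn_integral_cmult) measurable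
    also have "\<dots> < \<infinity>"
      using order.strict_trans1[OF SUP_Y[of T], of \<infinity>] that by (auto simp: ennreal_mult_less_top)
    finally show ?thesis .
  qed
  have loc_v: "loc_int (\<lambda>(t, x). v t x)"
    unfolding loc_int_def
  proof (intro conjI allI)
    show "(\<lambda>(t, x). v t x) \<in> borel_measurable borel" using vm by (simp add: case_prod_beta')
    fix R :: real
    define h where "h z = indicator {0..\<bar>R\<bar>} (fst z) * v (fst z) (snd z)" for z :: "real \<times> real"
    have [measurable]: "h \<in> borel_measurable borel" unfolding h_def[abs_def] by measurable
    have "(\<integral>\<^sup>+t. \<integral>\<^sup>+x. ennreal ((h (t, x))\<^sup>2) \<partial>lborel \<partial>lborel) \<le> (\<integral>\<^sup>+t. ennreal (B (\<bar>R\<bar> + 1)) * indicator {0..\<bar>R\<bar>} t \<partial>lborel)"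
    proof (rule nn_integral_mono)
      fix t :: real
      show "(\<integral>\<^sup>+x. ennreal ((h (t, x))\<^sup>2) \<partial>lborel) \<le> ennreal (B (\<bar>R\<bar> + 1)) * indicator {0..\<bar>R\<bar>} t"
      proof (cases "t \<in> {0..\<bar>R\<bar>}")
        case True
        then have "nr (v t) \<le> B (\<bar>R\<bar> + 1)" using v_le[of t] B_mono[of "t + 1" "\<bar>R\<bar> + 1"] by simp
        then show ?thesis using True nn_integral_square_eq[OF vL[of t]] by (simp add: h_def ennreal_leI)
      qed (simp add: h_def)
    qed
    also have "\<dots> = ennreal (B (\<bar>R\<bar> + 1) * \<bar>R\<bar>)"
      using B_nonneg by (simp add: nn_integral_cmult_indicator ennreal_mult)
    finally have "L2R h \<and> nr h \<le> B (\<bar>R\<bar> + 1) * \<bar>R\<bar>" using B_nonneg by (intro L2R_iterated) auto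
    then have "integrable lborel (\<lambda>z. indicator (cball 0 R) z * h z)"
      using loc_int_L2[of h] by (auto simp: loc_int_def)
    moreover have "indicator (cball 0 R) z * h z = indicator (cball 0 R) z * (case z of (t, x) \<Rightarrow> v t x)" for z
    proof -
      have "v (fst z) (snd z) = 0" if "fst z < 0" using v0[of "fst z"] that by (simp add: G_def)
      moreover have "\<bar>fst z\<bar> \<le> R" if "norm z \<le> R" using norm_fst_le[of "fst z" "snd z"] that by simp
      ultimately show ?thesis
        by (cases "fst z < 0") (auto simp: h_def indicator_def case_prod_beta')
    qed
    ultimately show "integrable lborel (\<lambda>z. indicator (cball 0 R) z * (case z of (t, x) \<Rightarrow> v t x))" by simp
  qed
  have "AE z in lborel \<Otimes>\<^sub>M lborel. 0 < fst z \<longrightarrow> fst z \<in> (G :: real set)"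
  proof (rule lborel_pair.AE_pair_measure)
    show "AE t in lborel. AE x in lborel. 0 < fst (t, x) \<longrightarrow> fst (t, x) \<in> G"
      using AE_G by eventually_elim simp
  qed measurable
  then have AE_Gz: "AE z in (lborel :: (real \<times> real) measure). 0 < fst z \<longrightarrow> fst z \<in> G" unfolding lborel_prod .
  have "weak_dt u v"
  proof (rule weak_derivativeI[OF open_half_plane loc_int_u loc_v, of \<tau>s])
    show "\<tau>s k \<noteq> 0" for k using \<tau>s_pos[of k] by simp
    show "\<tau>s \<longlonglongrightarrow> 0" by (rule \<tau>s_tendsto)
    fix \<phi> :: "real \<times> real \<Rightarrow> real" and D K
    assume \<phi>: "C1_compact_support UNIV \<phi> D" and K: "compact K" "K \<subseteq> {0<..} \<times> UNIV" "\<And>z. z \<notin> K \<Longrightarrow> \<phi> z = 0"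
    have \<phi>0: "\<phi> z = 0" if "fst z \<le> 0" for z
      using K(2) that by (intro K(3)) auto
    have [measurable]: "\<phi> \<in> borel_measurable borel" by (rule C1_compact_support_borel[OF \<phi>])
    \<comment> \<open>The exponential cancels the weight in \<open>gk\<close>, so that pairing with
      \<open>\<psi>\<close> is pairing time quotients of \<open>u\<close> with
      \<open>\<phi>\<close>; it is bounded on the support of \<open>\<phi>\<close>.\<close>
    define \<psi> where "\<psi> z = exp ((\<kappa> + 1) * fst z) * \<phi> z" for z
    obtain R where R: "\<And>z. norm z > R \<Longrightarrow> \<phi> z = 0" using C1_compact_support_bounded[OF \<phi>] by metis
    have "L2R \<psi>"
    proof (rule L2_le(1)[OF L2R_C1_compact_support(1)[OF \<phi>]])
      show "AE z in lborel. (\<psi> z)\<^sup>2 \<le> (exp ((\<kappa> + 1) * \<bar>R\<bar>))\<^sup>2 * (\<phi> z)\<^sup>2"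
      proof (rule AE_I2)
        fix z
        show "(\<psi> z)\<^sup>2 \<le> (exp ((\<kappa> + 1) * \<bar>R\<bar>))\<^sup>2 * (\<phi> z)\<^sup>2"
        proof (cases "norm z > R")
          case False
          then have "fst z \<le> \<bar>R\<bar>" using norm_fst_le[of "fst z" "snd z"] by simp
          then show ?thesis unfolding \<psi>_def power_mult_distrib
            using \<kappa>_nonneg by (intro mult_right_mono power_mono) auto
        qed (simp add: R \<psi>_def)
      qed
    qed (unfold \<psi>_def[abs_def], measurable)
    moreover have eq: "gk k z * \<psi> z = dqv (1, 0) (\<tau>s k) (\<lambda>(t, x). u t x) z * \<phi> z" for k z
    proof (cases "0 < fst z")
      case True
      have "wt (fst z) * exp ((\<kappa> + 1) * fst z) = 1" by (simp add: wt_def exp_add[symmetric] algebra_simps)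
      moreover have "dqv (1, 0) (\<tau>s k) (\<lambda>(t, x). u t x) z = tq k z" by (simp add: dqv_def tq_def case_prod_beta')
      moreover have "gk k z * \<psi> z = (wt (fst z) * exp ((\<kappa> + 1) * fst z)) * (tq k z * \<phi> z)"
        using True by (simp add: gk_def \<psi>_def)
      ultimately show ?thesis by simp
    qed (simp add: \<phi>0 \<psi>_def)
    have lim: "(\<lambda>k. LINT z|lborel. dqv (1, 0) (\<tau>s k) (\<lambda>(t, x). u t x) z * \<phi> z) \<longlonglongrightarrow> - (LINT z|lborel. (case z of (t, x) \<Rightarrow> u t x) * D z (1, 0))"
    proof (rule dqv_pairing_tendsto[OF \<phi> loc_int_u _ \<tau>s_tendsto])
      show "\<tau>s k \<noteq> 0" for k using \<tau>s_pos[of k] by simp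
    qed
    ultimately have "(LINT z|lborel. f z * \<psi> z) = - (LINT z|lborel. (case z of (t, x) \<Rightarrow> u t x) * D z (1, 0))"
      by (intro f3) (simp_all add: eq)
    moreover have "(LINT z|lborel. (case z of (t, x) \<Rightarrow> v t x) * \<phi> z) = (LINT z|lborel. f z * \<psi> z)"
    proof (rule integral_cong_AE)
      show "AE z in lborel. (case z of (t, x) \<Rightarrow> v t x) * \<phi> z = f z * \<psi> z"
        using AE_Gz
      proof eventually_elim
        case (elim z)
        then show ?case
          using vG[of "fst z"] \<phi>0[of z] by (cases "0 < fst z") (auto simp: \<psi>_def case_prod_beta')
      qed
      show "(\<lambda>z. (case z of (t, x) \<Rightarrow> v t x) * \<phi> z) \<in> borel_measurable lborel" unfolding case_prod_beta' by measurable
      show "(\<lambda>z. f z * \<psi> z) \<in> borel_measurable lborel" unfolding \<psi>_def by measurable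
    qed
    ultimately show "(\<lambda>k. LINT z|lborel. dqv (1, 0) (\<tau>s k) (\<lambda>(t, x). u t x) z * \<phi> z) \<longlonglongrightarrow> (LINT z|lborel. (case z of (t, x) \<Rightarrow> v t x) * \<phi> z)"
      using lim by simp
  qed
  moreover have "v \<in> Linf_sobolev T 0" "v \<in> L2_sobolev T 1" if "T > 0" for T
  proof -
    have "nr (v t) \<le> B (T + 1)" if "t < T" for t using v_le[of t] B_mono[of "t + 1" "T + 1"] that by simp
    then show "v \<in> Linf_sobolev T 0" "v \<in> L2_sobolev T 1"
      using Linf_L2_sobolevI[OF vm vL wd _ fin[OF that] hs_pos hs_tendsto that] by blast+
  qed
  ultimately show ?thesis using that by blast
qed

section \<open>Assembly of the solution\<close>

text \<open>The datum enters only through an integral and an equality almost everywhere, so its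
  continuous representative \<open>u0\<close> may stand for it.\<close>

lemma weak_solution_u:
  assumes "AE x in lebesgue. uin x = u0 x" "uin \<in> borel_measurable lebesgue"
  shows "weak_solution \<epsilon> uin u ux"
  unfolding weak_solution_def
proof (intro conjI allI impI weak_dx_u u_tendsto_0)
  show "AE x in lebesgue. u 0 x = uin x" using assms(1) by eventually_elim (simp add: u_nonpos)
  fix \<phi> :: "real \<times> real \<Rightarrow> real" and D assume \<phi>: "C1_compact_support ({0..} \<times> UNIV) \<phi> D"
  interpret test: viscoplastic_limit_test \<epsilon> M A u0 r u \<phi> D by unfold_locales (rule \<phi>)
  have "(\<lambda>x. \<phi> (0, x)) \<in> borel_measurable borel"
    using test.x_measurables(1)[of 0] by (simp add: test.\<phi>c_def[abs_def])
  then have [measurable]: "(\<lambda>x. \<phi> (0, x)) \<in> borel_measurable lebesgue" by (intro measurable_completion) simp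
  have [measurable]: "u0 \<in> borel_measurable lebesgue" using u0(1) by (intro measurable_completion) auto
  have "(LINT x|lebesgue. uin x * \<phi> (0, x)) = (LINT x|lebesgue. u0 x * \<phi> (0, x))"
    by (rule integral_cong_AE) (use assms in \<open>auto elim: eventually_mono\<close>)
  then show "(LINT t|lebesgue_on {0..}. LINT x|lebesgue. u t x * D (t, x) (1, 0)
      + ((u t x)\<^sup>2 / 2 - \<epsilon> * ux t x - plastic_stress \<epsilon> (ux t x)) * D (t, x) (0, 1))
      + (LINT x|lebesgue. uin x * \<phi> (0, x)) = 0"
    using test.weak_formulation by simp
qed

lemma vanishing_fluxes:
  assumes "T > 0"
  shows "vanishing_flux T (\<lambda>t x. 1 / 3 * (u t x) ^ 3)"
    and "vanishing_flux T (\<lambda>t x. u t x * \<epsilon> * ux t x)"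
    and "vanishing_flux T (\<lambda>t x. u t x * (ux t x / sqrt (\<bar>ux t x\<bar>\<^sup>2 + \<epsilon>\<^sup>2)))"
proof -
  show "vanishing_flux T (\<lambda>t x. 1 / 3 * (u t x) ^ 3)"
  proof (rule vanishing_fluxI[where G="\<lambda>t x. 1 / 3 * (u t x)\<^sup>2" and C="1 / 3 * M\<^sup>2"])
    show "\<bar>1 / 3 * (u t x)\<^sup>2\<bar> \<le> 1 / 3 * M\<^sup>2" for t x
      using power_mono[OF u_bound[of t x] abs_ge_zero, of 2] by simp
  qed (use assms in \<open>auto simp: power2_eq_square power3_eq_cube\<close>)
  show "vanishing_flux T (\<lambda>t x. u t x * \<epsilon> * ux t x)"
  proof (rule vanishing_fluxI[where G="\<lambda>t x. \<epsilon> * ux t x" and C="\<epsilon> * sqrt (4 * B T)"])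
    show "\<bar>\<epsilon> * ux t x\<bar> \<le> \<epsilon> * sqrt (4 * B T)" if "0 \<le> t" "t \<le> T" for t x
      unfolding abs_mult using ux_abs_le[of t T x] that eps by (intro mult_mono) auto
  qed (use assms in auto)
  show "vanishing_flux T (\<lambda>t x. u t x * (ux t x / sqrt (\<bar>ux t x\<bar>\<^sup>2 + \<epsilon>\<^sup>2)))"
  proof (rule vanishing_fluxI[where G="\<lambda>t x. plastic_stress \<epsilon> (ux t x)" and C=1])
    show "(\<lambda>z. plastic_stress \<epsilon> (ux (fst z) (snd z))) \<in> borel_measurable borel"
      using measurable_compose[OF ux_measurable borel_measurable_continuous_onI[OF continuous_plastic_stress]] eps by simp
    show "\<bar>plastic_stress \<epsilon> (ux t x)\<bar> \<le> 1" for t x by (rule abs_plastic_stress_le)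
  qed (use assms in \<open>auto simp: plastic_stress_def\<close>)
qed

end

theorem theorem2p1:
  fixes \<epsilon> :: real and uin :: "real \<Rightarrow> real"
  assumes "0 < \<epsilon>" and "\<epsilon> < 1"
    and "uin \<in> sobolev 2"
    and "(uin \<longlongrightarrow> 0) at_infinity"
  shows "\<exists>u ux ut :: real \<Rightarrow> real \<Rightarrow> real.
    continuous_on ({0..} \<times> UNIV) (\<lambda>(t, x). u t x) \<and>
    (AE t in lebesgue_on {0..}. continuous_on UNIV (ux t)) \<and>
    weak_solution \<epsilon> uin u ux \<and>
    weak_dt u ut \<and>
    (\<forall>T>0.
       u \<in> Linf_sobolev T 2 \<and>
       ut \<in> Linf_sobolev T 0 \<inter> L2_sobolev T 1 \<and>
       vanishing_flux T (\<lambda>t x. 1 / 3 * (u t x) ^ 3) \<and>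
       vanishing_flux T (\<lambda>t x. u t x * \<epsilon> * ux t x) \<and>
       vanishing_flux T (\<lambda>t x. u t x * (ux t x / sqrt (\<bar>ux t x\<bar>\<^sup>2 + \<epsilon>\<^sup>2))))"
proof -
  obtain u0 A where w: "L2R u0" "continuous_on UNIV u0" "AE x in lebesgue. uin x = u0 x"
    "\<And>y. y > 0 \<Longrightarrow> nr (dq y u0) \<le> A" "\<And>y. y > 0 \<Longrightarrow> nr (dq y (dq y u0)) \<le> A"
    by (rule sobolev_2_representative[OF assms(3)]) blast
  have A: "0 \<le> A" using order_trans[OF nsq_nonneg w(4)[of 1]] by simp
  have H: "(u0 b - u0 a)\<^sup>2 \<le> A * \<bar>b - a\<bar>" for a b
    by (rule Holder_of_dq_bound[OF w(1,2) _ LIMSEQ_Suc[OF lim_1_over_n]]) (auto intro: w(4))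
  \<comment> \<open>The sup bound that \<open>sup_bound_of_L2_Holder\<close> gives for the datum
    with averaging length 1.\<close>
  define M where "M = sqrt (2 * nr u0 + 2 * A)"
  have "\<bar>u0 x\<bar> \<le> M" for x
    unfolding M_def using sup_bound_of_L2_Holder[OF w(1) H, of 1 x] by (intro real_le_rsqrt) simp
  then interpret viscoplastic \<epsilon> M A u0
    using assms(1,2) A w by unfold_locales (auto simp: M_def)
  obtain r u where "strict_mono (r :: nat \<Rightarrow> nat)" "\<And>t x. (\<lambda>i. V (r i) t x) \<longlonglongrightarrow> u t x"
    "continuous_on UNIV (\<lambda>(t, x). u t x)"
    by (rule limit_exists) blast
  then interpret viscoplastic_limit \<epsilon> M A u0 r u by unfold_locales
  obtain v where v: "weak_dt u v" "\<And>T. T > 0 \<Longrightarrow> v \<in> Linf_sobolev T 0" "\<And>T. T > 0 \<Longrightarrow> v \<in> L2_sobolev T 1"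
    by (rule time_derivative) blast
  have "uin \<in> borel_measurable lebesgue" using assms(3) by (auto simp: numeral_2_eq_2 square_integrable_def)
  then have "weak_solution \<epsilon> uin u ux" by (rule weak_solution_u[OF w(3)])
  moreover have "continuous_on ({0..} \<times> UNIV) (\<lambda>(t, x). u t x)"
    by (rule continuous_on_subset[OF u_cont]) simp
  moreover have "continuous_on UNIV (ux t)" for t by (rule ux_props(3)[of t "max 0 t"]) auto
  ultimately show ?thesis
    using v u_Linf vanishing_fluxes by (intro exI[of _ u] exI[of _ ux] exI[of _ v]) auto
qed

end
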